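(* Let $(M,g,f,\mu)$ be a half conformally flat generalized quasi-Einstein manifold with $g$ of signature $(2,2)$ (so $\dim M=4$), with $\mu\neq-\frac12$ and $\|\nabla f\|\neq0$ at every point of $M$. Then $(M,g)$ is (locally) conformally flat and is locally isometric to a warped product of the form $I\times_\varphi N$, where $I\subset\mathbb{R}$ is an open interval and $N$ is of constant sectional curvature.
   Context: A quadruple $(M,g,f,\mu)$, where $(M,g)$ is a pseudo-Riemannian manifold, $f\in C^\infty(M)$ and $\mu\in\mathbb{R}$, is a generalized quasi-Einstein manifold if $\operatorname{Hes}_f+\rho-\mu\,df\otimes df=\lambda g$ for some $\lambda\in C^\infty(M)$. Here $\rho$ is the Ricci tensor of $g$ (with the sign convention that it is positive on round spheres) and $\operatorname{Hes}_f(X,Y)=XY(f)-(\nabla_XY)(f)$, with $\nabla$ the Levi-Civita connection. Fix a (local) orientation of the 4-manifold; the Hodge star splits $\Lambda^2=\Lambda^+\oplus\Lambda^-$ into self-dual and anti-self-dual 2-forms, and the Weyl tensor, as an operator on 2-forms, splits as $W=W^+\oplus W^-$. $(M,g)$ is self-dual if $W^-=0$ and anti-self-dual if $W^+=0$; it is half conformally flat if it is self-dual or anti-self-dual. $\|\nabla f\|\ne0$ means $g(\nabla f,\nabla f)\neq0$. A warped product $I\times_\varphi N$ has metric $\varepsilon\,dt^2+\varphi(t)^2g_N$, where $\varepsilon=\pm1$, $\varphi$ is a positive smooth function on $I$ and $(N,g_N)$ is a 3-dimensional pseudo-Riemannian manifold. All statements are local. *)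

theory Defs
  imports "HOL-Analysis.Analysis"
begin

section \<open>Smooth maps on open sets\<close>

text \<open>Only used for open sets, so the values of the derivatives depend only on the
  restriction of the map to the set.\<close>

primrec C_k_on :: "nat \<Rightarrow> 'v::real_normed_vector set \<Rightarrow> ('v \<Rightarrow> 'w::real_normed_vector) \<Rightarrow> bool" where
  "C_k_on 0 S F \<longleftrightarrow> continuous_on S F"
| "C_k_on (Suc k) S F \<longleftrightarrow>
     (\<forall>x\<in>S. F differentiable (at x)) \<and> (\<forall>v. C_k_on k S (\<lambda>x. frechet_derivative F (at x) v))"

definition smooth_on :: "'v::real_normed_vector set \<Rightarrow> ('v \<Rightarrow> 'w::real_normed_vector) \<Rightarrow> bool" where
  "smooth_on S F \<longleftrightarrow> (\<forall>k. C_k_on k S F)"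

definition diffeo_on :: "'v::real_normed_vector set \<Rightarrow> 'w::real_normed_vector set \<Rightarrow> ('v \<Rightarrow> 'w) \<Rightarrow> bool" where
  "diffeo_on S T F \<longleftrightarrow> open S \<and> open T \<and> bij_betw F S T \<and> smooth_on S F \<and> smooth_on T (inv_into S F)"

definition pd :: "'n::finite \<Rightarrow> (real^'n \<Rightarrow> real) \<Rightarrow> real^'n \<Rightarrow> real" where
  "pd i F x = frechet_derivative F (at x) (axis i 1)"

section \<open>Pseudo-Riemannian metrics on open subsets of coordinate space\<close>

type_synonym 'n metric = "real^'n \<Rightarrow> real^'n^'n"

definition metric_on :: "(real^'n::finite) set \<Rightarrow> 'n metric \<Rightarrow> bool" where
  "metric_on S g \<longleftrightarrow> open S \<and> smooth_on S g \<and> (\<forall>x\<in>S. transpose (g x) = g x \<and> invertible (g x))"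

definition ip :: "'n metric \<Rightarrow> real^'n \<Rightarrow> real^'n \<Rightarrow> real^'n::finite \<Rightarrow> real" where
  "ip g x u v = u \<bullet> (g x *v v)"

text \<open>\<open>p\<close> is the number of negative and \<open>q\<close> the number of positive squares.\<close>

definition has_signature :: "real^'n^'n::finite \<Rightarrow> nat \<Rightarrow> nat \<Rightarrow> bool" where
  "has_signature A p q \<longleftrightarrow>
     (\<exists>(P::real^'n^'n) (e::'n \<Rightarrow> real). invertible P \<and> (\<forall>i. e i = 1 \<or> e i = -1) \<and> card {i. e i = -1} = p \<and> card {i. e i = 1} = q \<and>
        transpose P ** A ** P = (\<chi> i j. if i = j then e i else 0))"

definition ginv :: "'n::finite metric \<Rightarrow> 'n \<Rightarrow> 'n \<Rightarrow> real^'n \<Rightarrow> real" where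
  "ginv g i j x = matrix_inv (g x) $ i $ j"

text \<open>Christoffel symbols of the Levi-Civita connection:
  \<open>\<nabla>\<^bsub>\<partial>i\<^esub> \<partial>j = (\<Sum>k. christoffel g k i j \<partial>k)\<close>.\<close>

definition christoffel :: "'n::finite metric \<Rightarrow> 'n \<Rightarrow> 'n \<Rightarrow> 'n \<Rightarrow> real^'n \<Rightarrow> real" where
  "christoffel g k i j x = 1/2 * (\<Sum>l\<in>UNIV. ginv g k l x *
     (pd i (\<lambda>y. g y $ j $ l) x + pd j (\<lambda>y. g y $ i $ l) x - pd l (\<lambda>y. g y $ i $ j) x))"

text \<open>\<open>R(X,Y)Z = \<nabla>\<^sub>X\<nabla>\<^sub>YZ - \<nabla>\<^sub>Y\<nabla>\<^sub>XZ - \<nabla>\<^bsub>[X,Y]\<^esub>Z\<close>, and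
  \<open>R(\<partial>i,\<partial>j)\<partial>k = (\<Sum>l. riem_up g l k i j \<partial>l)\<close>.\<close>

definition riem_up :: "'n::finite metric \<Rightarrow> 'n \<Rightarrow> 'n \<Rightarrow> 'n \<Rightarrow> 'n \<Rightarrow> real^'n \<Rightarrow> real" where
  "riem_up g l k i j x =
     pd i (christoffel g l j k) x - pd j (christoffel g l i k) x
     + (\<Sum>m\<in>UNIV. christoffel g l i m x * christoffel g m j k x
                 - christoffel g l j m x * christoffel g m i k x)"

text \<open>\<open>riem g i j k l = g(R(\<partial>i,\<partial>j)\<partial>k, \<partial>l)\<close>.\<close>

definition riem :: "'n::finite metric \<Rightarrow> 'n \<Rightarrow> 'n \<Rightarrow> 'n \<Rightarrow> 'n \<Rightarrow> real^'n \<Rightarrow> real" where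
  "riem g i j k l x = (\<Sum>m\<in>UNIV. g x $ l $ m * riem_up g m k i j x)"

text \<open>\<open>\<rho>(Y,Z)\<close> is the trace of \<open>X \<mapsto> R(X,Y)Z\<close>; it is positive on round spheres.\<close>

definition ricci :: "'n::finite metric \<Rightarrow> 'n \<Rightarrow> 'n \<Rightarrow> real^'n \<Rightarrow> real" where
  "ricci g j k x = (\<Sum>i\<in>UNIV. riem_up g i k i j x)"

definition scal :: "'n::finite metric \<Rightarrow> real^'n \<Rightarrow> real" where
  "scal g x = (\<Sum>i\<in>UNIV. \<Sum>j\<in>UNIV. ginv g i j x * ricci g i j x)"

definition weyl :: "'n::finite metric \<Rightarrow> 'n \<Rightarrow> 'n \<Rightarrow> 'n \<Rightarrow> 'n \<Rightarrow> real^'n \<Rightarrow> real" where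
  "weyl g i j k l x = riem g i j k l x
     - (ricci g j k x * g x $ i $ l - ricci g i k x * g x $ j $ l
        + g x $ j $ k * ricci g i l x - g x $ i $ k * ricci g j l x) / (real CARD('n) - 2)
     + scal g x * (g x $ j $ k * g x $ i $ l - g x $ i $ k * g x $ j $ l)
        / ((real CARD('n) - 1) * (real CARD('n) - 2))"

definition riem_vec :: "'n::finite metric \<Rightarrow> real^'n \<Rightarrow> real^'n \<Rightarrow> real^'n \<Rightarrow> real^'n \<Rightarrow> real^'n \<Rightarrow> real" where
  "riem_vec g x u v w z =
     (\<Sum>i\<in>UNIV. \<Sum>j\<in>UNIV. \<Sum>k\<in>UNIV. \<Sum>l\<in>UNIV. riem g i j k l x * u $ i * v $ j * w $ k * z $ l)"

definition gram :: "'n::finite metric \<Rightarrow> real^'n \<Rightarrow> real^'n \<Rightarrow> real^'n \<Rightarrow> real" where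
  "gram g x u v = ip g x u u * ip g x v v - (ip g x u v)\<^sup>2"

definition sectional_curvature :: "'n::finite metric \<Rightarrow> real^'n \<Rightarrow> real^'n \<Rightarrow> real^'n \<Rightarrow> real" where
  "sectional_curvature g x u v = riem_vec g x u v v u / gram g x u v"

text \<open>Sectional curvature is only defined on nondegenerate planes, that is, where the Gram
  determinant does not vanish.\<close>

definition constant_sectional_curvature :: "(real^'n::finite) set \<Rightarrow> 'n metric \<Rightarrow> bool" where
  "constant_sectional_curvature S g \<longleftrightarrow>
     (\<exists>\<kappa>. \<forall>x\<in>S. \<forall>u v. gram g x u v \<noteq> 0 \<longrightarrow> sectional_curvature g x u v = \<kappa>)"

definition flat_on :: "(real^'n::finite) set \<Rightarrow> 'n metric \<Rightarrow> bool" where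
  "flat_on S g \<longleftrightarrow> (\<forall>x\<in>S. \<forall>i j k l. riem g i j k l x = 0)"

definition conformally_flat_on :: "(real^'n::finite) set \<Rightarrow> 'n metric \<Rightarrow> bool" where
  "conformally_flat_on S g \<longleftrightarrow>
     (\<exists>\<sigma>::real^'n \<Rightarrow> real. smooth_on S \<sigma> \<and> flat_on S (\<lambda>x. exp (2 * \<sigma> x) *\<^sub>R g x))"

definition grad :: "'n::finite metric \<Rightarrow> (real^'n \<Rightarrow> real) \<Rightarrow> real^'n \<Rightarrow> real^'n" where
  "grad g F x = matrix_inv (g x) *v (\<chi> i. pd i F x)"

definition hess :: "'n::finite metric \<Rightarrow> (real^'n \<Rightarrow> real) \<Rightarrow> 'n \<Rightarrow> 'n \<Rightarrow> real^'n \<Rightarrow> real" where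
  "hess g F i j x = pd i (pd j F) x - (\<Sum>k\<in>UNIV. christoffel g k i j x * pd k F x)"

section \<open>Self-duality in dimension four\<close>

text \<open>A 2-form at a point is given by its skew-symmetric matrix of components. The
  orientation is the one of the coordinates.\<close>

definition is_2form :: "real^4^4 \<Rightarrow> bool" where
  "is_2form w \<longleftrightarrow> transpose w = - w"

definition raise2 :: "4 metric \<Rightarrow> real^4 \<Rightarrow> real^4^4 \<Rightarrow> real^4^4" where
  "raise2 g x w = matrix_inv (g x) ** w ** transpose (matrix_inv (g x))"

definition vol_form :: "4 metric \<Rightarrow> real^4 \<Rightarrow> 4 \<Rightarrow> 4 \<Rightarrow> 4 \<Rightarrow> 4 \<Rightarrow> real" where
  "vol_form g x i j k l = sqrt \<bar>det (g x)\<bar> *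
     det (vector [axis i 1, axis j 1, axis k 1, axis l 1] :: real^4^4)"

definition hodge :: "4 metric \<Rightarrow> real^4 \<Rightarrow> real^4^4 \<Rightarrow> real^4^4" where
  "hodge g x w = (\<chi> i j. 1/2 * (\<Sum>k\<in>UNIV. \<Sum>l\<in>UNIV. raise2 g x w $ k $ l * vol_form g x k l i j))"

text \<open>The order of the last two indices makes the curvature operator of the unit sphere, defined
  in the same way, equal to the identity.\<close>

definition weyl_op :: "4 metric \<Rightarrow> real^4 \<Rightarrow> real^4^4 \<Rightarrow> real^4^4" where
  "weyl_op g x w = (\<chi> i j. 1/2 * (\<Sum>k\<in>UNIV. \<Sum>l\<in>UNIV. weyl g i j l k x * raise2 g x w $ k $ l))"

text \<open>\<open>W\<^sup>+\<close> and \<open>W\<^sup>-\<close>: the Weyl operator composed with the projections \<open>(id \<plusminus> \<star>)/2\<close> onto the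
  self-dual and anti-self-dual 2-forms.\<close>

definition weyl_plus :: "4 metric \<Rightarrow> real^4 \<Rightarrow> real^4^4 \<Rightarrow> real^4^4" where
  "weyl_plus g x w = weyl_op g x ((1/2) *\<^sub>R (w + hodge g x w))"

definition weyl_minus :: "4 metric \<Rightarrow> real^4 \<Rightarrow> real^4^4 \<Rightarrow> real^4^4" where
  "weyl_minus g x w = weyl_op g x ((1/2) *\<^sub>R (w - hodge g x w))"

definition self_dual_on :: "(real^4) set \<Rightarrow> 4 metric \<Rightarrow> bool" where
  "self_dual_on S g \<longleftrightarrow> (\<forall>x\<in>S. \<forall>w. is_2form w \<longrightarrow> weyl_minus g x w = 0)"

definition anti_self_dual_on :: "(real^4) set \<Rightarrow> 4 metric \<Rightarrow> bool" where
  "anti_self_dual_on S g \<longleftrightarrow> (\<forall>x\<in>S. \<forall>w. is_2form w \<longrightarrow> weyl_plus g x w = 0)"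

section \<open>Warped products over an interval with three-dimensional fibre\<close>

definition warped_form ::
  "real \<Rightarrow> (real \<Rightarrow> real) \<Rightarrow> 3 metric \<Rightarrow> real \<times> (real^3) \<Rightarrow> real \<times> (real^3) \<Rightarrow> real \<times> (real^3) \<Rightarrow> real" where
  "warped_form \<epsilon> \<phi> h z u v =
     \<epsilon> * fst u * fst v + (\<phi> (fst z))\<^sup>2 * ip h (snd z) (snd u) (snd v)"

definition isometric_to_warped_product ::
  "(real^4) set \<Rightarrow> 4 metric \<Rightarrow> real set \<Rightarrow> real \<Rightarrow> (real \<Rightarrow> real) \<Rightarrow> (real^3) set \<Rightarrow> 3 metric \<Rightarrow> bool" where
  "isometric_to_warped_product S g I \<epsilon> \<phi> N h \<longleftrightarrow>
     (\<exists>\<Psi>. diffeo_on S (I \<times> N) \<Psi> \<and>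
        (\<forall>x\<in>S. \<forall>u v. ip g x u v =
           warped_form \<epsilon> \<phi> h (\<Psi> x) (frechet_derivative \<Psi> (at x) u) (frechet_derivative \<Psi> (at x) v)))"

definition warped_product_constant_curvature_fibre :: "(real^4) set \<Rightarrow> 4 metric \<Rightarrow> bool" where
  "warped_product_constant_curvature_fibre S g \<longleftrightarrow>
     (\<exists>I \<epsilon> \<phi> N h. open I \<and> is_interval I \<and> (\<epsilon> = 1 \<or> \<epsilon> = -1) \<and>
        smooth_on I \<phi> \<and> (\<forall>t\<in>I. \<phi> t > 0) \<and>
        metric_on N h \<and> constant_sectional_curvature N h \<and>
        isometric_to_warped_product S g I \<epsilon> \<phi> N h)"

section \<open>Pseudo-Riemannian manifolds\<close>

text \<open>A chart is a pair of a domain and a coordinate map; only the values of the map on the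
  domain matter. A tensor field is given by its components in every chart of the atlas.\<close>

type_synonym ('a, 'n) chart = "'a set \<times> ('a \<Rightarrow> real^'n)"

definition chart_image :: "('a, 'n::finite) chart \<Rightarrow> (real^'n) set" where
  "chart_image c = snd c ` fst c"

definition chart_inv :: "('a, 'n::finite) chart \<Rightarrow> real^'n \<Rightarrow> 'a" where
  "chart_inv c = inv_into (fst c) (snd c)"

definition transition :: "('a, 'n::finite) chart \<Rightarrow> ('a, 'n) chart \<Rightarrow> real^'n \<Rightarrow> real^'n" where
  "transition c d = snd d \<circ> chart_inv c"

definition smooth_manifold :: "'a topology \<Rightarrow> ('a, 'n::finite) chart set \<Rightarrow> bool" where
  "smooth_manifold M \<A> \<longleftrightarrow>
     Hausdorff_space M \<and> second_countable M \<and> (\<Union>c\<in>\<A>. fst c) = topspace M \<and>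
     (\<forall>c\<in>\<A>. openin M (fst c) \<and> open (chart_image c) \<and>
        homeomorphic_map (subtopology M (fst c)) (top_of_set (chart_image c)) (snd c)) \<and>
     (\<forall>c\<in>\<A>. \<forall>d\<in>\<A>. smooth_on (snd c ` (fst c \<inter> fst d)) (transition c d))"

definition pseudo_riemannian_manifold ::
  "'a topology \<Rightarrow> ('a, 'n::finite) chart set \<Rightarrow> (('a, 'n) chart \<Rightarrow> 'n metric) \<Rightarrow> bool" where
  "pseudo_riemannian_manifold M \<A> g \<longleftrightarrow>
     smooth_manifold M \<A> \<and>
     (\<forall>c\<in>\<A>. metric_on (chart_image c) (g c)) \<and>
     (\<forall>c\<in>\<A>. \<forall>d\<in>\<A>. \<forall>x\<in>snd c ` (fst c \<inter> fst d).
        g c x = transpose (jacobian (transition c d) (at x)) ** g d (transition c d x)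
                  ** jacobian (transition c d) (at x))"

definition manifold_signature ::
  "('a, 'n::finite) chart set \<Rightarrow> (('a, 'n) chart \<Rightarrow> 'n metric) \<Rightarrow> nat \<Rightarrow> nat \<Rightarrow> bool" where
  "manifold_signature \<A> g p q \<longleftrightarrow> (\<forall>c\<in>\<A>. \<forall>x\<in>chart_image c. has_signature (g c x) p q)"

definition smooth_function :: "('a, 'n::finite) chart set \<Rightarrow> ('a \<Rightarrow> real) \<Rightarrow> bool" where
  "smooth_function \<A> F \<longleftrightarrow> (\<forall>c\<in>\<A>. smooth_on (chart_image c) (F \<circ> chart_inv c))"

definition generalized_quasi_einstein ::
  "'a topology \<Rightarrow> ('a, 'n::finite) chart set \<Rightarrow> (('a, 'n) chart \<Rightarrow> 'n metric) \<Rightarrow> ('a \<Rightarrow> real) \<Rightarrow> real \<Rightarrow> bool" where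
  "generalized_quasi_einstein M \<A> g f \<mu> \<longleftrightarrow>
     pseudo_riemannian_manifold M \<A> g \<and> smooth_function \<A> f \<and>
     (\<exists>l::'a \<Rightarrow> real. smooth_function \<A> l \<and>
        (\<forall>c\<in>\<A>. \<forall>x\<in>chart_image c. \<forall>i j.
           hess (g c) (f \<circ> chart_inv c) i j x + ricci (g c) i j x
             - \<mu> * (pd i (f \<circ> chart_inv c) x * pd j (f \<circ> chart_inv c) x)
           = l (chart_inv c x) * g c x $ i $ j))"

definition nonnull_gradient ::
  "('a, 'n::finite) chart set \<Rightarrow> (('a, 'n) chart \<Rightarrow> 'n metric) \<Rightarrow> ('a \<Rightarrow> real) \<Rightarrow> bool" where
  "nonnull_gradient \<A> g f \<longleftrightarrow>
     (\<forall>c\<in>\<A>. \<forall>x\<in>chart_image c.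
        ip (g c) x (grad (g c) (f \<circ> chart_inv c) x) (grad (g c) (f \<circ> chart_inv c) x) \<noteq> 0)"

text \<open>Every point has a coordinate neighbourhood on which the metric has the property \<open>P\<close>. A
  neighbourhood is represented by its image \<open>S\<close> in a chart.\<close>

definition near_every_point ::
  "'a topology \<Rightarrow> ('a, 'n::finite) chart set \<Rightarrow> (('a, 'n) chart \<Rightarrow> 'n metric) \<Rightarrow>
   ((real^'n) set \<Rightarrow> 'n metric \<Rightarrow> bool) \<Rightarrow> bool" where
  "near_every_point M \<A> g P \<longleftrightarrow>
     (\<forall>p\<in>topspace M. \<exists>c\<in>\<A>. p \<in> fst c \<and>
        (\<exists>S. open S \<and> snd c p \<in> S \<and> S \<subseteq> chart_image c \<and> P S (g c)))"

text \<open>The local orientation is that of the chart. Reversing it exchanges the two alternatives, so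
  the notion does not depend on it, and no global orientation is needed.\<close>

definition half_conformally_flat ::
  "'a topology \<Rightarrow> ('a, 4) chart set \<Rightarrow> (('a, 4) chart \<Rightarrow> 4 metric) \<Rightarrow> bool" where
  "half_conformally_flat M \<A> g \<longleftrightarrow>
     near_every_point M \<A> g (\<lambda>S h. self_dual_on S h \<or> anti_self_dual_on S h)"

definition locally_conformally_flat ::
  "'a topology \<Rightarrow> ('a, 'n::finite) chart set \<Rightarrow> (('a, 'n) chart \<Rightarrow> 'n metric) \<Rightarrow> bool" where
  "locally_conformally_flat M \<A> g \<longleftrightarrow> near_every_point M \<A> g conformally_flat_on"

definition locally_warped_product_constant_curvature_fibre ::
  "'a topology \<Rightarrow> ('a, 4) chart set \<Rightarrow> (('a, 4) chart \<Rightarrow> 4 metric) \<Rightarrow> bool" where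
  "locally_warped_product_constant_curvature_fibre M \<A> g \<longleftrightarrow>
     near_every_point M \<A> g warped_product_constant_curvature_fibre"

end

theory Submission
  imports Defs
begin

text \<open>
  All statements are local, so the work is done on the image of one chart, and the case
  \<open>W\<^sup>- = 0\<close> and the case \<open>W\<^sup>+ = 0\<close> differ only by a sign \<open>\<sigma>\<close>. Write \<open>\<rho>\<close> for the Ricci tensor and
  call a 2-form selfdual when it lies in the eigenspace of the Hodge star on which the Weyl
  tensor is allowed to be nonzero.

  \<^emph>\<open>The Ricci tensor.\<close> The Ricci identity for \<open>f\<close>, in which the quasi-Einstein equation replaces
  the Hessian, expresses for every vector \<open>Z\<close> the 2-form
  \<open>(\<mu> + 1/2) df \<and> \<rho>(\<cdot>,Z) + v \<and> g(\<cdot>,Z)\<close>, with a covector \<open>v\<close>, by the Weyl tensor contracted with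
  the gradient and the Cotton tensor. The Weyl tensor is selfdual by hypothesis, and the second
  Bianchi identity makes the Cotton tensor selfdual too (\<open>cotton_selfdual\<close>). A selfdual 2-form
  \<open>df \<and> u\<close> is zero because the gradient is not null. Since \<open>\<mu> \<noteq> -1/2\<close>, it follows that
  \<open>\<rho> = x g + y df \<otimes> df\<close> (\<open>ricci_form\<close>).

  \<^emph>\<open>The Weyl tensor.\<close> Now the Hessian of \<open>f\<close> has the same form, and the Ricci identity determines
  the curvature contracted with the gradient. It leaves nothing for the Weyl tensor contracted
  with the gradient, and a selfdual 2-form that annihilates a nonnull vector vanishes. So
  \<open>W = 0\<close> (\<open>ca_derivative_and_weyl\<close>), the Cotton tensor vanishes as well, and curvature, Hessian
  and the differentials of the coefficient functions that matter below are expressed by \<open>g\<close> and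
  \<open>df\<close>.

  \<^emph>\<open>Integration.\<close> By these structure equations the level sets of \<open>f\<close> are umbilical with a
  constant curvature \<open>\<kappa>\<close>, once they are rescaled by a function \<open>\<phi>\<close> of \<open>f\<close>. Constant curvature
  is turned into coordinates by means of functions \<open>B\<close> which are constant along the gradient and
  satisfy \<open>Hess B = -\<kappa> B h\<close> on the rescaled level sets. They are the parallel sections of a linear
  connection that is flat on the covectors annihilating the gradient (\<open>fibre_conn_flat\<close>), so
  Frobenius' theorem (\<open>parallel_section\<close>) gives one with any value and any such differential at
  a point. The first integrals \<open>\<phi>\<^sup>2 \<langle>dB, dB'\<rangle> + \<kappa> B B'\<close> of this system (\<open>fibre_integral\<close>) give
  both conclusions.

  Three such functions that vanish at the point and have independent differentials there, and the
  arc length \<open>t\<close> of the gradient lines, are coordinates. In them the cometric is \<open>\<epsilon> \<partial>\<^sub>t \<otimes> \<partial>\<^sub>t + \<phi>\<^sup>-\<^sup>2 (C - \<kappa> y \<otimes> y)\<close> with a constant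
  matrix \<open>C\<close>, and \<open>C - \<kappa> y \<otimes> y\<close> is the cometric of a space of curvature \<open>\<kappa>\<close>
  (\<open>warped_product_near\<close>).

  For conformal flatness, the analogous functions \<open>A\<close> on the base, with
  \<open>(\<phi> \<partial>\<^sub>t)\<^sup>2 A = \<epsilon> \<kappa> A\<close>, are added. The first integrals define an inner product
  on the span of \<open>A0, A1, B0, B 1, B 2, B 3\<close>; if \<open>\<kappa> \<noteq> 0\<close>, these functions map \<open>M\<close> into a null cone. The
  quotients by the null element \<open>A0 + B0\<close>, in this picture stereographic coordinates, have
  differentials with constant inner products for a metric conformal to \<open>g\<close>, which is therefore
  flat (\<open>conformally_flat_near\<close>).
\<close>

section \<open>Calculus of smooth functions\<close>

lemma frechet_eq_of_has_derivative:
  "(F has_derivative F') (at x) \<Longrightarrow> frechet_derivative F (at x) = F'"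
  using frechet_derivative_at by metis

lemma C_k_on_cong:
  assumes "open S" "\<And>x. x \<in> S \<Longrightarrow> F x = G x"
  shows "C_k_on k S F = C_k_on k S G"
  using assms
proof (induction k arbitrary: F G)
  case 0
  then show ?case by (auto cong: continuous_on_cong)
next
  case (Suc k)
  have d: "F differentiable (at x) \<longleftrightarrow> G differentiable (at x)" if "x \<in> S" for x
    unfolding differentiable_def
    using has_derivative_transform_within_open[OF _ Suc.prems(1) that, of F _ UNIV G]
      has_derivative_transform_within_open[OF _ Suc.prems(1) that, of G _ UNIV F] Suc.prems(2) by auto
  have fr: "frechet_derivative F (at x) v = frechet_derivative G (at x) v" if "x \<in> S" for x v
  proof -
    have "(F has_derivative F') (at x) \<longleftrightarrow> (G has_derivative F') (at x)" for F'
      using has_derivative_transform_within_open[OF _ Suc.prems(1) that, of F _ UNIV G]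
        has_derivative_transform_within_open[OF _ Suc.prems(1) that, of G _ UNIV F] Suc.prems(2) by auto
    then show ?thesis by (simp add: frechet_derivative_def)
  qed
  have "C_k_on k S (\<lambda>x. frechet_derivative F (at x) v) = C_k_on k S (\<lambda>x. frechet_derivative G (at x) v)" for v
    by (rule Suc.IH) (use Suc.prems(1) fr in auto)
  then show ?case using d by simp
qed

lemma C_k_on_subset: "C_k_on k S F \<Longrightarrow> T \<subseteq> S \<Longrightarrow> C_k_on k T F"
  by (induction k arbitrary: F) (auto intro: continuous_on_subset)

lemma C_k_on_Suc_imp: "C_k_on (Suc k) S F \<Longrightarrow> C_k_on k S F"
proof (induction k arbitrary: F)
  case 0
  then show ?case
    by (auto intro!: continuous_at_imp_continuous_on differentiable_imp_continuous_within)
next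
  case (Suc k)
  then show ?case by (metis C_k_on.simps(2))
qed

lemma C_k_on_imp_continuous_on: "C_k_on k S F \<Longrightarrow> continuous_on S F"
  by (induction k) (simp, metis C_k_on_Suc_imp)

lemma C_k_on_SucI:
  assumes "open S" "\<And>x. x \<in> S \<Longrightarrow> (F has_derivative F' x) (at x)" "\<And>v. C_k_on k S (\<lambda>x. F' x v)"
  shows "C_k_on (Suc k) S F"
proof -
  have "C_k_on k S (\<lambda>x. frechet_derivative F (at x) v)" for v
    by (subst C_k_on_cong[OF assms(1), of _ "\<lambda>x. F' x v"])
       (use assms(2,3) frechet_eq_of_has_derivative in metis)+
  then show ?thesis using assms(2) by (auto simp: differentiable_def)
qed

lemma C_k_on_SucD:
  assumes "C_k_on (Suc k) S F"
  shows "\<And>x. x \<in> S \<Longrightarrow> (F has_derivative frechet_derivative F (at x)) (at x)"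
    "\<And>v. C_k_on k S (\<lambda>x. frechet_derivative F (at x) v)"
  using assms by (auto simp: frechet_derivative_works[symmetric])

lemma C_k_on_const: "open S \<Longrightarrow> C_k_on k S (\<lambda>x. c)"
  by (induction k arbitrary: c) auto

lemma C_k_on_bounded_linear:
  assumes "open S" "bounded_linear L" "C_k_on k S F"
  shows "C_k_on k S (\<lambda>x. L (F x))"
  using assms(3)
proof (induction k arbitrary: F)
  case 0
  then show ?case using bounded_linear.continuous_on[OF assms(2)] by auto
next
  case (Suc k)
  note d = C_k_on_SucD[OF Suc.prems]
  show ?case
    by (rule C_k_on_SucI[OF assms(1) bounded_linear.has_derivative[OF assms(2) d(1)]])
       (auto intro: Suc.IH d(2))
qed

lemma C_k_on_linear_map: "open S \<Longrightarrow> bounded_linear L \<Longrightarrow> C_k_on k S L"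
proof (cases k)
  case (Suc m)
  assume "open S" "bounded_linear L"
  then show ?thesis unfolding Suc
    by (intro C_k_on_SucI[OF _ bounded_linear_imp_has_derivative] C_k_on_const)
qed (auto simp: linear_continuous_on)

lemma C_k_on_add:
  assumes "open S" "C_k_on k S F" "C_k_on k S G"
  shows "C_k_on k S (\<lambda>x. F x + G x)"
  using assms(2,3)
proof (induction k arbitrary: F G)
  case 0
  then show ?case by (auto intro: continuous_intros)
next
  case (Suc k)
  note d = C_k_on_SucD[OF Suc.prems(1)] and e = C_k_on_SucD[OF Suc.prems(2)]
  show ?case
    by (rule C_k_on_SucI[OF assms(1) has_derivative_add[OF d(1) e(1)]])
       (auto intro: Suc.IH d(2) e(2))
qed

lemma C_k_on_bilinear:
  assumes "open S" "bounded_bilinear prd" "C_k_on k S F" "C_k_on k S G"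
  shows "C_k_on k S (\<lambda>x. prd (F x) (G x))"
  using assms(3,4)
proof (induction k arbitrary: F G)
  case 0
  then show ?case using bounded_bilinear.continuous_on[OF assms(2)] by auto
next
  case (Suc k)
  note d = C_k_on_SucD[OF Suc.prems(1)] and e = C_k_on_SucD[OF Suc.prems(2)]
  show ?case
    by (rule C_k_on_SucI[OF assms(1) bounded_bilinear.FDERIV[OF assms(2) d(1) e(1)]])
       (assumption | rule C_k_on_add[OF assms(1)] Suc.IH[OF C_k_on_Suc_imp[OF Suc.prems(1)] e(2)]
         Suc.IH[OF d(2) C_k_on_Suc_imp[OF Suc.prems(2)]])+
qed

lemma C_k_on_sum:
  assumes "open S" "\<And>i. i \<in> I \<Longrightarrow> C_k_on k S (F i)"
  shows "C_k_on k S (\<lambda>x. \<Sum>i\<in>I. F i x)"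
  using assms(2)
  by (induction I rule: infinite_finite_induct) (auto intro: C_k_on_const C_k_on_add assms(1))

text \<open>The derivative of a composition is expanded along a basis, so that the chain rule
  becomes a sum of products to which the induction hypothesis applies.\<close>

lemma C_k_on_compose:
  fixes F :: "'v::real_normed_vector \<Rightarrow> 'w::euclidean_space" and G :: "'w \<Rightarrow> 'u::real_normed_vector"
  assumes "open S" "open T" "C_k_on k S F" "C_k_on k T G" "F ` S \<subseteq> T"
  shows "C_k_on k S (\<lambda>x. G (F x))"
  using assms(3-5)
proof (induction k arbitrary: G)
  case 0
  then show ?case using continuous_on_compose2[of T G S F] by auto
next
  case (Suc k)
  note d = C_k_on_SucD[OF Suc.prems(1)] and e = C_k_on_SucD[OF Suc.prems(2)]
  have der: "((\<lambda>x. G (F x)) has_derivative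
      (\<lambda>v. \<Sum>b\<in>Basis. (frechet_derivative F (at x) v \<bullet> b) *\<^sub>R frechet_derivative G (at (F x)) b)) (at x)"
    if x: "x \<in> S" for x
  proof -
    have g: "(G has_derivative frechet_derivative G (at (F x))) (at (F x))"
      using e(1) x Suc.prems(3) by blast
    have "frechet_derivative G (at (F x)) w = (\<Sum>b\<in>Basis. (w \<bullet> b) *\<^sub>R frechet_derivative G (at (F x)) b)" for w
      using g by (subst euclidean_representation[of w, symmetric])
        (simp add: linear_sum linear_cmul has_derivative_linear o_def)
    then show ?thesis
      by (intro has_derivative_eq_rhs[OF has_derivative_compose[OF d(1)[OF x] g]] ext)
  qed
  show ?case
    by (rule C_k_on_SucI[OF assms(1) der])
       (auto intro!: C_k_on_sum[OF assms(1)] C_k_on_bilinear[OF assms(1) bounded_bilinear_scaleR]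
          C_k_on_bounded_linear[OF assms(1) bounded_linear_inner_left d(2)]
          Suc.IH[OF C_k_on_Suc_imp[OF Suc.prems(1)] e(2) Suc.prems(3)])
qed

lemma C_k_on_inverse: "C_k_on k (- {0}) (inverse :: real \<Rightarrow> real)"
proof (induction k)
  case (Suc k)
  show ?case
    by (rule C_k_on_SucI[OF _ has_derivative_inverse'])
       (auto intro!: C_k_on_bounded_linear[OF _ bounded_linear_minus[OF bounded_linear_ident]]
         C_k_on_bilinear[OF _ bounded_bilinear_mult] C_k_on_const Suc)
qed (auto intro: continuous_intros)

lemma C_k_on_exp: "C_k_on k UNIV (exp :: real \<Rightarrow> real)"
proof (induction k)
  case (Suc k)
  show ?case
    by (rule C_k_on_SucI[where F' = "\<lambda>x v. v * exp x"])
       (auto intro!: C_k_on_bilinear[OF _ bounded_bilinear_mult] C_k_on_const Suc derivative_eq_intros)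
qed (auto intro: continuous_intros)

lemma C_k_on_sqrt: "C_k_on k {0<..} (sqrt :: real \<Rightarrow> real)"
proof (induction k)
  case (Suc k)
  have inv: "C_k_on k {0<..} (\<lambda>x::real. inverse (sqrt x))"
    by (rule C_k_on_compose[of "{0<..}" "-{0}", OF _ _ Suc C_k_on_inverse]) auto
  have half: "C_k_on k {0<..} (\<lambda>x::real. inverse (sqrt x) * (1/2))"
    by (intro C_k_on_bilinear[OF _ bounded_bilinear_mult inv] C_k_on_const) auto
  have der: "(sqrt has_derivative (\<lambda>v. v * (inverse (sqrt x) * (1/2)))) (at x)" if "x \<in> {0<..}" for x :: real
    using that by (auto intro!: derivative_eq_intros simp: field_simps)
  show ?case
    by (rule C_k_on_SucI[OF _ der])
       (simp, assumption, rule C_k_on_bilinear[OF _ bounded_bilinear_mult C_k_on_const half], auto)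
next
  case 0
  have "continuous_on {0<..} (\<lambda>x::real. sqrt x)"
    by (intro continuous_on_real_sqrt continuous_on_id)
  then show ?case by simp
qed

lemma C_k_on_ln: "C_k_on k {0<..} (ln :: real \<Rightarrow> real)"
proof (cases k)
  case (Suc m)
  have der: "(ln has_derivative (\<lambda>v. v * inverse x)) (at x)" if "x \<in> {0<..}" for x :: real
    using that by (auto intro!: derivative_eq_intros simp: field_simps)
  show ?thesis unfolding Suc
    by (rule C_k_on_SucI[OF _ der])
       (auto intro!: C_k_on_bilinear[OF _ bounded_bilinear_mult] C_k_on_const
          C_k_on_subset[OF C_k_on_inverse])
qed (auto intro!: continuous_intros)

lemma smooth_on_cong:
  "open S \<Longrightarrow> (\<And>x. x \<in> S \<Longrightarrow> F x = G x) \<Longrightarrow> smooth_on S F = smooth_on S G"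
  unfolding smooth_on_def using C_k_on_cong[of S F G] by simp

lemma smooth_on_subset: "smooth_on S F \<Longrightarrow> T \<subseteq> S \<Longrightarrow> smooth_on T F"
  unfolding smooth_on_def using C_k_on_subset by blast

lemma smooth_on_has_derivative:
  "smooth_on S F \<Longrightarrow> x \<in> S \<Longrightarrow> (F has_derivative frechet_derivative F (at x)) (at x)"
  unfolding smooth_on_def using C_k_on_SucD(1) by blast

lemma smooth_on_differentiable: "smooth_on S F \<Longrightarrow> x \<in> S \<Longrightarrow> F differentiable (at x)"
  using smooth_on_has_derivative differentiable_def by blast

lemma smooth_on_continuous: "smooth_on S F \<Longrightarrow> continuous_on S F"
  unfolding smooth_on_def using C_k_on_imp_continuous_on by blast

named_theorems smooth_intros

lemma smooth_on_const [smooth_intros]: "open S \<Longrightarrow> smooth_on S (\<lambda>x. c)"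
  by (simp add: smooth_on_def C_k_on_const)

lemma smooth_on_bounded_linear:
  "open S \<Longrightarrow> bounded_linear L \<Longrightarrow> smooth_on S F \<Longrightarrow> smooth_on S (\<lambda>x. L (F x))"
  by (simp add: smooth_on_def C_k_on_bounded_linear)

lemma smooth_on_linear_map: "open S \<Longrightarrow> bounded_linear L \<Longrightarrow> smooth_on S L"
  by (simp add: smooth_on_def C_k_on_linear_map)

lemma smooth_on_add [smooth_intros]:
  "open S \<Longrightarrow> smooth_on S F \<Longrightarrow> smooth_on S G \<Longrightarrow> smooth_on S (\<lambda>x. F x + G x)"
  by (simp add: smooth_on_def C_k_on_add)

lemma smooth_on_minus [smooth_intros]:
  "open S \<Longrightarrow> smooth_on S F \<Longrightarrow> smooth_on S (\<lambda>x. - F x)"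
  using smooth_on_bounded_linear[OF _ bounded_linear_minus[OF bounded_linear_ident]] .

lemma smooth_on_diff [smooth_intros]:
  "open S \<Longrightarrow> smooth_on S F \<Longrightarrow> smooth_on S G \<Longrightarrow> smooth_on S (\<lambda>x. F x - G x)"
  using smooth_on_add[of S F "\<lambda>x. - G x"] smooth_on_minus[of S G] by simp

lemma smooth_on_scaleR [smooth_intros]:
  "open S \<Longrightarrow> smooth_on S F \<Longrightarrow> smooth_on S G \<Longrightarrow> smooth_on S (\<lambda>x. F x *\<^sub>R G x)"
  by (simp add: smooth_on_def C_k_on_bilinear[OF _ bounded_bilinear_scaleR])

lemma smooth_on_mult [smooth_intros]:
  fixes F G :: "'v::real_normed_vector \<Rightarrow> real"
  shows "open S \<Longrightarrow> smooth_on S F \<Longrightarrow> smooth_on S G \<Longrightarrow> smooth_on S (\<lambda>x. F x * G x)"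
  by (simp add: smooth_on_def C_k_on_bilinear[OF _ bounded_bilinear_mult])

lemma smooth_on_power [smooth_intros]:
  fixes F :: "'v::real_normed_vector \<Rightarrow> real"
  shows "open S \<Longrightarrow> smooth_on S F \<Longrightarrow> smooth_on S (\<lambda>x. F x ^ n)"
  by (induction n) (auto intro: smooth_intros)

lemma smooth_on_sum [smooth_intros]:
  "open S \<Longrightarrow> (\<And>i. i \<in> I \<Longrightarrow> smooth_on S (F i)) \<Longrightarrow> smooth_on S (\<lambda>x. \<Sum>i\<in>I. F i x)"
  by (simp add: smooth_on_def C_k_on_sum)

lemma smooth_on_prod [smooth_intros]:
  fixes F :: "'i \<Rightarrow> 'v::real_normed_vector \<Rightarrow> real"
  assumes "open S" "\<And>i. i \<in> I \<Longrightarrow> smooth_on S (F i)"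
  shows "smooth_on S (\<lambda>x. \<Prod>i\<in>I. F i x)"
  using assms(2)
  by (induction I rule: infinite_finite_induct) (auto intro: smooth_intros assms(1))

lemma smooth_on_compose:
  fixes F :: "'v::real_normed_vector \<Rightarrow> 'w::euclidean_space" and G :: "'w \<Rightarrow> 'u::real_normed_vector"
  shows "open S \<Longrightarrow> open T \<Longrightarrow> smooth_on S F \<Longrightarrow> smooth_on T G \<Longrightarrow> F ` S \<subseteq> T
    \<Longrightarrow> smooth_on S (\<lambda>x. G (F x))"
  unfolding smooth_on_def using C_k_on_compose[of S T _ F G] by blast

lemma smooth_on_inverse [smooth_intros]:
  fixes F :: "'v::real_normed_vector \<Rightarrow> real"
  assumes "open S" "smooth_on S F" "\<And>x. x \<in> S \<Longrightarrow> F x \<noteq> 0"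
  shows "smooth_on S (\<lambda>x. inverse (F x))"
  by (rule smooth_on_compose[OF assms(1) _ assms(2), of "-{0}"])
     (use assms(3) in \<open>auto simp: smooth_on_def C_k_on_inverse\<close>)

lemma smooth_on_divide [smooth_intros]:
  fixes F G :: "'v::real_normed_vector \<Rightarrow> real"
  shows "open S \<Longrightarrow> smooth_on S F \<Longrightarrow> smooth_on S G \<Longrightarrow> (\<And>x. x \<in> S \<Longrightarrow> G x \<noteq> 0)
    \<Longrightarrow> smooth_on S (\<lambda>x. F x / G x)"
  unfolding divide_inverse by (intro smooth_intros)

lemma smooth_on_exp [smooth_intros]:
  fixes F :: "'v::real_normed_vector \<Rightarrow> real"
  shows "open S \<Longrightarrow> smooth_on S F \<Longrightarrow> smooth_on S (\<lambda>x. exp (F x))"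
  by (rule smooth_on_compose[of _ UNIV]) (auto simp: smooth_on_def C_k_on_exp)

lemma smooth_on_ln [smooth_intros]:
  fixes F :: "'v::real_normed_vector \<Rightarrow> real"
  shows "open S \<Longrightarrow> smooth_on S F \<Longrightarrow> (\<And>x. x \<in> S \<Longrightarrow> F x > 0) \<Longrightarrow> smooth_on S (\<lambda>x. ln (F x))"
  by (rule smooth_on_compose[of _ "{0<..}"]) (auto simp: smooth_on_def C_k_on_ln)

lemma smooth_on_sqrt [smooth_intros]:
  fixes F :: "'v::real_normed_vector \<Rightarrow> real"
  shows "open S \<Longrightarrow> smooth_on S F \<Longrightarrow> (\<And>x. x \<in> S \<Longrightarrow> F x > 0) \<Longrightarrow> smooth_on S (\<lambda>x. sqrt (F x))"
  by (rule smooth_on_compose[of _ "{0<..}"]) (auto simp: smooth_on_def C_k_on_sqrt)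

lemma smooth_on_vec_nth [smooth_intros]:
  "open S \<Longrightarrow> smooth_on S F \<Longrightarrow> smooth_on S (\<lambda>x. F x $ i)"
  using smooth_on_bounded_linear[OF _ bounded_linear_vec_nth] .

lemma smooth_on_frechet [smooth_intros]:
  "smooth_on S F \<Longrightarrow> smooth_on S (\<lambda>x. frechet_derivative F (at x) v)"
  unfolding smooth_on_def using C_k_on_SucD(2)[of _ S F] by blast

lemma smooth_on_pd [smooth_intros]: "smooth_on S F \<Longrightarrow> smooth_on S (pd i F)"
  unfolding pd_def[abs_def] by (rule smooth_on_frechet)

lemma smooth_on_euclidean:
  fixes F :: "'v::real_normed_vector \<Rightarrow> 'w::euclidean_space"
  assumes "open S" "\<And>b. b \<in> Basis \<Longrightarrow> smooth_on S (\<lambda>x. F x \<bullet> b)"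
  shows "smooth_on S F"
proof -
  have "smooth_on S (\<lambda>x. \<Sum>b\<in>Basis. (F x \<bullet> b) *\<^sub>R b)"
    by (intro smooth_intros assms)
  then show ?thesis by (simp add: euclidean_representation)
qed

lemma smooth_on_vec:
  fixes F :: "'v::real_normed_vector \<Rightarrow> 'w::euclidean_space^'n"
  assumes "open S" "\<And>i. smooth_on S (\<lambda>x. F x $ i)"
  shows "smooth_on S F"
proof (rule smooth_on_euclidean[OF assms(1)])
  fix b :: "'w^'n" assume "b \<in> Basis"
  then obtain i u where b: "b = axis i u" by (auto simp: Basis_vec_def)
  show "smooth_on S (\<lambda>x. F x \<bullet> b)" unfolding b inner_axis
    by (rule smooth_on_bounded_linear[OF assms(1) bounded_linear_inner_left assms(2)])
qed

lemma smooth_on_Pair [smooth_intros]: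
  assumes "open S" "smooth_on S F" "smooth_on S G"
  shows "smooth_on S (\<lambda>x. (F x, G x))"
proof -
  have "smooth_on S (\<lambda>x. (F x, 0) + (0, G x))"
    by (intro smooth_on_add assms smooth_on_bounded_linear[OF assms(1) _ assms(2), of "\<lambda>y. (y, 0)"]
        smooth_on_bounded_linear[OF assms(1) _ assms(3), of "\<lambda>y. (0, y)"] bounded_linear_Pair
        bounded_linear_ident bounded_linear_zero)
  then show ?thesis by simp
qed

lemma smooth_on_coord [smooth_intros]: "open S \<Longrightarrow> smooth_on S (\<lambda>x. x $ i)"
  using smooth_on_linear_map[OF _ bounded_linear_vec_nth] .

subsection \<open>Partial derivatives\<close>

lemma frechet_eq_sum_pd:
  fixes F :: "real^'n \<Rightarrow> real"
  assumes "F differentiable (at x)"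
  shows "frechet_derivative F (at x) v = (\<Sum>i\<in>UNIV. v $ i * pd i F x)"
proof -
  have lin: "linear (frechet_derivative F (at x))"
    using assms linear_frechet_derivative by blast
  have "v = (\<Sum>i\<in>UNIV. v $ i *\<^sub>R axis i 1)"
    using basis_expansion[of v] by (simp add: scalar_mult_eq_scaleR)
  then have "frechet_derivative F (at x) v = frechet_derivative F (at x) (\<Sum>i\<in>UNIV. v $ i *\<^sub>R axis i 1)"
    by simp
  then show ?thesis unfolding pd_def by (simp add: linear_sum[OF lin] linear_cmul[OF lin])
qed

lemma has_derivative_imp_pd: "(F has_derivative F') (at x) \<Longrightarrow> pd i F x = F' (axis i 1)"
  unfolding pd_def using frechet_eq_of_has_derivative by metis

lemma differentiable_imp_has_derivative:
  "F differentiable (at x) \<Longrightarrow> (F has_derivative frechet_derivative F (at x)) (at x)"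
  by (simp add: frechet_derivative_works[symmetric])

lemma pd_const [simp]: "pd i (\<lambda>x. c) x = 0"
  by (simp add: pd_def)

lemma pd_add:
  "F differentiable (at x) \<Longrightarrow> G differentiable (at x) \<Longrightarrow> pd i (\<lambda>x. F x + G x) x = pd i F x + pd i G x"
  by (subst has_derivative_imp_pd[OF has_derivative_add])
     (auto intro: differentiable_imp_has_derivative simp: pd_def)

lemma pd_minus: "F differentiable (at x) \<Longrightarrow> pd i (\<lambda>x. - F x) x = - pd i F x"
  by (subst has_derivative_imp_pd[OF has_derivative_minus])
     (auto intro: differentiable_imp_has_derivative simp: pd_def)

lemma pd_diff:
  "F differentiable (at x) \<Longrightarrow> G differentiable (at x) \<Longrightarrow> pd i (\<lambda>x. F x - G x) x = pd i F x - pd i G x"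
  by (subst has_derivative_imp_pd[OF has_derivative_diff])
     (auto intro: differentiable_imp_has_derivative simp: pd_def)

lemma pd_mult:
  "F differentiable (at x) \<Longrightarrow> G differentiable (at x)
    \<Longrightarrow> pd i (\<lambda>x. F x * G x) x = pd i F x * G x + F x * pd i G x"
  by (subst has_derivative_imp_pd[OF has_derivative_mult])
     (auto intro: differentiable_imp_has_derivative simp: pd_def)

lemma pd_cmult: "F differentiable (at x) \<Longrightarrow> pd i (\<lambda>x. c * F x) x = c * pd i F x"
  by (subst pd_mult) auto

lemma pd_sum:
  "(\<And>j. j \<in> I \<Longrightarrow> F j differentiable (at x))
    \<Longrightarrow> pd i (\<lambda>x. \<Sum>j\<in>I. F j x) x = (\<Sum>j\<in>I. pd i (F j) x)"
  by (subst has_derivative_imp_pd[OF has_derivative_sum])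
     (auto intro: differentiable_imp_has_derivative simp: pd_def)

lemma pd_chain:
  assumes "F differentiable (at x)" "(h has_real_derivative h') (at (F x))"
  shows "pd i (\<lambda>x. h (F x)) x = h' * pd i F x"
proof -
  have "((\<lambda>x. h (F x)) has_derivative (\<lambda>v. frechet_derivative F (at x) v * h')) (at x)"
    using has_derivative_compose[OF differentiable_imp_has_derivative[OF assms(1)]
      assms(2)[unfolded has_field_derivative_def]]
    by (simp add: mult.commute)
  from has_derivative_imp_pd[OF this] show ?thesis by (simp add: pd_def)
qed

lemma pd_divide:
  assumes "F differentiable (at x)" "G differentiable (at x)" "G x \<noteq> 0"
  shows "pd i (\<lambda>x. F x / G x) x = (pd i F x * G x - F x * pd i G x) / (G x)\<^sup>2"
  using assms
  by (subst has_derivative_imp_pd[OF has_derivative_divide'])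
     (auto intro: differentiable_imp_has_derivative simp: pd_def power2_eq_square)

lemma pd_coord: "pd i (\<lambda>x. x $ j) x = (if i = j then 1 else 0)"
  by (subst has_derivative_imp_pd[OF bounded_linear_imp_has_derivative[OF bounded_linear_vec_nth]])
     (auto simp: axis_def)

lemma pd_transform:
  assumes "open S" "x \<in> S" "\<And>y. y \<in> S \<Longrightarrow> F y = G y"
  shows "pd i F x = pd i G x"
proof -
  have "(F has_derivative F') (at x) \<longleftrightarrow> (G has_derivative F') (at x)" for F'
    using has_derivative_transform_within_open[OF _ assms(1,2), of F _ UNIV G]
      has_derivative_transform_within_open[OF _ assms(1,2), of G _ UNIV F] assms(3) by auto
  then show ?thesis unfolding pd_def frechet_derivative_def by simp
qed

lemma line_has_derivative:
  fixes F :: "real^'n \<Rightarrow> real"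
  assumes "F differentiable (at (y + s *\<^sub>R axis i 1))"
  shows "((\<lambda>s. F (y + s *\<^sub>R axis i 1)) has_real_derivative pd i F (y + s *\<^sub>R axis i 1)) (at s)"
proof -
  have "((\<lambda>s. y + s *\<^sub>R axis i (1::real)) has_derivative (\<lambda>h. h *\<^sub>R axis i 1)) (at s)"
    by (auto intro!: derivative_eq_intros)
  from has_derivative_compose[OF this differentiable_imp_has_derivative[OF assms]]
  have "((\<lambda>s. F (y + s *\<^sub>R axis i 1)) has_derivative
      (\<lambda>h. frechet_derivative F (at (y + s *\<^sub>R axis i 1)) (h *\<^sub>R axis i 1))) (at s)" .
  moreover have "linear (frechet_derivative F (at (y + s *\<^sub>R axis i 1)))"
    using assms linear_frechet_derivative by blast
  ultimately show ?thesis
    by (simp add: has_field_derivative_def pd_def linear_cmul mult.commute[of _ "frechet_derivative _ _ _"])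
qed

text \<open>Both mixed partial derivatives are limits of the same second difference quotient, which
  two applications of the mean value theorem express by either of them at a nearby point.\<close>

lemma second_difference_mvt:
  fixes F :: "real^'n \<Rightarrow> real"
  assumes sm: "smooth_on (ball x r) F" and h: "0 < h" "h < r / 2"
  shows "\<exists>y. norm (y - x) \<le> 2 * h \<and>
    F (x + h *\<^sub>R axis i 1 + h *\<^sub>R axis j 1) - F (x + h *\<^sub>R axis i 1) - F (x + h *\<^sub>R axis j 1) + F x
      = h * h * pd j (pd i F) y"
proof -
  let ?e = "\<lambda>i. axis i 1 :: real^'n"
  have nrm: "norm (s *\<^sub>R ?e i + t *\<^sub>R ?e j) \<le> \<bar>s\<bar> + \<bar>t\<bar>" for s t
    using norm_triangle_ineq[of "s *\<^sub>R ?e i" "t *\<^sub>R ?e j"] by simp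
  have inb: "x + s *\<^sub>R ?e i + t *\<^sub>R ?e j \<in> ball x r" if "0 \<le> s" "s \<le> h" "0 \<le> t" "t \<le> h" for s t
    using nrm[of s t] that h norm_minus_cancel[of "s *\<^sub>R ?e i + t *\<^sub>R ?e j"] by (simp add: dist_norm algebra_simps)
  let ?g = "\<lambda>s. F (x + h *\<^sub>R ?e j + s *\<^sub>R ?e i) - F (x + s *\<^sub>R ?e i)"
  have g': "(?g has_real_derivative pd i F (x + h *\<^sub>R ?e j + s *\<^sub>R ?e i) - pd i F (x + s *\<^sub>R ?e i)) (at s)"
    if "0 \<le> s" "s \<le> h" for s
    using inb[of s h] inb[of s 0] that h
    by (intro derivative_intros line_has_derivative smooth_on_differentiable[OF sm]) (auto simp: algebra_simps)
  obtain s where s: "0 < s" "s < h" "?g h - ?g 0 = (h - 0) * (pd i F (x + h *\<^sub>R ?e j + s *\<^sub>R ?e i) - pd i F (x + s *\<^sub>R ?e i))"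
    using MVT2[OF h(1) g'] by blast
  have k': "((\<lambda>t. pd i F (x + s *\<^sub>R ?e i + t *\<^sub>R ?e j)) has_real_derivative
      pd j (pd i F) (x + s *\<^sub>R ?e i + t *\<^sub>R ?e j)) (at t)"
    if "0 \<le> t" "t \<le> h" for t
    using inb[of s t] that s
    by (intro line_has_derivative smooth_on_differentiable[OF smooth_on_pd[OF sm]]) auto
  obtain t where t: "0 < t" "t < h" "pd i F (x + s *\<^sub>R ?e i + h *\<^sub>R ?e j) - pd i F (x + s *\<^sub>R ?e i + 0 *\<^sub>R ?e j)
       = (h - 0) * pd j (pd i F) (x + s *\<^sub>R ?e i + t *\<^sub>R ?e j)"
    using MVT2[OF h(1) k'] by blast
  have "norm (x + s *\<^sub>R ?e i + t *\<^sub>R ?e j - x) \<le> 2 * h"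
    using nrm[of s t] s t by (simp add: algebra_simps)
  moreover have "F (x + h *\<^sub>R ?e i + h *\<^sub>R ?e j) - F (x + h *\<^sub>R ?e i) - F (x + h *\<^sub>R ?e j) + F x
      = h * h * pd j (pd i F) (x + s *\<^sub>R ?e i + t *\<^sub>R ?e j)"
    using s(3) t(3) by (simp add: algebra_simps)
  ultimately show ?thesis by blast
qed

lemma pd_commute:
  fixes F :: "real^'n \<Rightarrow> real"
  assumes S: "open S" "x \<in> S" and sm: "smooth_on S F"
  shows "pd i (pd j F) x = pd j (pd i F) x"
proof (rule ccontr)
  assume ne: "pd i (pd j F) x \<noteq> pd j (pd i F) x"
  define e where "e = \<bar>pd i (pd j F) x - pd j (pd i F) x\<bar> / 2"
  have e: "e > 0" using ne by (simp add: e_def)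
  obtain r where r: "r > 0" "ball x r \<subseteq> S" using S openE by blast
  have sm': "smooth_on (ball x r) F" using sm r smooth_on_subset by blast
  have ct: "isCont (pd i (pd j F)) x" for i j
    using smooth_on_continuous[OF smooth_on_pd[OF smooth_on_pd[OF sm]]] S
    by (simp add: continuous_on_eq_continuous_at)
  obtain d where d: "d > 0" "\<And>y. dist y x < d \<Longrightarrow> dist (pd i (pd j F) y) (pd i (pd j F) x) < e"
    using ct[of i j] e unfolding continuous_at_eps_delta by blast
  obtain d' where d': "d' > 0" "\<And>y. dist y x < d' \<Longrightarrow> dist (pd j (pd i F) y) (pd j (pd i F) x) < e"
    using ct[of j i] e unfolding continuous_at_eps_delta by blast
  define h where "h = min (r/3) (min (d/3) (d'/3))"
  have h: "0 < h" "h < r/2" "2 * h < d" "2 * h < d'" using r d d' by (auto simp: h_def min_def)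
  obtain y where y: "norm (y - x) \<le> 2 * h" "F (x + h *\<^sub>R axis i 1 + h *\<^sub>R axis j 1) - F (x + h *\<^sub>R axis i 1) - F (x + h *\<^sub>R axis j 1) + F x
      = h * h * pd j (pd i F) y" using second_difference_mvt[OF sm' h(1,2)] by blast
  obtain z where z: "norm (z - x) \<le> 2 * h" "F (x + h *\<^sub>R axis j 1 + h *\<^sub>R axis i 1) - F (x + h *\<^sub>R axis j 1) - F (x + h *\<^sub>R axis i 1) + F x
      = h * h * pd i (pd j F) z" using second_difference_mvt[OF sm' h(1,2)] by blast
  have "h * h * pd j (pd i F) y = h * h * pd i (pd j F) z"
    using y(2) z(2) by (simp add: algebra_simps)
  then have "pd j (pd i F) y = pd i (pd j F) z" using h by simp
  moreover have "dist (pd i (pd j F) z) (pd i (pd j F) x) < e" "dist (pd j (pd i F) y) (pd j (pd i F) x) < e"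
    using y z h d(2)[of z] d'(2)[of y] by (auto simp: dist_norm)
  ultimately show False unfolding e_def dist_real_def by (auto simp: abs_if split: if_splits)
qed

lemma pd_zero_imp_constant:
  fixes F :: "real^'n \<Rightarrow> real"
  assumes "open S" "convex S" "smooth_on S F" "\<And>i x. x \<in> S \<Longrightarrow> pd i F x = 0" "x \<in> S" "y \<in> S"
  shows "F x = F y"
proof -
  have "(F has_derivative (\<lambda>h. 0)) (at x within S)" if "x \<in> S" for x
  proof -
    have "frechet_derivative F (at x) = (\<lambda>v. 0)"
      using frechet_eq_sum_pd[OF smooth_on_differentiable[OF assms(3) that]] assms(4)[OF that] by auto
    then show ?thesis
      using smooth_on_has_derivative[OF assms(3) that] has_derivative_at_withinI by metis
  qed
  then show ?thesis using has_derivative_zero_constant[OF assms(2)] assms(5,6) by metis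
qed

subsection \<open>Inverse matrices\<close>

lemma smooth_on_det [smooth_intros]:
  fixes A :: "'v::real_normed_vector \<Rightarrow> real^'n^'n"
  assumes "open S" "\<And>i j. smooth_on S (\<lambda>x. A x $ i $ j)"
  shows "smooth_on S (\<lambda>x. det (A x))"
  unfolding det_def by (intro smooth_intros assms)

lemma matrix_inv_both:
  assumes "invertible A" shows "A ** matrix_inv A = mat 1 \<and> matrix_inv A ** A = mat 1"
  using assms unfolding invertible_def matrix_inv_def by (rule someI_ex)

lemmas matrix_inv_right = matrix_inv_both[THEN conjunct1]
  and matrix_inv_left = matrix_inv_both[THEN conjunct2]

lemma matrix_inv_unique_left:
  fixes A B :: "real^'n^'n"
  assumes "A ** B = mat 1" shows "matrix_inv A = B"
proof -
  have "invertible A" using assms invertible_right_inverse by blast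
  then have "matrix_inv A = matrix_inv A ** (A ** B)" using assms by simp
  also have "\<dots> = B" by (simp add: matrix_mul_assoc matrix_inv_left \<open>invertible A\<close>)
  finally show ?thesis .
qed

lemma matrix_inv_transpose:
  fixes A :: "real^'n^'n"
  assumes "invertible A" shows "transpose (matrix_inv A) = matrix_inv (transpose A)"
  by (metis assms matrix_inv_left matrix_inv_unique_left matrix_transpose_mul transpose_mat)

lemma triple_product_entry:
  fixes A B C :: "real^'n^'n"
  shows "(A ** B ** transpose C) $ i $ j = (\<Sum>a\<in>UNIV. \<Sum>b\<in>UNIV. A $ i $ a * B $ a $ b * C $ j $ b)"
  unfolding matrix_matrix_mult_def transpose_def by (simp add: sum_distrib_right) (rule sum.swap)

text \<open>The entries of the inverse are quotients of determinants by Cramer's rule.\<close>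

lemma smooth_on_matrix_inv:
  fixes A :: "'v::real_normed_vector \<Rightarrow> real^'n^'n"
  assumes S: "open S" and A: "\<And>i j. smooth_on S (\<lambda>x. A x $ i $ j)"
    and inv: "\<And>x. x \<in> S \<Longrightarrow> invertible (A x)"
  shows "smooth_on S (\<lambda>x. matrix_inv (A x) $ i $ j)"
proof -
  have eq: "matrix_inv (A x) $ i $ j
      = det (\<chi> k l. if l = i then (axis j 1 :: real^'n) $ k else A x $ k $ l) / det (A x)" if "x \<in> S" for x
  proof -
    have "A x *v (matrix_inv (A x) *v axis j 1) = axis j 1"
      using matrix_inv_right[OF inv[OF that]] by (simp add: matrix_vector_mul_assoc)
    moreover have "det (A x) \<noteq> 0" using inv[OF that] invertible_det_nz by blast
    ultimately have "matrix_inv (A x) *v axis j 1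
      = (\<chi> i. det (\<chi> k l. if l = i then (axis j 1 :: real^'n) $ k else A x $ k $ l) / det (A x))"
      by (simp add: cramer)
    moreover have "(matrix_inv (A x) *v axis j 1) $ i = matrix_inv (A x) $ i $ j"
      by (simp add: matrix_vector_mult_basis column_def)
    ultimately show ?thesis by simp
  qed
  have "smooth_on S (\<lambda>x. (\<chi> k l. if l = i then (axis j 1 :: real^'n) $ k else A x $ k $ l) $ k $ l)" for k l
    using A by (cases "l = i") (auto intro: smooth_intros S)
  then have "smooth_on S (\<lambda>x. det (\<chi> k l. if l = i then (axis j 1 :: real^'n) $ k else A x $ k $ l) / det (A x))"
    using inv by (intro smooth_on_divide smooth_on_det S A) (auto simp: invertible_det_nz[symmetric])
  then show ?thesis using smooth_on_cong[OF S eq] by simp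
qed

section \<open>Parallel sections of linear connections\<close>

subsection \<open>Linear ordinary differential equations on the unit interval\<close>

text \<open>Picard iteration. The bound by one half makes the integral operator a contraction, so that its
  fixed point exists on the whole unit interval.\<close>

lemma linear_ode_exists:
  fixes M :: "real \<Rightarrow> 'e::euclidean_space \<Rightarrow> 'e" and u0 :: 'e
  assumes lin: "\<And>s. s \<in> {0..1} \<Longrightarrow> linear (M s)"
    and cont: "\<And>u. continuous_on {0..1} u \<Longrightarrow> continuous_on {0..1} (\<lambda>s. M s (u s))"
    and bnd: "\<And>s e. s \<in> {0..1} \<Longrightarrow> norm (M s e) \<le> norm e / 2"
  obtains u where "u 0 = u0"
    "\<And>s. s \<in> {0..1} \<Longrightarrow> (u has_vector_derivative M s (u s)) (at s within {0..1})"
proof -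
  define J where "J u t = u0 + integral {0..t} (\<lambda>s. M s (u s))" for u :: "real \<Rightarrow> 'e" and t
  \<comment> \<open>bounded continuous functions live on the whole line; clamping to the unit interval extends
    the integral operator to them\<close>
  define cl where "cl t = max 0 (min 1 t)" for t :: real
  have cl: "cl t \<in> {0..1}" for t by (auto simp: cl_def)
  define T where "T u = Bcontfun (\<lambda>t. J (apply_bcontfun u) (cl t))" for u
  have c1: "continuous_on {0..1} (\<lambda>s. M s (apply_bcontfun u s))" for u
    by (rule cont) simp
  have c2: "continuous_on {0..1} (J (apply_bcontfun u))" for u
    unfolding J_def[abs_def]
    by (intro continuous_intros indefinite_integral_continuous_1 integrable_continuous_real c1)
  have mem: "(\<lambda>t. J (apply_bcontfun u) (cl t)) \<in> bcontfun" for u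
  proof -
    have "compact (J (apply_bcontfun u) ` {0..1})"
      using c2 compact_continuous_image compact_Icc by blast
    then obtain b where "\<forall>t\<in>{0..1}. norm (J (apply_bcontfun u) t) \<le> b"
      using compact_imp_bounded bounded_iff by (metis imageI)
    moreover have "continuous_on UNIV (\<lambda>t. J (apply_bcontfun u) (cl t))"
      by (rule continuous_on_compose2[OF c2, of _ cl]) (use cl in \<open>auto simp: cl_def[abs_def] intro!: continuous_intros\<close>)
    ultimately show ?thesis using cl by (intro bcontfun_normI) auto
  qed
  have Tap: "apply_bcontfun (T u) t = J (apply_bcontfun u) (cl t)" for u t
    unfolding T_def using Bcontfun_inverse[OF mem] by simp
  have contr: "dist (T u) (T v) \<le> 1/2 * dist u v" for u v
  proof (rule dist_bound)
    fix t
    have sub: "{0..cl t} \<subseteq> {0..1}" using cl by auto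
    have i: "(\<lambda>s. M s (apply_bcontfun w s)) integrable_on {0..cl t}" for w
      by (rule integrable_continuous_real[OF continuous_on_subset[OF c1 sub]])
    have "norm (integral {0..cl t} (\<lambda>s. M s (apply_bcontfun u s - apply_bcontfun v s))) \<le> dist u v / 2 * (cl t - 0)"
    proof (rule integral_bound)
      show "continuous_on {0..cl t} (\<lambda>s. M s (apply_bcontfun u s - apply_bcontfun v s))"
        by (rule continuous_on_subset[OF cont sub]) (auto intro!: continuous_intros)
      fix s assume "s \<in> {0..cl t}"
      then have "norm (M s (apply_bcontfun u s - apply_bcontfun v s)) \<le> norm (apply_bcontfun u s - apply_bcontfun v s) / 2"
        using sub bnd by blast
      also have "\<dots> \<le> dist u v / 2" using dist_bounded[of u s v] by (simp add: dist_norm)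
      finally show "norm (M s (apply_bcontfun u s - apply_bcontfun v s)) \<le> dist u v / 2" .
    qed (use cl in auto)
    also have "dist u v / 2 * (cl t - 0) \<le> dist u v / 2 * 1"
      by (rule mult_left_mono) (use cl in auto)
    finally have "norm (integral {0..cl t} (\<lambda>s. M s (apply_bcontfun u s - apply_bcontfun v s))) \<le> dist u v / 2" by simp
    moreover have "integral {0..cl t} (\<lambda>s. M s (apply_bcontfun u s - apply_bcontfun v s))
       = integral {0..cl t} (\<lambda>s. M s (apply_bcontfun u s)) - integral {0..cl t} (\<lambda>s. M s (apply_bcontfun v s))"
      by (subst integral_diff[symmetric, OF i i], rule integral_cong)
         (use sub lin in \<open>auto simp: linear_diff\<close>)
    ultimately show "dist (apply_bcontfun (T u) t) (apply_bcontfun (T v) t) \<le> 1/2 * dist u v"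
      by (simp add: Tap J_def dist_norm)
  qed
  obtain u where u: "T u = u" using banach_fix_type[of "1/2" T] contr by auto
  have eq: "apply_bcontfun u t = J (apply_bcontfun u) t" if "t \<in> {0..1}" for t
    using Tap[of u t] that u by (simp add: cl_def)
  show ?thesis
  proof
    show "apply_bcontfun u 0 = u0" using eq[of 0] by (simp add: J_def)
    fix s :: real assume s: "s \<in> {0..1}"
    have "(J (apply_bcontfun u) has_vector_derivative M s (apply_bcontfun u s)) (at s within {0..1})"
      unfolding J_def[abs_def]
      using has_vector_derivative_add[OF has_vector_derivative_const[of u0] integral_has_vector_derivative[OF c1[of u] s]]
      by simp
    then show "(apply_bcontfun u has_vector_derivative M s (apply_bcontfun u s)) (at s within {0..1})"
      by (rule has_vector_derivative_transform[rotated 2]) (use s eq in auto)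
  qed
qed

text \<open>A Gronwall estimate: since the coefficient of the growth is at most one half, the
  mean value theorem absorbs the supremum of \<open>w\<close>.\<close>

lemma ode_small:
  fixes w :: "real \<Rightarrow> 'e::euclidean_space"
  assumes d: "\<And>s. s \<in> {0..1} \<Longrightarrow> (w has_vector_derivative w' s) (at s within {0..1})"
    and b: "\<And>s. s \<in> {0..1} \<Longrightarrow> norm (w' s) \<le> norm (w s) / 2 + c"
    and w0: "w 0 = 0" and s: "s \<in> {0..1}"
  shows "norm (w s) \<le> 2 * c"
proof -
  have "continuous_on {0..1} (\<lambda>s. norm (w s))"
    using d by (intro continuous_on_norm) (meson continuous_on_vector_derivative)
  then obtain s0 where s0: "s0 \<in> {0..1}" "\<And>s. s \<in> {0..1} \<Longrightarrow> norm (w s) \<le> norm (w s0)"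
    using continuous_attains_sup[of "{0..1::real}" "\<lambda>s. norm (w s)"] by auto
  let ?B = "norm (w s0) / 2 + c"
  have B: "norm (w' s) \<le> ?B" if "s \<in> {0..1}" for s
    using b[OF that] s0(2)[OF that] by simp
  have "norm (w s0 - w 0) \<le> ?B * norm (s0 - 0)"
  proof (rule differentiable_bound[of "{0..1}" w "\<lambda>s h. h *\<^sub>R w' s"])
    fix s :: real assume "s \<in> {0..1}"
    then show "onorm (\<lambda>h. h *\<^sub>R w' s) \<le> ?B"
      by (intro onorm_le) (auto intro!: mult_right_mono B simp: mult.commute[of "\<bar>_\<bar>"])
  qed (use d s0 in \<open>auto simp: has_vector_derivative_def\<close>)
  moreover have "?B * norm (s0 - 0) \<le> ?B * 1"
    using s0(1) order_trans[OF norm_ge_zero B[OF s0(1)]] by (intro mult_left_mono) auto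
  ultimately have "norm (w s0) \<le> ?B" using w0 by simp
  then show ?thesis using s0(2)[OF s] by simp
qed

subsection \<open>Bounds on a compact ball\<close>

lemma linear_bound_on_Basis:
  fixes f :: "'v::euclidean_space \<Rightarrow> 'e::real_normed_vector"
  assumes "linear f" "\<And>b. b \<in> Basis \<Longrightarrow> norm (f b) \<le> K b"
  shows "norm (f h) \<le> (\<Sum>b\<in>Basis. K b) * norm h"
proof -
  have "norm (f h) = norm (\<Sum>b\<in>Basis. (h \<bullet> b) *\<^sub>R f b)"
    by (subst euclidean_representation[of h, symmetric])
       (simp add: linear_sum[OF assms(1)] linear_cmul[OF assms(1)] o_def)
  also have "\<dots> \<le> (\<Sum>b\<in>Basis. norm h * K b)"
  proof (rule sum_norm_le)
    fix b :: 'v assume b: "b \<in> Basis"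
    show "norm ((h \<bullet> b) *\<^sub>R f b) \<le> norm h * K b"
      by (simp, intro mult_mono) (use assms(2)[OF b] Basis_le_norm[OF b] in auto)
  qed
  finally show ?thesis by (simp add: sum_distrib_left mult.commute)
qed

text \<open>The last bound is the quadratic estimate of the linearization error; it comes from a Lipschitz
  bound for the derivative, along the segment from \<open>x\<close> to \<open>y\<close>.\<close>

lemma smooth_bounds:
  fixes G :: "'v::euclidean_space \<Rightarrow> 'e::real_normed_vector"
  assumes S: "open S" "cball p R \<subseteq> S" and G: "smooth_on S G"
  obtains C where "C \<ge> 0" "\<And>x. x \<in> cball p R \<Longrightarrow> norm (G x) \<le> C"
    "\<And>x h. x \<in> cball p R \<Longrightarrow> norm (frechet_derivative G (at x) h) \<le> C * norm h"
    "\<And>x y. x \<in> cball p R \<Longrightarrow> y \<in> cball p R \<Longrightarrow>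
        norm (G y - G x - frechet_derivative G (at x) (y - x)) \<le> C * norm (y - x) * norm (y - x)"
proof -
  let ?D = "\<lambda>x. frechet_derivative G (at x)"
  have bdd: "\<exists>C. \<forall>x\<in>cball p R. norm (H x) \<le> C" if "smooth_on S H" for H :: "'v \<Rightarrow> 'e"
  proof -
    have "compact (H ` cball p R)"
      by (intro compact_continuous_image continuous_on_subset[OF smooth_on_continuous[OF that] S(2)] compact_cball)
    then show ?thesis using compact_imp_bounded bounded_iff by (metis imageI)
  qed
  have lin: "linear (frechet_derivative H (at x))" if "smooth_on S H" "x \<in> cball p R" for x and H :: "'v \<Rightarrow> 'e"
    using linear_frechet_derivative smooth_on_differentiable[OF that(1)] that(2) S(2) by blast
  have dbd: "\<exists>C. \<forall>x\<in>cball p R. \<forall>h. norm (frechet_derivative H (at x) h) \<le> C * norm h"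
    if H: "smooth_on S H" for H :: "'v \<Rightarrow> 'e"
  proof -
    have "\<forall>b. \<exists>C. \<forall>x\<in>cball p R. norm (frechet_derivative H (at x) b) \<le> C"
      using bdd smooth_on_frechet[OF H] by blast
    then obtain K where "\<And>b x. x \<in> cball p R \<Longrightarrow> norm (frechet_derivative H (at x) b) \<le> K b" by metis
    then show ?thesis
      using linear_bound_on_Basis[OF lin[OF H]] by blast
  qed
  obtain C1 where C1: "\<And>x. x \<in> cball p R \<Longrightarrow> norm (G x) \<le> C1" using bdd[OF G] by blast
  obtain C2 where C2: "\<And>x h. x \<in> cball p R \<Longrightarrow> norm (?D x h) \<le> C2 * norm h" using dbd[OF G] by blast
  have "\<forall>b. \<exists>C. \<forall>x\<in>cball p R. \<forall>h. norm (frechet_derivative (\<lambda>x. ?D x b) (at x) h) \<le> C * norm h"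
    using dbd smooth_on_frechet[OF G] by blast
  then obtain K where K: "\<And>b x h. x \<in> cball p R \<Longrightarrow> norm (frechet_derivative (\<lambda>x. ?D x b) (at x) h) \<le> K b * norm h"
    by metis
  have lip: "norm (?D y b - ?D x b) \<le> K b * norm (y - x)" if "x \<in> cball p R" "y \<in> cball p R" for x y b
  proof (rule differentiable_bound[of "cball p R" "\<lambda>x. ?D x b" "\<lambda>x. frechet_derivative (\<lambda>x. ?D x b) (at x)"])
    fix z assume "z \<in> cball p R"
    then show "((\<lambda>x. ?D x b) has_derivative frechet_derivative (\<lambda>x. ?D x b) (at z)) (at z within cball p R)"
      using S(2) smooth_on_has_derivative[OF smooth_on_frechet[OF G]] has_derivative_at_withinI by blast
    show "onorm (frechet_derivative (\<lambda>x. ?D x b) (at z)) \<le> K b"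
      by (intro onorm_le K \<open>z \<in> cball p R\<close>)
  qed (use that in auto)
  define C3 where "C3 = (\<Sum>b\<in>Basis. K b)"
  have tay: "norm (G y - G x - ?D x (y - x)) \<le> C3 * norm (y - x) * norm (y - x)"
    if xy: "x \<in> cball p R" "y \<in> cball p R" for x y
  proof -
    have K0: "0 \<le> K b * norm (y - x)" for b using lip[OF xy, of b] norm_ge_zero order_trans by blast
    let ?I = "closed_segment x y"
    have seg: "?I \<subseteq> cball p R" using xy by (simp add: closed_segment_subset)
    have "norm (G y - G x - ?D x (y - x)) \<le> norm (y - x) * (C3 * norm (y - x))"
    proof (rule differentiable_bound_linearization[where S = ?I and f' = ?D])
      show "x + t *\<^sub>R (y - x) \<in> ?I" if "t \<in> {0..1}" for t
        using that by (auto simp: closed_segment_def algebra_simps intro!: exI[of _ t])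
      fix z assume z: "z \<in> ?I"
      then show "(G has_derivative ?D z) (at z within ?I)"
        using seg S(2) smooth_on_has_derivative[OF G] has_derivative_at_withinI by blast
      have zx: "norm (z - x) \<le> norm (y - x)"
        using segment_bound(1)[OF z] by (simp add: norm_minus_commute)
      have zR: "z \<in> cball p R" using z seg by blast
      have "linear (\<lambda>i. ?D z i - ?D x i)" using lin[OF G zR] lin[OF G xy(1)] by (intro linear_compose_sub)
      moreover have "norm (?D z b - ?D x b) \<le> K b * norm (y - x)" for b
      proof (cases "norm (y - x) = 0")
        case True then show ?thesis using zx by simp
      next
        case False
        then have "K b \<ge> 0" using K0[of b] by (simp add: zero_le_mult_iff)
        then show ?thesis using lip[OF xy(1) zR, of b] mult_left_mono[OF zx, of "K b"] by linarith
      qed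
      ultimately have "norm (?D z h - ?D x h) \<le> (\<Sum>b\<in>Basis. K b * norm (y - x)) * norm h" for h
        using linear_bound_on_Basis[of "\<lambda>i. ?D z i - ?D x i" "\<lambda>b. K b * norm (y - x)"] by blast
      then show "onorm (?D z - ?D x) \<le> C3 * norm (y - x)"
        by (intro onorm_le) (simp add: C3_def sum_distrib_right)
    qed (simp_all)
    then show ?thesis by (simp add: mult_ac)
  qed
  let ?C = "max 0 (max C1 (max C2 C3))"
  show ?thesis
  proof (rule that[of ?C])
    show "norm (G x) \<le> ?C" if "x \<in> cball p R" for x using C1[OF that] by (simp add: le_max_iff_disj)
    show "norm (?D x h) \<le> ?C * norm h" if "x \<in> cball p R" for x h
      using C2[OF that, of h] mult_right_mono[of C2 ?C "norm h"] by (simp add: le_max_iff_disj)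
    show "norm (G y - G x - ?D x (y - x)) \<le> ?C * norm (y - x) * norm (y - x)"
      if "x \<in> cball p R" "y \<in> cball p R" for x y
      using tay[OF that] mult_right_mono[of C3 ?C "norm (y - x) * norm (y - x)"] by (simp add: le_max_iff_disj mult.assoc)
  qed simp
qed

subsection \<open>Families of linear maps\<close>

text \<open>Smoothness of a family of linear maps \<open>T x\<close> means smoothness of its values at each fixed vector. Expanding along a basis gives the product rule for \<open>T x (u x)\<close>.\<close>

lemma linear_expand:
  fixes f :: "'v::euclidean_space \<Rightarrow> 'e::real_normed_vector"
  assumes "linear f" shows "f h = (\<Sum>b\<in>Basis. (h \<bullet> b) *\<^sub>R f b)"
  by (subst euclidean_representation[of h, symmetric])
     (simp add: linear_sum[OF assms(1)] linear_cmul[OF assms(1)] o_def)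

lemma family_has_derivative:
  fixes T :: "'v::real_normed_vector \<Rightarrow> 'e::euclidean_space \<Rightarrow> 'c::real_normed_vector"
  assumes "\<And>x. linear (T x)" "\<And>e. smooth_on S (\<lambda>x. T x e)" "x \<in> S"
  shows "((\<lambda>x. T x e) has_derivative
    (\<lambda>h. \<Sum>b\<in>Basis. (e \<bullet> b) *\<^sub>R frechet_derivative (\<lambda>x. T x b) (at x) h)) (at x)"
proof -
  have "((\<lambda>x. \<Sum>b\<in>Basis. (e \<bullet> b) *\<^sub>R T x b) has_derivative
    (\<lambda>h. \<Sum>b\<in>Basis. (e \<bullet> b) *\<^sub>R frechet_derivative (\<lambda>x. T x b) (at x) h)) (at x)"
    by (intro has_derivative_sum has_derivative_scaleR_right smooth_on_has_derivative[OF assms(2,3)])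
  moreover have "(\<lambda>x. \<Sum>b\<in>Basis. (e \<bullet> b) *\<^sub>R T x b) = (\<lambda>x. T x e)"
    by (intro ext linear_expand[OF assms(1), symmetric])
  ultimately show ?thesis by simp
qed

lemma family_frechet_expand:
  fixes T :: "'v::real_normed_vector \<Rightarrow> 'e::euclidean_space \<Rightarrow> 'c::real_normed_vector"
  assumes "\<And>x. linear (T x)" "\<And>e. smooth_on S (\<lambda>x. T x e)" "x \<in> S"
  shows "frechet_derivative (\<lambda>x. T x e) (at x) h
    = (\<Sum>b\<in>Basis. (e \<bullet> b) *\<^sub>R frechet_derivative (\<lambda>x. T x b) (at x) h)"
  by (rule fun_cong[OF frechet_eq_of_has_derivative[OF family_has_derivative[OF assms]]])

lemma family_frechet_linear:
  fixes T :: "'v::real_normed_vector \<Rightarrow> 'e::euclidean_space \<Rightarrow> 'c::real_normed_vector"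
  assumes "\<And>x. linear (T x)" "\<And>e. smooth_on S (\<lambda>x. T x e)" "x \<in> S"
  shows "linear (\<lambda>e. frechet_derivative (\<lambda>x. T x e) (at x) h)"
proof -
  have eq: "(\<lambda>e. frechet_derivative (\<lambda>x. T x e) (at x) h)
    = (\<lambda>e. \<Sum>b\<in>Basis. (e \<bullet> b) *\<^sub>R frechet_derivative (\<lambda>x. T x b) (at x) h)"
    by (intro ext family_frechet_expand[OF assms])
  show ?thesis unfolding eq
    by (intro linearI) (simp_all add: inner_add_left scaleR_add_left sum.distrib scaleR_sum_right)
qed

lemma family_ray_derivative:
  fixes T :: "'v::real_normed_vector \<Rightarrow> 'e::euclidean_space \<Rightarrow> 'c::real_normed_vector"
  assumes T: "\<And>x. linear (T x)" "\<And>e. smooth_on S (\<lambda>x. T x e)" "p + s *\<^sub>R y \<in> S"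
    and u: "(u has_vector_derivative u') (at s within I)"
  shows "((\<lambda>s. T (p + s *\<^sub>R y) (u s)) has_vector_derivative
    T (p + s *\<^sub>R y) u' + frechet_derivative (\<lambda>x. T x (u s)) (at (p + s *\<^sub>R y)) y) (at s within I)"
proof -
  have ray: "((\<lambda>s. p + s *\<^sub>R y) has_derivative (\<lambda>h. h *\<^sub>R y)) (at s within I)"
    by (auto intro!: derivative_eq_intros)
  have c: "((\<lambda>s. T (p + s *\<^sub>R y) b) has_vector_derivative frechet_derivative (\<lambda>x. T x b) (at (p + s *\<^sub>R y)) y) (at s within I)" for b
  proof -
    have d: "((\<lambda>x. T x b) has_derivative frechet_derivative (\<lambda>x. T x b) (at (p + s *\<^sub>R y))) (at (p + s *\<^sub>R y))"
      by (rule smooth_on_has_derivative[OF T(2,3)])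
    show ?thesis
      using has_derivative_compose[OF ray d]
      by (simp add: has_vector_derivative_def linear_cmul[OF has_derivative_linear[OF d]])
  qed
  have u': "((\<lambda>s. u s \<bullet> b) has_real_derivative (u' \<bullet> b)) (at s within I)" for b
    using has_derivative_inner_left[OF u[unfolded has_vector_derivative_def], of b]
    by (simp add: has_field_derivative_def mult.commute[of _ "u' \<bullet> b"] fun_eq_iff)
  have "((\<lambda>s. \<Sum>b\<in>Basis. (u s \<bullet> b) *\<^sub>R T (p + s *\<^sub>R y) b) has_vector_derivative
     (\<Sum>b\<in>Basis. (u s \<bullet> b) *\<^sub>R frechet_derivative (\<lambda>x. T x b) (at (p + s *\<^sub>R y)) y + (u' \<bullet> b) *\<^sub>R T (p + s *\<^sub>R y) b)) (at s within I)"
    by (intro has_vector_derivative_sum has_vector_derivative_scaleR u' c)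
  then show ?thesis
    by (subst linear_expand[OF T(1)], subst linear_expand[OF T(1), of _ u'], subst family_frechet_expand[OF T])
       (simp add: sum.distrib add.commute)
qed

lemma family_ray_continuous:
  fixes T :: "'v::real_normed_vector \<Rightarrow> 'e::euclidean_space \<Rightarrow> 'c::real_normed_vector"
  assumes T: "\<And>x. linear (T x)" "\<And>e. smooth_on S (\<lambda>x. T x e)" "\<And>s. s \<in> I \<Longrightarrow> p + s *\<^sub>R y \<in> S"
    and u: "continuous_on I u"
  shows "continuous_on I (\<lambda>s. T (p + s *\<^sub>R y) (u s))"
proof -
  have "continuous_on I (\<lambda>s. T (p + s *\<^sub>R y) b)" for b
    by (rule continuous_on_compose2[OF smooth_on_continuous[OF T(2)[of b]]])
       (auto intro!: continuous_intros T(3))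
  then show ?thesis
    by (subst linear_expand[OF T(1)]) (auto intro!: continuous_intros u)
qed

subsection \<open>Existence of parallel sections\<close>

lemma bilinear_bound_on_Basis:
  fixes B :: "'v::euclidean_space \<Rightarrow> 'e::euclidean_space \<Rightarrow> 'c::real_normed_vector"
  assumes "\<And>e. linear (\<lambda>v. B v e)" "\<And>v. linear (B v)"
    and "\<And>b c. b \<in> Basis \<Longrightarrow> c \<in> Basis \<Longrightarrow> norm (B b c) \<le> K b c * k"
  shows "norm (B v e) \<le> (\<Sum>c\<in>Basis. \<Sum>b\<in>Basis. K b c) * k * norm v * norm e"
proof -
  have "norm (B v c) \<le> (\<Sum>b\<in>Basis. K b c * k) * norm v" if "c \<in> Basis" for c
    using linear_bound_on_Basis[OF assms(1)[of c], of "\<lambda>b. K b c * k" v] assms(3) that by blast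
  from linear_bound_on_Basis[OF assms(2)[of v] this, of e]
  moreover have "(\<Sum>c\<in>Basis. (\<Sum>b\<in>Basis. K b c * k) * norm v) = (\<Sum>c\<in>Basis. \<Sum>b\<in>Basis. K b c) * k * norm v"
    by (simp only: sum_distrib_right)
  ultimately show ?thesis by simp
qed

text \<open>Frobenius' theorem for the linear equation \<open>dF = a F\<close>, whose integrability condition is only
  required on the subbundle \<open>L = 0\<close>. That subbundle is preserved by the equation, which is the
  meaning of the hypothesis on the derivative of \<open>L\<close>.

  The section is defined by transporting the value at \<open>p\<close> along rays, by an ordinary differential
  equation. Along a ray \<open>L\<close> satisfies a homogeneous linear equation and stays zero. It remains to
  see that the section satisfies \<open>dF = a F\<close> in all directions.\<close>

theorem parallel_section_vector:
  fixes a :: "'v::euclidean_space \<Rightarrow> 'v \<Rightarrow> 'e::euclidean_space \<Rightarrow> 'e"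
    and L :: "'v \<Rightarrow> 'e \<Rightarrow> real" and m :: "'v \<Rightarrow> 'v \<Rightarrow> real"
  assumes S: "open S" "p \<in> S"
    and av: "\<And>x e. linear (\<lambda>v. a x v e)" and ae: "\<And>x v. linear (a x v)"
    and asm: "\<And>v e. smooth_on S (\<lambda>x. a x v e)"
    and Le: "\<And>x. linear (L x)" and Lsm: "\<And>e. smooth_on S (\<lambda>x. L x e)"
    and mv: "\<And>x. linear (m x)" and msm: "\<And>v. smooth_on S (\<lambda>x. m x v)"
    and Lder: "\<And>x v e. x \<in> S \<Longrightarrow>
      frechet_derivative (\<lambda>x. L x e) (at x) v + L x (a x v e) = m x v * L x e"
    and flat: "\<And>x v w e. x \<in> S \<Longrightarrow> L x e = 0 \<Longrightarrow>
      frechet_derivative (\<lambda>x. a x w e) (at x) v + a x w (a x v e)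
        = frechet_derivative (\<lambda>x. a x v e) (at x) w + a x v (a x w e)"
    and F0: "L p F0 = 0"
  obtains r F where "r > 0" "ball p r \<subseteq> S" "smooth_on (ball p r) F" "F p = F0"
    "\<And>x. x \<in> ball p r \<Longrightarrow> L x (F x) = 0"
    "\<And>x. x \<in> ball p r \<Longrightarrow> (F has_derivative (\<lambda>v. a x v (F x))) (at x)"
proof -
  obtain R where R: "R > 0" "cball p R \<subseteq> S" using S open_contains_cball by blast
  define Da where "Da x h v e = frechet_derivative (\<lambda>x. a x v e) (at x) h" for x h v e
  have Dae: "linear (Da x h v)" if "x \<in> S" for x h v
    unfolding Da_def[abs_def] by (rule family_frechet_linear[of "\<lambda>x e. a x v e", OF ae asm that])
  have Dav: "linear (\<lambda>v. Da x h v e)" if "x \<in> S" for x h e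
    unfolding Da_def[abs_def] by (rule family_frechet_linear[of "\<lambda>x v. a x v e", OF av asm that])
  have Dah: "linear (\<lambda>h. Da x h v e)" if "x \<in> S" for x v e
    unfolding Da_def[abs_def] using linear_frechet_derivative[OF smooth_on_differentiable[OF asm that]]
    by (simp add: eta_contract_eq)
  have "\<exists>C. \<forall>x\<in>cball p R. norm (a x b c) \<le> C \<and> (\<forall>h. norm (Da x h b c) \<le> C * norm h) \<and>
      (\<forall>y\<in>cball p R. norm (a y b c - a x b c - Da x (y - x) b c) \<le> C * norm (y - x) * norm (y - x)) \<and> C \<ge> 0" for b c
    unfolding Da_def by (rule smooth_bounds[OF S(1) R(2) asm[of b c]]) blast
  then obtain K where K: "\<And>b c x. x \<in> cball p R \<Longrightarrow> norm (a x b c) \<le> K b c"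
      "\<And>b c x h. x \<in> cball p R \<Longrightarrow> norm (Da x h b c) \<le> K b c * norm h"
      "\<And>b c x y. x \<in> cball p R \<Longrightarrow> y \<in> cball p R \<Longrightarrow>
         norm (a y b c - a x b c - Da x (y - x) b c) \<le> K b c * norm (y - x) * norm (y - x)"
      "\<And>b c x. x \<in> cball p R \<Longrightarrow> K b c \<ge> 0"
    by metis
  define K0 where "K0 = (\<Sum>c\<in>Basis. \<Sum>b\<in>Basis. K b c)"
  have K0: "K0 \<ge> 0" using K(4)[of p] R(1) by (auto simp: K0_def intro!: sum_nonneg)
  have b1: "norm (a x v e) \<le> K0 * norm v * norm e" if "x \<in> cball p R" for x v e
    using bilinear_bound_on_Basis[of "a x" K 1 v e, OF av ae] K(1)[OF that] by (simp add: K0_def)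
  have b2: "norm (Da x h v e) \<le> K0 * norm h * norm v * norm e" if "x \<in> cball p R" for x h v e
    using bilinear_bound_on_Basis[of "Da x h" K "norm h" v e, OF Dav Dae] K(2)[OF that] that R(2)
    by (auto simp: K0_def)
  have b3: "norm (a y v e - a x v e - Da x (y - x) v e) \<le> K0 * (norm (y - x) * norm (y - x)) * norm v * norm e"
    if "x \<in> cball p R" "y \<in> cball p R" for x y v e
    unfolding K0_def
    by (rule bilinear_bound_on_Basis[of "\<lambda>v e. a y v e - a x v e - Da x (y - x) v e" K])
       (use that R(2) K(3)[OF that] in \<open>auto intro!: linear_compose_sub av ae Dae Dav simp: mult.assoc\<close>)
  have "\<exists>C. \<forall>x\<in>cball p R. norm (m x b) \<le> C" for b
    by (rule smooth_bounds[OF S(1) R(2) msm[of b]]) blast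
  then obtain Kb where Kb: "\<And>b x. x \<in> cball p R \<Longrightarrow> norm (m x b) \<le> Kb b" by metis
  define Km where "Km = \<bar>\<Sum>b\<in>Basis. Kb b\<bar>"
  have bm: "\<bar>m x v\<bar> \<le> Km * norm v" if "x \<in> cball p R" for x v
    using linear_bound_on_Basis[OF mv[of x], of Kb v] Kb[OF that]
      mult_right_mono[of "\<Sum>b\<in>Basis. Kb b" Km "norm v"] abs_ge_self[of "\<Sum>b\<in>Basis. Kb b"]
    unfolding Km_def by auto
  \<comment> \<open>this radius makes the coefficients of all equations along rays at most one half\<close>
  define r where "r = min R (1 / (2 * (K0 + Km + 1)))"
  have pos: "K0 + Km + 1 > 0" using K0 by (simp add: Km_def)
  have r: "r > 0" "r \<le> R" using R pos by (auto simp: r_def)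
  have "r \<le> 1 / (2 * (K0 + Km + 1))" by (simp add: r_def)
  then have "r * (2 * (K0 + Km + 1)) \<le> 1"
    using pos by (subst (asm) pos_le_divide_eq) auto
  then have "2 * (K0 * r) + 2 * (Km * r) + 2 * r \<le> 1" by (simp add: algebra_simps)
  moreover have "0 \<le> K0 * r" "0 \<le> Km * r" using r(1) K0 by (simp_all add: Km_def)
  ultimately have rK: "K0 * r \<le> 1/2" "Km * r \<le> 1/2" using r(1) by linarith+
  have ray: "p + s *\<^sub>R y \<in> cball p R" "p + s *\<^sub>R y \<in> S" if "norm y \<le> r" "s \<in> {0..1}" for s y
  proof -
    have "\<bar>s\<bar> * norm y \<le> 1 * R" using that r by (intro mult_mono) auto
    then show "p + s *\<^sub>R y \<in> cball p R" by (simp add: dist_norm)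
    then show "p + s *\<^sub>R y \<in> S" using R by blast
  qed
  have half: "norm (a x v e) \<le> norm e / 2" if "x \<in> cball p R" "norm v \<le> r" for x v e
  proof -
    have "K0 * norm v * norm e \<le> K0 * r * norm e"
      by (intro mult_right_mono mult_left_mono that K0) simp
    also have "\<dots> \<le> 1/2 * norm e" by (rule mult_right_mono[OF rK(1)]) simp
    finally show ?thesis using b1[OF that(1), of v e] by simp
  qed
  have "\<exists>u. u 0 = F0 \<and> (\<forall>s\<in>{0..1}. (u has_vector_derivative a (p + s *\<^sub>R y) y (u s)) (at s within {0..1}))"
    if y: "norm y \<le> r" for y
  proof (rule linear_ode_exists[of "\<lambda>s. a (p + s *\<^sub>R y) y" F0])
    show "continuous_on {0..1} (\<lambda>s. a (p + s *\<^sub>R y) y (u s))" if "continuous_on {0..1} u" for u :: "real \<Rightarrow> 'e"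
      by (rule family_ray_continuous[of "\<lambda>x e. a x y e", OF ae asm ray(2)[OF y] that])
  qed (use ae half ray(1) y in auto)
  then obtain U where U0: "\<And>y. norm y \<le> r \<Longrightarrow> U y 0 = F0"
    and U: "\<And>y s. norm y \<le> r \<Longrightarrow> s \<in> {0..1} \<Longrightarrow>
      (U y has_vector_derivative a (p + s *\<^sub>R y) y (U y s)) (at s within {0..1})"
    by metis
  have Ub: "norm (U y s) \<le> norm F0 + norm F0" if y: "norm y \<le> r" and s: "s \<in> {0..1}" for y s
  proof -
    have "norm (U y s - F0) \<le> 2 * (norm F0 / 2)"
    proof (rule ode_small[where w' = "\<lambda>s. a (p + s *\<^sub>R y) y (U y s)"])
      fix t :: real assume t: "t \<in> {0..1}"
      show "((\<lambda>s. U y s - F0) has_vector_derivative a (p + t *\<^sub>R y) y (U y t)) (at t within {0..1})"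
        using has_vector_derivative_diff[OF U[OF y t] has_vector_derivative_const[of F0]] by simp
      have "norm (U y t) \<le> norm (U y t - F0) + norm F0" using norm_triangle_ineq[of "U y t - F0" F0] by simp
      then show "norm (a (p + t *\<^sub>R y) y (U y t)) \<le> norm (U y t - F0) / 2 + norm F0 / 2"
        using half[OF ray(1)[OF y t] y, of "U y t"] by simp
    qed (use U0 y s in auto)
    then show ?thesis using norm_triangle_ineq[of "U y s - F0" F0] by simp
  qed
  define N where "N = norm F0 + norm F0"
  have N: "N \<ge> 0" by (simp add: N_def)
  have LU: "L (p + s *\<^sub>R y) (U y s) = 0" if y: "norm y \<le> r" and s: "s \<in> {0..1}" for y s
  proof -
    have "norm (L (p + s *\<^sub>R y) (U y s)) \<le> 2 * 0"
    proof (rule ode_small[where w = "\<lambda>s. L (p + s *\<^sub>R y) (U y s)" and w' = "\<lambda>s. m (p + s *\<^sub>R y) y * L (p + s *\<^sub>R y) (U y s)"])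
      fix t :: real assume t: "t \<in> {0..1}"
      show "((\<lambda>s. L (p + s *\<^sub>R y) (U y s)) has_vector_derivative m (p + t *\<^sub>R y) y * L (p + t *\<^sub>R y) (U y t)) (at t within {0..1})"
        using family_ray_derivative[OF Le Lsm ray(2)[OF y t] U[OF y t]] Lder[OF ray(2)[OF y t], of "U y t" y]
        by (simp add: add.commute)
      have "\<bar>m (p + t *\<^sub>R y) y\<bar> \<le> 1/2"
        using bm[OF ray(1)[OF y t], of y] mult_left_mono[OF y, of Km] rK(2) by (simp add: Km_def)
      then show "norm (m (p + t *\<^sub>R y) y * L (p + t *\<^sub>R y) (U y t)) \<le> norm (L (p + t *\<^sub>R y) (U y t)) / 2 + 0"
        using mult_right_mono[of "\<bar>m (p + t *\<^sub>R y) y\<bar>" "1/2" "\<bar>L (p + t *\<^sub>R y) (U y t)\<bar>"]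
        by (simp add: abs_mult)
    qed (use U0 y F0 s in auto)
    then show ?thesis by simp
  qed
  define F where "F x = U (x - p) 1" for x
  define Vb where "Vb = N + K0 * (2 * r) * N"
  define C where "C = K0 * K0 * N + K0 * r * K0 * N + K0 * Vb + K0 * r * Vb"
  \<comment> \<open>the quadratic error of the candidate derivative satisfies a Gronwall estimate along
    the ray, because the terms linear in \<open>h\<close> cancel by flatness\<close>
  have est: "norm (U (y + h) 1 - U y 1 - a (p + y) h (U y 1)) \<le> 2 * (C * (norm h * norm h))"
    if y: "norm y \<le> r" and yh: "norm (y + h) \<le> r" for y h
  proof -
    have hr: "norm h \<le> 2 * r" using norm_triangle_ineq4[of "y + h" y] y yh by simp
    define w where "w s = U (y + h) s - U y s - s *\<^sub>R a (p + s *\<^sub>R y) h (U y s)" for s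
    define w' where "w' s = a (p + s *\<^sub>R (y + h)) (y + h) (U (y + h) s) - a (p + s *\<^sub>R y) y (U y s)
       - (s *\<^sub>R (a (p + s *\<^sub>R y) h (a (p + s *\<^sub>R y) y (U y s)) + Da (p + s *\<^sub>R y) y h (U y s)) + a (p + s *\<^sub>R y) h (U y s))" for s
    have "norm (w 1) \<le> 2 * (C * (norm h * norm h))"
    proof (rule ode_small[where w = w and w' = w'])
      fix s :: real assume s: "s \<in> {0..1}"
      have "((\<lambda>s. a (p + s *\<^sub>R y) h (U y s)) has_vector_derivative
         a (p + s *\<^sub>R y) h (a (p + s *\<^sub>R y) y (U y s)) + Da (p + s *\<^sub>R y) y h (U y s)) (at s within {0..1})"
        unfolding Da_def
        by (rule family_ray_derivative[of "\<lambda>x e. a x h e", OF ae asm ray(2)[OF y s] U[OF y s]])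
      from has_vector_derivative_scaleR[OF DERIV_ident this]
      have "((\<lambda>s. s *\<^sub>R a (p + s *\<^sub>R y) h (U y s)) has_vector_derivative
         s *\<^sub>R (a (p + s *\<^sub>R y) h (a (p + s *\<^sub>R y) y (U y s)) + Da (p + s *\<^sub>R y) y h (U y s)) + a (p + s *\<^sub>R y) h (U y s)) (at s within {0..1})"
        by simp
      from has_vector_derivative_diff[OF has_vector_derivative_diff[OF U[OF yh s] U[OF y s]] this]
      show "(w has_vector_derivative w' s) (at s within {0..1})"
        unfolding w_def[abs_def] w'_def .
      define x where "x = p + s *\<^sub>R y"
      define u where "u = U y s"
      define z where "z = p + s *\<^sub>R (y + h)"
      define v where "v = u + s *\<^sub>R a x h u"
      have x: "x \<in> cball p R" "x \<in> S" and z: "z \<in> cball p R"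
        using ray[OF y s] ray[OF yh s] by (auto simp: x_def z_def)
      have s1: "\<bar>s\<bar> \<le> 1" "\<bar>s * s\<bar> \<le> 1" using s mult_mono[of s 1 s 1] by auto
      have zx: "z - x = s *\<^sub>R h" by (simp add: z_def x_def algebra_simps)
      have un: "norm u \<le> N" using Ub[OF y s] by (simp add: u_def N_def)
      have au: "norm (a x h u) \<le> K0 * norm h * N"
        using b1[OF x(1), of h u] mult_left_mono[OF un, of "K0 * norm h"] K0 by simp
      have vn: "norm v \<le> Vb"
      proof -
        have "norm v \<le> norm u + \<bar>s\<bar> * norm (a x h u)" using norm_triangle_ineq[of u "s *\<^sub>R a x h u"] by (simp add: v_def)
        moreover have "\<bar>s\<bar> * norm (a x h u) \<le> 1 * (K0 * norm h * N)" by (intro mult_mono s1 au) auto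
        moreover have "K0 * norm h * N \<le> K0 * (2 * r) * N" by (intro mult_mono mult_left_mono hr) (use K0 N r in auto)
        ultimately show ?thesis using un by (simp add: Vb_def)
      qed
      define Q where "Q = a z (y + h) v - a x (y + h) v - Da x (z - x) (y + h) v"
      have Ueq: "U (y + h) s = w s + v" by (simp add: w_def v_def u_def x_def)
      have lin: "a x (y + h) v = a x y u + s *\<^sub>R a x y (a x h u) + a x h u + s *\<^sub>R a x h (a x h u)"
        unfolding v_def
        by (simp add: linear_add[OF av] linear_add[OF ae] linear_cmul[OF ae] scaleR_add_right)
      have linD: "Da x (z - x) (y + h) v = s *\<^sub>R Da x h y u + (s * s) *\<^sub>R Da x h y (a x h u) + s *\<^sub>R Da x h h v"
        unfolding zx linear_cmul[OF Dah[OF x(2)]] linear_add[OF Dav[OF x(2)]]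
        unfolding v_def linear_add[OF Dae[OF x(2)]] linear_cmul[OF Dae[OF x(2)]]
        by (simp add: algebra_simps scaleR_add_right)
      have fl: "Da x h y u + a x y (a x h u) = Da x y h u + a x h (a x y u)"
        unfolding Da_def by (rule flat[OF x(2)]) (use LU[OF y s] in \<open>simp add: x_def u_def\<close>)
      then have fl': "s *\<^sub>R Da x h y u + s *\<^sub>R a x y (a x h u) = s *\<^sub>R Da x y h u + s *\<^sub>R a x h (a x y u)"
        by (metis scaleR_add_right)
      have "w' s = a z (y + h) (w s) + Q + s *\<^sub>R a x h (a x h u) + (s * s) *\<^sub>R Da x h y (a x h u) + s *\<^sub>R Da x h h v"
        unfolding w'_def Ueq x_def[symmetric] z_def[symmetric] u_def[symmetric] linear_add[OF ae] Q_def lin linD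
        using fl' by (simp add: algebra_simps)
      then have "norm (w' s) \<le> norm (a z (y + h) (w s)) + norm Q + norm (s *\<^sub>R a x h (a x h u))
          + norm ((s * s) *\<^sub>R Da x h y (a x h u)) + norm (s *\<^sub>R Da x h h v)"
        by (simp only:) (intro norm_triangle_mono order_refl)
      moreover have "norm (a z (y + h) (w s)) \<le> norm (w s) / 2" by (rule half[OF z yh])
      moreover have "norm Q \<le> K0 * r * Vb * (norm h * norm h)"
      proof -
        have "norm Q \<le> K0 * (norm (z - x) * norm (z - x)) * norm (y + h) * norm v"
          unfolding Q_def by (rule b3[OF x(1) z])
        also have "\<dots> \<le> K0 * (norm h * norm h) * r * Vb"
          using s1 yh vn K0 r N unfolding zx
          by (intro mult_mono mult_left_mono) (auto intro!: mult_left_le_one_le mult_nonneg_nonneg simp: Vb_def)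
        finally show ?thesis by (simp add: mult_ac)
      qed
      moreover have "norm (s *\<^sub>R a x h (a x h u)) \<le> K0 * K0 * N * (norm h * norm h)"
      proof -
        have "norm (a x h (a x h u)) \<le> K0 * norm h * norm (a x h u)" by (rule b1[OF x(1)])
        also have "\<dots> \<le> K0 * norm h * (K0 * norm h * N)" by (intro mult_left_mono au) (use K0 in auto)
        finally have "norm (a x h (a x h u)) \<le> K0 * K0 * N * (norm h * norm h)" by (simp add: mult_ac)
        then show ?thesis using s1 mult_left_le_one_le[of "norm (a x h (a x h u))" "\<bar>s\<bar>"] by simp
      qed
      moreover have "norm ((s * s) *\<^sub>R Da x h y (a x h u)) \<le> K0 * r * K0 * N * (norm h * norm h)"
      proof -
        have "norm (Da x h y (a x h u)) \<le> K0 * norm h * norm y * norm (a x h u)" by (rule b2[OF x(1)])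
        also have "\<dots> \<le> K0 * norm h * r * (K0 * norm h * N)" by (intro mult_mono mult_left_mono au y) (use K0 r in auto)
        finally have "norm (Da x h y (a x h u)) \<le> K0 * r * K0 * N * (norm h * norm h)" by (simp add: mult_ac)
        then show ?thesis using s1 mult_left_le_one_le[of "norm (Da x h y (a x h u))" "\<bar>s * s\<bar>"] by simp
      qed
      moreover have "norm (s *\<^sub>R Da x h h v) \<le> K0 * Vb * (norm h * norm h)"
      proof -
        have "norm (Da x h h v) \<le> K0 * norm h * norm h * norm v" by (rule b2[OF x(1)])
        also have "\<dots> \<le> K0 * norm h * norm h * Vb" by (intro mult_left_mono vn) (use K0 in auto)
        finally have "norm (Da x h h v) \<le> K0 * Vb * (norm h * norm h)" by (simp add: mult_ac)
        then show ?thesis using s1 mult_left_le_one_le[of "norm (Da x h h v)" "\<bar>s\<bar>"] by simp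
      qed
      ultimately show "norm (w' s) \<le> norm (w s) / 2 + C * (norm h * norm h)"
        unfolding C_def by (simp add: algebra_simps)
    qed (use U0 y yh in \<open>auto simp: w_def\<close>)
    then show ?thesis by (simp add: w_def)
  qed
  have der: "(F has_derivative (\<lambda>v. a x v (F x))) (at x)" if x: "x \<in> ball p r" for x
    unfolding has_derivative_at_alt
  proof (intro conjI allI impI)
    have xR: "x \<in> cball p R" using x r by auto
    have "norm (a x v (F x)) \<le> norm v * (K0 * norm (F x))" for v
      using b1[OF xR, of v "F x"] by (simp add: mult_ac)
    then show "bounded_linear (\<lambda>v. a x v (F x))"
      by (intro bounded_linear_intro[where K = "K0 * norm (F x)"]) (auto simp: linear_add[OF av] linear_cmul[OF av])
    fix e :: real assume e: "e > 0"
    obtain d where d: "d > 0" "ball x d \<subseteq> ball p r" using x openE[OF open_ball] by blast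
    let ?d = "min d (e / (2 * \<bar>C\<bar> + 1))"
    show "\<exists>d>0. \<forall>y. norm (y - x) < d \<longrightarrow> norm (F y - F x - a x (y - x) (F x)) \<le> e * norm (y - x)"
    proof (intro exI[of _ ?d] conjI allI impI)
      show "?d > 0" using d e by auto
      fix y assume y: "norm (y - x) < ?d"
      then have "y \<in> ball x d" by (simp add: dist_norm norm_minus_commute)
      then have yr: "norm (y - p) \<le> r" using d(2) by (auto simp: dist_norm norm_minus_commute)
      have xr: "norm (x - p) \<le> r" using x by (auto simp: dist_norm norm_minus_commute)
      have "norm (F y - F x - a x (y - x) (F x)) \<le> 2 * (C * (norm (y - x) * norm (y - x)))"
        using est[OF xr, of "y - x"] yr by (simp add: F_def)
      also have "\<dots> \<le> ((2 * \<bar>C\<bar> + 1) * norm (y - x)) * norm (y - x)"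
        using mult_right_mono[of "2 * C" "2 * \<bar>C\<bar> + 1" "norm (y - x) * norm (y - x)"] by (simp add: mult_ac)
      also have "\<dots> \<le> e * norm (y - x)"
        using y by (intro mult_right_mono) (auto simp: field_simps)
      finally show "norm (F y - F x - a x (y - x) (F x)) \<le> e * norm (y - x)" .
    qed
  qed
  have sub: "ball p r \<subseteq> S" using R r by auto
  have "C_k_on k (ball p r) F" for k
  proof (induction k)
    case 0
    then show ?case using der by (auto intro!: continuous_at_imp_continuous_on has_derivative_continuous)
  next
    case (Suc k)
    have "C_k_on k (ball p r) (\<lambda>x. \<Sum>b\<in>Basis. (F x \<bullet> b) *\<^sub>R a x v b)" for v
      using asm Suc sub
      by (intro C_k_on_sum C_k_on_bilinear[OF _ bounded_bilinear_scaleR] open_ball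
          C_k_on_bounded_linear[OF _ bounded_linear_inner_left])
         (auto simp: smooth_on_def intro: C_k_on_subset)
    then have "C_k_on k (ball p r) (\<lambda>x. a x v (F x))" for v
      using linear_expand[OF ae, of _ v] by (simp add: linear_expand[OF ae, symmetric])
    then show ?case by (intro C_k_on_SucI[OF open_ball der]) auto
  qed
  moreover have "L x (F x) = 0" if "x \<in> ball p r" for x
    using LU[of "x - p" 1] that by (auto simp: F_def dist_norm norm_minus_commute)
  moreover have "F p = F0"
  proof -
    have "norm (U 0 1 - F0) \<le> 2 * 0"
    proof (rule ode_small[where w = "\<lambda>s. U 0 s - F0" and w' = "\<lambda>s. 0"])
      fix s :: real assume s: "s \<in> {0..1}"
      have "a (p + s *\<^sub>R 0) 0 (U 0 s) = 0" by (rule linear_0[OF av])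
      then show "((\<lambda>s. U 0 s - F0) has_vector_derivative 0) (at s within {0..1})"
        using has_vector_derivative_diff[OF U[of 0, OF _ s] has_vector_derivative_const[of F0]] r(1) by simp
    qed (use U0[of 0] r(1) in auto)
    then show ?thesis by (simp add: F_def)
  qed
  ultimately show ?thesis
    using that[of r F] r(1) sub der by (auto simp: smooth_on_def)
qed

text \<open>The same theorem in terms of the coefficients of the connection in the coordinate directions.\<close>

theorem parallel_section:
  fixes A :: "'n::finite \<Rightarrow> real^'n \<Rightarrow> 'e::euclidean_space \<Rightarrow> 'e"
    and L :: "real^'n \<Rightarrow> 'e \<Rightarrow> real" and m :: "'n \<Rightarrow> real^'n \<Rightarrow> real"
  assumes S: "open S" "p \<in> S"
    and lin: "\<And>i x. linear (A i x)" and sm: "\<And>i e. smooth_on S (\<lambda>x. A i x e)"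
    and Le: "\<And>x. linear (L x)" and Lsm: "\<And>e. smooth_on S (\<lambda>x. L x e)"
    and msm: "\<And>i. smooth_on S (m i)"
    and Lder: "\<And>x i e. x \<in> S \<Longrightarrow> pd i (\<lambda>x. L x e) x + L x (A i x e) = m i x * L x e"
    and flat: "\<And>x i j e. x \<in> S \<Longrightarrow> L x e = 0 \<Longrightarrow>
      frechet_derivative (\<lambda>x. A j x e) (at x) (axis i 1) + A j x (A i x e)
        = frechet_derivative (\<lambda>x. A i x e) (at x) (axis j 1) + A i x (A j x e)"
    and F0: "L p F0 = 0"
  obtains r F where "r > 0" "ball p r \<subseteq> S" "smooth_on (ball p r) F" "F p = F0"
    "\<And>x. x \<in> ball p r \<Longrightarrow> L x (F x) = 0"
    "\<And>x i. x \<in> ball p r \<Longrightarrow> frechet_derivative F (at x) (axis i 1) = A i x (F x)"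
proof -
  define a where "a x v e = (\<Sum>i\<in>UNIV. (v $ i) *\<^sub>R A i x e)" for x v e
  define mm where "mm x v = (\<Sum>i\<in>UNIV. v $ i * m i x)" for x v
  have av: "linear (\<lambda>v. a x v e)" for x e
    unfolding a_def by (intro linearI) (simp_all add: scaleR_add_left sum.distrib scaleR_sum_right)
  have ae: "linear (a x v)" for x v
    unfolding a_def[abs_def]
    by (intro linearI) (simp_all add: linear_add[OF lin] linear_cmul[OF lin] scaleR_add_right sum.distrib scaleR_sum_right mult.commute)
  have asm: "smooth_on S (\<lambda>x. a x v e)" for v e
    unfolding a_def by (intro smooth_intros S sm)
  have mv: "linear (mm x)" for x
    unfolding mm_def[abs_def] by (intro linearI) (simp_all add: distrib_right sum.distrib sum_distrib_left mult.assoc)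
  have mmsm: "smooth_on S (\<lambda>x. mm x v)" for v
    unfolding mm_def by (intro smooth_intros S msm)
  have Dlin: "linear (frechet_derivative H (at x))" if "smooth_on S H" "x \<in> S" for x and H :: "real^'n \<Rightarrow> 'e"
    using linear_frechet_derivative smooth_on_differentiable[OF that] by blast
  have bas: "v = (\<Sum>i\<in>UNIV. v $ i *\<^sub>R axis i 1)" for v :: "real^'n"
    using basis_expansion[of v] by (simp add: scalar_mult_eq_scaleR)
  have Dexp: "frechet_derivative H (at x) v = (\<Sum>i\<in>UNIV. v $ i *\<^sub>R frechet_derivative H (at x) (axis i 1))"
    if "smooth_on S H" "x \<in> S" for x v and H :: "real^'n \<Rightarrow> 'e"
    using Dlin[OF that] by (subst bas[of v]) (simp add: linear_sum linear_cmul o_def)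
  have Da: "frechet_derivative (\<lambda>x. a x w e) (at x) v
      = (\<Sum>i\<in>UNIV. \<Sum>j\<in>UNIV. (v $ i * w $ j) *\<^sub>R frechet_derivative (\<lambda>x. A j x e) (at x) (axis i 1))" if x: "x \<in> S" for x v w e
  proof -
    have "((\<lambda>x. a x w e) has_derivative (\<lambda>v. \<Sum>j\<in>UNIV. (w $ j) *\<^sub>R frechet_derivative (\<lambda>x. A j x e) (at x) v)) (at x)"
      unfolding a_def by (intro has_derivative_sum has_derivative_scaleR_right smooth_on_has_derivative[OF sm x])
    then have "frechet_derivative (\<lambda>x. a x w e) (at x) v = (\<Sum>j\<in>UNIV. (w $ j) *\<^sub>R frechet_derivative (\<lambda>x. A j x e) (at x) v)"
      by (rule fun_cong[OF frechet_eq_of_has_derivative])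
    also have "\<dots> = (\<Sum>j\<in>UNIV. \<Sum>i\<in>UNIV. (v $ i * w $ j) *\<^sub>R frechet_derivative (\<lambda>x. A j x e) (at x) (axis i 1))"
      by (intro sum.cong refl, subst Dexp[OF sm x]) (simp add: scaleR_sum_right mult.commute)
    finally show ?thesis by (subst sum.swap)
  qed
  have aa: "a x w (a x v e) = (\<Sum>i\<in>UNIV. \<Sum>j\<in>UNIV. (v $ i * w $ j) *\<^sub>R A j x (A i x e))" for x v w e
  proof -
    have "a x w (a x v e) = (\<Sum>j\<in>UNIV. \<Sum>i\<in>UNIV. (v $ i * w $ j) *\<^sub>R A j x (A i x e))"
      unfolding a_def by (simp only: linear_sum[OF lin] linear_cmul[OF lin] scaleR_sum_right scaleR_scaleR mult.commute o_def)
    then show ?thesis by (subst sum.swap)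
  qed
  obtain r F where F: "r > 0" "ball p r \<subseteq> S" "smooth_on (ball p r) F" "F p = F0"
    "\<And>x. x \<in> ball p r \<Longrightarrow> L x (F x) = 0"
    "\<And>x. x \<in> ball p r \<Longrightarrow> (F has_derivative (\<lambda>v. a x v (F x))) (at x)"
  proof (rule parallel_section_vector[OF S av ae asm Le Lsm mv mmsm _ _ F0])
    fix x v e assume x: "x \<in> S"
    have "frechet_derivative (\<lambda>x. L x e) (at x) v = (\<Sum>i\<in>UNIV. v $ i * pd i (\<lambda>x. L x e) x)"
      by (rule frechet_eq_sum_pd[OF smooth_on_differentiable[OF Lsm x]])
    moreover have "L x (a x v e) = (\<Sum>i\<in>UNIV. v $ i * L x (A i x e))"
      unfolding a_def by (simp add: linear_sum[OF Le] linear_cmul[OF Le])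
    ultimately show "frechet_derivative (\<lambda>x. L x e) (at x) v + L x (a x v e) = mm x v * L x e"
      unfolding mm_def by (simp add: sum_distrib_right sum.distrib[symmetric] mult.assoc distrib_left[symmetric] Lder[OF x])
  next
    fix x v w e assume x: "x \<in> S" and L0: "L x e = 0"
    have "frechet_derivative (\<lambda>x. a x w e) (at x) v + a x w (a x v e)
       = (\<Sum>i\<in>UNIV. \<Sum>j\<in>UNIV. (v $ i * w $ j) *\<^sub>R
           (frechet_derivative (\<lambda>x. A j x e) (at x) (axis i 1) + A j x (A i x e)))"
      unfolding Da[OF x] aa by (simp only: scaleR_add_right sum.distrib)
    also have "\<dots> = (\<Sum>i\<in>UNIV. \<Sum>j\<in>UNIV. (v $ i * w $ j) *\<^sub>R
           (frechet_derivative (\<lambda>x. A i x e) (at x) (axis j 1) + A i x (A j x e)))"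
      by (intro sum.cong refl arg_cong2[where f = scaleR] flat[OF x L0])
    also have "\<dots> = frechet_derivative (\<lambda>x. a x v e) (at x) w + a x v (a x w e)"
      unfolding Da[OF x] aa by (subst sum.swap) (simp add: scaleR_add_right sum.distrib mult.commute)
    finally show "frechet_derivative (\<lambda>x. a x w e) (at x) v + a x w (a x v e)
        = frechet_derivative (\<lambda>x. a x v e) (at x) w + a x v (a x w e)" .
  qed blast
  have "frechet_derivative F (at x) (axis i 1) = A i x (F x)" if "x \<in> ball p r" for x i
  proof -
    have "frechet_derivative F (at x) (axis i 1) = a x (axis i 1) (F x)"
      by (rule fun_cong[OF frechet_eq_of_has_derivative[OF F(6)[OF that]]])
    also have "\<dots> = (\<Sum>j\<in>UNIV. if j = i then A i x (F x) else 0)"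
      unfolding a_def by (intro sum.cong) (auto simp: axis_def)
    finally show ?thesis by simp
  qed
  then show ?thesis using that F by blast
qed

text \<open>For a closed one-form \<open>w\<close>, the system \<open>dA = A' w\<close>, \<open>dA' = k A w\<close> is integrable since \<open>w \<and> w = 0\<close>.\<close>

lemma linear_oscillator_exists:
  fixes w :: "'n::finite \<Rightarrow> real^'n \<Rightarrow> real"
  assumes S: "open S" "p \<in> S" and sm: "\<And>i. smooth_on S (w i)"
    and closed: "\<And>x i j. x \<in> S \<Longrightarrow> pd i (w j) x = pd j (w i) x"
  obtains r A A' where "r > 0" "ball p r \<subseteq> S" "smooth_on (ball p r) A" "smooth_on (ball p r) A'"
    "A p = a0" "A' p = a1" "\<And>x i. x \<in> ball p r \<Longrightarrow> pd i A x = A' x * w i x"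
    "\<And>x i. x \<in> ball p r \<Longrightarrow> pd i A' x = k * A x * w i x"
proof -
  define L where "L i x e = (snd e * w i x, k * fst e * w i x)" for i x and e :: "real \<times> real"
  have Lsm: "smooth_on S (\<lambda>x. L i x e)" for i e
    unfolding L_def by (intro smooth_intros S(1) sm)
  have dL: "frechet_derivative (\<lambda>x. L j x e) (at x) (axis i 1) = (snd e * pd i (w j) x, k * fst e * pd i (w j) x)" if "x \<in> S" for i j e x
  proof -
    have "((\<lambda>x. L j x e) has_derivative (\<lambda>v. (snd e * frechet_derivative (w j) (at x) v, k * fst e * frechet_derivative (w j) (at x) v))) (at x)"
      unfolding L_def by (intro derivative_intros smooth_on_has_derivative[OF sm that])
    from fun_cong[OF frechet_eq_of_has_derivative[OF this]] show ?thesis by (simp add: pd_def)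
  qed
  obtain r F where F: "r > 0" "ball p r \<subseteq> S" "smooth_on (ball p r) F" "F p = (a0, a1)"
    "\<And>x i. x \<in> ball p r \<Longrightarrow> frechet_derivative F (at x) (axis i 1) = L i x (F x)"
  proof (rule parallel_section[of S p L "\<lambda>_ _. 0" "\<lambda>_ _. 0" "(a0, a1)"])
    show "linear (L i x)" for i x
      unfolding L_def[abs_def] by (intro linearI) (simp_all add: algebra_simps)
    fix x i j and e :: "real \<times> real" assume "x \<in> S"
    then show "frechet_derivative (\<lambda>x. L j x e) (at x) (axis i 1) + L j x (L i x e) =
       frechet_derivative (\<lambda>x. L i x e) (at x) (axis j 1) + L i x (L j x e)"
      using closed by (simp add: dL) (simp add: L_def mult_ac)
  qed (use S Lsm in \<open>auto intro!: smooth_intros simp: linear_0 linear_zero\<close>)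
  have comp: "smooth_on (ball p r) (\<lambda>x. fst (F x))" "smooth_on (ball p r) (\<lambda>x. snd (F x))"
    by (auto intro!: smooth_on_bounded_linear[OF open_ball _ F(3)] bounded_linear_fst bounded_linear_snd)
  have "pd i (\<lambda>x. fst (F x)) x = snd (F x) * w i x \<and> pd i (\<lambda>x. snd (F x)) x = k * fst (F x) * w i x" if "x \<in> ball p r" for x i
  proof -
    note d = smooth_on_has_derivative[OF F(3) that]
    show ?thesis
      using has_derivative_imp_pd[OF has_derivative_fst[OF d], of i] has_derivative_imp_pd[OF has_derivative_snd[OF d], of i]
        F(5)[OF that] by (simp add: L_def)
  qed
  then show ?thesis using that[OF F(1,2) comp] F(4) by simp
qed

text \<open>The case \<open>k = 0\<close> and \<open>A' = 1\<close>.\<close>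

corollary poincare_lemma:
  fixes w :: "'n::finite \<Rightarrow> real^'n \<Rightarrow> real"
  assumes S: "open S" "p \<in> S" and sm: "\<And>i. smooth_on S (w i)"
    and closed: "\<And>x i j. x \<in> S \<Longrightarrow> pd i (w j) x = pd j (w i) x"
  obtains r T where "r > 0" "ball p r \<subseteq> S" "smooth_on (ball p r) T" "T p = t0"
    "\<And>x i. x \<in> ball p r \<Longrightarrow> pd i T x = w i x"
proof (rule linear_oscillator_exists[OF S sm closed, of t0 1 0])
  fix r A A' assume A: "r > 0" "ball p r \<subseteq> S" "smooth_on (ball p r) A" "smooth_on (ball p r) A'" "A p = t0" "A' p = 1"
    "\<And>x i. x \<in> ball p r \<Longrightarrow> pd i A x = A' x * w i x" "\<And>x i. x \<in> ball p r \<Longrightarrow> pd i A' x = 0 * A x * w i x"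
  have "A' x = 1" if "x \<in> ball p r" for x
    using pd_zero_imp_constant[OF open_ball convex_ball A(4), of x p] that A(1,6,8) by simp
  then show ?thesis using that[OF A(1-3,5)] A(7) by simp
qed

section \<open>The Levi-Civita connection in coordinates\<close>

lemma pd_sum_mult:
  assumes "\<And>m. m \<in> I \<Longrightarrow> F m differentiable (at x)" "\<And>m. m \<in> I \<Longrightarrow> G m differentiable (at x)"
  shows "pd i (\<lambda>x. \<Sum>m\<in>I. F m x * G m x) x = (\<Sum>m\<in>I. pd i (F m) x * G m x + F m x * pd i (G m) x)"
  using assms by (subst pd_sum) (auto intro!: sum.cong pd_mult)

context
  fixes S :: "(real^'n::finite) set" and g :: "'n metric"
  assumes met: "metric_on S g"
begin

lemma metric_open: "open S"
  using met by (simp add: metric_on_def)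

lemma metric_smooth [smooth_intros]: "smooth_on S (\<lambda>x. g x $ i $ j)"
  using met metric_open unfolding metric_on_def by (intro smooth_on_vec_nth) auto

lemma metric_sym: "x \<in> S \<Longrightarrow> g x $ i $ j = g x $ j $ i"
proof -
  assume "x \<in> S"
  then have "transpose (g x) $ i $ j = g x $ i $ j" using met by (simp add: metric_on_def)
  then show ?thesis by (simp add: transpose_def)
qed

lemma metric_invertible: "x \<in> S \<Longrightarrow> invertible (g x)"
  using met by (simp add: metric_on_def)

lemma ginv_smooth [smooth_intros]: "smooth_on S (ginv g i j)"
  unfolding ginv_def[abs_def]
  by (rule smooth_on_matrix_inv[OF metric_open metric_smooth metric_invertible])

lemma ginv_sym: "x \<in> S \<Longrightarrow> ginv g i j x = ginv g j i x"
proof -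
  assume x: "x \<in> S"
  have "transpose (g x) = g x" using met x by (simp add: metric_on_def)
  then have "transpose (matrix_inv (g x)) $ i $ j = matrix_inv (g x) $ i $ j"
    using matrix_inv_transpose[OF metric_invertible[OF x]] by simp
  then show ?thesis by (simp add: transpose_def ginv_def)
qed

lemma metric_ginv: "x \<in> S \<Longrightarrow> (\<Sum>k\<in>UNIV. g x $ i $ k * ginv g k j x) = (if i = j then 1 else 0)"
  using matrix_inv_right[OF metric_invertible, of x]
  unfolding ginv_def matrix_matrix_mult_def mat_def by (simp add: vec_eq_iff)

lemma ginv_metric: "x \<in> S \<Longrightarrow> (\<Sum>k\<in>UNIV. ginv g i k x * g x $ k $ j) = (if i = j then 1 else 0)"
  using matrix_inv_left[OF metric_invertible, of x]
  unfolding ginv_def matrix_matrix_mult_def mat_def by (simp add: vec_eq_iff)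

lemma ginv_metric_contract: "x \<in> S \<Longrightarrow> (\<Sum>l\<in>UNIV. ginv g k l x * (\<Sum>m\<in>UNIV. g x $ l $ m * F m)) = F k"
proof -
  assume x: "x \<in> S"
  have "(\<Sum>l\<in>UNIV. ginv g k l x * (\<Sum>m\<in>UNIV. g x $ l $ m * F m))
      = (\<Sum>m\<in>UNIV. (\<Sum>l\<in>UNIV. ginv g k l x * g x $ l $ m) * F m)"
    unfolding sum_distrib_left sum_distrib_right by (subst sum.swap) (simp add: mult.assoc)
  also have "\<dots> = (\<Sum>m\<in>UNIV. if k = m then F m else 0)"
    by (intro sum.cong) (auto simp: ginv_metric[OF x])
  finally show ?thesis by simp
qed

lemma metric_ginv_contract: "x \<in> S \<Longrightarrow> (\<Sum>l\<in>UNIV. g x $ k $ l * (\<Sum>m\<in>UNIV. ginv g l m x * F m)) = F k"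
proof -
  assume x: "x \<in> S"
  have "(\<Sum>l\<in>UNIV. g x $ k $ l * (\<Sum>m\<in>UNIV. ginv g l m x * F m))
      = (\<Sum>m\<in>UNIV. (\<Sum>l\<in>UNIV. g x $ k $ l * ginv g l m x) * F m)"
    unfolding sum_distrib_left sum_distrib_right by (subst sum.swap) (simp add: mult.assoc)
  also have "\<dots> = (\<Sum>m\<in>UNIV. if k = m then F m else 0)"
    by (intro sum.cong) (auto simp: metric_ginv[OF x])
  finally show ?thesis by simp
qed

lemma pd_metric_sym: "x \<in> S \<Longrightarrow> pd k (\<lambda>y. g y $ i $ j) x = pd k (\<lambda>y. g y $ j $ i) x"
  by (rule pd_transform[OF metric_open]) (auto intro: metric_sym)

lemma christoffel_sym: "x \<in> S \<Longrightarrow> christoffel g k i j x = christoffel g k j i x"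
  unfolding christoffel_def by (simp add: pd_metric_sym[of x _ i j] add.commute)

lemma christoffel_smooth [smooth_intros]: "smooth_on S (christoffel g k i j)"
  unfolding christoffel_def[abs_def]
  by (intro smooth_intros metric_open)

lemma christoffel_lower:
  assumes x: "x \<in> S"
  shows "(\<Sum>k\<in>UNIV. g x $ l $ k * christoffel g k i j x)
    = (pd i (\<lambda>y. g y $ j $ l) x + pd j (\<lambda>y. g y $ i $ l) x - pd l (\<lambda>y. g y $ i $ j) x) / 2"
proof -
  have "(\<Sum>k\<in>UNIV. g x $ l $ k * christoffel g k i j x)
    = 1/2 * (\<Sum>k\<in>UNIV. g x $ l $ k * (\<Sum>m\<in>UNIV. ginv g k m x *
     (pd i (\<lambda>y. g y $ j $ m) x + pd j (\<lambda>y. g y $ i $ m) x - pd m (\<lambda>y. g y $ i $ j) x)))"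
    unfolding christoffel_def by (simp add: sum_distrib_left mult_ac)
  also have "\<dots> = 1/2 * (pd i (\<lambda>y. g y $ j $ l) x + pd j (\<lambda>y. g y $ i $ l) x - pd l (\<lambda>y. g y $ i $ j) x)"
    by (subst metric_ginv_contract[OF x]) simp
  finally show ?thesis by simp
qed

lemma metric_compat:
  assumes x: "x \<in> S"
  shows "pd k (\<lambda>y. g y $ i $ j) x
    = (\<Sum>l\<in>UNIV. christoffel g l k i x * g x $ l $ j) + (\<Sum>l\<in>UNIV. christoffel g l k j x * g x $ i $ l)"
proof -
  have "(\<Sum>l\<in>UNIV. christoffel g l k i x * g x $ l $ j) = (\<Sum>l\<in>UNIV. g x $ j $ l * christoffel g l k i x)"
    by (intro sum.cong) (auto simp: metric_sym[OF x, of j])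
  moreover have "(\<Sum>l\<in>UNIV. christoffel g l k j x * g x $ i $ l) = (\<Sum>l\<in>UNIV. g x $ i $ l * christoffel g l k j x)"
    by (intro sum.cong) auto
  ultimately show ?thesis
    unfolding christoffel_lower[OF x] using pd_metric_sym[OF x] by (simp add: field_simps)
qed

text \<open>Symmetry and compatibility characterize the Christoffel symbols, so that those of a given metric
  can be guessed and checked.\<close>

lemma christoffel_unique:
  assumes x: "x \<in> S" and sym: "\<And>k i j. G k i j = G k j i"
    and compat: "\<And>k i j. pd k (\<lambda>y. g y $ i $ j) x
      = (\<Sum>l\<in>UNIV. G l k i * g x $ l $ j) + (\<Sum>l\<in>UNIV. G l k j * g x $ i $ l)"
  shows "christoffel g k i j x = G k i j"
proof -
  let ?H = "\<lambda>l i j. \<Sum>m\<in>UNIV. g x $ l $ m * G m i j"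
  have H: "(\<Sum>m\<in>UNIV. G m i j * g x $ m $ l) = ?H l i j" "(\<Sum>m\<in>UNIV. G m i j * g x $ l $ m) = ?H l i j" for i j l
    by (auto intro!: sum.cong simp: metric_sym[OF x, of l])
  have Hs: "?H l i j = ?H l j i" for l i j by (simp add: sym[of _ i])
  have "pd i (\<lambda>y. g y $ j $ l) x + pd j (\<lambda>y. g y $ i $ l) x - pd l (\<lambda>y. g y $ i $ j) x = 2 * ?H l i j" for l
    unfolding compat H using Hs by simp
  then have "christoffel g k i j x = (\<Sum>l\<in>UNIV. ginv g k l x * ?H l i j)"
    unfolding christoffel_def by (simp add: sum_distrib_left)
  then show ?thesis using ginv_metric_contract[OF x] by simp
qed

lemma pd_ginv:
  assumes x: "x \<in> S"
  shows "pd k (ginv g i j) x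
    = - (\<Sum>l\<in>UNIV. christoffel g i k l x * ginv g l j x) - (\<Sum>l\<in>UNIV. christoffel g j k l x * ginv g i l x)"
proof -
  note d = smooth_on_differentiable[OF _ x]
  have 0: "(\<Sum>l\<in>UNIV. g x $ a $ l * pd k (ginv g l j) x) = - (\<Sum>l\<in>UNIV. pd k (\<lambda>y. g y $ a $ l) x * ginv g l j x)" for a
  proof -
    have "pd k (\<lambda>y. \<Sum>l\<in>UNIV. g y $ a $ l * ginv g l j y) x = pd k (\<lambda>y. if a = j then 1 else 0) x"
      by (rule pd_transform[OF metric_open x]) (simp add: metric_ginv)
    moreover have "pd k (\<lambda>y. \<Sum>l\<in>UNIV. g y $ a $ l * ginv g l j y) x
       = (\<Sum>l\<in>UNIV. pd k (\<lambda>y. g y $ a $ l) x * ginv g l j x + g x $ a $ l * pd k (ginv g l j) x)"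
      by (subst pd_sum) (auto intro!: d smooth_intros metric_open sum.cong pd_mult)
    ultimately show ?thesis by (simp add: sum.distrib)
  qed
  have 1: "(\<Sum>l\<in>UNIV. pd k (\<lambda>y. g y $ a $ l) x * ginv g l j x)
      = (\<Sum>l\<in>UNIV. g x $ a $ l * ((\<Sum>b\<in>UNIV. christoffel g l k b x * ginv g b j x) + (\<Sum>b\<in>UNIV. christoffel g j k b x * ginv g l b x)))" for a
  proof -
    have "(\<Sum>l\<in>UNIV. pd k (\<lambda>y. g y $ a $ l) x * ginv g l j x)
       = (\<Sum>l\<in>UNIV. \<Sum>b\<in>UNIV. christoffel g b k a x * (g x $ b $ l * ginv g l j x))
       + (\<Sum>l\<in>UNIV. \<Sum>b\<in>UNIV. g x $ a $ b * (christoffel g b k l x * ginv g l j x))"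
      by (simp only: metric_compat[OF x] distrib_right sum.distrib sum_distrib_right) (simp add: mult_ac)
    also have "(\<Sum>l\<in>UNIV. \<Sum>b\<in>UNIV. christoffel g b k a x * (g x $ b $ l * ginv g l j x)) = christoffel g j k a x"
      by (subst sum.swap) (simp add: sum_distrib_left[symmetric] metric_ginv[OF x] if_distrib cong: if_cong)
    also have "(\<Sum>l\<in>UNIV. \<Sum>b\<in>UNIV. g x $ a $ b * (christoffel g b k l x * ginv g l j x))
       = (\<Sum>l\<in>UNIV. g x $ a $ l * (\<Sum>b\<in>UNIV. christoffel g l k b x * ginv g b j x))"
      by (subst sum.swap) (simp add: sum_distrib_left)
    also have "christoffel g j k a x = (\<Sum>l\<in>UNIV. g x $ a $ l * (\<Sum>b\<in>UNIV. christoffel g j k b x * ginv g l b x))"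
      using metric_ginv_contract[OF x, of a "\<lambda>b. christoffel g j k b x"] by (simp add: mult.commute)
    finally show ?thesis by (simp add: distrib_left sum.distrib)
  qed
  have "pd k (ginv g i j) x = (\<Sum>l\<in>UNIV. ginv g i l x * (\<Sum>m\<in>UNIV. g x $ l $ m * pd k (ginv g m j) x))"
    by (rule ginv_metric_contract[OF x, symmetric])
  also have "\<dots> = - (\<Sum>l\<in>UNIV. ginv g i l x * (\<Sum>m\<in>UNIV. g x $ l $ m * ((\<Sum>b\<in>UNIV. christoffel g m k b x * ginv g b j x) + (\<Sum>b\<in>UNIV. christoffel g j k b x * ginv g m b x))))"
    unfolding 0 1 by (simp add: sum_negf)
  also have "\<dots> = - ((\<Sum>b\<in>UNIV. christoffel g i k b x * ginv g b j x) + (\<Sum>b\<in>UNIV. christoffel g j k b x * ginv g i b x))"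
    by (subst ginv_metric_contract[OF x]) simp
  finally show ?thesis by simp
qed

subsection \<open>Symmetries of the curvature tensor\<close>

lemma riem_up_smooth [smooth_intros]: "smooth_on S (riem_up g l k i j)"
  unfolding riem_up_def[abs_def] by (intro smooth_intros metric_open)

lemma riem_smooth [smooth_intros]: "smooth_on S (riem g i j k l)"
  unfolding riem_def[abs_def] by (intro smooth_intros metric_open)

lemma ricci_smooth [smooth_intros]: "smooth_on S (ricci g i j)"
  unfolding ricci_def[abs_def] by (intro smooth_intros metric_open)

lemma scal_smooth [smooth_intros]: "smooth_on S (scal g)"
  unfolding scal_def[abs_def] by (intro smooth_intros metric_open)

lemma riem_up_antisym: "riem_up g l k i j x = - riem_up g l k j i x"
  unfolding riem_up_def by (simp add: sum_subtractf)

lemma riem_antisym12: "riem g i j k l x = - riem g j i k l x"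
  unfolding riem_def by (subst riem_up_antisym) (simp add: sum_negf)

text \<open>Second derivatives of the metric commute; expressed by compatibility, their difference is the
  part of the curvature that is symmetric in the last two indices.\<close>

lemma riem_antisym34:
  assumes x: "x \<in> S" shows "riem g i j k l x = - riem g i j l k x"
proof -
  note d = smooth_on_differentiable[OF _ x]
  let ?G = "christoffel g"
  define T where "T i j k l = (\<Sum>m\<in>UNIV. pd i (?G m j k) x * g x $ m $ l) + (\<Sum>m\<in>UNIV. \<Sum>q\<in>UNIV. ?G m j k x * (?G q i m x * g x $ q $ l))" for i j k l
  define X where "X i j k l = (\<Sum>m\<in>UNIV. \<Sum>q\<in>UNIV. ?G m j k x * (?G q i l x * g x $ m $ q))" for i j k l
  have Xs: "X i j l k = X j i k l" for i j k l
    unfolding X_def by (subst sum.swap) (auto intro!: sum.cong simp: metric_sym[OF x] mult_ac)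
  have R: "riem g i j k l x = T i j k l - T j i k l" for i j k l
  proof -
    have "T i j k l = (\<Sum>m\<in>UNIV. g x $ l $ m * pd i (?G m j k) x) + (\<Sum>m\<in>UNIV. g x $ l $ m * (\<Sum>q\<in>UNIV. ?G m i q x * ?G q j k x))" for i j
      unfolding T_def
      by (subst sum.swap, simp add: sum_distrib_left metric_sym[OF x, of _ l] mult_ac)
    then show ?thesis
      unfolding riem_def riem_up_def by (simp add: sum.distrib sum_subtractf algebra_simps)
  qed
  have dd: "pd i (pd j (\<lambda>y. g y $ k $ l)) x = T i j k l + X i j k l + (T i j l k + X i j l k)" for i j
  proof -
    have "pd i (pd j (\<lambda>y. g y $ k $ l)) x
      = pd i (\<lambda>x. (\<Sum>m\<in>UNIV. ?G m j k x * g x $ m $ l) + (\<Sum>m\<in>UNIV. ?G m j l x * g x $ k $ m)) x"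
      by (rule pd_transform[OF metric_open x]) (simp add: metric_compat)
    also have "\<dots> = (\<Sum>m\<in>UNIV. pd i (?G m j k) x * g x $ m $ l + ?G m j k x * pd i (\<lambda>y. g y $ m $ l) x)
        + (\<Sum>m\<in>UNIV. pd i (?G m j l) x * g x $ k $ m + ?G m j l x * pd i (\<lambda>y. g y $ k $ m) x)"
      by (subst pd_add) (auto intro!: d smooth_intros metric_open arg_cong2[where f = plus] pd_sum_mult)
    also have "\<dots> = T i j k l + X i j k l + (T i j l k + X i j l k)"
      unfolding T_def X_def metric_compat[OF x]
      by (simp add: sum.distrib distrib_left sum_distrib_left metric_sym[OF x])
    finally show ?thesis .
  qed
  have "pd i (pd j (\<lambda>y. g y $ k $ l)) x = pd j (pd i (\<lambda>y. g y $ k $ l)) x"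
    by (rule pd_commute[OF metric_open x metric_smooth])
  then show ?thesis unfolding dd R using Xs[of i j k l] Xs[of j i k l] by simp
qed

lemma riem_up_bianchi1:
  assumes x: "x \<in> S" shows "riem_up g l k i j x + riem_up g l i j k x + riem_up g l j k i x = 0"
proof -
  have s: "christoffel g l i j = christoffel g l i j" for l i j by simp
  have p: "pd a (christoffel g l i j) x = pd a (christoffel g l j i) x" for a l i j
    by (rule pd_transform[OF metric_open x]) (rule christoffel_sym)
  show ?thesis
    unfolding riem_up_def sum_subtractf
    using p[of i l j k] p[of j l k i] p[of k l i j]
    by (simp add: christoffel_sym[OF x, of _ k j] christoffel_sym[OF x, of _ j i] christoffel_sym[OF x, of _ k i])
qed

lemma riem_bianchi1: "x \<in> S \<Longrightarrow> riem g i j k l x + riem g j k i l x + riem g k i j l x = 0"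
proof -
  assume x: "x \<in> S"
  have "riem g i j k l x + riem g j k i l x + riem g k i j l x
     = (\<Sum>m\<in>UNIV. g x $ l $ m * (riem_up g m k i j x + riem_up g m i j k x + riem_up g m j k i x))"
    unfolding riem_def by (simp add: sum.distrib distrib_left)
  then show ?thesis by (simp add: riem_up_bianchi1[OF x])
qed

lemma riem_pair_sym: "x \<in> S \<Longrightarrow> riem g i j k l x = riem g k l i j x"
proof -
  assume x: "x \<in> S"
  note B = riem_bianchi1[OF x] and A = riem_antisym12[of _ _ _ _ x] and A' = riem_antisym34[OF x]
  show ?thesis
    using B[of i j k l] B[of j k l i] B[of k l i j] B[of l i j k]
      A[of j k i l] A'[of j k i l] A[of k i j l] A'[of k i j l] A[of k l j i] A'[of k l j i] A[of l j k i] A'[of l j k i]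
      A[of l i k j] A'[of l i k j] A[of i k l j] A'[of i k l j] A[of i j l k] A'[of i j l k] A[of j l i k] A'[of j l i k]
      A'[of i j k l] A'[of k l i j] A[of j l k i] A[of i k j l] A'[of i k j l] A[of l i j k] A'[of l i j k] A[of j k l i] A'[of j k l i]
    by linarith
qed

lemma riem_up_riem: "x \<in> S \<Longrightarrow> riem_up g l k i j x = (\<Sum>m\<in>UNIV. ginv g l m x * riem g i j k m x)"
  unfolding riem_def using ginv_metric_contract by simp

lemma ricci_riem: "x \<in> S \<Longrightarrow> ricci g j k x = (\<Sum>i\<in>UNIV. \<Sum>m\<in>UNIV. ginv g i m x * riem g i j k m x)"
  unfolding ricci_def using riem_up_riem by simp

lemma ricci_sym: "x \<in> S \<Longrightarrow> ricci g j k x = ricci g k j x"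
proof -
  assume x: "x \<in> S"
  have *: "riem g i j k m x = riem g m k j i x" for i m
    using riem_pair_sym[OF x, of i j k m] riem_antisym12[of k m i j x] riem_antisym34[OF x, of m k i j] by simp
  show ?thesis unfolding ricci_riem[OF x] *
    by (subst sum.swap) (simp add: ginv_sym[OF x])
qed

end

subsection \<open>Covariant derivatives of tensors\<close>

definition cov2 :: "'n::finite metric \<Rightarrow> ('n \<Rightarrow> 'n \<Rightarrow> real^'n \<Rightarrow> real) \<Rightarrow> 'n \<Rightarrow> 'n \<Rightarrow> 'n \<Rightarrow> real^'n \<Rightarrow> real" where
  "cov2 g T m i j x = pd m (T i j) x - (\<Sum>q\<in>UNIV. christoffel g q m i x * T q j x)
     - (\<Sum>q\<in>UNIV. christoffel g q m j x * T i q x)"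

definition cov4 :: "'n::finite metric \<Rightarrow> ('n \<Rightarrow> 'n \<Rightarrow> 'n \<Rightarrow> 'n \<Rightarrow> real^'n \<Rightarrow> real)
    \<Rightarrow> 'n \<Rightarrow> 'n \<Rightarrow> 'n \<Rightarrow> 'n \<Rightarrow> 'n \<Rightarrow> real^'n \<Rightarrow> real" where
  "cov4 g T m i j k l x = pd m (T i j k l) x
     - (\<Sum>q\<in>UNIV. christoffel g q m i x * T q j k l x) - (\<Sum>q\<in>UNIV. christoffel g q m j x * T i q k l x)
     - (\<Sum>q\<in>UNIV. christoffel g q m k x * T i j q l x) - (\<Sum>q\<in>UNIV. christoffel g q m l x * T i j k q x)"

lemma cov2_add:
  assumes "\<And>i j. T i j differentiable (at x)" "\<And>i j. U i j differentiable (at x)"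
  shows "cov2 g (\<lambda>i j x. T i j x + U i j x) m i j x = cov2 g T m i j x + cov2 g U m i j x"
  unfolding cov2_def by (subst pd_add) (auto simp: assms algebra_simps sum.distrib)

lemma cov2_scalar:
  assumes "F differentiable (at x)" "\<And>i j. T i j differentiable (at x)"
  shows "cov2 g (\<lambda>i j x. F x * T i j x) m i j x = pd m F x * T i j x + F x * cov2 g T m i j x"
  unfolding cov2_def by (subst pd_mult) (auto simp: assms algebra_simps sum_distrib_left)

lemma cov4_diff:
  assumes "\<And>i j k l. T i j k l differentiable (at x)" "\<And>i j k l. U i j k l differentiable (at x)"
  shows "cov4 g (\<lambda>i j k l x. T i j k l x - U i j k l x) m i j k l x = cov4 g T m i j k l x - cov4 g U m i j k l x"
  unfolding cov4_def by (subst pd_diff) (auto simp: assms algebra_simps sum_subtractf)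

lemma cov4_add:
  assumes "\<And>i j k l. T i j k l differentiable (at x)" "\<And>i j k l. U i j k l differentiable (at x)"
  shows "cov4 g (\<lambda>i j k l x. T i j k l x + U i j k l x) m i j k l x = cov4 g T m i j k l x + cov4 g U m i j k l x"
  unfolding cov4_def by (subst pd_add) (auto simp: assms algebra_simps sum.distrib)

lemma cov4_cmult:
  assumes "\<And>i j k l. T i j k l differentiable (at x)"
  shows "cov4 g (\<lambda>i j k l x. c * T i j k l x) m i j k l x = c * cov4 g T m i j k l x"
  unfolding cov4_def by (subst pd_cmult) (auto simp: assms algebra_simps sum_distrib_left)

lemma cov4_product_jk_il:
  assumes "\<And>i j. T i j differentiable (at x)" "\<And>i j. U i j differentiable (at x)"
  shows "cov4 g (\<lambda>i j k l x. T j k x * U i l x) m i j k l x = cov2 g T m j k x * U i l x + T j k x * cov2 g U m i l x"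
  unfolding cov4_def cov2_def
  by (subst pd_mult) (auto simp: assms algebra_simps sum_distrib_left)

lemma cov4_product_ik_jl:
  assumes "\<And>i j. T i j differentiable (at x)" "\<And>i j. U i j differentiable (at x)"
  shows "cov4 g (\<lambda>i j k l x. T i k x * U j l x) m i j k l x = cov2 g T m i k x * U j l x + T i k x * cov2 g U m j l x"
  unfolding cov4_def cov2_def
  by (subst pd_mult) (auto simp: assms algebra_simps sum_distrib_left)

context
  fixes S :: "(real^'n::finite) set" and g :: "'n metric"
  assumes met: "metric_on S g"
begin

lemmas lc_smooth = smooth_intros metric_smooth[OF met] ginv_smooth[OF met] christoffel_smooth[OF met]
  riem_up_smooth[OF met] riem_smooth[OF met] ricci_smooth[OF met] scal_smooth[OF met] metric_open[OF met]

lemma cov2_metric: "x \<in> S \<Longrightarrow> cov2 g (\<lambda>i j x. g x $ i $ j) m i j x = 0"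
  unfolding cov2_def by (simp add: metric_compat[OF met])

text \<open>The identity \<open>d\<Omega> + [\<omega>, \<Omega>] = 0\<close> for the curvature \<open>\<Omega>\<close> of a connection matrix \<open>\<omega>\<close>.\<close>

lemma riem_up_bianchi2:
  assumes x: "x \<in> S"
  shows "pd m (riem_up g l k i j) x + pd i (riem_up g l k j m) x + pd j (riem_up g l k m i) x
      + (\<Sum>n\<in>UNIV. christoffel g l m n x * riem_up g n k i j x - riem_up g l n i j x * christoffel g n m k x)
      + (\<Sum>n\<in>UNIV. christoffel g l i n x * riem_up g n k j m x - riem_up g l n j m x * christoffel g n i k x)
      + (\<Sum>n\<in>UNIV. christoffel g l j n x * riem_up g n k m i x - riem_up g l n m i x * christoffel g n j k x) = 0"
proof -
  note d = smooth_on_differentiable[OF _ x]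
  let ?G = "christoffel g"
  define u where "u m i j = (\<Sum>n\<in>UNIV. pd m (?G l i n) x * ?G n j k x)" for m i j
  define v where "v m i j = (\<Sum>n\<in>UNIV. ?G l m n x * pd i (?G n j k) x)" for m i j
  define T where "T m i j = (\<Sum>n\<in>UNIV. \<Sum>q\<in>UNIV. ?G l m n x * (?G n i q x * ?G q j k x))" for m i j
  have D: "pd m (riem_up g l k i j) x = pd m (pd i (?G l j k)) x - pd m (pd j (?G l i k)) x
      + (u m i j + v i m j - u m j i - v j m i)" for m i j
  proof -
    have "pd m (riem_up g l k i j) x = pd m (pd i (?G l j k)) x - pd m (pd j (?G l i k)) x
      + (pd m (\<lambda>x. \<Sum>n\<in>UNIV. ?G l i n x * ?G n j k x) x - pd m (\<lambda>x. \<Sum>n\<in>UNIV. ?G l j n x * ?G n i k x) x)"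
      unfolding riem_up_def[abs_def] sum_subtractf
      by (subst pd_add, (intro d lc_smooth)+, subst pd_diff, (intro d lc_smooth)+, subst pd_diff, (intro d lc_smooth)+, simp)
    then show ?thesis
      by (subst (asm) (1 2) pd_sum_mult) (auto intro!: d lc_smooth simp: u_def v_def sum.distrib)
  qed
  have E: "(\<Sum>n\<in>UNIV. ?G l m n x * riem_up g n k i j x - riem_up g l n i j x * ?G n m k x)
     = v m i j - v m j i + (T m i j - T m j i) - (u i j m - u j i m) - (T i j m - T j i m)" for m i j
  proof -
    have "(\<Sum>n\<in>UNIV. ?G l m n x * riem_up g n k i j x) = v m i j - v m j i + (T m i j - T m j i)" (is ?A)
      unfolding riem_up_def v_def T_def
      by (simp add: algebra_simps sum.distrib sum_subtractf sum_distrib_left)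
    have Tq: "T i j m = (\<Sum>n\<in>UNIV. (\<Sum>q\<in>UNIV. ?G l i q x * ?G q j n x) * ?G n m k x)" for i j
      unfolding T_def sum_distrib_right by (subst sum.swap) (simp add: mult_ac)
    have "(\<Sum>n\<in>UNIV. riem_up g l n i j x * ?G n m k x) = u i j m - u j i m + (T i j m - T j i m)"
      unfolding riem_up_def u_def Tq
      by (simp only: left_diff_distrib distrib_right sum.distrib sum_subtractf)
    with \<open>?A\<close> show ?thesis by (simp add: sum_subtractf)
  qed
  have c: "pd a (pd b (?G l e k)) x = pd b (pd a (?G l e k)) x" for a b e
    by (rule pd_commute[OF metric_open[OF met] x christoffel_smooth[OF met]])
  show "pd m (riem_up g l k i j) x + pd i (riem_up g l k j m) x + pd j (riem_up g l k m i) x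
      + (\<Sum>n\<in>UNIV. christoffel g l m n x * riem_up g n k i j x - riem_up g l n i j x * christoffel g n m k x)
      + (\<Sum>n\<in>UNIV. christoffel g l i n x * riem_up g n k j m x - riem_up g l n j m x * christoffel g n i k x)
      + (\<Sum>n\<in>UNIV. christoffel g l j n x * riem_up g n k m i x - riem_up g l n m i x * christoffel g n j k x) = 0"
    unfolding D E using c[of m i j] c[of m j i] c[of i j m] by simp
qed

text \<open>The metric is parallel, so that the last index can be lowered outside the derivative.\<close>

lemma cov4_riem:
  assumes x: "x \<in> S"
  shows "cov4 g (riem g) m i j k l x = (\<Sum>n\<in>UNIV. g x $ l $ n *
     (pd m (riem_up g n k i j) x
      + (\<Sum>q\<in>UNIV. christoffel g n m q x * riem_up g q k i j x - riem_up g n q i j x * christoffel g q m k x)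
      - (\<Sum>q\<in>UNIV. christoffel g q m i x * riem_up g n k q j x) - (\<Sum>q\<in>UNIV. christoffel g q m j x * riem_up g n k i q x)))"
proof -
  note d = smooth_on_differentiable[OF _ x]
  let ?G = "christoffel g"
  have "pd m (riem g i j k l) x = (\<Sum>n\<in>UNIV. pd m (\<lambda>y. g y $ l $ n) x * riem_up g n k i j x + g x $ l $ n * pd m (riem_up g n k i j) x)"
    unfolding riem_def[abs_def] by (rule pd_sum_mult) (auto intro!: d lc_smooth)
  also have "\<dots> = (\<Sum>n\<in>UNIV. g x $ l $ n * pd m (riem_up g n k i j) x)
     + (\<Sum>q\<in>UNIV. ?G q m l x * riem g i j k q x)
     + (\<Sum>n\<in>UNIV. g x $ l $ n * (\<Sum>q\<in>UNIV. ?G n m q x * riem_up g q k i j x))"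
  proof -
    have "(\<Sum>n\<in>UNIV. (\<Sum>q\<in>UNIV. ?G q m l x * g x $ q $ n) * riem_up g n k i j x) = (\<Sum>q\<in>UNIV. ?G q m l x * riem g i j k q x)"
      unfolding riem_def sum_distrib_left sum_distrib_right by (subst sum.swap) (simp add: mult_ac)
    moreover have "(\<Sum>n\<in>UNIV. (\<Sum>q\<in>UNIV. ?G q m n x * g x $ l $ q) * riem_up g n k i j x)
       = (\<Sum>n\<in>UNIV. g x $ l $ n * (\<Sum>q\<in>UNIV. ?G n m q x * riem_up g q k i j x))"
      unfolding sum_distrib_left sum_distrib_right by (subst sum.swap) (simp add: mult_ac)
    ultimately show ?thesis unfolding metric_compat[OF met x] distrib_right sum.distrib by simp
  qed
  finally have P: "pd m (riem g i j k l) x = (\<Sum>n\<in>UNIV. g x $ l $ n * pd m (riem_up g n k i j) x)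
     + (\<Sum>q\<in>UNIV. ?G q m l x * riem g i j k q x)
     + (\<Sum>n\<in>UNIV. g x $ l $ n * (\<Sum>q\<in>UNIV. ?G n m q x * riem_up g q k i j x))" .
  have Q: "(\<Sum>q\<in>UNIV. c q * (\<Sum>n\<in>UNIV. g x $ l $ n * R q n)) = (\<Sum>n\<in>UNIV. g x $ l $ n * (\<Sum>q\<in>UNIV. c q * R q n))" for c R
    unfolding sum_distrib_left by (subst sum.swap) (simp add: mult_ac)
  have "(\<Sum>q\<in>UNIV. ?G q m i x * riem g q j k l x) = (\<Sum>n\<in>UNIV. g x $ l $ n * (\<Sum>q\<in>UNIV. ?G q m i x * riem_up g n k q j x))"
    "(\<Sum>q\<in>UNIV. ?G q m j x * riem g i q k l x) = (\<Sum>n\<in>UNIV. g x $ l $ n * (\<Sum>q\<in>UNIV. ?G q m j x * riem_up g n k i q x))"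
    "(\<Sum>q\<in>UNIV. ?G q m k x * riem g i j q l x) = (\<Sum>n\<in>UNIV. g x $ l $ n * (\<Sum>q\<in>UNIV. ?G q m k x * riem_up g n q i j x))"
    unfolding riem_def by (rule Q)+
  then show ?thesis unfolding cov4_def P
    by (simp add: algebra_simps sum.distrib sum_subtractf)
qed

lemma cov4_riem_bianchi2:
  assumes x: "x \<in> S"
  shows "cov4 g (riem g) m i j k l x + cov4 g (riem g) i j m k l x + cov4 g (riem g) j m i k l x = 0"
proof -
  let ?G = "christoffel g"
  define s where "s a b c n = (\<Sum>q\<in>UNIV. ?G q a b x * riem_up g n k q c x)" for a b c n
  have s: "(\<Sum>q\<in>UNIV. ?G q a c x * riem_up g n k b q x) = - s a c b n" for a b c n
    unfolding s_def by (subst riem_up_antisym[OF met, of _ _ b]) (simp add: sum_negf)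
  have ss: "s a b c n = s b a c n" for a b c n
    unfolding s_def by (simp add: christoffel_sym[OF met x, of _ a b])
  have "cov4 g (riem g) m i j k l x + cov4 g (riem g) i j m k l x + cov4 g (riem g) j m i k l x
    = (\<Sum>n\<in>UNIV. g x $ l $ n * (
      pd m (riem_up g n k i j) x + pd i (riem_up g n k j m) x + pd j (riem_up g n k m i) x
      + (\<Sum>q\<in>UNIV. ?G n m q x * riem_up g q k i j x - riem_up g n q i j x * ?G q m k x)
      + (\<Sum>q\<in>UNIV. ?G n i q x * riem_up g q k j m x - riem_up g n q j m x * ?G q i k x)
      + (\<Sum>q\<in>UNIV. ?G n j q x * riem_up g q k m i x - riem_up g n q m i x * ?G q j k x)))"
    unfolding cov4_riem[OF x] s s_def[symmetric] sum.distrib[symmetric] distrib_left[symmetric]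
    using ss[of m i] ss[of i j] ss[of j m] by (intro sum.cong refl arg_cong2[where f = times]) simp
  also have "\<dots> = 0" unfolding riem_up_bianchi2[OF x] by simp
  finally show ?thesis .
qed

lemma hess_smooth: "smooth_on S F \<Longrightarrow> smooth_on S (hess g F i j)"
  unfolding hess_def[abs_def] by (intro lc_smooth)

lemma hess_sym: "x \<in> S \<Longrightarrow> smooth_on S F \<Longrightarrow> hess g F i j x = hess g F j i x"
  unfolding hess_def using pd_commute[OF metric_open[OF met]] christoffel_sym[OF met] by simp

lemma ricci_identity:
  assumes x: "x \<in> S" and F: "smooth_on S F"
  shows "cov2 g (hess g F) i j k x - cov2 g (hess g F) j i k x = - (\<Sum>l\<in>UNIV. riem_up g l k i j x * pd l F x)"
proof -
  note d = smooth_on_differentiable[OF _ x]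
  let ?G = "christoffel g"
  have D: "pd i (hess g F j k) x = pd i (pd j (pd k F)) x - (\<Sum>l\<in>UNIV. pd i (?G l j k) x * pd l F x + ?G l j k x * pd i (pd l F) x)" for i j
    unfolding hess_def[abs_def]
    by (subst pd_diff, (intro d lc_smooth F)+, subst pd_sum_mult) (auto intro!: d lc_smooth F)
  have c: "pd i (pd j (pd k F)) x = pd j (pd i (pd k F)) x"
    by (rule pd_commute[OF metric_open[OF met] x smooth_on_pd[OF F]])
  have s: "(\<Sum>q\<in>UNIV. ?G q i j x * hess g F q k x) = (\<Sum>q\<in>UNIV. ?G q j i x * hess g F q k x)"
    by (simp add: christoffel_sym[OF met x, of _ i j])
  have h: "(\<Sum>q\<in>UNIV. ?G q i k x * hess g F j q x)
     = (\<Sum>q\<in>UNIV. ?G q i k x * pd j (pd q F) x) - (\<Sum>l\<in>UNIV. (\<Sum>q\<in>UNIV. ?G l j q x * ?G q i k x) * pd l F x)" for i j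
    unfolding hess_def right_diff_distrib sum_subtractf sum_distrib_left sum_distrib_right
    by (subst sum.swap) (simp add: mult_ac)
  show ?thesis
    unfolding cov2_def D h s c riem_up_def
    by (simp add: algebra_simps sum.distrib sum_subtractf)
qed

end

subsection \<open>Contraction with a frame\<close>

definition con :: "('n::finite \<Rightarrow> real^'n) \<Rightarrow> ('n \<Rightarrow> real) \<Rightarrow> 'n \<Rightarrow> real" where
  "con Q F a = (\<Sum>i\<in>UNIV. Q a $ i * F i)"

definition con2 :: "('n::finite \<Rightarrow> real^'n) \<Rightarrow> ('n \<Rightarrow> 'n \<Rightarrow> real) \<Rightarrow> 'n \<Rightarrow> 'n \<Rightarrow> real" where
  "con2 Q T a b = con Q (\<lambda>i. con Q (T i) b) a"

definition con4 :: "('n::finite \<Rightarrow> real^'n) \<Rightarrow> ('n \<Rightarrow> 'n \<Rightarrow> 'n \<Rightarrow> 'n \<Rightarrow> real) \<Rightarrow> 'n \<Rightarrow> 'n \<Rightarrow> 'n \<Rightarrow> 'n \<Rightarrow> real" where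
  "con4 Q T a b c d = con2 Q (\<lambda>i j. con2 Q (T i j) c d) a b"

lemma con_add: "con Q (\<lambda>i. F i + G i) a = con Q F a + con Q G a"
  and con_diff: "con Q (\<lambda>i. F i - G i) a = con Q F a - con Q G a"
  and con_minus: "con Q (\<lambda>i. - F i) a = - con Q F a"
  and con_cmult: "con Q (\<lambda>i. c * F i) a = c * con Q F a"
  and con_multc: "con Q (\<lambda>i. F i * c) a = con Q F a * c"
  and con_divide: "con Q (\<lambda>i. F i / c) a = con Q F a / c"
  and con_zero: "con Q (\<lambda>i. 0) a = 0"
  by (simp_all add: con_def algebra_simps sum.distrib sum_subtractf sum_negf sum_distrib_left sum_divide_distrib)

lemmas con_simps = con_add con_diff con_minus con_cmult con_multc con_divide con_zero

lemma con_sum: "con Q (\<lambda>i. \<Sum>j\<in>I. F i j) a = (\<Sum>j\<in>I. con Q (\<lambda>i. F i j) a)"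
  unfolding con_def sum_distrib_left by (rule sum.swap)

lemma con_swap: "con Q (\<lambda>i. con R (\<lambda>j. T i j) b) a = con R (\<lambda>j. con Q (\<lambda>i. T i j) a) b"
  unfolding con_def sum_distrib_left by (subst sum.swap) (simp add: mult_ac)

text \<open>A frame with value \<open>Q\<close> and vanishing covariant derivative at \<open>p\<close>: the linear terms cancel the
  Christoffel symbols there.\<close>

definition parallel_frame :: "'n::finite metric \<Rightarrow> real^'n \<Rightarrow> ('n \<Rightarrow> real^'n) \<Rightarrow> real^'n \<Rightarrow> 'n \<Rightarrow> real^'n" where
  "parallel_frame g p Q x a =
    (\<chi> i. Q a $ i - (\<Sum>m\<in>UNIV. \<Sum>n\<in>UNIV. christoffel g i m n p * (x $ m - p $ m) * Q a $ n))"

lemma parallel_frame_at [simp]: "parallel_frame g p Q p = Q"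
  by (simp add: parallel_frame_def vec_eq_iff fun_eq_iff)

lemma parallel_frame_smooth: "smooth_on UNIV (\<lambda>x. parallel_frame g p Q x a $ i)"
  by (simp add: parallel_frame_def) (intro smooth_intros; simp)

lemma pd_parallel_frame:
  "pd m (\<lambda>x. parallel_frame g p Q x a $ i) p = - (\<Sum>n\<in>UNIV. christoffel g i m n p * Q a $ n)"
proof -
  have d: "F differentiable (at p)" if "smooth_on UNIV F" for F :: "real^'a \<Rightarrow> real"
    using smooth_on_differentiable[OF that] by simp
  define H where "H k n x = christoffel g i k n p * (x $ k - p $ k) * Q a $ n" for k n and x :: "real^'a"
  have H: "smooth_on UNIV (H k n)" for k n
    unfolding H_def[abs_def] by (intro smooth_intros open_UNIV)
  have "pd m (\<lambda>x. parallel_frame g p Q x a $ i) p = pd m (\<lambda>x. Q a $ i - (\<Sum>k\<in>UNIV. \<Sum>n\<in>UNIV. H k n x)) p"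
    by (simp add: parallel_frame_def H_def)
  also have "\<dots> = - (\<Sum>k\<in>UNIV. pd m (\<lambda>x. \<Sum>n\<in>UNIV. H k n x) p)"
    by (subst pd_diff) (auto intro!: d smooth_intros H pd_sum)
  also have "\<dots> = - (\<Sum>k\<in>UNIV. \<Sum>n\<in>UNIV. pd m (H k n) p)"
    by (subst pd_sum) (auto intro!: d H)
  finally have "pd m (\<lambda>x. parallel_frame g p Q x a $ i) p
    = - (\<Sum>k\<in>UNIV. \<Sum>n\<in>UNIV. pd m (\<lambda>x. christoffel g i k n p * (x $ k - p $ k) * Q a $ n) p)"
    by (simp add: H_def[abs_def])
  also have "\<dots> = - (\<Sum>k\<in>UNIV. \<Sum>n\<in>UNIV. christoffel g i k n p * (if m = k then 1 else 0) * Q a $ n)"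
  proof -
    have "pd m (\<lambda>x. christoffel g i k n p * (x $ k - p $ k) * Q a $ n) p
       = christoffel g i k n p * (if m = k then 1 else 0) * Q a $ n" for k n
    proof -
      have "pd m (\<lambda>x. christoffel g i k n p * (x $ k - p $ k) * Q a $ n) p
        = pd m (\<lambda>x. (christoffel g i k n p * Q a $ n) * (x $ k - p $ k)) p"
        by (simp add: mult_ac)
      also have "\<dots> = (christoffel g i k n p * Q a $ n) * (if m = k then 1 else 0)"
        by (subst pd_cmult, (intro d smooth_intros; simp), subst pd_diff) (auto intro!: d smooth_intros simp: pd_coord)
      finally show ?thesis by simp
    qed
    then show ?thesis by simp
  qed
  also have "\<dots> = - (\<Sum>n\<in>UNIV. christoffel g i m n p * Q a $ n)"
    by (subst sum.swap) (simp add: if_distrib if_distribR cong: if_cong)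
  finally show ?thesis .
qed

text \<open>At \<open>p\<close> the ordinary derivatives of components in this frame are the components of the covariant
  derivative. In this way relations between frame components of tensors can be differentiated
  covariantly without a product rule for each of them.\<close>

lemma pd_con_parallel_frame:
  assumes "\<And>i. F i differentiable (at p)"
  shows "pd m (\<lambda>x. con (parallel_frame g p Q x) (\<lambda>i. F i x) a) p
    = con Q (\<lambda>i. pd m (F i) p - (\<Sum>q\<in>UNIV. christoffel g q m i p * F q p)) a"
proof -
  have d: "(\<lambda>x. parallel_frame g p Q x a $ i) differentiable (at p)" for i
    using smooth_on_differentiable[OF parallel_frame_smooth] by simp
  have "pd m (\<lambda>x. con (parallel_frame g p Q x) (\<lambda>i. F i x) a) p
    = (\<Sum>i\<in>UNIV. pd m (\<lambda>x. parallel_frame g p Q x a $ i) p * F i p + Q a $ i * pd m (F i) p)"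
    unfolding con_def by (subst pd_sum_mult) (auto simp: d assms)
  also have "\<dots> = con Q (\<lambda>i. pd m (F i) p) a - (\<Sum>i\<in>UNIV. \<Sum>n\<in>UNIV. christoffel g i m n p * Q a $ n * F i p)"
    by (simp add: pd_parallel_frame con_def sum.distrib sum_negf sum_distrib_right sum_subtractf)
  also have "(\<Sum>i\<in>UNIV. \<Sum>n\<in>UNIV. christoffel g i m n p * Q a $ n * F i p)
     = con Q (\<lambda>i. \<Sum>q\<in>UNIV. christoffel g q m i p * F q p) a"
    unfolding con_def sum_distrib_left by (subst sum.swap) (simp add: mult_ac)
  finally show ?thesis by (simp add: con_diff)
qed

lemma con_parallel_frame_differentiable:
  assumes "\<And>i. F i differentiable (at p)"
  shows "(\<lambda>x. con (parallel_frame g p Q x) (\<lambda>i. F i x) a) differentiable (at p)"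
  unfolding con_def using smooth_on_differentiable[OF parallel_frame_smooth, of p] assms
  by (intro differentiable_sum differentiable_mult ballI) auto

lemma pd_con2_parallel_frame:
  assumes "\<And>i j. T i j differentiable (at p)"
  shows "pd m (\<lambda>x. con2 (parallel_frame g p Q x) (\<lambda>i j. T i j x) a b) p = con2 Q (\<lambda>i j. cov2 g T m i j p) a b"
proof -
  have "pd m (\<lambda>x. con2 (parallel_frame g p Q x) (\<lambda>i j. T i j x) a b) p
    = con Q (\<lambda>i. con Q (\<lambda>j. pd m (T i j) p - (\<Sum>q\<in>UNIV. christoffel g q m j p * T i q p)) b
        - (\<Sum>q\<in>UNIV. christoffel g q m i p * con Q (\<lambda>j. T q j p) b)) a"
    unfolding con2_def
    by (subst pd_con_parallel_frame) (auto intro!: con_parallel_frame_differentiable assms simp: pd_con_parallel_frame[OF assms])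
  then show ?thesis
    unfolding con2_def cov2_def by (simp add: con_simps con_sum algebra_simps)
qed

lemma con2_parallel_frame_differentiable:
  assumes "\<And>i j. T i j differentiable (at p)"
  shows "(\<lambda>x. con2 (parallel_frame g p Q x) (\<lambda>i j. T i j x) a b) differentiable (at p)"
  unfolding con2_def by (intro con_parallel_frame_differentiable assms)

lemma pd_con4_parallel_frame:
  assumes "\<And>i j k l. T i j k l differentiable (at p)"
  shows "pd m (\<lambda>x. con4 (parallel_frame g p Q x) (\<lambda>i j k l. T i j k l x) a b c d) p
    = con4 Q (\<lambda>i j k l. cov4 g T m i j k l p) a b c d"
proof -
  have "pd m (\<lambda>x. con4 (parallel_frame g p Q x) (\<lambda>i j k l. T i j k l x) a b c d) p
    = con2 Q (\<lambda>i j. cov2 g (\<lambda>i j x. con2 (parallel_frame g p Q x) (\<lambda>k l. T i j k l x) c d) m i j p) a b"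
    unfolding con4_def by (rule pd_con2_parallel_frame) (intro con2_parallel_frame_differentiable assms)
  then show ?thesis
    unfolding con4_def cov2_def pd_con2_parallel_frame[OF assms] parallel_frame_at
    unfolding con2_def cov2_def cov4_def by (simp add: con_simps con_sum algebra_simps)
qed

section \<open>Self-duality in a frame that is orthonormal and parallel at a point\<close>

lemma det_4:
  "det (A::real^4^4) =
    A$1$1 * (A$2$2 * (A$3$3 * A$4$4 - A$3$4 * A$4$3) - A$2$3 * (A$3$2 * A$4$4 - A$3$4 * A$4$2) + A$2$4 * (A$3$2 * A$4$3 - A$3$3 * A$4$2))
  - A$1$2 * (A$2$1 * (A$3$3 * A$4$4 - A$3$4 * A$4$3) - A$2$3 * (A$3$1 * A$4$4 - A$3$4 * A$4$1) + A$2$4 * (A$3$1 * A$4$3 - A$3$3 * A$4$1))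
  + A$1$3 * (A$2$1 * (A$3$2 * A$4$4 - A$3$4 * A$4$2) - A$2$2 * (A$3$1 * A$4$4 - A$3$4 * A$4$1) + A$2$4 * (A$3$1 * A$4$2 - A$3$2 * A$4$1))
  - A$1$4 * (A$2$1 * (A$3$2 * A$4$3 - A$3$3 * A$4$2) - A$2$2 * (A$3$1 * A$4$3 - A$3$3 * A$4$1) + A$2$3 * (A$3$1 * A$4$2 - A$3$2 * A$4$1))"
proof -
  have f1: "finite {2::4, 3, 4}" "1 \<notin> {2::4, 3, 4}" by auto
  have f2: "finite {3::4, 4}" "2 \<notin> {3::4, 4}" by auto
  have f3: "finite {4::4}" "3 \<notin> {4::4}" by auto
  show ?thesis
    unfolding det_def UNIV_4
    unfolding sum_over_permutations_insert[OF f1]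
    unfolding sum_over_permutations_insert[OF f2]
    unfolding sum_over_permutations_insert[OF f3]
    unfolding permutes_sing
    by (simp add: sign_swap_id permutation_swap_id sign_compose permutation_compose sign_id swap_id_eq algebra_simps)
qed

text \<open>Twice the Schouten tensor in dimension four.\<close>

definition sch :: "4 metric \<Rightarrow> 4 \<Rightarrow> 4 \<Rightarrow> real^4 \<Rightarrow> real" where
  "sch g i j x = ricci g i j x - scal g x / 6 * g x $ i $ j"

lemma weyl_sch:
  "weyl g i j k l x = riem g i j k l x
    - (1/2) * (sch g j k x * g x $ i $ l - sch g i k x * g x $ j $ l + g x $ j $ k * sch g i l x - g x $ i $ k * sch g j l x)"
  unfolding weyl_def sch_def by (simp add: field_simps)

text \<open>The inner products of an orthonormal frame of signature (2,2).\<close>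

definition eta :: "4 \<Rightarrow> 4 \<Rightarrow> real" where
  "eta a b = (if a = b then if a = 1 \<or> a = 2 then -1 else 1 else 0)"

text \<open>The eigenvalue equation of the Hodge star on the components of a 2-form in an orthonormal frame;
  the sign \<open>s\<close> combines the eigenvalue with the orientation of the frame.\<close>

definition selfdual :: "real \<Rightarrow> (4 \<Rightarrow> 4 \<Rightarrow> real) \<Rightarrow> bool" where
  "selfdual s V \<longleftrightarrow> V 1 2 = s * V 3 4 \<and> V 1 3 = s * V 2 4 \<and> V 1 4 = - s * V 2 3"

definition eps :: "4 \<Rightarrow> 4 \<Rightarrow> 4 \<Rightarrow> 4 \<Rightarrow> real" where
  "eps a b c d = det (vector [axis a 1, axis b 1, axis c 1, axis d 1] :: real^4^4)"

lemma vector_4_nth [simp]: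
  "(vector [a, b, c, d] :: 'a::zero^4) $ 1 = a" "(vector [a, b, c, d] :: 'a^4) $ 2 = b"
  "(vector [a, b, c, d] :: 'a^4) $ 3 = c" "(vector [a, b, c, d] :: 'a^4) $ 4 = d"
  by (simp_all add: vector_def)

lemma sum_swap_pairs:
  "(\<Sum>i\<in>A. \<Sum>j\<in>B. \<Sum>k\<in>C. \<Sum>l\<in>D. f i j k l) = (\<Sum>k\<in>C. \<Sum>l\<in>D. \<Sum>i\<in>A. \<Sum>j\<in>B. f i j k l)"
proof -
  have "(\<Sum>i\<in>A. \<Sum>j\<in>B. \<Sum>k\<in>C. \<Sum>l\<in>D. f i j k l) = (\<Sum>i\<in>A. \<Sum>k\<in>C. \<Sum>j\<in>B. \<Sum>l\<in>D. f i j k l)"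
    by (intro sum.cong refl sum.swap)
  also have "\<dots> = (\<Sum>k\<in>C. \<Sum>i\<in>A. \<Sum>j\<in>B. \<Sum>l\<in>D. f i j k l)" by (rule sum.swap)
  also have "\<dots> = (\<Sum>k\<in>C. \<Sum>i\<in>A. \<Sum>l\<in>D. \<Sum>j\<in>B. f i j k l)" by (intro sum.cong refl sum.swap)
  also have "\<dots> = (\<Sum>k\<in>C. \<Sum>l\<in>D. \<Sum>i\<in>A. \<Sum>j\<in>B. f i j k l)" by (intro sum.cong refl sum.swap)
  finally show ?thesis .
qed

lemma det_vector_expand:
  fixes a b c v :: "real^4"
  shows "(\<Sum>j\<in>UNIV. v $ j * det (vector [a, b, c, axis j 1] :: real^4^4)) = det (vector [a, b, c, v] :: real^4^4)"
    "(\<Sum>j\<in>UNIV. v $ j * det (vector [a, b, axis j 1, c] :: real^4^4)) = det (vector [a, b, v, c] :: real^4^4)"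
    "(\<Sum>j\<in>UNIV. v $ j * det (vector [a, axis j 1, b, c] :: real^4^4)) = det (vector [a, v, b, c] :: real^4^4)"
    "(\<Sum>j\<in>UNIV. v $ j * det (vector [axis j 1, a, b, c] :: real^4^4)) = det (vector [v, a, b, c] :: real^4^4)"
  unfolding det_4 sum_4 by (simp_all add: axis_def algebra_simps)

lemma det_frame_vectors:
  fixes Y :: "4 \<Rightarrow> real^4"
  shows "det (vector [Y a, Y b, Y c, Y d] :: real^4^4) = eps a b c d * det (\<chi> k a. Y a $ k)"
proof -
  have "(vector [Y a, Y b, Y c, Y d] :: real^4^4)
     = vector [axis a 1, axis b 1, axis c 1, axis d 1] ** transpose (\<chi> k a. Y a $ k)"
    by (simp add: vec_eq_iff forall_4 matrix_matrix_mult_def transpose_def axis_def if_distrib if_distribR cong: if_cong)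
  then show ?thesis by (simp add: eps_def det_mul)
qed

lemma pd_zero_matrix_inv:
  fixes G :: "real^'m \<Rightarrow> real^'n^'n"
  assumes T: "open T" "p \<in> T" and sm: "\<And>i j. smooth_on T (\<lambda>x. G x $ i $ j)"
    and inv: "\<And>x. x \<in> T \<Longrightarrow> invertible (G x)" and z: "\<And>i j. pd m (\<lambda>x. G x $ i $ j) p = 0"
  shows "pd m (\<lambda>x. matrix_inv (G x) $ i $ j) p = 0"
proof -
  have sH: "smooth_on T (\<lambda>x. matrix_inv (G x) $ i $ j)" for i j
    by (rule smooth_on_matrix_inv[OF T(1) sm inv])
  note d = smooth_on_differentiable[OF _ T(2)]
  have GH: "(\<Sum>k\<in>UNIV. G x $ a $ k * matrix_inv (G x) $ k $ b) = (if a = b then 1 else 0)" if "x \<in> T" for a b x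
    using matrix_inv_right[OF inv[OF that]] by (simp add: matrix_matrix_mult_def mat_def vec_eq_iff)
  have HG: "(\<Sum>k\<in>UNIV. matrix_inv (G p) $ a $ k * G p $ k $ b) = (if a = b then 1 else 0)" for a b
    using matrix_inv_left[OF inv[OF T(2)]] by (simp add: matrix_matrix_mult_def mat_def vec_eq_iff)
  have 0: "(\<Sum>k\<in>UNIV. G p $ a $ k * pd m (\<lambda>x. matrix_inv (G x) $ k $ j) p) = 0" for a
  proof -
    have "pd m (\<lambda>x. \<Sum>k\<in>UNIV. G x $ a $ k * matrix_inv (G x) $ k $ j) p = pd m (\<lambda>x. if a = j then 1 else 0) p"
      by (rule pd_transform[OF T]) (simp add: GH)
    then show ?thesis by (subst (asm) pd_sum_mult) (auto intro!: d sm sH simp: z)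
  qed
  have "0 = (\<Sum>a\<in>UNIV. matrix_inv (G p) $ i $ a * (\<Sum>k\<in>UNIV. G p $ a $ k * pd m (\<lambda>x. matrix_inv (G x) $ k $ j) p))"
    by (simp add: 0)
  also have "\<dots> = (\<Sum>k\<in>UNIV. (\<Sum>a\<in>UNIV. matrix_inv (G p) $ i $ a * G p $ a $ k) * pd m (\<lambda>x. matrix_inv (G x) $ k $ j) p)"
    unfolding sum_distrib_left sum_distrib_right by (subst sum.swap) (simp add: mult_ac)
  also have "\<dots> = pd m (\<lambda>x. matrix_inv (G x) $ i $ j) p"
    by (simp add: HG if_distrib if_distribR cong: if_cong)
  finally show ?thesis by simp
qed

lemma pd_zero_det:
  fixes G :: "real^'m \<Rightarrow> real^'n^'n"
  assumes T: "open T" "p \<in> T" and sm: "\<And>i j. smooth_on T (\<lambda>x. G x $ i $ j)"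
    and z: "\<And>i j. pd m (\<lambda>x. G x $ i $ j) p = 0"
  shows "pd m (\<lambda>x. det (G x)) p = 0"
proof -
  have pr: "pd m (\<lambda>x. \<Prod>i\<in>I. G x $ i $ \<pi> i) p = 0" for I and \<pi> :: "'n \<Rightarrow> 'n"
  proof (induction I rule: infinite_finite_induct)
    case (insert a I)
    then show ?case
      by (simp, subst pd_mult)
         (auto intro!: smooth_on_differentiable[OF _ T(2)] smooth_on_prod T sm simp: z)
  qed auto
  show ?thesis unfolding det_def
    by (subst pd_sum) (auto intro!: smooth_on_differentiable[OF _ T(2)] smooth_intros T sm sum.neutral simp: pd_cmult pr
        pd_cmult[OF smooth_on_differentiable[OF smooth_on_prod[OF T(1)] T(2)], OF sm])
qed

context
  fixes S :: "(real^4) set" and g :: "4 metric"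
  assumes met: "metric_on S g"
begin

lemma sch_smooth: "smooth_on S (sch g i j)"
  unfolding sch_def[abs_def] by (intro lc_smooth[OF met] metric_open[OF met]; simp)

lemma sch_sym: "x \<in> S \<Longrightarrow> sch g i j x = sch g j i x"
  unfolding sch_def using ricci_sym[OF met] metric_sym[OF met] by simp

lemma weyl_smooth: "smooth_on S (weyl g i j k l)"
proof -
  have "weyl g i j k l = (\<lambda>x. riem g i j k l x
    - (1/2) * (sch g j k x * g x $ i $ l - sch g i k x * g x $ j $ l + g x $ j $ k * sch g i l x - g x $ i $ k * sch g j l x))"
    by (intro ext weyl_sch)
  then show ?thesis by (simp only:) (intro lc_smooth[OF met] sch_smooth)
qed

lemma weyl_antisym34: "x \<in> S \<Longrightarrow> weyl g i j k l x = - weyl g i j l k x"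
  unfolding weyl_sch using riem_antisym34[OF met, of x i j k l] by (simp add: field_simps)

lemma weyl_pair_sym:
  assumes x: "x \<in> S" shows "weyl g i j k l x = weyl g k l i j x"
  unfolding weyl_sch riem_pair_sym[OF met x, of i j k l] sch_sym[OF x, of l i] sch_sym[OF x, of k i]
    sch_sym[OF x, of k j] sch_sym[OF x, of l j] metric_sym[OF met x, of k j] metric_sym[OF met x, of l j]
    metric_sym[OF met x, of l i] metric_sym[OF met x, of k i]
  by (simp add: algebra_simps)

text \<open>The duality of the Weyl operator is evaluated on the 2-form whose raised components in the frame
  \<open>Y\<close> are \<open>N\<close>. Here \<open>H\<close> is the inverse Gram matrix of the frame and \<open>Vol\<close> lists the components of
  the Hodge dual, so that \<open>H ** Vol ** transpose H\<close> are its raised components. The frame is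
  arbitrary, because the relation will be differentiated in a moving frame.\<close>

lemma weyl_hodge_frame:
  fixes Y :: "4 \<Rightarrow> real^4" and N :: "real^4^4"
  assumes x: "x \<in> S" and dg: "det (g x) > 0" and dY: "det (\<chi> k a. Y a $ k :: real^4^4) \<noteq> 0"
    and sd: "\<And>w. is_2form w \<Longrightarrow> weyl_op g x w = \<sigma> *\<^sub>R weyl_op g x (hodge g x w)"
    and N: "transpose N = - N"
  defines "Ym \<equiv> (\<chi> k a. Y a $ k) :: real^4^4"
  defines "H \<equiv> matrix_inv (transpose Ym ** g x ** Ym)"
  defines "Vol \<equiv> (\<chi> e f. 1/2 * (\<Sum>a\<in>UNIV. \<Sum>b\<in>UNIV. N $ a $ b * (sqrt (det (g x)) * det Ym * eps a b e f))) :: real^4^4"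
  shows "(\<Sum>c\<in>UNIV. \<Sum>d\<in>UNIV. N $ c $ d * con4 Y (\<lambda>i j k l. weyl g i j k l x) a b d c)
    = \<sigma> * (\<Sum>c\<in>UNIV. \<Sum>d\<in>UNIV. (H ** Vol ** transpose H) $ c $ d * con4 Y (\<lambda>i j k l. weyl g i j k l x) a b d c)"
proof -
  let ?g = "g x" and ?gi = "matrix_inv (g x)"
  have gt: "transpose ?g = ?g" and ig: "invertible ?g" using met x by (auto simp: metric_on_def)
  have git: "transpose ?gi = ?gi" using matrix_inv_transpose[OF ig] gt by simp
  have iY: "invertible Ym" using dY by (simp add: Ym_def invertible_det_nz)
  let ?Yi = "matrix_inv Ym"
  have YY: "Ym ** ?Yi = mat 1" "?Yi ** Ym = mat 1" using matrix_inv_right[OF iY] matrix_inv_left[OF iY] .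
  then have YYt: "transpose ?Yi ** transpose Ym = mat 1" "transpose Ym ** transpose ?Yi = mat 1"
    by (metis matrix_transpose_mul transpose_mat)+
  have H: "H = ?Yi ** ?gi ** transpose ?Yi"
  proof -
    have "(transpose Ym ** ?g ** Ym) ** (?Yi ** ?gi ** transpose ?Yi) = transpose Ym ** (?g ** (Ym ** ?Yi) ** ?gi) ** transpose ?Yi"
      by (simp only: matrix_mul_assoc)
    also have "\<dots> = mat 1" using matrix_inv_right[OF ig] by (simp add: YY YYt)
    finally show ?thesis unfolding H_def by (rule matrix_inv_unique_left)
  qed
  define w where "w = ?g ** (Ym ** N ** transpose Ym) ** ?g"
  have "transpose w = ?g ** (Ym ** transpose N ** transpose Ym) ** ?g"
    unfolding w_def by (simp add: matrix_transpose_mul gt matrix_mul_assoc)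
  also have "\<dots> = - w" unfolding w_def N by (simp add: vec_eq_iff matrix_matrix_mult_def sum_negf)
  finally have w2: "is_2form w" by (simp add: is_2form_def)
  have r1: "raise2 g x w = Ym ** N ** transpose Ym"
  proof -
    have "raise2 g x w = (?gi ** ?g) ** (Ym ** N ** transpose Ym) ** (?g ** ?gi)"
      unfolding raise2_def w_def git by (simp only: matrix_mul_assoc)
    then show ?thesis using matrix_inv_right[OF ig] matrix_inv_left[OF ig] by simp
  qed
  note expand = triple_product_entry
  have vol: "transpose Ym ** hodge g x w ** Ym = Vol"
  proof -
    have "(transpose Ym ** hodge g x w ** transpose (transpose Ym)) $ e $ f = Vol $ e $ f" for e f
    proof -
      have "(transpose Ym ** hodge g x w ** transpose (transpose Ym)) $ e $ f
        = (\<Sum>i\<in>UNIV. \<Sum>j\<in>UNIV. Y e $ i * (1/2 * (\<Sum>k\<in>UNIV. \<Sum>l\<in>UNIV. (\<Sum>a\<in>UNIV. \<Sum>b\<in>UNIV. Y a $ k * N $ a $ b * Y b $ l) * vol_form g x k l i j)) * Y f $ j)"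
        unfolding expand hodge_def r1 by (simp add: transpose_def Ym_def)
      also have "\<dots> = 1/2 * (\<Sum>a\<in>UNIV. \<Sum>b\<in>UNIV. N $ a $ b * (sqrt (det ?g) *
          (\<Sum>k\<in>UNIV. Y a $ k * (\<Sum>l\<in>UNIV. Y b $ l * (\<Sum>i\<in>UNIV. Y e $ i * (\<Sum>j\<in>UNIV. Y f $ j *
             det (vector [axis k 1, axis l 1, axis i 1, axis j 1] :: real^4^4)))))))"
      proof -
        let ?T = "\<lambda>k l i j. det (vector [axis k 1, axis l 1, axis i 1, axis j 1] :: real^4^4)"
        let ?f = "\<lambda>i j k l a b. Y e $ i * Y f $ j * Y a $ k * N $ a $ b * Y b $ l * (sqrt (det ?g) * ?T k l i j)"
        have "(\<Sum>i\<in>UNIV. \<Sum>j\<in>UNIV. Y e $ i * (1/2 * (\<Sum>k\<in>UNIV. \<Sum>l\<in>UNIV. (\<Sum>a\<in>UNIV. \<Sum>b\<in>UNIV. Y a $ k * N $ a $ b * Y b $ l) * vol_form g x k l i j)) * Y f $ j)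
          = 1/2 * (\<Sum>i\<in>UNIV. \<Sum>j\<in>UNIV. \<Sum>k\<in>UNIV. \<Sum>l\<in>UNIV. \<Sum>a\<in>UNIV. \<Sum>b\<in>UNIV. ?f i j k l a b)"
          unfolding vol_form_def using dg
          by (simp only: sum_distrib_left sum_distrib_right abs_of_pos) (simp add: mult_ac)
        also have "(\<Sum>i\<in>UNIV. \<Sum>j\<in>UNIV. \<Sum>k\<in>UNIV. \<Sum>l\<in>UNIV. \<Sum>a\<in>UNIV. \<Sum>b\<in>UNIV. ?f i j k l a b)
          = (\<Sum>k\<in>UNIV. \<Sum>l\<in>UNIV. \<Sum>i\<in>UNIV. \<Sum>j\<in>UNIV. \<Sum>a\<in>UNIV. \<Sum>b\<in>UNIV. ?f i j k l a b)"
          by (rule sum_swap_pairs)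
        also have "\<dots> = (\<Sum>k\<in>UNIV. \<Sum>l\<in>UNIV. \<Sum>a\<in>UNIV. \<Sum>b\<in>UNIV. \<Sum>i\<in>UNIV. \<Sum>j\<in>UNIV. ?f i j k l a b)"
          by (intro sum.cong refl sum_swap_pairs)
        also have "\<dots> = (\<Sum>a\<in>UNIV. \<Sum>b\<in>UNIV. \<Sum>k\<in>UNIV. \<Sum>l\<in>UNIV. \<Sum>i\<in>UNIV. \<Sum>j\<in>UNIV. ?f i j k l a b)"
          by (rule sum_swap_pairs)
        finally show ?thesis
          by (simp only: sum_distrib_left) (simp add: mult_ac)
      qed
      also have "\<dots> = Vol $ e $ f"
        unfolding det_vector_expand det_frame_vectors Vol_def Ym_def by (simp add: mult_ac)
      finally show ?thesis .
    qed
    then show ?thesis by (simp add: vec_eq_iff)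
  qed
  have r2: "raise2 g x (hodge g x w) = Ym ** (H ** Vol ** transpose H) ** transpose Ym"
  proof -
    have "Ym ** (H ** Vol ** transpose H) ** transpose Ym
      = (Ym ** ?Yi) ** ?gi ** (transpose ?Yi ** transpose Ym) ** hodge g x w ** (Ym ** ?Yi) ** ?gi ** (transpose ?Yi ** transpose Ym)"
      unfolding H vol[symmetric] matrix_transpose_mul git transpose_transpose by (simp only: matrix_mul_assoc)
    then show ?thesis unfolding raise2_def git YY YYt by simp
  qed
  have op: "weyl_op g x v $ i $ j = 1/2 * (\<Sum>c\<in>UNIV. \<Sum>d\<in>UNIV. B $ c $ d * con2 Y (\<lambda>k l. weyl g i j k l x) d c)"
    if "raise2 g x v = Ym ** B ** transpose Ym" for v B i j
  proof -
    have "(\<Sum>k\<in>UNIV. \<Sum>l\<in>UNIV. weyl g i j l k x * raise2 g x v $ k $ l)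
      = (\<Sum>c\<in>UNIV. \<Sum>d\<in>UNIV. B $ c $ d * con2 Y (\<lambda>k l. weyl g i j k l x) d c)"
      unfolding that expand con2_def con_def Ym_def sum_4 by (simp add: algebra_simps)
    then show ?thesis by (simp add: weyl_op_def)
  qed
  have base: "(\<Sum>c\<in>UNIV. \<Sum>d\<in>UNIV. N $ c $ d * con2 Y (\<lambda>k l. weyl g i j k l x) d c)
    = \<sigma> * (\<Sum>c\<in>UNIV. \<Sum>d\<in>UNIV. (H ** Vol ** transpose H) $ c $ d * con2 Y (\<lambda>k l. weyl g i j k l x) d c)" for i j
  proof -
    have "weyl_op g x w $ i $ j = \<sigma> * weyl_op g x (hodge g x w) $ i $ j" using sd[OF w2] by simp
    then show ?thesis unfolding op[OF r1] op[OF r2] by simp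
  qed
  have c4: "(\<Sum>c\<in>UNIV. \<Sum>d\<in>UNIV. B $ c $ d * con4 Y (\<lambda>i j k l. weyl g i j k l x) a b d c)
     = con2 Y (\<lambda>i j. \<Sum>c\<in>UNIV. \<Sum>d\<in>UNIV. B $ c $ d * con2 Y (\<lambda>k l. weyl g i j k l x) d c) a b" for B :: "real^4^4"
    unfolding con4_def con2_def by (simp add: con_sum con_cmult)
  show ?thesis unfolding c4 base by (simp add: con2_def con_cmult)
qed

end

lemma eps_values:
  "eps 1 2 e f = (if e = 3 \<and> f = 4 then 1 else if e = 4 \<and> f = 3 then -1 else 0)"
  "eps 1 3 e f = (if e = 2 \<and> f = 4 then -1 else if e = 4 \<and> f = 2 then 1 else 0)"
  "eps 1 4 e f = (if e = 2 \<and> f = 3 then 1 else if e = 3 \<and> f = 2 then -1 else 0)"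
proof -
  have "\<forall>e f. eps 1 2 e f = (if e = 3 \<and> f = 4 then 1 else if e = 4 \<and> f = 3 then -1 else 0)"
    by (simp add: forall_4 eps_def det_4 axis_def)
  then show "eps 1 2 e f = (if e = 3 \<and> f = 4 then 1 else if e = 4 \<and> f = 3 then -1 else 0)" by blast
  have "\<forall>e f. eps 1 3 e f = (if e = 2 \<and> f = 4 then -1 else if e = 4 \<and> f = 2 then 1 else 0)"
    by (simp add: forall_4 eps_def det_4 axis_def)
  then show "eps 1 3 e f = (if e = 2 \<and> f = 4 then -1 else if e = 4 \<and> f = 2 then 1 else 0)" by blast
  have "\<forall>e f. eps 1 4 e f = (if e = 2 \<and> f = 3 then 1 else if e = 3 \<and> f = 2 then -1 else 0)"
    by (simp add: forall_4 eps_def det_4 axis_def)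
  then show "eps 1 4 e f = (if e = 2 \<and> f = 3 then 1 else if e = 3 \<and> f = 2 then -1 else 0)" by blast
qed

lemma eps_antisym: "eps b a e f = - eps a b e f"
  unfolding eps_def det_4 by (simp add: algebra_simps)

lemma eta_conjugate:
  "((\<chi> a b. eta a b) ** B ** transpose (\<chi> a b. eta a b)) $ c $ d = eta c c * eta d d * B $ c $ d"
proof -
  have "\<forall>c d. ((\<chi> a b. eta a b) ** B ** transpose (\<chi> a b. eta a b)) $ c $ d = eta c c * eta d d * B $ c $ d"
    by (simp add: forall_4 matrix_matrix_mult_def transpose_def sum_4 eta_def)
  then show ?thesis by blast
qed

text \<open>It suffices to test the relation on the three bivectors that contain the first frame vector; the
  duals of these are the other three.\<close>

lemma selfdual_of_hodge_relation:
  fixes U :: "4 \<Rightarrow> 4 \<Rightarrow> real"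
  assumes U: "\<And>c d. U c d = - U d c"
    and rel: "\<And>N :: real^4^4. transpose N = - N \<Longrightarrow>
      (\<Sum>c\<in>UNIV. \<Sum>d\<in>UNIV. N $ c $ d * U d c) = \<sigma> * (\<Sum>c\<in>UNIV. \<Sum>d\<in>UNIV.
        ((\<chi> a b. eta a b) ** (\<chi> e f. 1/2 * (\<Sum>a\<in>UNIV. \<Sum>b\<in>UNIV. N $ a $ b * (q * eps a b e f)))
          ** transpose (\<chi> a b. eta a b)) $ c $ d * U d c)"
  shows "selfdual (\<sigma> * q) U"
proof -
  define N where "N u v = ((\<chi> a b. if a = u \<and> b = v then 1 else if a = v \<and> b = u then -1 else 0) :: real^4^4)" for u v :: 4
  have N: "transpose (N u v) = - N u v" if "u \<noteq> v" for u v
    using that by (auto simp: N_def transpose_def vec_eq_iff)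
  have S: "(\<Sum>a\<in>UNIV. \<Sum>b\<in>UNIV. N 1 2 $ a $ b * F a b) = F 1 2 - F 2 1"
    "(\<Sum>a\<in>UNIV. \<Sum>b\<in>UNIV. N 1 3 $ a $ b * F a b) = F 1 3 - F 3 1"
    "(\<Sum>a\<in>UNIV. \<Sum>b\<in>UNIV. N 1 4 $ a $ b * F a b) = F 1 4 - F 4 1" for F :: "4 \<Rightarrow> 4 \<Rightarrow> real"
    by (simp_all add: N_def sum_4)
  have R12: "U 2 1 - U 1 2 = \<sigma> * (q * (U 4 3 - U 3 4))"
    using rel[OF N[of 1 2]] unfolding eta_conjugate S vec_lambda_beta eps_antisym[of 2 1] eps_values
    by (simp add: sum_4 eta_def algebra_simps)
  have R13: "U 3 1 - U 1 3 = \<sigma> * (q * (U 4 2 - U 2 4))"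
    using rel[OF N[of 1 3]] unfolding eta_conjugate S vec_lambda_beta eps_antisym[of 3 1] eps_values
    by (simp add: sum_4 eta_def algebra_simps)
  have R14: "U 4 1 - U 1 4 = - (\<sigma> * (q * (U 3 2 - U 2 3)))"
    using rel[OF N[of 1 4]] unfolding eta_conjugate S vec_lambda_beta eps_antisym[of 4 1] eps_values
    by (simp add: sum_4 eta_def algebra_simps)
  have "U 1 2 = \<sigma> * q * U 3 4" using R12 U[of 2 1] U[of 4 3] by algebra
  moreover have "U 1 3 = \<sigma> * q * U 2 4" using R13 U[of 3 1] U[of 4 2] by algebra
  moreover have "U 1 4 = - (\<sigma> * q) * U 2 3" using R14 U[of 4 1] U[of 3 2] by algebra
  ultimately show ?thesis unfolding selfdual_def by blast
qed

context
  fixes S :: "(real^4) set" and g :: "4 metric"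
  assumes met: "metric_on S g"
begin

lemma frame_gram:
  "(transpose (\<chi> k a. Y a $ k) ** g x ** (\<chi> k a. Y a $ k)) $ a $ b = con2 Y (\<lambda>i j. g x $ i $ j) a b"
  unfolding con2_def con_def matrix_matrix_mult_def transpose_def
  by (simp add: sum_distrib_left sum_distrib_right mult_ac) (rule sum.swap)

text \<open>In a frame that is parallel at \<open>p\<close> the Gram matrix, hence the matrix of the Hodge star,
  is stationary at \<open>p\<close>. So the covariant derivative of the Weyl tensor satisfies at \<open>p\<close> the
  same duality relation as the Weyl tensor.\<close>

lemma weyl_selfdual_at:
  assumes p: "p \<in> S" and dg: "\<And>x. x \<in> S \<Longrightarrow> det (g x) > 0"
    and sd: "\<And>x w. x \<in> S \<Longrightarrow> is_2form w \<Longrightarrow> weyl_op g x w = \<sigma> *\<^sub>R weyl_op g x (hodge g x w)"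
    and Q: "\<And>a b. con2 Q (\<lambda>i j. g p $ i $ j) a b = eta a b"
  obtains q where "q = 1 \<or> q = -1"
    "\<And>a b. selfdual (\<sigma> * q) (con4 Q (\<lambda>i j k l. weyl g i j k l p) a b)"
    "\<And>m a b. selfdual (\<sigma> * q) (con4 Q (\<lambda>i j k l. cov4 g (weyl g) m i j k l p) a b)"
proof -
  define Y where "Y = parallel_frame g p Q"
  define Ym where "Ym x = ((\<chi> k a. Y x a $ k) :: real^4^4)" for x
  define G where "G x = transpose (Ym x) ** g x ** Ym x" for x
  define T where "T = {x\<in>S. det (Ym x) \<noteq> 0}"
  \<comment> \<open>the volume of the frame; its square is the Gram determinant and therefore stationary at \<open>p\<close>\<close>
  define qq where "qq x = sqrt (det (g x)) * det (Ym x)" for x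
  have Yp: "Y p = Q" by (simp add: Y_def)
  have Gc: "G x $ a $ b = con2 (Y x) (\<lambda>i j. g x $ i $ j) a b" for x a b
    unfolding G_def Ym_def by (rule frame_gram)
  have Gp: "G p = (\<chi> a b. eta a b)" by (simp add: vec_eq_iff Gc Yp Q)
  have dGp: "det (G p) = 1" unfolding Gp det_4 by (simp add: eta_def)
  have dG: "det (G x) = det (g x) * (det (Ym x))\<^sup>2" for x
    unfolding G_def by (simp add: det_mul power2_eq_square)
  have Y0: "smooth_on S (\<lambda>x. Y x a $ k)" for a k
    unfolding Y_def by (rule smooth_on_subset[OF parallel_frame_smooth]) simp
  have Ym0: "smooth_on S (\<lambda>x. Ym x $ k $ a)" for a k
    unfolding Ym_def using Y0 by simp
  have oT: "open T"
  proof -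
    have "continuous_on S (\<lambda>x. det (Ym x))"
      by (rule smooth_on_continuous[OF smooth_on_det[OF metric_open[OF met] Ym0]])
    from continuous_open_preimage[OF this metric_open[OF met], of "- {0}"]
    show ?thesis by (simp add: T_def vimage_def Int_def open_Compl)
  qed
  have TS: "T \<subseteq> S" by (auto simp: T_def)
  have pT: "p \<in> T" using p dG[of p] dGp by (auto simp: T_def)
  have sub: "smooth_on T F" if "smooth_on S F" for F :: "real^4 \<Rightarrow> real"
    using smooth_on_subset[OF that TS] .
  have GsmS: "smooth_on S (\<lambda>x. G x $ a $ b)" for a b
    unfolding Gc con2_def con_def by (intro smooth_intros metric_open[OF met] metric_smooth[OF met] Y0)
  note Gsm = sub[OF GsmS]
  have Ginv: "invertible (G x)" if "x \<in> T" for x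
    using that dG[of x] dg[of x] unfolding invertible_det_nz T_def by auto
  note d = smooth_on_differentiable[OF _ pT]
  have Gz: "pd m (\<lambda>x. G x $ a $ b) p = 0" for m a b
    unfolding Gc Y_def
    by (subst pd_con2_parallel_frame)
       (auto intro!: smooth_on_differentiable[OF metric_smooth[OF met] p] simp: cov2_metric[OF met p] con2_def con_zero)
  have Hsm: "smooth_on T (\<lambda>x. matrix_inv (G x) $ i $ j)" for i j
    by (rule smooth_on_matrix_inv[OF oT Gsm Ginv])
  have Hz: "pd m (\<lambda>x. matrix_inv (G x) $ i $ j) p = 0" for m i j
    by (rule pd_zero_matrix_inv[OF oT pT Gsm Ginv Gz])
  have Hp: "matrix_inv (G p) = (\<chi> a b. eta a b)"
    by (rule matrix_inv_unique_left) (simp add: Gp vec_eq_iff matrix_matrix_mult_def mat_def forall_4 sum_4 eta_def)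
  have qsm: "smooth_on T qq"
    unfolding qq_def[abs_def] using dg TS
    by (intro smooth_intros oT sub[OF metric_smooth[OF met]] sub[OF Ym0]) auto
  have q2: "(qq x)\<^sup>2 = det (G x)" if "x \<in> T" for x
    using dg[of x] that TS by (auto simp: qq_def dG power_mult_distrib)
  have q1: "qq p = 1 \<or> qq p = -1" using q2[OF pT] dGp by (simp add: power2_eq_1_iff)
  have qz: "pd m qq p = 0" for m
  proof -
    have "pd m (\<lambda>x. qq x * qq x) p = pd m (\<lambda>x. det (G x)) p"
      by (rule pd_transform[OF oT pT]) (simp add: q2[symmetric] power2_eq_square)
    also have "\<dots> = 0" by (rule pd_zero_det[OF oT pT Gsm Gz])
    finally have "2 * qq p * pd m qq p = 0" by (simp add: pd_mult d[OF qsm] mult.commute disj_commute)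
    then show ?thesis using q1 by auto
  qed
  define Vol where "Vol N x = ((\<chi> e f. 1/2 * (\<Sum>a\<in>UNIV. \<Sum>b\<in>UNIV. N $ a $ b * (qq x * eps a b e f))) :: real^4^4)" for N :: "real^4^4" and x
  define M where "M N x = matrix_inv (G x) ** Vol N x ** transpose (matrix_inv (G x))" for N x
  define V where "V a b c d x = con4 (Y x) (\<lambda>i j k l. weyl g i j k l x) a b c d" for a b c d x
  have Vsm: "smooth_on T (V a b c d)" for a b c d
    unfolding V_def[abs_def] con4_def con2_def con_def
    by (intro sub smooth_intros metric_open[OF met] weyl_smooth[OF met] Y0)
  have Volsm: "smooth_on T (\<lambda>x. Vol N x $ e $ f)" for N e f
    unfolding Vol_def by simp (intro smooth_intros oT qsm; simp)
  have Volz: "pd m (\<lambda>x. Vol N x $ e $ f) p = 0" for m N e f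
  proof -
    have eq: "(\<lambda>x. Vol N x $ e $ f) = (\<lambda>x. (1/2 * (\<Sum>a\<in>UNIV. \<Sum>b\<in>UNIV. N $ a $ b * eps a b e f)) * qq x)"
      unfolding Vol_def by (simp add: sum_distrib_left sum_distrib_right mult_ac)
    show ?thesis unfolding eq by (subst pd_cmult) (simp_all add: d qsm qz)
  qed
  have Mexp: "M N x $ c $ e = (\<Sum>a\<in>UNIV. \<Sum>b\<in>UNIV. matrix_inv (G x) $ c $ a * Vol N x $ a $ b * matrix_inv (G x) $ e $ b)" for N x c e
    unfolding M_def by (rule triple_product_entry)
  have Msm: "smooth_on T (\<lambda>x. M N x $ c $ e)" for N c e
    unfolding Mexp by (intro smooth_intros oT Hsm Volsm)
  have Mz: "pd m (\<lambda>x. M N x $ c $ e) p = 0" for m N c e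
  proof -
    have "pd m (\<lambda>x. matrix_inv (G x) $ c $ a * Vol N x $ a $ b * matrix_inv (G x) $ e $ b) p = 0" for a b
      by (subst pd_mult, (intro d smooth_intros oT Hsm Volsm)+, subst pd_mult, (intro d smooth_intros oT Hsm Volsm)+)
         (simp add: Hz Volz)
    then have "pd m (\<lambda>x. \<Sum>b\<in>UNIV. matrix_inv (G x) $ c $ a * Vol N x $ a $ b * matrix_inv (G x) $ e $ b) p = 0" for a
      by (subst pd_sum) (auto intro!: d smooth_intros oT Hsm Volsm)
    then show ?thesis unfolding Mexp
      by (subst pd_sum) (auto intro!: d smooth_intros oT Hsm Volsm)
  qed
  have rel: "(\<Sum>c\<in>UNIV. \<Sum>e\<in>UNIV. N $ c $ e * V a b e c x) = \<sigma> * (\<Sum>c\<in>UNIV. \<Sum>e\<in>UNIV. M N x $ c $ e * V a b e c x)"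
    if x: "x \<in> T" and N: "transpose N = - N" for N x a b
    unfolding V_def M_def Vol_def G_def Ym_def qq_def
    by (rule weyl_hodge_frame[OF met _ dg _ sd N]) (use x TS in \<open>auto simp: T_def Ym_def\<close>)
  have Vanti: "V a b c e x = - V a b e c x" if "x \<in> S" for a b c e x
  proof -
    have w: "weyl g i j k l x = - weyl g i j l k x" for i j k l by (rule weyl_antisym34[OF met that])
    show ?thesis unfolding V_def con4_def con2_def
      by (subst con_swap, subst w) (simp add: con_minus)
  qed
  have Vdanti: "pd m (V a b c e) p = - pd m (V a b e c) p" for m a b c e
  proof -
    have "pd m (V a b c e) p = pd m (\<lambda>x. - V a b e c x) p"
      by (rule pd_transform[OF metric_open[OF met] p]) (rule Vanti)
    then show ?thesis by (simp add: pd_minus d Vsm)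
  qed
  have 1: "selfdual (\<sigma> * qq p) (\<lambda>c e. V a b c e p)" for a b
  proof (rule selfdual_of_hodge_relation[OF Vanti[OF p]])
    fix N :: "real^4^4" assume N: "transpose N = - N"
    show "(\<Sum>c\<in>UNIV. \<Sum>d\<in>UNIV. N $ c $ d * V a b d c p) = \<sigma> * (\<Sum>c\<in>UNIV. \<Sum>d\<in>UNIV.
        ((\<chi> a b. eta a b) ** (\<chi> e f. 1/2 * (\<Sum>a\<in>UNIV. \<Sum>b\<in>UNIV. N $ a $ b * (qq p * eps a b e f)))
          ** transpose (\<chi> a b. eta a b)) $ c $ d * V a b d c p)"
      using rel[OF pT N, of a b] unfolding M_def Hp Vol_def .
  qed
  have 2: "selfdual (\<sigma> * qq p) (\<lambda>c e. pd m (V a b c e) p)" for m a b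
  proof (rule selfdual_of_hodge_relation[OF Vdanti])
    fix N :: "real^4^4" assume N: "transpose N = - N"
    have dsum: "pd m (\<lambda>x. \<Sum>c\<in>UNIV. \<Sum>e\<in>UNIV. K c e x * V a b e c x) p = (\<Sum>c\<in>UNIV. \<Sum>e\<in>UNIV. K c e p * pd m (V a b e c) p)"
      if K: "\<And>c e. smooth_on T (K c e)" "\<And>c e. pd m (K c e) p = 0" for K
      by (subst pd_sum, (intro d smooth_intros oT K Vsm), intro sum.cong refl, subst pd_sum_mult)
         (auto intro!: d K Vsm simp: K)
    have "pd m (\<lambda>x. \<Sum>c\<in>UNIV. \<Sum>e\<in>UNIV. N $ c $ e * V a b e c x) p
      = pd m (\<lambda>x. \<sigma> * (\<Sum>c\<in>UNIV. \<Sum>e\<in>UNIV. M N x $ c $ e * V a b e c x)) p"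
      by (rule pd_transform[OF oT pT]) (rule rel[OF _ N])
    also have "\<dots> = \<sigma> * pd m (\<lambda>x. \<Sum>c\<in>UNIV. \<Sum>e\<in>UNIV. M N x $ c $ e * V a b e c x) p"
      by (rule pd_cmult) (intro d smooth_intros oT Msm Vsm)
    finally have "(\<Sum>c\<in>UNIV. \<Sum>e\<in>UNIV. N $ c $ e * pd m (V a b e c) p)
      = \<sigma> * (\<Sum>c\<in>UNIV. \<Sum>e\<in>UNIV. M N p $ c $ e * pd m (V a b e c) p)"
      using dsum[of "\<lambda>c e x. N $ c $ e"] dsum[of "\<lambda>c e x. M N x $ c $ e"] Msm Mz oT
      by (simp add: smooth_on_const)
    then show "(\<Sum>c\<in>UNIV. \<Sum>d\<in>UNIV. N $ c $ d * pd m (V a b d c) p) = \<sigma> * (\<Sum>c\<in>UNIV. \<Sum>d\<in>UNIV.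
        ((\<chi> a b. eta a b) ** (\<chi> e f. 1/2 * (\<Sum>a\<in>UNIV. \<Sum>b\<in>UNIV. N $ a $ b * (qq p * eps a b e f)))
          ** transpose (\<chi> a b. eta a b)) $ c $ d * pd m (V a b d c) p)"
      unfolding M_def Hp Vol_def .
  qed
  have Vd: "pd m (V a b c e) p = con4 Q (\<lambda>i j k l. cov4 g (weyl g) m i j k l p) a b c e" for m a b c e
    unfolding V_def[abs_def] Y_def
    by (rule pd_con4_parallel_frame) (rule smooth_on_differentiable[OF weyl_smooth[OF met] p])
  show ?thesis
  proof (rule that[OF q1])
    show "selfdual (\<sigma> * qq p) (con4 Q (\<lambda>i j k l. weyl g i j k l p) a b)" for a b
      using 1[of a b] by (simp add: V_def Yp)
    show "selfdual (\<sigma> * qq p) (con4 Q (\<lambda>i j k l. cov4 g (weyl g) m i j k l p) a b)" for m a b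
      using 2[of m a b] by (simp add: Vd)
  qed
qed

end

section \<open>Linear algebra in an orthonormal frame of signature (2,2)\<close>

lemma eta_simps [simp]:
  "eta 1 1 = -1" "eta 2 2 = -1" "eta 3 3 = 1" "eta 4 4 = 1"
  "eta 1 2 = 0" "eta 1 3 = 0" "eta 1 4 = 0" "eta 2 1 = 0" "eta 2 3 = 0" "eta 2 4 = 0"
  "eta 3 1 = 0" "eta 3 2 = 0" "eta 3 4 = 0" "eta 4 1 = 0" "eta 4 2 = 0" "eta 4 3 = 0"
  by (simp_all add: eta_def)

lemma eta_sym: "eta a b = eta b a"
  by (simp add: eta_def)

lemma sum_eta_left: "(\<Sum>b\<in>UNIV. eta b b * (eta b a * F b)) = F a"
proof -
  have "\<forall>a. (\<Sum>b\<in>UNIV. eta b b * (eta b a * F b)) = F a" by (simp add: forall_4 sum_4)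
  then show ?thesis by blast
qed

text \<open>Here \<open>D\<close>, \<open>Wd\<close> and \<open>E\<close> stand for the covariant derivatives of the Riemann and Weyl tensors and of
  \<open>sch\<close>. The second Bianchi identity for \<open>D\<close> contains \<open>E\<close> only through its antisymmetrization \<open>C\<close>. The
  cyclic sum of \<open>Wd\<close> is selfdual in the last two indices, so the other half of the identity is
  free of the Weyl tensor, and these equations say that \<open>C\<close> is selfdual in the first two indices.\<close>

lemma cotton_selfdual:
  fixes D Wd :: "4 \<Rightarrow> 4 \<Rightarrow> 4 \<Rightarrow> 4 \<Rightarrow> 4 \<Rightarrow> real" and E :: "4 \<Rightarrow> 4 \<Rightarrow> 4 \<Rightarrow> real"
  assumes s: "s = 1 \<or> s = -1"
    and E: "\<And>m b c. E m b c = E m c b"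
    and D: "\<And>m a b c d. D m a b c d = Wd m a b c d
      + (1/2) * (E m b c * eta a d - E m a c * eta b d + eta b c * E m a d - eta a c * E m b d)"
    and B: "\<And>m a b c d. D m a b c d + D a b m c d + D b m a c d = 0"
    and W: "\<And>m a b. selfdual s (Wd m a b)"
  shows "selfdual s (\<lambda>a b. E a b c - E b a c)"
proof -
  define C where "C a b c = E a b c - E b a c" for a b c
  define K where "K m a b c d = C m b c * eta a d - C m b d * eta a c + C a m c * eta b d - C a m d * eta b c
      + C b a c * eta m d - C b a d * eta m c" for m a b c d
  have K0: "Wd m a b c d + Wd a b m c d + Wd b m a c d = - (1/2) * K m a b c d" for m a b c d
    using B[of m a b c d] unfolding D K_def C_def
    by argo
  have Keq: "K m a b c d = -2 * (Wd m a b c d + Wd a b m c d + Wd b m a c d)" for m a b c d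
    using K0[of m a b c d] by simp
  have K: "selfdual s (K m a b)" for m a b
    using W[of m a b] W[of a b m] W[of b m a]
    unfolding selfdual_def Keq by (simp add: algebra_simps)
  have anti: "C b a c = - C a b c" for a b c by (simp add: C_def)
  have cyc: "C a b c + C b c a + C c a b = 0" for a b c
    using E[of a b c] E[of b c a] E[of c a b] by (simp add: C_def)
  note sub = anti[of 2 1] anti[of 3 1] anti[of 4 1] anti[of 3 2] anti[of 4 2] anti[of 4 3]
  note cycs = cyc[of 1 2 3] cyc[of 1 2 4] cyc[of 1 3 4] cyc[of 2 3 4]
  note Ks = K[of 1 2 3] K[of 1 2 4] K[of 1 3 4] K[of 2 3 4]
  have ss: "s * s = 1" using s by auto
  note R = Ks[unfolded selfdual_def K_def eta_simps sub]
  have "C 1 2 1 = s * C 3 4 1" "C 1 3 1 = s * C 2 4 1" "C 1 4 1 = - s * C 2 3 1"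
    "C 1 2 2 = s * C 3 4 2" "C 1 3 2 = s * C 2 4 2" "C 1 4 2 = - s * C 2 3 2"
    "C 1 2 3 = s * C 3 4 3" "C 1 3 3 = s * C 2 4 3" "C 1 4 3 = - s * C 2 3 3"
    "C 1 2 4 = s * C 3 4 4" "C 1 3 4 = s * C 2 4 4" "C 1 4 4 = - s * C 2 3 4"
    using R cycs s by (simp_all add: sub, auto)
  then have "\<forall>c. selfdual s (\<lambda>a b. C a b c)" by (simp add: selfdual_def forall_4)
  then show ?thesis by (simp add: C_def)
qed

text \<open>A 2-form annihilated by \<open>f\<close> is the dual of some \<open>f \<and> u\<close>, hence itself a multiple of \<open>f \<and> u\<close> if it
  is selfdual; contracting with the nonnull \<open>f\<close> once more gives zero.\<close>

lemma selfdual_contraction_zero: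
  fixes V :: "4 \<Rightarrow> 4 \<Rightarrow> real"
  assumes s: "s = 1 \<or> s = -1" and V: "\<And>a b. V a b = - V b a" and sd: "selfdual s V"
    and z: "\<And>a. (\<Sum>b\<in>UNIV. eta b b * (V a b * f b)) = 0"
    and N: "(\<Sum>b\<in>UNIV. eta b b * (f b * f b)) \<noteq> 0"
  shows "V a b = 0"
proof -
  let ?N = "- f 1 * f 1 - f 2 * f 2 + f 3 * f 3 + f 4 * f 4"
  have dd: "V c c = 0" for c using V[of c c] by simp
  have ss: "s * s = 1" using s by auto
  have e: "V 1 2 = s * V 3 4" "V 1 3 = s * V 2 4" "V 1 4 = - s * V 2 3"
    using sd by (auto simp: selfdual_def)
  have z1: "- V 1 2 * f 2 + V 1 3 * f 3 + V 1 4 * f 4 = 0" using z[of 1] by (simp add: sum_4 dd)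
  have z2: "V 1 2 * f 1 + V 2 3 * f 3 + V 2 4 * f 4 = 0" using z[of 2] by (simp add: sum_4 dd V[of 2 1])
  have z3: "V 1 3 * f 1 + V 2 3 * f 2 + V 3 4 * f 4 = 0" using z[of 3] by (simp add: sum_4 dd V[of 3 1] V[of 3 2])
  have z4: "V 1 4 * f 1 + V 2 4 * f 2 - V 3 4 * f 3 = 0" using z[of 4] by (simp add: sum_4 dd V[of 4 1] V[of 4 2] V[of 4 3])
  have N': "?N \<noteq> 0" using N by (simp add: sum_4)
  \<comment> \<open>each of these is a combination of the four equations with coefficients linear in \<open>f\<close>\<close>
  have "?N * V 3 4 = 0" using z1 z2 z3 z4 ss unfolding e by algebra
  moreover have "?N * V 2 4 = 0" using z1 z2 z3 z4 ss unfolding e by algebra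
  moreover have "?N * V 2 3 = 0" using z1 z2 z3 z4 ss unfolding e by algebra
  ultimately have 0: "V 3 4 = 0" "V 2 4 = 0" "V 2 3 = 0" using N' by auto
  have "\<forall>a b. V a b = 0"
    using 0 e dd V[of 2 1] V[of 3 1] V[of 4 1] V[of 3 2] V[of 4 2] V[of 4 3] by (simp add: forall_4)
  then show ?thesis by blast
qed

text \<open>The part \<open>v\<close> of \<open>u\<close> that is orthogonal to \<open>f\<close> gives the same bivector \<open>f \<and> v\<close>, whose contraction with
  \<open>f\<close> is a nonzero multiple of \<open>v\<close>.\<close>

lemma selfdual_wedge_zero:
  assumes s: "s = 1 \<or> s = -1" and sd: "selfdual s (\<lambda>a b. f a * u b - f b * u a)"
    and N: "(\<Sum>b\<in>UNIV. eta b b * (f b * f b)) \<noteq> 0"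
  shows "f a * u b = f b * u a"
proof -
  define n where "n = (\<Sum>b\<in>UNIV. eta b b * (f b * f b))"
  define k where "k = (\<Sum>b\<in>UNIV. eta b b * (f b * u b)) / n"
  define v where "v b = u b - k * f b" for b
  have n: "n \<noteq> 0" using N by (simp add: n_def)
  have eq: "f a * u b - f b * u a = f a * v b - f b * v a" for a b by (simp add: v_def algebra_simps)
  have fv: "(\<Sum>b\<in>UNIV. eta b b * (f b * v b)) = 0"
  proof -
    have "(\<Sum>b\<in>UNIV. eta b b * (f b * v b)) = (\<Sum>b\<in>UNIV. eta b b * (f b * u b)) - k * n"
      by (simp add: v_def n_def sum_4 algebra_simps)
    then show ?thesis using n by (simp add: k_def)
  qed
  have fv': "- f 1 * v 1 - f 2 * v 2 + f 3 * v 3 + f 4 * v 4 = 0" using fv by (simp add: sum_4)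
  have n': "- f 1 * f 1 - f 2 * f 2 + f 3 * f 3 + f 4 * f 4 = n" by (simp add: n_def sum_4)
  have ss: "s * s = 1" using s by auto
  have e: "f 1 * v 2 - f 2 * v 1 = s * (f 3 * v 4 - f 4 * v 3)" "f 1 * v 3 - f 3 * v 1 = s * (f 2 * v 4 - f 4 * v 2)"
    "f 1 * v 4 - f 4 * v 1 = - s * (f 2 * v 3 - f 3 * v 2)"
    using sd unfolding eq by (auto simp: selfdual_def)
  \<comment> \<open>a simple bivector equal to its dual up to sign is annihilated by the vectors of its plane\<close>
  have "n * v 1 = 0" using e fv' n' ss by algebra
  moreover have "n * v 2 = 0" using e fv' n' ss by algebra
  moreover have "n * v 3 = 0" using e fv' n' ss by algebra
  moreover have "n * v 4 = 0" using e fv' n' ss by algebra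
  ultimately have "\<forall>b. v b = 0" using n by (simp add: forall_4)
  then show ?thesis using eq[of a b] by simp
qed

lemma selfdual_sum:
  fixes V :: "'i::finite \<Rightarrow> 4 \<Rightarrow> 4 \<Rightarrow> real"
  assumes "\<And>c. selfdual s (V c)"
  shows "selfdual s (\<lambda>a b. \<Sum>c\<in>UNIV. k c * V c a b)"
proof -
  have "V c 1 2 = s * V c 3 4" "V c 1 3 = s * V c 2 4" "V c 1 4 = - s * V c 2 3" for c
    using assms[of c] by (auto simp: selfdual_def)
  then show ?thesis unfolding selfdual_def by (simp add: sum_distrib_left mult_ac sum_negf)
qed

text \<open>Under the Hodge star, the trace corresponds to the cyclic sum.\<close>

lemma selfdual_trace_zero:
  fixes \<omega> :: "4 \<Rightarrow> 4 \<Rightarrow> 4 \<Rightarrow> real"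
  assumes sd: "\<And>c. selfdual s (\<lambda>a b. \<omega> a b c)" and anti: "\<And>a b c. \<omega> a b c = - \<omega> b a c"
    and cyc: "\<And>a b c. \<omega> a b c + \<omega> b c a + \<omega> c a b = 0" and s: "s = 1 \<or> s = -1"
  shows "(\<Sum>b\<in>UNIV. eta b b * \<omega> a b b) = 0"
proof -
  have dd: "\<omega> c c e = 0" for c e using anti[of c c e] by simp
  have e: "\<omega> 1 2 c = s * \<omega> 3 4 c" "\<omega> 1 3 c = s * \<omega> 2 4 c" "\<omega> 1 4 c = - s * \<omega> 2 3 c" for c
    using sd[of c] by (auto simp: selfdual_def)
  have ss: "s * s = 1" using s by auto
  note an = anti[of 2 1] anti[of 3 1] anti[of 4 1] anti[of 3 2] anti[of 4 2] anti[of 4 3]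
  have "\<omega> 2 3 4 - \<omega> 2 4 3 + \<omega> 3 4 2 = 0" using cyc[of 2 3 4] an by simp
  moreover have "s * \<omega> 2 4 4 + s * \<omega> 2 3 3 + \<omega> 3 4 1 = 0" using cyc[of 1 3 4] an e by simp
  moreover have "s * \<omega> 3 4 4 + s * \<omega> 2 3 2 + \<omega> 2 4 1 = 0" using cyc[of 1 2 4] an e by simp
  moreover have "s * \<omega> 3 4 3 - s * \<omega> 2 4 2 + \<omega> 2 3 1 = 0" using cyc[of 1 2 3] an e by simp
  ultimately have
    "- \<omega> 1 2 2 + \<omega> 1 3 3 + \<omega> 1 4 4 = 0" "\<omega> 1 2 1 + \<omega> 2 3 3 + \<omega> 2 4 4 = 0"
    "\<omega> 1 3 1 + \<omega> 2 3 2 + \<omega> 3 4 4 = 0" "\<omega> 1 4 1 + \<omega> 2 4 2 - \<omega> 3 4 3 = 0"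
    unfolding e using s by auto
  then have "\<forall>a. (\<Sum>b\<in>UNIV. eta b b * \<omega> a b b) = 0"
    by (simp add: forall_4 sum_4 dd an)
  then show ?thesis by blast
qed

text \<open>Contracting the hypothesis with \<open>f\<close> gives a selfdual bivector \<open>f \<and> u\<close>, and the trace of the hypothesis
  determines \<open>v\<close>. Together they show that \<open>f\<close> is an eigenvector of \<open>\<rho>\<close> and that \<open>v\<close> is a multiple of
  \<open>f\<close>. Then each bivector of the hypothesis is itself of the form \<open>f \<and> u\<close>, hence zero, and this
  determines \<open>\<rho>\<close>.\<close>

lemma ricci_eigenvalues:
  fixes \<rho> :: "4 \<Rightarrow> 4 \<Rightarrow> real" and f v :: "4 \<Rightarrow> real"
  assumes s: "s = 1 \<or> s = -1" and sym: "\<And>a b. \<rho> a b = \<rho> b a" and m: "m \<noteq> 0"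
    and N: "(\<Sum>b\<in>UNIV. eta b b * (f b * f b)) \<noteq> 0"
    and sd: "\<And>c. selfdual s (\<lambda>a b. m * (f a * \<rho> b c - f b * \<rho> a c) + v a * eta b c - v b * eta a c)"
  obtains x y where "\<And>a b. \<rho> a b = x * eta a b + y * (f a * f b)"
proof -
  define \<omega> where "\<omega> a b c = m * (f a * \<rho> b c - f b * \<rho> a c) + v a * eta b c - v b * eta a c" for a b c
  define n where "n = (\<Sum>b\<in>UNIV. eta b b * (f b * f b))"
  define r where "r a = (\<Sum>c\<in>UNIV. eta c c * (\<rho> a c * f c))" for a
  define \<tau> where "\<tau> = (\<Sum>c\<in>UNIV. eta c c * \<rho> c c)"
  have n0: "n \<noteq> 0" using N by (simp add: n_def)
  have fe: "(\<Sum>c\<in>UNIV. eta c c * (eta a c * f c)) = f a" for a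
    using sum_eta_left[of a f] by (simp add: eta_sym)
  have "selfdual s (\<lambda>a b. \<Sum>c\<in>UNIV. (eta c c * f c) * \<omega> a b c)"
    unfolding \<omega>_def by (rule selfdual_sum[OF sd])
  moreover have "(\<Sum>c\<in>UNIV. (eta c c * f c) * \<omega> a b c) = f a * (m * r b - v b) - f b * (m * r a - v a)" for a b
  proof -
    have "(\<Sum>c\<in>UNIV. (eta c c * f c) * \<omega> a b c) = m * (f a * r b - f b * r a)
      + v a * (\<Sum>c\<in>UNIV. eta c c * (eta b c * f c)) - v b * (\<Sum>c\<in>UNIV. eta c c * (eta a c * f c))"
      unfolding \<omega>_def r_def by (simp add: sum_4 algebra_simps)
    then show ?thesis unfolding fe by (simp add: algebra_simps)
  qed
  ultimately have "selfdual s (\<lambda>a b. f a * (m * r b - v b) - f b * (m * r a - v a))" by simp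
  from selfdual_wedge_zero[OF s this N]
  have w1: "f a * (m * r b - v b) = f b * (m * r a - v a)" for a b .
  have "(\<Sum>b\<in>UNIV. eta b b * \<omega> a b b) = 0" for a
    by (rule selfdual_trace_zero[of s]) (use sd s in \<open>simp_all add: \<omega>_def sym eta_sym algebra_simps\<close>)
  moreover have "(\<Sum>b\<in>UNIV. eta b b * \<omega> a b b) = m * (\<tau> * f a - r a) + 3 * v a" for a
  proof -
    have "(\<Sum>b\<in>UNIV. eta b b * \<omega> a b b) = m * (\<tau> * f a - r a) + 4 * v a - (\<Sum>b\<in>UNIV. eta b b * (eta b a * v b))"
      unfolding \<omega>_def r_def \<tau>_def by (simp add: sum_4 algebra_simps eta_sym)
    then show ?thesis by (simp add: sum_eta_left)
  qed
  ultimately have v: "v a = m * (r a - \<tau> * f a) / 3" for a by (simp add: field_simps)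
  have "m * (f a * r b - f b * r a) = 0" for a b
    using w1[of a b] unfolding v by (simp add: field_simps)
  then have w2: "f a * r b = f b * r a" for a b using m by simp
  define \<theta> where "\<theta> = (\<Sum>c\<in>UNIV. eta c c * (f c * r c)) / n"
  have r: "r b = \<theta> * f b" for b
  proof -
    have "n * r b = (\<Sum>a\<in>UNIV. eta a a * (f a * (f a * r b)))" by (simp add: n_def sum_4 algebra_simps)
    also have "\<dots> = (\<Sum>a\<in>UNIV. eta a a * (f a * (f b * r a)))" using w2 by simp
    also have "\<dots> = (\<Sum>c\<in>UNIV. eta c c * (f c * r c)) * f b" by (simp add: sum_4 algebra_simps)
    also have "\<dots> = n * \<theta> * f b" using n0 by (simp add: \<theta>_def)
    finally show ?thesis using n0 by simp
  qed
  define \<kappa> where "\<kappa> = m * (\<theta> - \<tau>) / 3"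
  have v': "v a = \<kappa> * f a" for a unfolding v r \<kappa>_def by (simp add: algebra_simps)
  define U where "U b c = m * \<rho> b c + \<kappa> * eta b c" for b c
  have "selfdual s (\<lambda>a b. f a * U b c - f b * U a c)" for c
    using sd[of c] unfolding U_def v' by (simp add: algebra_simps)
  from selfdual_wedge_zero[OF s this N]
  have w3: "f a * U b c = f b * U a c" for a b c .
  have U: "n * U b c = (m * \<theta> + \<kappa>) * (f b * f c)" for b c
  proof -
    have "n * U b c = (\<Sum>a\<in>UNIV. eta a a * (f a * (f a * U b c)))" by (simp add: n_def sum_4 algebra_simps)
    also have "\<dots> = (\<Sum>a\<in>UNIV. eta a a * (f a * (f b * U a c)))" using w3 by simp
    also have "\<dots> = f b * (m * r c + \<kappa> * (\<Sum>a\<in>UNIV. eta a a * (eta a c * f a)))"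
      unfolding U_def r_def by (simp add: sum_4 algebra_simps sym[of c])
    also have "\<dots> = (m * \<theta> + \<kappa>) * (f b * f c)" unfolding sum_eta_left r by (simp add: algebra_simps)
    finally show ?thesis .
  qed
  define K where "K = (m * \<theta> + \<kappa>) / n"
  show ?thesis
  proof
    fix b c
    have "U b c = K * (f b * f c)" using U[of b c] n0 by (simp add: K_def field_simps)
    then have "m * \<rho> b c = - \<kappa> * eta b c + K * (f b * f c)" by (simp add: U_def)
    then show "\<rho> b c = (- \<kappa> / m) * eta b c + (K / m) * (f b * f c)"
      using m by (simp add: field_simps)
  qed
qed

text \<open>This is applied to the antisymmetrized covariant derivative of a tensor \<open>a g + b df \<otimes> df\<close>, with
  \<open>\<alpha> = da\<close>, \<open>\<beta> = db\<close>, and \<open>Z\<close> either zero or the curvature contracted with the gradient. Comparing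
  the contraction with \<open>f\<close> and the trace shows that \<open>\<alpha>\<close> is a multiple of \<open>f\<close> and that \<open>\<beta>\<close>
  contributes nothing.\<close>

lemma codazzi_coefficients:
  fixes \<alpha> \<beta> f :: "4 \<Rightarrow> real" and Z :: "4 \<Rightarrow> 4 \<Rightarrow> 4 \<Rightarrow> real"
  assumes N: "(\<Sum>b\<in>UNIV. eta b b * (f b * f b)) \<noteq> 0"
    and eq: "\<And>a b c. \<alpha> a * eta b c - \<alpha> b * eta a c + (\<beta> a * f b - \<beta> b * f a) * f c
      + k * (f b * eta a c - f a * eta b c) = - Z a b c"
    and Zf: "\<And>a b. (\<Sum>c\<in>UNIV. eta c c * (Z a b c * f c)) = 0"
    and Ztr: "\<And>a. (\<Sum>b\<in>UNIV. eta b b * Z a b b) = h * f a"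
  shows "\<alpha> a = (k - h / 3) * f a" "Z a b c = h / 3 * (f a * eta b c - f b * eta a c)"
proof -
  define n where "n = (\<Sum>b\<in>UNIV. eta b b * (f b * f b))"
  define \<beta>f where "\<beta>f = (\<Sum>b\<in>UNIV. eta b b * (\<beta> b * f b))"
  have n0: "n \<noteq> 0" using N by (simp add: n_def)
  have fe: "(\<Sum>c\<in>UNIV. eta c c * (eta a c * f c)) = f a" for a
    using sum_eta_left[of a f] by (simp add: eta_sym)
  have c1: "\<alpha> a * f b - \<alpha> b * f a + n * (\<beta> a * f b - \<beta> b * f a) = 0" for a b
  proof -
    have "(\<Sum>c\<in>UNIV. eta c c * ((\<alpha> a * eta b c - \<alpha> b * eta a c + (\<beta> a * f b - \<beta> b * f a) * f c
      + k * (f b * eta a c - f a * eta b c)) * f c)) = (\<Sum>c\<in>UNIV. eta c c * (- Z a b c * f c))"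
      by (simp only: eq)
    moreover have "(\<Sum>c\<in>UNIV. eta c c * ((\<alpha> a * eta b c - \<alpha> b * eta a c + (\<beta> a * f b - \<beta> b * f a) * f c
      + k * (f b * eta a c - f a * eta b c)) * f c))
      = (\<alpha> a - k * f a) * (\<Sum>c\<in>UNIV. eta c c * (eta b c * f c)) - (\<alpha> b - k * f b) * (\<Sum>c\<in>UNIV. eta c c * (eta a c * f c))
        + n * (\<beta> a * f b - \<beta> b * f a)"
      unfolding n_def by (simp add: sum_4 algebra_simps)
    moreover have "(\<Sum>c\<in>UNIV. eta c c * (- Z a b c * f c)) = 0"
      using Zf[of a b] by (simp add: sum_negf)
    ultimately show ?thesis unfolding fe by (simp add: algebra_simps)
  qed
  have c2: "3 * \<alpha> a + n * \<beta> a - \<beta>f * f a - 3 * k * f a = - h * f a" for a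
  proof -
    have "(\<Sum>b\<in>UNIV. eta b b * (\<alpha> a * eta b b - \<alpha> b * eta a b + (\<beta> a * f b - \<beta> b * f a) * f b
      + k * (f b * eta a b - f a * eta b b))) = (\<Sum>b\<in>UNIV. eta b b * (- Z a b b))"
      by (simp only: eq)
    moreover have "(\<Sum>b\<in>UNIV. eta b b * (\<alpha> a * eta b b - \<alpha> b * eta a b + (\<beta> a * f b - \<beta> b * f a) * f b
      + k * (f b * eta a b - f a * eta b b)))
      = 4 * \<alpha> a - (\<Sum>b\<in>UNIV. eta b b * (eta b a * \<alpha> b)) + n * \<beta> a - \<beta>f * f a - 4 * k * f a + k * (\<Sum>b\<in>UNIV. eta b b * (eta b a * f b))"
      unfolding n_def \<beta>f_def by (simp add: sum_4 algebra_simps eta_sym)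
    moreover have "(\<Sum>b\<in>UNIV. eta b b * (- Z a b b)) = - h * f a"
      using Ztr[of a] by (simp add: sum_negf)
    ultimately show ?thesis unfolding sum_eta_left by (simp add: algebra_simps)
  qed
  have aw: "\<alpha> a * f b = \<alpha> b * f a" for a b
    using c1[of a b] arg_cong[OF c2[of a], of "\<lambda>t. t * f b"] arg_cong[OF c2[of b], of "\<lambda>t. t * f a"]
    by (simp add: algebra_simps)
  then have bw: "\<beta> a * f b = \<beta> b * f a" for a b using c1[of a b] n0 by simp
  have nb: "n * \<beta> a = \<beta>f * f a" for a
  proof -
    have "n * \<beta> a = (\<Sum>b\<in>UNIV. eta b b * (f b * (\<beta> a * f b)))" by (simp add: n_def sum_4 algebra_simps)
    also have "\<dots> = (\<Sum>b\<in>UNIV. eta b b * (f b * (\<beta> b * f a)))" using bw by simp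
    also have "\<dots> = \<beta>f * f a" by (simp add: \<beta>f_def sum_4 algebra_simps)
    finally show ?thesis .
  qed
  have al: "\<alpha> a = (k - h / 3) * f a" for a
    using c2[of a] nb[of a] by (simp add: field_simps)
  show "\<alpha> a = (k - h / 3) * f a" by (rule al)
  show "Z a b c = h / 3 * (f a * eta b c - f b * eta a c)"
    using eq[of a b c] bw[of a b] unfolding al[of a] al[of b] by (simp add: algebra_simps)
qed

text \<open>The hypotheses on \<open>P\<close> and on the contraction of \<open>R\<close> with \<open>f\<close> match exactly: the contraction comes
  from the Schouten part of \<open>R\<close> alone, which leaves zero for \<open>W\<close>.\<close>

lemma weyl_vanishes:
  fixes W R :: "4 \<Rightarrow> 4 \<Rightarrow> 4 \<Rightarrow> 4 \<Rightarrow> real" and f :: "4 \<Rightarrow> real"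
  assumes s: "s = 1 \<or> s = -1" and N: "n = (\<Sum>b\<in>UNIV. eta b b * (f b * f b))" "n \<noteq> 0"
    and sd: "\<And>a b. selfdual s (W a b)" and anti: "\<And>a b c d. W a b c d = - W a b d c"
    and W: "\<And>a b c d. W a b c d = R a b c d
      - (1/2) * (P b c * eta a d - P a c * eta b d + eta b c * P a d - eta a c * P b d)"
    and P: "\<And>a b. P a b = (x / 3 - y * n / 6) * eta a b + y * (f a * f b)"
    and Z: "\<And>a b c. (\<Sum>d\<in>UNIV. eta d d * (R a b c d * f d)) = (x + y * n) / 3 * (f a * eta b c - f b * eta a c)"
  shows "W a b c d = 0"
proof (rule selfdual_contraction_zero[OF s anti sd])
  have fe: "(\<Sum>c\<in>UNIV. eta c c * (eta a c * f c)) = f a" for a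
    using sum_eta_left[of a f] by (simp add: eta_sym)
  fix c
  have A: "(\<Sum>d\<in>UNIV. eta d d * (W a b c d * f d)) = (\<Sum>d\<in>UNIV. eta d d * (R a b c d * f d))
     - (1/2) * (P b c * (\<Sum>d\<in>UNIV. eta d d * (eta a d * f d)) - P a c * (\<Sum>d\<in>UNIV. eta d d * (eta b d * f d))
       + eta b c * (\<Sum>d\<in>UNIV. eta d d * (P a d * f d)) - eta a c * (\<Sum>d\<in>UNIV. eta d d * (P b d * f d)))"
    unfolding W by (simp add: sum_4 algebra_simps)
  have B: "(\<Sum>d\<in>UNIV. eta d d * (P a d * f d)) = (x / 3 - y * n / 6) * f a + y * (f a * n)" for a
  proof -
    have "(\<Sum>d\<in>UNIV. eta d d * ((k * eta a d + y * (f a * f d)) * f d))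
        = k * (\<Sum>d\<in>UNIV. eta d d * (eta a d * f d)) + y * (f a * (\<Sum>b\<in>UNIV. eta b b * (f b * f b)))" for k
      by (simp add: sum_4 algebra_simps)
    then show ?thesis unfolding P fe N(1)[symmetric] .
  qed
  show "(\<Sum>d\<in>UNIV. eta d d * (W a b c d * f d)) = 0"
    unfolding A B Z fe unfolding P by (simp add: field_simps)
qed (use N in simp)

section \<open>Tensor components in an orthonormal frame\<close>

lemma cov2_cong:
  assumes "open S" "x \<in> S" "\<And>y i j. y \<in> S \<Longrightarrow> T i j y = U i j y"
  shows "cov2 g T m i j x = cov2 g U m i j x"
  unfolding cov2_def using pd_transform[OF assms(1,2), of "T i j" "U i j"] assms(2,3) by simp

lemma cov4_cong:
  assumes "open S" "x \<in> S" "\<And>y i j k l. y \<in> S \<Longrightarrow> T i j k l y = U i j k l y"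
  shows "cov4 g T m i j k l x = cov4 g U m i j k l x"
  unfolding cov4_def using pd_transform[OF assms(1,2), of "T i j k l" "U i j k l"] assms(2,3) by simp

lemma cov2_gradient_square:
  assumes "\<And>i. pd i F differentiable (at x)"
  shows "cov2 g (\<lambda>i j x. pd i F x * pd j F x) m i j x = hess g F m i x * pd j F x + pd i F x * hess g F m j x"
  unfolding cov2_def hess_def by (subst pd_mult) (auto simp: assms algebra_simps sum_distrib_left sum_distrib_right)

context
  fixes S :: "(real^4) set" and g :: "4 metric" and p :: "real^4" and Q :: "4 \<Rightarrow> real^4"
  assumes met: "metric_on S g" and p: "p \<in> S"
    and Q: "\<And>a b. con2 Q (\<lambda>i j. g p $ i $ j) a b = eta a b"
begin

lemma frame_ginv: "ginv g i j p = (\<Sum>a\<in>UNIV. eta a a * (Q a $ i * Q a $ j))"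
proof -
  define Y where "Y = ((\<chi> k a. Q a $ k) :: real^4^4)"
  define E where "E = ((\<chi> a b. eta a b) :: real^4^4)"
  have "transpose Y ** g p ** Y = E"
    unfolding Y_def E_def by (simp add: vec_eq_iff frame_gram[OF met] Q)
  moreover have EE: "E ** E = mat 1"
    unfolding E_def by (simp add: vec_eq_iff matrix_matrix_mult_def mat_def forall_4 sum_4)
  ultimately have "(transpose Y ** g p) ** (Y ** E) = mat 1" by (simp add: matrix_mul_assoc)
  then have "(Y ** E) ** (transpose Y ** g p) = mat 1" by (simp add: matrix_left_right_inverse)
  then have "(Y ** E ** transpose Y) ** g p = mat 1" by (simp add: matrix_mul_assoc)
  then have "g p ** (Y ** E ** transpose Y) = mat 1" by (simp add: matrix_left_right_inverse)
  then have "matrix_inv (g p) = Y ** E ** transpose Y" by (rule matrix_inv_unique_left)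
  then show ?thesis
    unfolding ginv_def by (simp add: matrix_matrix_mult_def transpose_def Y_def E_def sum_4)
qed

lemma frame_trace:
  "(\<Sum>i\<in>UNIV. \<Sum>j\<in>UNIV. ginv g i j p * T i j) = (\<Sum>a\<in>UNIV. eta a a * con2 Q T a a)"
proof -
  have "(\<Sum>i\<in>UNIV. \<Sum>j\<in>UNIV. ginv g i j p * T i j)
    = (\<Sum>i\<in>UNIV. \<Sum>j\<in>UNIV. \<Sum>a\<in>UNIV. eta a a * (Q a $ i * (Q a $ j * T i j)))"
    unfolding frame_ginv by (simp only: sum_distrib_right) (simp add: mult_ac)
  also have "\<dots> = (\<Sum>i\<in>UNIV. \<Sum>a\<in>UNIV. \<Sum>j\<in>UNIV. eta a a * (Q a $ i * (Q a $ j * T i j)))"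
    by (intro sum.cong refl sum.swap)
  also have "\<dots> = (\<Sum>a\<in>UNIV. \<Sum>i\<in>UNIV. \<Sum>j\<in>UNIV. eta a a * (Q a $ i * (Q a $ j * T i j)))"
    by (rule sum.swap)
  finally show ?thesis unfolding con2_def con_def by (simp add: sum_distrib_left)
qed

lemma frame_expand: "F i = (\<Sum>a\<in>UNIV. (\<Sum>j\<in>UNIV. g p $ i $ j * Q a $ j) * (eta a a * con Q F a))"
proof -
  have "F i = (\<Sum>j\<in>UNIV. g p $ i $ j * (\<Sum>k\<in>UNIV. ginv g j k p * F k))"
    using metric_ginv_contract[OF met p] by simp
  also have "\<dots> = (\<Sum>a\<in>UNIV. (\<Sum>j\<in>UNIV. g p $ i $ j * Q a $ j) * (eta a a * con Q F a))"
    unfolding frame_ginv con_def sum_4 by (simp add: algebra_simps)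
  finally show ?thesis .
qed

lemma con_inject: "(\<And>a. con Q F a = con Q G a) \<Longrightarrow> F i = G i"
  by (subst frame_expand[of F], subst frame_expand[of G]) simp

lemma con2_inject:
  assumes "\<And>a b. con2 Q T a b = con2 Q U a b" shows "T i j = U i j"
proof -
  have "con Q (T i) b = con Q (U i) b" for i b
    by (rule con_inject[of "\<lambda>i. con Q (T i) b" "\<lambda>i. con Q (U i) b"]) (use assms in \<open>simp add: con2_def\<close>)
  then show ?thesis by (rule con_inject)
qed

lemma con4_inject:
  assumes "\<And>a b c d. con4 Q T a b c d = con4 Q U a b c d" shows "T i j k l = U i j k l"
proof -
  have "con2 Q (T i j) c d = con2 Q (U i j) c d" for i j c d
    by (rule con2_inject[of "\<lambda>i j. con2 Q (T i j) c d" "\<lambda>i j. con2 Q (U i j) c d"])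
       (use assms in \<open>simp add: con4_def\<close>)
  then show ?thesis by (rule con2_inject)
qed

lemma con3_riem_up:
  "con Q (\<lambda>i. con Q (\<lambda>j. con Q (\<lambda>k. \<Sum>l\<in>UNIV. riem_up g l k i j p * F l) c) b) a
    = (\<Sum>d\<in>UNIV. eta d d * (con4 Q (\<lambda>i j k l. riem g i j k l p) a b c d * con Q F d))"
proof -
  have "(\<Sum>l\<in>UNIV. riem_up g l k i j p * F l) = (\<Sum>d\<in>UNIV. eta d d * (con Q F d * con Q (\<lambda>m. riem g i j k m p) d))" for i j k
  proof -
    have "(\<Sum>l\<in>UNIV. riem_up g l k i j p * F l) = (\<Sum>l\<in>UNIV. \<Sum>m\<in>UNIV. ginv g l m p * (F l * riem g i j k m p))"
      unfolding riem_up_riem[OF met p] by (simp only: sum_distrib_right) (simp add: mult_ac)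
    also have "\<dots> = (\<Sum>d\<in>UNIV. eta d d * (con Q F d * con Q (\<lambda>m. riem g i j k m p) d))"
      unfolding frame_trace con2_def by (simp add: con_simps)
    finally show ?thesis .
  qed
  then show ?thesis unfolding con4_def con2_def by (simp add: con_sum con_simps mult_ac)
qed

lemma con2_ricci:
  "con2 Q (\<lambda>i j. ricci g i j p) b c = (\<Sum>a\<in>UNIV. eta a a * con4 Q (\<lambda>i j k l. riem g i j k l p) a b c a)"
proof -
  have "ricci g j k p = (\<Sum>a\<in>UNIV. eta a a * con Q (\<lambda>i. con Q (\<lambda>m. riem g i j k m p) a) a)" for j k
    unfolding ricci_riem[OF met p] frame_trace con2_def ..
  then have 1: "con2 Q (\<lambda>i j. ricci g i j p) b c
    = (\<Sum>a\<in>UNIV. eta a a * con Q (\<lambda>j. con Q (\<lambda>k. con Q (\<lambda>i. con Q (\<lambda>m. riem g i j k m p) a) a) c) b)"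
    unfolding con2_def by (simp add: con_sum con_simps)
  have 2: "con Q (\<lambda>j. con Q (\<lambda>k. con Q (\<lambda>i. con Q (\<lambda>m. riem g i j k m p) a) a) c) b
      = con Q (\<lambda>i. con Q (\<lambda>j. con Q (\<lambda>k. con Q (\<lambda>m. riem g i j k m p) a) c) b) a" for a
    by (subst (2) con_swap) (rule con_swap)
  show ?thesis unfolding 1 2 unfolding con4_def con2_def ..
qed

lemma con4_weyl:
  "con4 Q (\<lambda>i j k l. weyl g i j k l p) a b c d = con4 Q (\<lambda>i j k l. riem g i j k l p) a b c d
    - (1/2) * (con2 Q (\<lambda>i j. sch g i j p) b c * eta a d - con2 Q (\<lambda>i j. sch g i j p) a c * eta b d
      + eta b c * con2 Q (\<lambda>i j. sch g i j p) a d - eta a c * con2 Q (\<lambda>i j. sch g i j p) b d)"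
  unfolding weyl_sch Q[symmetric] con4_def con2_def by (simp add: con_simps)

lemma con4_riem_antisym34: "con4 Q (\<lambda>i j k l. riem g i j k l p) a b c d = - con4 Q (\<lambda>i j k l. riem g i j k l p) a b d c"
proof -
  have w: "riem g i j k l p = - riem g i j l k p" for i j k l by (rule riem_antisym34[OF met p])
  show ?thesis unfolding con4_def con2_def by (subst con_swap, subst w) (simp add: con_minus)
qed

lemma con4_riem_trace: "(\<Sum>b\<in>UNIV. eta b b * con4 Q (\<lambda>i j k l. riem g i j k l p) a b b d) = con2 Q (\<lambda>i j. ricci g i j p) a d"
proof -
  have w: "riem g i j k l p = riem g j i l k p" for i j k l
    using riem_antisym34[OF met p, of i j k l] riem_antisym12[OF met, of i j l k p] by simp
  have "con4 Q (\<lambda>i j k l. riem g i j k l p) a b c d = con4 Q (\<lambda>i j k l. riem g i j k l p) b a d c" for a b c d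
    unfolding con4_def con2_def
    by (subst w, subst con_swap, subst (2) con_swap, rule refl)
  then show ?thesis unfolding con2_ricci by simp
qed

lemma con4_weyl_pair: "con4 Q (\<lambda>i j k l. weyl g i j k l p) a b c d = con4 Q (\<lambda>i j k l. weyl g i j k l p) c d a b"
proof -
  have "con4 Q (\<lambda>i j k l. weyl g i j k l p) a b c d = con4 Q (\<lambda>i j k l. weyl g k l i j p) a b c d"
    using weyl_pair_sym[OF met p] by simp
  also have "\<dots> = con4 Q (\<lambda>i j k l. weyl g i j k l p) c d a b"
  proof -
    have "con4 Q (\<lambda>i j k l. weyl g k l i j p) a b c d
      = con Q (\<lambda>i. con Q (\<lambda>k. con Q (\<lambda>j. con Q (\<lambda>l. weyl g k l i j p) d) b) c) a"
      unfolding con4_def con2_def by (subst (2) con_swap) (rule refl)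
    also have "\<dots> = con Q (\<lambda>k. con Q (\<lambda>i. con Q (\<lambda>l. con Q (\<lambda>j. weyl g k l i j p) b) d) a) c"
      by (subst con_swap, subst (3) con_swap) (rule refl)
    also have "\<dots> = con4 Q (\<lambda>i j k l. weyl g i j k l p) c d a b"
      unfolding con4_def con2_def by (subst (2) con_swap) (rule refl)
    finally show ?thesis .
  qed
  finally show ?thesis .
qed

lemma con4_weyl_antisym34: "con4 Q (\<lambda>i j k l. weyl g i j k l p) a b c d = - con4 Q (\<lambda>i j k l. weyl g i j k l p) a b d c"
proof -
  have w: "weyl g i j k l p = - weyl g i j l k p" for i j k l by (rule weyl_antisym34[OF met p])
  show ?thesis unfolding con4_def con2_def by (subst con_swap, subst w) (simp add: con_minus)
qed

text \<open>Twice the components of the Cotton tensor in the frame.\<close>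

definition cotton :: "4 \<Rightarrow> 4 \<Rightarrow> 4 \<Rightarrow> real" where
  "cotton a b c = con Q (\<lambda>i. con Q (\<lambda>j. con Q (\<lambda>k. cov2 g (sch g) i j k p - cov2 g (sch g) j i k p) c) b) a"

lemma cotton_selfdual_at:
  assumes s: "s = 1 \<or> s = -1"
    and W: "\<And>m a b. selfdual s (con4 Q (\<lambda>i j k l. cov4 g (weyl g) m i j k l p) a b)"
  shows "selfdual s (\<lambda>a b. cotton a b c)"
proof -
  note d = smooth_on_differentiable[OF _ p]
  define D where "D m a b c d = con Q (\<lambda>m. con4 Q (\<lambda>i j k l. cov4 g (riem g) m i j k l p) a b c d) m" for m a b c d
  define Wd where "Wd m a b c d = con Q (\<lambda>m. con4 Q (\<lambda>i j k l. cov4 g (weyl g) m i j k l p) a b c d) m" for m a b c d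
  define E where "E m b c = con Q (\<lambda>m. con2 Q (\<lambda>i j. cov2 g (sch g) m i j p) b c) m" for m b c
  have d0: "(\<lambda>x. g x $ i $ j) differentiable (at p)" "sch g i j differentiable (at p)"
    "riem g i j k l differentiable (at p)" for i j k l
    using d[OF metric_smooth[OF met]] d[OF sch_smooth[OF met]] d[OF riem_smooth[OF met]] by auto
  have cw: "cov4 g (weyl g) m i j k l p = cov4 g (riem g) m i j k l p
    - (1/2) * (cov2 g (sch g) m j k p * g p $ i $ l - cov2 g (sch g) m i k p * g p $ j $ l
        + g p $ j $ k * cov2 g (sch g) m i l p - g p $ i $ k * cov2 g (sch g) m j l p)" for m i j k l
  proof -
    have "cov4 g (weyl g) m i j k l p = cov4 g (\<lambda>i j k l x. riem g i j k l x
      - (1/2) * (sch g j k x * g x $ i $ l - sch g i k x * g x $ j $ l + g x $ j $ k * sch g i l x - g x $ i $ k * sch g j l x)) m i j k l p"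
      by (rule cov4_cong[OF metric_open[OF met] p]) (rule weyl_sch)
    also have "\<dots> = cov4 g (riem g) m i j k l p - (1/2) *
      (cov4 g (\<lambda>i j k l x. sch g j k x * g x $ i $ l) m i j k l p - cov4 g (\<lambda>i j k l x. sch g i k x * g x $ j $ l) m i j k l p
       + cov4 g (\<lambda>i j k l x. g x $ j $ k * sch g i l x) m i j k l p - cov4 g (\<lambda>i j k l x. g x $ i $ k * sch g j l x) m i j k l p)"
      by (subst cov4_diff, intro d0, intro differentiable_mult differentiable_diff differentiable_add d0 differentiable_const,
          subst cov4_cmult, intro differentiable_mult differentiable_diff differentiable_add d0,
          subst cov4_diff, intro differentiable_mult differentiable_diff differentiable_add d0, intro differentiable_mult d0,
          subst cov4_add, intro differentiable_mult differentiable_diff differentiable_add d0, intro differentiable_mult d0,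
          subst cov4_diff, intro differentiable_mult d0, intro differentiable_mult d0, rule refl)
    also have "\<dots> = cov4 g (riem g) m i j k l p
    - (1/2) * (cov2 g (sch g) m j k p * g p $ i $ l - cov2 g (sch g) m i k p * g p $ j $ l
        + g p $ j $ k * cov2 g (sch g) m i l p - g p $ i $ k * cov2 g (sch g) m j l p)"
      by (simp add: cov4_product_jk_il[of "sch g"] cov4_product_ik_jl[of "sch g"]
          cov4_product_jk_il[of "\<lambda>i j x. g x $ i $ j"] cov4_product_ik_jl[of "\<lambda>i j x. g x $ i $ j"] d0 cov2_metric[OF met p])
    finally show ?thesis .
  qed
  have DW: "D m a b c d = Wd m a b c d
      + (1/2) * (E m b c * eta a d - E m a c * eta b d + eta b c * E m a d - eta a c * E m b d)" for m a b c d
    unfolding D_def Wd_def E_def cw Q[symmetric] con4_def con2_def by (simp add: con_simps)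
  have Esym: "E m b c = E m c b" for m b c
  proof -
    have "cov2 g (sch g) m i j p = cov2 g (sch g) m j i p" for m i j
      unfolding cov2_def
      using pd_transform[OF metric_open[OF met] p, of "sch g i j" "sch g j i"] sch_sym[OF met] p by simp
    then show ?thesis unfolding E_def con2_def by (subst con_swap) simp
  qed
  have B: "D m a b c d + D a b m c d + D b m a c d = 0" for m a b c d
  proof -
    let ?T = "\<lambda>m i j. con2 Q (\<lambda>k l. cov4 g (riem g) m i j k l p) c d"
    have 1: "D a b m c d = con Q (\<lambda>x. con Q (\<lambda>i. con Q (\<lambda>j. ?T i j x) b) a) m"
      unfolding D_def con4_def con2_def by (subst (2) con_swap) (rule con_swap)
    have 2: "D b m a c d = con Q (\<lambda>x. con Q (\<lambda>i. con Q (\<lambda>j. ?T j x i) b) a) m"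
      unfolding D_def con4_def con2_def by (subst con_swap, subst (2) con_swap) (rule refl)
    have 3: "D m a b c d = con Q (\<lambda>x. con Q (\<lambda>i. con Q (\<lambda>j. ?T x i j) b) a) m"
      unfolding D_def con4_def con2_def ..
    have "?T x i j + ?T i j x + ?T j x i = 0" for x i j
      using cov4_riem_bianchi2[OF met p, of x i j] unfolding con2_def con_add[symmetric] by (simp add: con_zero)
    then show ?thesis unfolding 1 2 3 con_add[symmetric] by (simp add: con_zero)
  qed
  have Wsd: "selfdual s (Wd m a b)" for m a b
    unfolding Wd_def con_def using selfdual_sum[of s "\<lambda>m. con4 Q (\<lambda>i j k l. cov4 g (weyl g) m i j k l p) a b", OF W] by simp
  have "E a b c - E b a c = cotton a b c" for a b c
  proof -
    have "E b a c = con Q (\<lambda>i. con Q (\<lambda>j. con Q (\<lambda>k. cov2 g (sch g) j i k p) c) b) a"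
      unfolding E_def con2_def by (rule con_swap)
    then show ?thesis unfolding cotton_def E_def con2_def by (simp add: con_simps)
  qed
  then show ?thesis using cotton_selfdual[OF s Esym DW B Wsd, of c] by simp
qed

end

section \<open>The structure equations\<close>

lemma selfdual_diff: "selfdual s V \<Longrightarrow> selfdual s U \<Longrightarrow> selfdual s (\<lambda>a b. V a b - U a b)"
  unfolding selfdual_def by (simp add: algebra_simps)

text \<open>A chart domain with the hypotheses of the theorem, where \<open>\<sigma>\<close> is 1 if \<open>W\<^sup>- = 0\<close> and -1 if
  \<open>W\<^sup>+ = 0\<close>. The determinant is positive because of the signature.\<close>

locale quasi_einstein_chart =
  fixes S :: "(real^4) set" and g :: "4 metric" and f l :: "real^4 \<Rightarrow> real" and \<mu> \<sigma> :: real
  assumes met: "metric_on S g" and fsm: "smooth_on S f" and lsm: "smooth_on S l"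
    and qe: "\<And>x i j. x \<in> S \<Longrightarrow>
      hess g f i j x + ricci g i j x - \<mu> * (pd i f x * pd j f x) = l x * g x $ i $ j"
    and nonnull: "\<And>x. x \<in> S \<Longrightarrow> (\<Sum>i\<in>UNIV. \<Sum>j\<in>UNIV. ginv g i j x * (pd i f x * pd j f x)) \<noteq> 0"
    and det_pos: "\<And>x. x \<in> S \<Longrightarrow> det (g x) > 0"
    and frame: "\<And>x. x \<in> S \<Longrightarrow> \<exists>Q. \<forall>a b. con2 Q (\<lambda>i j. g x $ i $ j) a b = eta a b"
    and sigma: "\<sigma> = 1 \<or> \<sigma> = -1"
    and sd: "\<And>x w. x \<in> S \<Longrightarrow> is_2form w \<Longrightarrow> weyl_op g x w = \<sigma> *\<^sub>R weyl_op g x (hodge g x w)"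
    and mu: "\<mu> \<noteq> - 1 / 2"
begin

lemma open_S: "open S" by (rule metric_open[OF met])

lemmas chart_smooth = lc_smooth[OF met] sch_smooth[OF met] fsm lsm hess_smooth[OF met fsm]

definition gradsq :: "real^4 \<Rightarrow> real" where
  "gradsq x = (\<Sum>i\<in>UNIV. \<Sum>j\<in>UNIV. ginv g i j x * (pd i f x * pd j f x))"

lemma gradsq_smooth: "smooth_on S gradsq"
  unfolding gradsq_def[abs_def] by (intro chart_smooth)

lemma gradsq_nonzero: "x \<in> S \<Longrightarrow> gradsq x \<noteq> 0"
  unfolding gradsq_def by (rule nonnull)

lemma gradsq_frame:
  assumes p: "p \<in> S" and Q: "\<And>a b. con2 Q (\<lambda>i j. g p $ i $ j) a b = eta a b"
  shows "gradsq p = (\<Sum>a\<in>UNIV. eta a a * (con Q (\<lambda>i. pd i f p) a * con Q (\<lambda>i. pd i f p) a))"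
  unfolding gradsq_def frame_trace[OF met p Q] con2_def by (simp add: con_simps)

text \<open>The Ricci identity for \<open>f\<close>, with the Hessian replaced by means of the quasi-Einstein equation,
  gives the equation \<open>key\<close> below. Its right-hand side is selfdual, so that \<open>ricci_eigenvalues\<close> applies to the
  left-hand side; the coefficient there is nonzero because of the condition on \<open>\<mu>\<close>.\<close>

lemma ricci_form:
  assumes p: "p \<in> S"
  obtains x y where "\<And>i j. ricci g i j p = x * g p $ i $ j + y * (pd i f p * pd j f p)"
proof -
  obtain Q where Q: "\<And>a b. con2 Q (\<lambda>i j. g p $ i $ j) a b = eta a b" using frame[OF p] by blast
  note d = smooth_on_differentiable[OF _ p]
  obtain q where q: "q = 1 \<or> q = -1"
    and W: "\<And>a b. selfdual (\<sigma> * q) (con4 Q (\<lambda>i j k l. weyl g i j k l p) a b)"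
    and dW: "\<And>m a b. selfdual (\<sigma> * q) (con4 Q (\<lambda>i j k l. cov4 g (weyl g) m i j k l p) a b)"
    using weyl_selfdual_at[OF met p det_pos sd Q] by blast
  define s where "s = \<sigma> * q"
  have s: "s = 1 \<or> s = -1" using sigma q by (auto simp: s_def)
  define fh where "fh = con Q (\<lambda>i. pd i f p)"
  define Wh where "Wh = con4 Q (\<lambda>i j k l. weyl g i j k l p)"
  define Rh where "Rh = con4 Q (\<lambda>i j k l. riem g i j k l p)"
  define \<rho> where "\<rho> = con2 Q (\<lambda>i j. ricci g i j p)"
  define P where "P = con2 Q (\<lambda>i j. sch g i j p)"
  define C where "C = cotton g p Q"
  define k where "k x = l x - scal g x / 6" for x
  define kd where "kd = con Q (\<lambda>i. pd i k p)"
  define t where "t = scal g p"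
  have Csd: "selfdual s (\<lambda>a b. C a b c)" for c
    unfolding C_def by (rule cotton_selfdual_at[OF met p Q s]) (use dW in \<open>simp add: s_def\<close>)
  have ksm: "smooth_on S k" unfolding k_def[abs_def] by (intro chart_smooth) simp
  have hs: "hess g f i j x = k x * g x $ i $ j - sch g i j x + \<mu> * (pd i f x * pd j f x)" if "x \<in> S" for i j x
    using qe[OF that, of i j] unfolding k_def sch_def by (simp add: algebra_simps)
  have dh: "cov2 g (hess g f) i j m p = pd i k p * g p $ j $ m - cov2 g (sch g) i j m p
      + \<mu> * (hess g f i j p * pd m f p + pd j f p * hess g f i m p)" for i j m
  proof -
    have "cov2 g (hess g f) i j m p
       = cov2 g (\<lambda>i j x. k x * g x $ i $ j + ((-1) * sch g i j x + \<mu> * (pd i f x * pd j f x))) i j m p"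
      by (rule cov2_cong[OF open_S p]) (simp add: hs)
    also have "\<dots> = cov2 g (\<lambda>i j x. k x * g x $ i $ j) i j m p + (cov2 g (\<lambda>i j x. (-1) * sch g i j x) i j m p
       + cov2 g (\<lambda>i j x. \<mu> * (pd i f x * pd j f x)) i j m p)"
      by (subst cov2_add, (intro d chart_smooth ksm smooth_on_const)+, subst cov2_add, (intro d chart_smooth ksm smooth_on_const)+, rule refl)
    also have "\<dots> = pd i k p * g p $ j $ m - cov2 g (sch g) i j m p
      + \<mu> * (hess g f i j p * pd m f p + pd j f p * hess g f i m p)"
      by (subst cov2_scalar, intro d ksm, intro d chart_smooth,
          subst cov2_scalar, simp, intro d chart_smooth,
          subst cov2_scalar, simp, intro d chart_smooth,
          subst cov2_gradient_square, intro d chart_smooth)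
         (simp add: cov2_metric[OF met p])
    finally show ?thesis .
  qed
  have id: "kd a * eta b c - kd b * eta a c - C a b c + \<mu> * (fh b * con2 Q (\<lambda>i j. hess g f i j p) a c - fh a * con2 Q (\<lambda>i j. hess g f i j p) b c)
     = - (\<Sum>e\<in>UNIV. eta e e * (Rh a b c e * fh e))" for a b c
  proof -
    have "pd i k p * g p $ j $ m - pd j k p * g p $ i $ m - (cov2 g (sch g) i j m p - cov2 g (sch g) j i m p)
       + \<mu> * (pd j f p * hess g f i m p - pd i f p * hess g f j m p) = - (\<Sum>e\<in>UNIV. riem_up g e m i j p * pd e f p)" for i j m
      using ricci_identity[OF met p fsm, of i j m] unfolding dh
      by (simp add: hess_sym[OF met p fsm, of j i] algebra_simps)
    then have "con Q (\<lambda>i. con Q (\<lambda>j. con Q (\<lambda>m. pd i k p * g p $ j $ m - pd j k p * g p $ i $ m - (cov2 g (sch g) i j m p - cov2 g (sch g) j i m p)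
       + \<mu> * (pd j f p * hess g f i m p - pd i f p * hess g f j m p)) c) b) a
      = con Q (\<lambda>i. con Q (\<lambda>j. con Q (\<lambda>m. - (\<Sum>e\<in>UNIV. riem_up g e m i j p * pd e f p)) c) b) a"
      by simp
    then show ?thesis
      unfolding con_minus con3_riem_up[OF met p Q] Rh_def[symmetric] fh_def[symmetric]
      unfolding con_add con_diff cotton_def[OF met p Q] C_def
      unfolding con_simps
      by (simp add: con_simps Q[symmetric] con2_def kd_def fh_def)
  qed
  have hh: "con2 Q (\<lambda>i j. hess g f i j p) a b = l p * eta a b - \<rho> a b + \<mu> * (fh a * fh b)" for a b
  proof -
    have "hess g f i j p = l p * g p $ i $ j - ricci g i j p + \<mu> * (pd i f p * pd j f p)" for i j
      using qe[OF p, of i j] by simp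
    then show ?thesis unfolding \<rho>_def fh_def Q[symmetric] con2_def by (simp add: con_simps)
  qed
  have Ph: "P a b = \<rho> a b - t / 6 * eta a b" for a b
    unfolding P_def \<rho>_def sch_def t_def Q[symmetric] con2_def by (simp add: con_simps)
  have Wc: "Wh a b c e = Rh a b c e - (1/2) * (P b c * eta a e - P a c * eta b e + eta b c * P a e - eta a c * P b e)" for a b c e
    unfolding Wh_def Rh_def P_def by (rule con4_weyl[OF met p Q])
  define r where "r a = (\<Sum>e\<in>UNIV. eta e e * (P a e * fh e))" for a
  define Wf where "Wf a b c = (\<Sum>e\<in>UNIV. eta e e * (Wh a b c e * fh e))" for a b c
  have fe: "(\<Sum>c\<in>UNIV. eta c c * (eta a c * fh c)) = fh a" for a
    using sum_eta_left[of a fh] by (simp add: eta_sym)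
  have Rf: "(\<Sum>e\<in>UNIV. eta e e * (Rh a b c e * fh e))
     = Wf a b c + (1/2) * (P b c * fh a - P a c * fh b + eta b c * r a - eta a c * r b)" for a b c
  proof -
    have "Wf a b c = (\<Sum>e\<in>UNIV. eta e e * (Rh a b c e * fh e)) - (1/2) *
       (P b c * (\<Sum>e\<in>UNIV. eta e e * (eta a e * fh e)) - P a c * (\<Sum>e\<in>UNIV. eta e e * (eta b e * fh e)) + eta b c * r a - eta a c * r b)"
      unfolding Wf_def Wc r_def by (simp add: sum_4 algebra_simps)
    then show ?thesis unfolding fe by simp
  qed
  define v where "v a = kd a - \<mu> * l p * fh a - t / 12 * fh a + r a / 2" for a
  have key: "(\<mu> + 1/2) * (fh a * \<rho> b c - fh b * \<rho> a c) + v a * eta b c - v b * eta a c = C a b c - Wf a b c" for a b c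
    using id[of a b c] unfolding hh Rf Ph v_def by (simp add: field_simps)
  have Wfsd: "selfdual s (\<lambda>a b. Wf a b c)" for c
  proof -
    have "selfdual s (\<lambda>a b. \<Sum>e\<in>UNIV. (eta e e * fh e) * Wh c e a b)"
      by (rule selfdual_sum) (use W in \<open>simp add: Wh_def s_def\<close>)
    then show ?thesis unfolding Wf_def Wh_def by (subst con4_weyl_pair[OF met p Q]) (simp add: mult_ac)
  qed
  have "\<rho> a b = \<rho> b a" for a b
    unfolding \<rho>_def con2_def by (subst con_swap) (simp add: ricci_sym[OF met p])
  moreover have "\<mu> + 1/2 \<noteq> 0" using mu by simp
  moreover have "(\<Sum>b\<in>UNIV. eta b b * (fh b * fh b)) \<noteq> 0"
    using gradsq_nonzero[OF p] gradsq_frame[OF p Q] by (simp add: fh_def)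
  moreover have "selfdual s (\<lambda>a b. (\<mu> + 1/2) * (fh a * \<rho> b c - fh b * \<rho> a c) + v a * eta b c - v b * eta a c)" for c
    unfolding key by (rule selfdual_diff[OF Csd Wfsd])
  ultimately obtain x y where xy: "\<And>a b. \<rho> a b = x * eta a b + y * (fh a * fh b)"
    using ricci_eigenvalues[OF s, of \<rho> "\<mu> + 1/2" fh v] by blast
  have "ricci g i j p = x * g p $ i $ j + y * (pd i f p * pd j f p)" for i j
  proof (rule con2_inject[OF met p Q])
    fix a b
    show "con2 Q (\<lambda>i j. ricci g i j p) a b = con2 Q (\<lambda>i j. x * g p $ i $ j + y * (pd i f p * pd j f p)) a b"
      using xy[of a b] unfolding \<rho>_def fh_def Q[symmetric] con2_def by (simp add: con_simps)
  qed
  then show ?thesis using that by blast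
qed

text \<open>The components of the gradient of \<open>f\<close>.\<close>

definition fup :: "4 \<Rightarrow> real^4 \<Rightarrow> real" where
  "fup i x = (\<Sum>j\<in>UNIV. ginv g i j x * pd j f x)"

text \<open>The coefficients in \<open>ricci_form\<close>, solved from the scalar curvature and the Ricci curvature of the
  gradient. Unlike the coefficients obtained pointwise, they are visibly smooth.\<close>

definition ric_y :: "real^4 \<Rightarrow> real" where
  "ric_y x = (4 * (\<Sum>i\<in>UNIV. \<Sum>j\<in>UNIV. fup i x * (fup j x * ricci g i j x)) / gradsq x - scal g x) / (3 * gradsq x)"

definition ric_x :: "real^4 \<Rightarrow> real" where
  "ric_x x = (scal g x - ric_y x * gradsq x) / 4"

lemma fup_smooth: "smooth_on S (fup i)"
  unfolding fup_def[abs_def] by (intro chart_smooth)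

lemma ric_y_smooth: "smooth_on S ric_y"
  unfolding ric_y_def[abs_def] using gradsq_nonzero
  by (intro chart_smooth fup_smooth gradsq_smooth) auto

lemma ric_x_smooth: "smooth_on S ric_x"
  unfolding ric_x_def[abs_def] by (intro chart_smooth ric_y_smooth gradsq_smooth) auto

lemma lower_fup: "x \<in> S \<Longrightarrow> (\<Sum>j\<in>UNIV. g x $ i $ j * fup j x) = pd i f x"
  unfolding fup_def by (rule metric_ginv_contract[OF met])

lemma fup_grad: "(\<Sum>i\<in>UNIV. fup i x * pd i f x) = gradsq x"
  unfolding fup_def gradsq_def by (simp only: sum_distrib_right) (simp add: mult_ac)

lemma ricci_eq:
  assumes p: "p \<in> S"
  shows "ricci g i j p = ric_x p * g p $ i $ j + ric_y p * (pd i f p * pd j f p)"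
proof -
  obtain x y where xy: "\<And>i j. ricci g i j p = x * g p $ i $ j + y * (pd i f p * pd j f p)"
    using ricci_form[OF p] by blast
  have tr: "(\<Sum>i\<in>UNIV. \<Sum>j\<in>UNIV. ginv g i j p * g p $ i $ j) = 4"
  proof -
    have "(\<Sum>j\<in>UNIV. ginv g i j p * g p $ i $ j) = 1" for i
      using ginv_metric[OF met p, of i i] by (simp add: metric_sym[OF met p, of i])
    then show ?thesis by simp
  qed
  have "scal g p = x * (\<Sum>i\<in>UNIV. \<Sum>j\<in>UNIV. ginv g i j p * g p $ i $ j) + y * gradsq p"
    unfolding scal_def xy gradsq_def
    by (simp add: sum_distrib_left distrib_left sum.distrib mult_ac)
  then have sc: "scal g p = 4 * x + y * gradsq p" unfolding tr by simp
  have "(\<Sum>i\<in>UNIV. \<Sum>j\<in>UNIV. fup i p * (fup j p * ricci g i j p))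
     = x * (\<Sum>i\<in>UNIV. fup i p * (\<Sum>j\<in>UNIV. g p $ i $ j * fup j p))
       + y * ((\<Sum>i\<in>UNIV. fup i p * pd i f p) * (\<Sum>j\<in>UNIV. fup j p * pd j f p))"
    unfolding xy sum_product by (simp add: sum_distrib_left distrib_left sum.distrib mult_ac)
  then have rf: "(\<Sum>i\<in>UNIV. \<Sum>j\<in>UNIV. fup i p * (fup j p * ricci g i j p)) = x * gradsq p + y * (gradsq p * gradsq p)"
    unfolding lower_fup[OF p] fup_grad .
  have "ric_y p = y" unfolding ric_y_def rf sc using gradsq_nonzero[OF p] by (simp add: field_simps)
  moreover from this have "ric_x p = x" unfolding ric_x_def sc by simp
  ultimately show ?thesis using xy by simp
qed

text \<open>The coefficients of \<open>g\<close> and \<open>df \<otimes> df\<close> in the Hessian, and the coefficient of \<open>g\<close> in the tensor \<open>sch\<close>.\<close>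

definition ca :: "real^4 \<Rightarrow> real" where "ca x = l x - ric_x x"
definition cb :: "real^4 \<Rightarrow> real" where "cb x = \<mu> - ric_y x"
definition curv :: "real^4 \<Rightarrow> real" where "curv x = ric_x x / 3 - ric_y x * gradsq x / 6"

lemma ca_smooth: "smooth_on S ca"
  unfolding ca_def[abs_def] by (intro chart_smooth ric_x_smooth)

lemma cb_smooth: "smooth_on S cb"
  unfolding cb_def[abs_def] by (intro chart_smooth ric_y_smooth)

lemma curv_smooth: "smooth_on S curv"
  unfolding curv_def[abs_def] by (intro chart_smooth ric_x_smooth ric_y_smooth gradsq_smooth) auto

lemma hess_eq: "x \<in> S \<Longrightarrow> hess g f i j x = ca x * g x $ i $ j + cb x * (pd i f x * pd j f x)"
  using qe[of x i j] ricci_eq[of x i j] unfolding ca_def cb_def by (simp add: algebra_simps)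

lemma sch_eq: "x \<in> S \<Longrightarrow> sch g i j x = curv x * g x $ i $ j + ric_y x * (pd i f x * pd j f x)"
  unfolding sch_def curv_def using ricci_eq[of x i j] by (simp add: ric_x_def field_simps)

lemma cov2_structure:
  assumes p: "p \<in> S" and A: "smooth_on S A" and B: "smooth_on S B"
    and T: "\<And>x i j. x \<in> S \<Longrightarrow> T i j x = A x * g x $ i $ j + B x * (pd i f x * pd j f x)"
  shows "cov2 g T i j m p = pd i A p * g p $ j $ m + pd i B p * (pd j f p * pd m f p)
    + B p * (hess g f i j p * pd m f p + pd j f p * hess g f i m p)"
proof -
  note d = smooth_on_differentiable[OF _ p]
  have "cov2 g T i j m p = cov2 g (\<lambda>i j x. A x * g x $ i $ j + B x * (pd i f x * pd j f x)) i j m p"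
    by (rule cov2_cong[OF open_S p]) (rule T)
  also have "\<dots> = cov2 g (\<lambda>i j x. A x * g x $ i $ j) i j m p + cov2 g (\<lambda>i j x. B x * (pd i f x * pd j f x)) i j m p"
    by (subst cov2_add, (intro d chart_smooth A B)+, rule refl)
  also have "\<dots> = pd i A p * g p $ j $ m + pd i B p * (pd j f p * pd m f p)
    + B p * (hess g f i j p * pd m f p + pd j f p * hess g f i m p)"
    by (subst cov2_scalar, intro d A, intro d chart_smooth, subst cov2_scalar, intro d B, intro d chart_smooth,
        subst cov2_gradient_square, intro d chart_smooth) (simp add: cov2_metric[OF met p])
  finally show ?thesis .
qed

lemma cov2_hess:
  assumes p: "p \<in> S"
  shows "cov2 g (hess g f) i j m p = pd i ca p * g p $ j $ m + pd i cb p * (pd j f p * pd m f p)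
    + cb p * (hess g f i j p * pd m f p + pd j f p * hess g f i m p)"
  by (rule cov2_structure[OF p ca_smooth cb_smooth]) (rule hess_eq)

lemma cov2_sch:
  assumes p: "p \<in> S"
  shows "cov2 g (sch g) i j m p = pd i curv p * g p $ j $ m + pd i ric_y p * (pd j f p * pd m f p)
    + ric_y p * (hess g f i j p * pd m f p + pd j f p * hess g f i m p)"
  by (rule cov2_structure[OF p curv_smooth ric_y_smooth]) (rule sch_eq)

text \<open>The Ricci identity for a Hessian \<open>a g + b df \<otimes> df\<close> expresses the curvature contracted with the
  gradient by \<open>da\<close> and \<open>db\<close>. Its trace is a Ricci curvature and is known, so that it is determined
  completely, and the Weyl tensor vanishes by \<open>weyl_vanishes\<close>.\<close>

lemma ca_derivative_and_weyl:
  assumes p: "p \<in> S"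
  shows "pd i ca p = (ca p * cb p - (ric_x p + ric_y p * gradsq p) / 3) * pd i f p"
    and "weyl g i j k m p = 0"
proof -
  obtain Q where Q: "\<And>a b. con2 Q (\<lambda>i j. g p $ i $ j) a b = eta a b" using frame[OF p] by blast
  obtain q where q: "q = 1 \<or> q = -1"
    and W: "\<And>a b. selfdual (\<sigma> * q) (con4 Q (\<lambda>i j k l. weyl g i j k l p) a b)"
    and "\<And>m a b. selfdual (\<sigma> * q) (con4 Q (\<lambda>i j k l. cov4 g (weyl g) m i j k l p) a b)"
    using weyl_selfdual_at[OF met p det_pos sd Q] by blast
  have s: "\<sigma> * q = 1 \<or> \<sigma> * q = -1" using sigma q by auto
  define fh where "fh = con Q (\<lambda>i. pd i f p)"
  define Rh where "Rh = con4 Q (\<lambda>i j k l. riem g i j k l p)"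
  define n where "n = gradsq p"
  have n: "n = (\<Sum>b\<in>UNIV. eta b b * (fh b * fh b))" "n \<noteq> 0"
    using gradsq_frame[OF p Q] gradsq_nonzero[OF p] by (auto simp: n_def fh_def)
  define Z where "Z a b c = (\<Sum>e\<in>UNIV. eta e e * (Rh a b c e * fh e))" for a b c
  have id: "con Q (\<lambda>i. pd i ca p) a * eta b c - con Q (\<lambda>i. pd i ca p) b * eta a c
      + (con Q (\<lambda>i. pd i cb p) a * fh b - con Q (\<lambda>i. pd i cb p) b * fh a) * fh c
      + ca p * cb p * (fh b * eta a c - fh a * eta b c) = - Z a b c" for a b c
  proof -
    have "pd i ca p * g p $ j $ m - pd j ca p * g p $ i $ m + (pd i cb p * pd j f p - pd j cb p * pd i f p) * pd m f p
       + ca p * cb p * (pd j f p * g p $ i $ m - pd i f p * g p $ j $ m) = - (\<Sum>e\<in>UNIV. riem_up g e m i j p * pd e f p)" for i j m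
      using ricci_identity[OF met p fsm, of i j m]
      unfolding cov2_hess[OF p] hess_eq[OF p]
      by (simp add: metric_sym[OF met p, of j i] algebra_simps)
    then have "con Q (\<lambda>i. con Q (\<lambda>j. con Q (\<lambda>m. pd i ca p * g p $ j $ m - pd j ca p * g p $ i $ m + (pd i cb p * pd j f p - pd j cb p * pd i f p) * pd m f p
       + ca p * cb p * (pd j f p * g p $ i $ m - pd i f p * g p $ j $ m)) c) b) a
      = con Q (\<lambda>i. con Q (\<lambda>j. con Q (\<lambda>m. - (\<Sum>e\<in>UNIV. riem_up g e m i j p * pd e f p)) c) b) a"
      by simp
    then show ?thesis
      unfolding con_minus con3_riem_up[OF met p Q] Rh_def[symmetric] fh_def[symmetric] Z_def
      by (simp add: con_simps Q[symmetric] con2_def fh_def)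
  qed
  have Zf: "(\<Sum>c\<in>UNIV. eta c c * (Z a b c * fh c)) = 0" for a b
  proof -
    have "Rh a b c e = - Rh a b e c" for c e unfolding Rh_def by (rule con4_riem_antisym34[OF met p Q])
    note an = this[of 2 1] this[of 3 1] this[of 4 1] this[of 3 2] this[of 4 2] this[of 4 3]
    have dd: "Rh a b c c = 0" for c using \<open>\<And>e c. Rh a b c e = - Rh a b e c\<close>[of c c] by simp
    show ?thesis unfolding Z_def by (simp add: sum_4 dd an algebra_simps)
  qed
  have Ztr: "(\<Sum>b\<in>UNIV. eta b b * Z a b b) = (ric_x p + ric_y p * n) * fh a" for a
  proof -
    have "(\<Sum>b\<in>UNIV. eta b b * Z a b b) = (\<Sum>e\<in>UNIV. eta e e * ((\<Sum>b\<in>UNIV. eta b b * Rh a b b e) * fh e))"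
      unfolding Z_def by (simp add: sum_4 algebra_simps)
    also have "\<dots> = (\<Sum>e\<in>UNIV. eta e e * ((ric_x p * eta a e + ric_y p * (fh a * fh e)) * fh e))"
      unfolding Rh_def con4_riem_trace[OF met p Q] ricci_eq[OF p] fh_def
      unfolding con2_def by (simp add: con_simps Q[symmetric, unfolded con2_def])
    also have "\<dots> = ric_x p * (\<Sum>e\<in>UNIV. eta e e * (eta e a * fh e)) + ric_y p * fh a * n"
      unfolding n(1) by (simp add: sum_4 algebra_simps eta_sym)
    finally show ?thesis unfolding sum_eta_left by (simp add: algebra_simps)
  qed
  have nz: "(\<Sum>b\<in>UNIV. eta b b * (fh b * fh b)) \<noteq> 0" using n by simp
  note cc = codazzi_coefficients[OF nz id Zf Ztr]
  show "pd i ca p = (ca p * cb p - (ric_x p + ric_y p * gradsq p) / 3) * pd i f p"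
  proof (rule con_inject[OF met p Q])
    fix a show "con Q (\<lambda>i. pd i ca p) a = con Q (\<lambda>i. (ca p * cb p - (ric_x p + ric_y p * gradsq p) / 3) * pd i f p) a"
      using cc(1)[of a] unfolding con_cmult fh_def n_def .
  qed
  define Wh where "Wh = con4 Q (\<lambda>i j k l. weyl g i j k l p)"
  define P where "P = con2 Q (\<lambda>i j. sch g i j p)"
  have "Wh a b c e = 0" for a b c e
  proof (rule weyl_vanishes[OF s n, of Wh Rh P "ric_x p" "ric_y p"])
    show "selfdual (\<sigma> * q) (Wh a b)" for a b unfolding Wh_def by (rule W)
    show "Wh a b c d = - Wh a b d c" for a b c d unfolding Wh_def by (rule con4_weyl_antisym34[OF met p Q])
    show "Wh a b c d = Rh a b c d - 1 / 2 * (P b c * eta a d - P a c * eta b d + eta b c * P a d - eta a c * P b d)" for a b c d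
      unfolding Wh_def Rh_def P_def by (rule con4_weyl[OF met p Q])
    show "P a b = (ric_x p / 3 - ric_y p * n / 6) * eta a b + ric_y p * (fh a * fh b)" for a b
      unfolding P_def sch_eq[OF p] curv_def n_def[symmetric] fh_def con2_def by (simp add: con_simps Q[symmetric, unfolded con2_def])
    show "(\<Sum>d\<in>UNIV. eta d d * (Rh a b c d * fh d)) = (ric_x p + ric_y p * n) / 3 * (fh a * eta b c - fh b * eta a c)" for a b c
      using cc(2)[of a b c] unfolding Z_def .
  qed
  moreover have "con4 Q (\<lambda>i j k l. 0) a b c e = 0" for a b c e
    by (simp add: con4_def con2_def con_zero)
  ultimately have "con4 Q (\<lambda>i j k l. weyl g i j k l p) a b c e = con4 Q (\<lambda>i j k l. 0) a b c e" for a b c e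
    by (simp add: Wh_def)
  then show "weyl g i j k m p = 0"
    by (rule con4_inject[OF met p Q, of "\<lambda>i j k l. weyl g i j k l p" "\<lambda>i j k l. 0"])
qed

text \<open>The Weyl tensor is zero, and so is its covariant derivative. Hence the Cotton tensor is selfdual
  for both signs, which makes it vanish.\<close>

lemma curv_derivative:
  assumes p: "p \<in> S" shows "pd i curv p = ric_y p * ca p * pd i f p"
proof -
  obtain Q where Q: "\<And>a b. con2 Q (\<lambda>i j. g p $ i $ j) a b = eta a b" using frame[OF p] by blast
  define fh where "fh = con Q (\<lambda>i. pd i f p)"
  have dW: "cov4 g (weyl g) m i j k l p = 0" for m i j k l
  proof -
    have "cov4 g (weyl g) m i j k l p = cov4 g (\<lambda>i j k l x. 0) m i j k l p"
      by (rule cov4_cong[OF open_S p]) (rule ca_derivative_and_weyl(2))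
    then show ?thesis by (simp add: cov4_def)
  qed
  have "selfdual s (\<lambda>a b. cotton g p Q a b c)" if "s = 1 \<or> s = -1" for s c
    by (rule cotton_selfdual_at[OF met p Q that]) (simp add: dW con4_def con2_def con_zero selfdual_def)
  from this[of 1] this[of "-1"]
  have C: "cotton g p Q 1 2 c = 0" "cotton g p Q 1 3 c = 0" "cotton g p Q 1 4 c = 0"
     "cotton g p Q 2 3 c = 0" "cotton g p Q 2 4 c = 0" "cotton g p Q 3 4 c = 0" for c
    by (force simp: selfdual_def)+
  have form: "cotton g p Q a b c = con Q (\<lambda>i. pd i curv p) a * eta b c - con Q (\<lambda>i. pd i curv p) b * eta a c
      + (con Q (\<lambda>i. pd i ric_y p) a * fh b - con Q (\<lambda>i. pd i ric_y p) b * fh a) * fh c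
      + ric_y p * ca p * (fh b * eta a c - fh a * eta b c)" for a b c
  proof -
    have "cov2 g (sch g) i j m p - cov2 g (sch g) j i m p
       = pd i curv p * g p $ j $ m - pd j curv p * g p $ i $ m + (pd i ric_y p * pd j f p - pd j ric_y p * pd i f p) * pd m f p
       + ric_y p * ca p * (pd j f p * g p $ i $ m - pd i f p * g p $ j $ m)" for i j m
      unfolding cov2_sch[OF p] hess_eq[OF p]
      by (simp add: metric_sym[OF met p, of j i] algebra_simps)
    then show ?thesis unfolding cotton_def[OF met p Q]
      by (simp add: con_simps Q[symmetric] con2_def fh_def)
  qed
  have anti: "cotton g p Q a b c = - cotton g p Q b a c" for a b c
    unfolding form by (simp add: algebra_simps)
  have "\<forall>a b. cotton g p Q a b c = 0" for c
    using C anti[of 2 1 c] anti[of 3 1 c] anti[of 4 1 c] anti[of 3 2 c] anti[of 4 2 c] anti[of 4 3 c]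
      anti[of 1 1 c] anti[of 2 2 c] anti[of 3 3 c] anti[of 4 4 c] by (simp add: forall_4)
  then have id: "con Q (\<lambda>i. pd i curv p) a * eta b c - con Q (\<lambda>i. pd i curv p) b * eta a c
      + (con Q (\<lambda>i. pd i ric_y p) a * fh b - con Q (\<lambda>i. pd i ric_y p) b * fh a) * fh c
      + ric_y p * ca p * (fh b * eta a c - fh a * eta b c) = - (\<lambda>a b c. 0) a b c" for a b c
    using form[of a b c] by simp
  have nz: "(\<Sum>b\<in>UNIV. eta b b * (fh b * fh b)) \<noteq> 0"
    using gradsq_nonzero[OF p] gradsq_frame[OF p Q] by (simp add: fh_def)
  have "con Q (\<lambda>i. pd i curv p) a = (ric_y p * ca p - 0 / 3) * fh a" for a
    by (rule codazzi_coefficients(1)[OF nz, of "con Q (\<lambda>i. pd i curv p)" "con Q (\<lambda>i. pd i ric_y p)" "ric_y p * ca p" "\<lambda>a b c. 0" 0])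
       (use id in simp_all)
  then have "con Q (\<lambda>i. pd i curv p) a = con Q (\<lambda>i. ric_y p * ca p * pd i f p) a" for a
    by (simp add: con_cmult fh_def)
  then show ?thesis
    by (rule con_inject[OF met p Q, of "\<lambda>i. pd i curv p" "\<lambda>i. ric_y p * ca p * pd i f p"])
qed

lemma riem_eq:
  assumes p: "p \<in> S"
  shows "riem g i j k m p = (1/2) * (sch g j k p * g p $ i $ m - sch g i k p * g p $ j $ m + g p $ j $ k * sch g i m p - g p $ i $ k * sch g j m p)"
  using ca_derivative_and_weyl(2)[OF p, of i j k m] unfolding weyl_sch by simp

lemma gradsq_derivative:
  assumes p: "p \<in> S" shows "pd k gradsq p = 2 * (ca p + cb p * gradsq p) * pd k f p"
proof -
  note d = smooth_on_differentiable[OF _ p]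
  let ?G = "\<lambda>a b c. christoffel g a b c p"
  define U where "U = (\<Sum>i\<in>UNIV. \<Sum>j\<in>UNIV. \<Sum>q\<in>UNIV. ?G i k q * (ginv g q j p * (pd i f p * pd j f p)))"
  have "pd k gradsq p = (\<Sum>i\<in>UNIV. \<Sum>j\<in>UNIV. pd k (\<lambda>x. ginv g i j x * (pd i f x * pd j f x)) p)"
    unfolding gradsq_def[abs_def]
    by (subst pd_sum, (intro d chart_smooth), intro sum.cong refl pd_sum) (intro d chart_smooth)
  also have "\<dots> = (\<Sum>i\<in>UNIV. \<Sum>j\<in>UNIV. pd k (ginv g i j) p * (pd i f p * pd j f p)
      + ginv g i j p * (pd k (pd i f) p * pd j f p) + ginv g i j p * (pd i f p * pd k (pd j f) p))"
    by (intro sum.cong refl, subst pd_mult, (intro d chart_smooth)+, subst pd_mult, (intro d chart_smooth)+) (simp add: algebra_simps)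
  also have "\<dots> = (\<Sum>i\<in>UNIV. \<Sum>j\<in>UNIV. pd k (ginv g i j) p * (pd i f p * pd j f p))
      + 2 * (\<Sum>i\<in>UNIV. pd k (pd i f) p * fup i p)"
  proof -
    have "(\<Sum>i\<in>UNIV. \<Sum>j\<in>UNIV. ginv g i j p * (pd i f p * pd k (pd j f) p)) = (\<Sum>i\<in>UNIV. \<Sum>j\<in>UNIV. ginv g i j p * (pd k (pd i f) p * pd j f p))"
      by (subst sum.swap) (simp add: ginv_sym[OF met p] mult_ac)
    then show ?thesis unfolding fup_def by (simp add: sum.distrib sum_distrib_left mult_ac)
  qed
  also have "(\<Sum>i\<in>UNIV. \<Sum>j\<in>UNIV. pd k (ginv g i j) p * (pd i f p * pd j f p)) = - 2 * (\<Sum>i\<in>UNIV. (\<Sum>q\<in>UNIV. ?G q k i * pd q f p) * fup i p)"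
  proof -
    have e: "(\<Sum>i\<in>UNIV. (\<Sum>q\<in>UNIV. ?G q k i * pd q f p) * fup i p) = U"
      unfolding U_def fup_def sum_4 by (simp add: algebra_simps)
    have "(\<Sum>i\<in>UNIV. \<Sum>j\<in>UNIV. pd k (ginv g i j) p * (pd i f p * pd j f p))
       = - U - (\<Sum>i\<in>UNIV. \<Sum>j\<in>UNIV. \<Sum>q\<in>UNIV. ?G j k q * (ginv g i q p * (pd i f p * pd j f p)))"
      unfolding pd_ginv[OF met p] U_def
      by (simp only: left_diff_distrib mult_minus_left sum_subtractf sum_negf sum_distrib_right) (simp add: mult_ac)
    also have "(\<Sum>i\<in>UNIV. \<Sum>j\<in>UNIV. \<Sum>q\<in>UNIV. ?G j k q * (ginv g i q p * (pd i f p * pd j f p))) = U"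
      unfolding U_def by (subst sum.swap) (simp add: ginv_sym[OF met p] mult_ac)
    finally show ?thesis unfolding e by simp
  qed
  also have "- 2 * (\<Sum>i\<in>UNIV. (\<Sum>q\<in>UNIV. ?G q k i * pd q f p) * fup i p) + 2 * (\<Sum>i\<in>UNIV. pd k (pd i f) p * fup i p)
      = 2 * (\<Sum>i\<in>UNIV. hess g f k i p * fup i p)"
    unfolding hess_def by (simp add: left_diff_distrib sum_subtractf)
  also have "(\<Sum>i\<in>UNIV. hess g f k i p * fup i p) = ca p * (\<Sum>i\<in>UNIV. g p $ k $ i * fup i p) + cb p * pd k f p * (\<Sum>i\<in>UNIV. fup i p * pd i f p)"
    unfolding hess_eq[OF p] by (simp only: distrib_right sum.distrib sum_distrib_left) (simp add: mult_ac)
  finally show ?thesis unfolding lower_fup[OF p] fup_grad by (simp add: algebra_simps)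
qed

end

section \<open>Functions on the fibre\<close>

lemma pd_pair_components:
  fixes F :: "real^'n \<Rightarrow> real \<times> (real^'m)"
  assumes "F differentiable (at x)"
  shows "pd i (\<lambda>x. fst (F x)) x = fst (frechet_derivative F (at x) (axis i 1))"
    "pd i (\<lambda>x. snd (F x) $ k) x = snd (frechet_derivative F (at x) (axis i 1)) $ k"
proof -
  note d = differentiable_imp_has_derivative[OF assms]
  show "pd i (\<lambda>x. fst (F x)) x = fst (frechet_derivative F (at x) (axis i 1))"
    by (rule has_derivative_imp_pd[OF has_derivative_fst[OF d]])
  show "pd i (\<lambda>x. snd (F x) $ k) x = snd (frechet_derivative F (at x) (axis i 1)) $ k"
    by (rule has_derivative_imp_pd[OF bounded_linear.has_derivative[OF bounded_linear_vec_nth has_derivative_snd[OF d]]])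
qed

text \<open>The polynomial identity behind the flatness of the connection \<open>fibre_conn\<close> below. All tensor
  components are variables: \<open>N\<close> is the square of the gradient and \<open>w\<close> its inverse, \<open>q\<close> and \<open>kk\<close> are the
  functions \<open>slope\<close> and \<open>fcurv\<close>, \<open>q'\<close> is the derivative of \<open>q\<close>, \<open>b\<close> is a covector, the names beginning with \<open>G\<close> are
  contractions of the Christoffel symbols, and \<open>X1 - X2\<close> is the curvature term.\<close>

lemma fibre_flatness_identity:
  fixes w N :: real
  assumes wN: "w * N = 1" and X: "X1 - X2 = (kk - q * q * N) * (gjk * bi - gik * bj) + y / 2 * fk * (fj * bi - fi * bj)"
    and q': "q' = w * (q * N * cb - (kk - q * q * N) - y * N / 2) - 2 * q * w * (q * N + cb * N)"
  shows "X1 - kk * B * (GGjki - fi * Gfjk * w) - q * (fi * Gbjk + bi * Gfjk)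
      - (- 2 * q * kk * fi * (gjk - fj * fk * w)
          + kk * (GGijk + GGikj - ((q * N * gij + cb * (fi * fj) + Gfij) * fk + fj * (q * N * gik + cb * (fi * fk) + Gfik)) * w
             + fj * fk * (2 * (q * N + cb * N) * fi) * (w * w))) * B
      - (q' * fi * fj + q * (q * N * gij + cb * (fi * fj) + Gfij)) * bk
      - (q' * fi * fk + q * (q * N * gik + cb * (fi * fk) + Gfik)) * bj
      - kk * bi * (gjk - fj * fk * w)
      - q * (fj * (Gbik - kk * B * (gik - fi * fk * w) - q * (fi * bk + fk * bi))
           + fk * (Gbij - kk * B * (gij - fi * fj * w) - q * (fi * bj + fj * bi)))
    = X2 - kk * B * (GGikj - fj * Gfik * w) - q * (fj * Gbik + bj * Gfik)
      - (- 2 * q * kk * fj * (gik - fi * fk * w)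
          + kk * (GGijk + GGjki - ((q * N * gij + cb * (fj * fi) + Gfij) * fk + fi * (q * N * gjk + cb * (fj * fk) + Gfjk)) * w
             + fi * fk * (2 * (q * N + cb * N) * fj) * (w * w))) * B
      - (q' * fj * fi + q * (q * N * gij + cb * (fj * fi) + Gfij)) * bk
      - (q' * fj * fk + q * (q * N * gjk + cb * (fj * fk) + Gfjk)) * bi
      - kk * bj * (gik - fi * fk * w)
      - q * (fi * (Gbjk - kk * B * (gjk - fj * fk * w) - q * (fj * bk + fk * bj))
           + fk * (Gbij - kk * B * (gij - fi * fj * w) - q * (fj * bi + fi * bj)))"
proof -
  have X1: "X1 = X2 + ((kk - q * q * N) * (gjk * bi - gik * bj) + y / 2 * fk * (fj * bi - fi * bj))" using X by simp
  have w0: "w \<noteq> 0" using wN by auto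
  then have N: "N = 1 / w" "w \<noteq> 0" using wN by (simp_all add: nonzero_eq_divide_eq mult.commute)
  show ?thesis unfolding X1 q' N(1) using N(2) by (simp add: field_simps)
qed

context quasi_einstein_chart
begin

text \<open>The level sets of \<open>f\<close> are umbilical: \<open>slope df\<close> is the logarithmic differential of the function
  that scales the metrics \<open>proj\<close> induced on them, and by the Gauss equation \<open>fcurv\<close> is their
  sectional curvature.\<close>

definition slope :: "real^4 \<Rightarrow> real" where "slope x = ca x / gradsq x"
definition fcurv :: "real^4 \<Rightarrow> real" where "fcurv x = curv x + (ca x)\<^sup>2 / gradsq x"
definition proj :: "4 \<Rightarrow> 4 \<Rightarrow> real^4 \<Rightarrow> real" where
  "proj i j x = g x $ i $ j - pd i f x * pd j f x * inverse (gradsq x)"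

lemma slope_smooth: "smooth_on S slope"
  unfolding slope_def[abs_def] by (intro smooth_on_divide open_S ca_smooth gradsq_smooth gradsq_nonzero)

lemma fcurv_smooth: "smooth_on S fcurv"
  unfolding fcurv_def[abs_def]
  by (intro smooth_on_add smooth_on_divide smooth_on_power open_S curv_smooth ca_smooth gradsq_smooth gradsq_nonzero)

lemma inverse_gradsq_smooth: "smooth_on S (\<lambda>x. inverse (gradsq x))"
  by (intro smooth_on_inverse open_S gradsq_smooth gradsq_nonzero)

lemma proj_smooth: "smooth_on S (proj i j)"
  unfolding proj_def[abs_def]
  by (intro smooth_on_diff smooth_on_mult smooth_on_inverse open_S gradsq_smooth gradsq_nonzero smooth_on_pd fsm metric_smooth[OF met])

lemma ca_slope: "x \<in> S \<Longrightarrow> ca x = slope x * gradsq x"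
  using gradsq_nonzero by (simp add: slope_def)

lemma curv_fcurv: "x \<in> S \<Longrightarrow> curv x = fcurv x - slope x * slope x * gradsq x"
  using gradsq_nonzero by (simp add: slope_def fcurv_def power2_eq_square)

lemma ca_derivative:
  assumes p: "p \<in> S"
  shows "pd i ca p = (ca p * cb p - (curv p + ric_y p * gradsq p / 2)) * pd i f p"
proof -
  have e: "(ric_x p + ric_y p * gradsq p) / 3 = curv p + ric_y p * gradsq p / 2"
    unfolding curv_def by (simp add: field_simps)
  show ?thesis unfolding ca_derivative_and_weyl(1)[OF p] e ..
qed

lemma slope_derivative:
  assumes p: "p \<in> S"
  shows "pd i slope p = (inverse (gradsq p) * (slope p * gradsq p * cb p - (fcurv p - slope p * slope p * gradsq p) - ric_y p * gradsq p / 2)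
      - 2 * slope p * inverse (gradsq p) * (slope p * gradsq p + cb p * gradsq p)) * pd i f p"
proof -
  note d = smooth_on_differentiable[OF _ p]
  have "pd i slope p = (pd i ca p * gradsq p - ca p * pd i gradsq p) / (gradsq p)\<^sup>2"
    unfolding slope_def[abs_def] by (rule pd_divide[OF d[OF ca_smooth] d[OF gradsq_smooth] gradsq_nonzero[OF p]])
  then show ?thesis
    unfolding ca_derivative[OF p] gradsq_derivative[OF p] ca_slope[OF p] curv_fcurv[OF p]
    using gradsq_nonzero[OF p] by (simp add: field_simps power2_eq_square)
qed

text \<open>So \<open>fcurv\<close> scales like the inverse square of a function with logarithmic derivative \<open>slope df\<close>.\<close>

lemma fcurv_derivative:
  assumes p: "p \<in> S" shows "pd i fcurv p = - 2 * slope p * fcurv p * pd i f p"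
proof -
  note d = smooth_on_differentiable[OF _ p]
  have eq: "fcurv x = curv x + slope x * ca x" if "x \<in> S" for x
    by (simp add: fcurv_def slope_def power2_eq_square)
  have "pd i fcurv p = pd i (\<lambda>x. curv x + slope x * ca x) p"
    by (rule pd_transform[OF open_S p]) (rule eq)
  also have "\<dots> = pd i curv p + (pd i slope p * ca p + slope p * pd i ca p)"
    by (subst pd_add, intro d curv_smooth, intro d smooth_on_mult open_S slope_smooth ca_smooth,
        subst pd_mult, intro d slope_smooth, intro d ca_smooth, rule refl)
  finally show ?thesis
    unfolding slope_derivative[OF p] curv_derivative[OF p] ca_derivative[OF p] ca_slope[OF p] curv_fcurv[OF p]
    using gradsq_nonzero[OF p] by (simp add: field_simps)
qed

lemma pd_pd_f: "x \<in> S \<Longrightarrow> pd i (pd j f) x = slope x * gradsq x * g x $ i $ j + cb x * (pd i f x * pd j f x)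
    + (\<Sum>k\<in>UNIV. christoffel g k i j x * pd k f x)"
  using hess_eq[of x i j] ca_slope[of x] unfolding hess_def by simp

lemma proj_derivative:
  assumes p: "p \<in> S"
  shows "pd i (proj j k) p = (\<Sum>q\<in>UNIV. christoffel g q i j p * g p $ q $ k) + (\<Sum>q\<in>UNIV. christoffel g q i k p * g p $ j $ q)
    - (pd i (pd j f) p * pd k f p + pd j f p * pd i (pd k f) p) * inverse (gradsq p)
    + pd j f p * pd k f p * (2 * (slope p * gradsq p + cb p * gradsq p) * pd i f p) * (inverse (gradsq p) * inverse (gradsq p))"
proof -
  note d = smooth_on_differentiable[OF _ p]
  have 1: "pd i (\<lambda>x. inverse (gradsq x)) p = - (inverse (gradsq p) * inverse (gradsq p)) * pd i gradsq p"
    by (rule pd_chain[OF d[OF gradsq_smooth]])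
       (use DERIV_inverse[OF gradsq_nonzero[OF p]] in \<open>simp add: numeral_2_eq_2\<close>)
  have "pd i (proj j k) p = pd i (\<lambda>x. g x $ j $ k) p - ((pd i (pd j f) p * pd k f p + pd j f p * pd i (pd k f) p) * inverse (gradsq p)
      + pd j f p * pd k f p * (- (inverse (gradsq p) * inverse (gradsq p)) * pd i gradsq p))"
    unfolding proj_def[abs_def] 1[symmetric]
    by (subst pd_diff, intro d metric_smooth[OF met],
        intro d smooth_on_mult open_S inverse_gradsq_smooth smooth_on_pd fsm,
        subst pd_mult, intro d smooth_on_mult open_S smooth_on_pd fsm,
        intro d inverse_gradsq_smooth,
        subst pd_mult, intro d smooth_on_pd fsm, intro d smooth_on_pd fsm, rule refl)
  then show ?thesis
    unfolding metric_compat[OF met p] gradsq_derivative[OF p] ca_slope[OF p] by (simp add: algebra_simps)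
qed

lemma fup_derivative:
  assumes p: "p \<in> S"
  shows "pd i (fup j) p = - (\<Sum>q\<in>UNIV. christoffel g j i q p * fup q p) + (if i = j then ca p else 0) + cb p * pd i f p * fup j p"
proof -
  note d = smooth_on_differentiable[OF _ p]
  have "pd i (fup j) p = (\<Sum>k\<in>UNIV. pd i (ginv g j k) p * pd k f p + ginv g j k p * pd i (pd k f) p)"
    unfolding fup_def[abs_def] by (rule pd_sum_mult) (intro d ginv_smooth[OF met] smooth_on_pd fsm)+
  also have "\<dots> = - (\<Sum>q\<in>UNIV. christoffel g j i q p * fup q p)
      + (\<Sum>k\<in>UNIV. ginv g j k p * (pd i (pd k f) p - (\<Sum>q\<in>UNIV. christoffel g q i k p * pd q f p)))"
    unfolding pd_ginv[OF met p] fup_def sum_4 by (simp add: algebra_simps)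
  also have "(\<Sum>k\<in>UNIV. ginv g j k p * (pd i (pd k f) p - (\<Sum>q\<in>UNIV. christoffel g q i k p * pd q f p)))
      = (\<Sum>k\<in>UNIV. ginv g j k p * (ca p * g p $ k $ i + cb p * (pd i f p * pd k f p)))"
    using hess_eq[OF p] metric_sym[OF met p, of i] by (simp add: hess_def)
  also have "\<dots> = ca p * (\<Sum>k\<in>UNIV. ginv g j k p * g p $ k $ i) + cb p * pd i f p * fup j p"
    unfolding fup_def sum_4 by (simp add: algebra_simps)
  finally show ?thesis unfolding ginv_metric[OF met p] by auto
qed

text \<open>Since the Weyl tensor vanishes, the curvature is built from \<open>g\<close> and \<open>sch\<close>, and the part \<open>df \<otimes> df\<close>
  of \<open>sch\<close> annihilates the raised covector.\<close>

lemma riem_up_tangential: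
  assumes p: "p \<in> S" and b: "(\<Sum>j\<in>UNIV. fup j p * b j) = 0"
  shows "(\<Sum>m\<in>UNIV. riem_up g m k i j p * b m) = curv p * (g p $ j $ k * b i - g p $ i $ k * b j)
     + ric_y p / 2 * pd k f p * (pd j f p * b i - pd i f p * b j)"
proof -
  define bu where "bu n = (\<Sum>m\<in>UNIV. ginv g n m p * b m)" for n
  have "(\<Sum>m\<in>UNIV. riem_up g m k i j p * b m) = (\<Sum>n\<in>UNIV. riem g i j k n p * bu n)"
    unfolding riem_up_riem[OF met p] bu_def sum_4
    by (simp add: algebra_simps ginv_sym[OF met p, of 2 1] ginv_sym[OF met p, of 3 1] ginv_sym[OF met p, of 4 1]
        ginv_sym[OF met p, of 3 2] ginv_sym[OF met p, of 4 2] ginv_sym[OF met p, of 4 3])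
  moreover have gb: "(\<Sum>n\<in>UNIV. g p $ a $ n * bu n) = b a" for a
    unfolding bu_def by (rule metric_ginv_contract[OF met p])
  moreover have fb: "(\<Sum>n\<in>UNIV. pd n f p * bu n) = 0"
  proof -
    have "(\<Sum>n\<in>UNIV. pd n f p * bu n) = (\<Sum>j\<in>UNIV. fup j p * b j)"
      unfolding bu_def fup_def sum_4
      by (simp add: algebra_simps ginv_sym[OF met p, of 2 1] ginv_sym[OF met p, of 3 1] ginv_sym[OF met p, of 4 1]
        ginv_sym[OF met p, of 3 2] ginv_sym[OF met p, of 4 2] ginv_sym[OF met p, of 4 3])
    then show ?thesis using b by simp
  qed
  moreover have sb: "(\<Sum>n\<in>UNIV. sch g a n p * bu n) = curv p * b a" for a
  proof -
    have "(\<Sum>n\<in>UNIV. sch g a n p * bu n) = curv p * (\<Sum>n\<in>UNIV. g p $ a $ n * bu n) + ric_y p * pd a f p * (\<Sum>n\<in>UNIV. pd n f p * bu n)"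
      unfolding sch_eq[OF p] sum_4 by (simp add: algebra_simps)
    then show ?thesis unfolding gb fb by simp
  qed
  have "(\<Sum>n\<in>UNIV. riem g i j k n p * bu n) = (1/2) * (sch g j k p * (\<Sum>n\<in>UNIV. g p $ i $ n * bu n) - sch g i k p * (\<Sum>n\<in>UNIV. g p $ j $ n * bu n)
      + g p $ j $ k * (\<Sum>n\<in>UNIV. sch g i n p * bu n) - g p $ i $ k * (\<Sum>n\<in>UNIV. sch g j n p * bu n))"
    unfolding riem_eq[OF p] sum_4 by (simp add: algebra_simps)
  then have "(\<Sum>n\<in>UNIV. riem g i j k n p * bu n) = (1/2) * (sch g j k p * b i - sch g i k p * b j
      + g p $ j $ k * (curv p * b i) - g p $ i $ k * (curv p * b j))"
    unfolding gb sb .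
  ultimately show ?thesis unfolding sch_eq[OF p] by (simp add: field_simps)
qed

text \<open>Parallel sections are pairs of a function \<open>B\<close> and its differential. If the differential annihilates
  the gradient, the equation for it says that \<open>Hess B = -fcurv B proj\<close> holds on each level set. In a
  space of constant curvature these are the restrictions of the linear functions of the ambient
  space of its standard quadric model.\<close>

definition fibre_conn :: "4 \<Rightarrow> real^4 \<Rightarrow> real \<times> (real^4) \<Rightarrow> real \<times> (real^4)" where
  "fibre_conn i x e = (snd e $ i, \<chi> j. (\<Sum>k\<in>UNIV. christoffel g k i j x * snd e $ k)
      - fcurv x * fst e * proj i j x - slope x * (pd i f x * snd e $ j + pd j f x * snd e $ i))"

lemma fibre_conn_linear: "linear (fibre_conn i x)"
  by (rule linearI) (simp_all add: fibre_conn_def vec_eq_iff algebra_simps sum.distrib sum_distrib_left)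

lemma fibre_conn_smooth: "smooth_on S (\<lambda>x. fibre_conn i x e)"
  unfolding fibre_conn_def
  by (intro smooth_on_Pair smooth_on_vec; (simp only: vec_lambda_beta)?)
     (intro chart_smooth proj_smooth slope_smooth fcurv_smooth)+

lemma fup_proj:
  assumes "x \<in> S" shows "(\<Sum>j\<in>UNIV. fup j x * proj i j x) = 0"
proof -
  have "(\<Sum>j\<in>UNIV. fup j x * proj i j x) = (\<Sum>j\<in>UNIV. g x $ i $ j * fup j x) - pd i f x * inverse (gradsq x) * (\<Sum>j\<in>UNIV. fup j x * pd j f x)"
    unfolding proj_def sum_4 by (simp add: algebra_simps)
  then show ?thesis unfolding lower_fup[OF assms] fup_grad using gradsq_nonzero[OF assms] by simp
qed

text \<open>The covectors that annihilate the gradient are preserved by the connection.\<close>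

lemma fibre_conn_constraint:
  assumes x: "x \<in> S"
  shows "pd i (\<lambda>x. \<Sum>j\<in>UNIV. fup j x * snd e $ j) x + (\<Sum>j\<in>UNIV. fup j x * snd (fibre_conn i x e) $ j)
    = (cb x - slope x) * pd i f x * (\<Sum>j\<in>UNIV. fup j x * snd e $ j)"
proof -
  note d = smooth_on_differentiable[OF _ x]
  let ?b = "\<lambda>j. snd e $ j"
  have 1: "pd i (\<lambda>x. \<Sum>j\<in>UNIV. fup j x * ?b j) x = (\<Sum>j\<in>UNIV. pd i (fup j) x * ?b j)"
    by (subst pd_sum_mult) (auto intro!: d fup_smooth)
  have 2: "(\<Sum>j\<in>UNIV. pd i (fup j) x * ?b j) = - (\<Sum>j\<in>UNIV. (\<Sum>q\<in>UNIV. christoffel g j i q x * fup q x) * ?b j)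
     + ca x * ?b i + cb x * pd i f x * (\<Sum>j\<in>UNIV. fup j x * ?b j)"
  proof -
    have "(\<Sum>j\<in>UNIV. (if i = j then ca x else 0) * ?b j) = ca x * ?b i"
      by (simp add: if_distrib if_distribR cong: if_cong)
    moreover have "(\<Sum>j\<in>UNIV. cb x * pd i f x * fup j x * ?b j) = cb x * pd i f x * (\<Sum>j\<in>UNIV. fup j x * ?b j)"
      by (simp add: sum_distrib_left mult_ac)
    ultimately show ?thesis
      unfolding fup_derivative[OF x] by (simp only: distrib_right sum.distrib mult_minus_left sum_negf)
  qed
  have 3: "(\<Sum>j\<in>UNIV. fup j x * snd (fibre_conn i x e) $ j)
     = (\<Sum>j\<in>UNIV. (\<Sum>q\<in>UNIV. christoffel g j i q x * fup q x) * ?b j) - fcurv x * fst e * (\<Sum>j\<in>UNIV. fup j x * proj i j x)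
      - slope x * (pd i f x * (\<Sum>j\<in>UNIV. fup j x * ?b j) + (\<Sum>j\<in>UNIV. fup j x * pd j f x) * ?b i)"
    unfolding fibre_conn_def sum_4 by (simp add: algebra_simps)
  show ?thesis unfolding 1 2 3 fup_proj[OF x] fup_grad ca_slope[OF x] by (simp add: algebra_simps)
qed

lemma pd_fibre_conn:
  assumes x: "x \<in> S"
  shows "pd i (\<lambda>x. snd (fibre_conn j x e) $ k) x = (\<Sum>q\<in>UNIV. pd i (christoffel g q j k) x * snd e $ q)
    - (pd i fcurv x * proj j k x + fcurv x * pd i (proj j k) x) * fst e
    - (pd i slope x * pd j f x + slope x * pd i (pd j f) x) * snd e $ k
    - (pd i slope x * pd k f x + slope x * pd i (pd k f) x) * snd e $ j"
proof -
  note d = smooth_on_differentiable[OF _ x]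
  let ?b = "snd e"
  have eq: "(\<lambda>x. snd (fibre_conn j x e) $ k) = (\<lambda>x. (\<Sum>q\<in>UNIV. christoffel g q j k x * ?b $ q)
      - ((fcurv x * proj j k x) * fst e + ((slope x * pd j f x) * ?b $ k + (slope x * pd k f x) * ?b $ j)))"
    unfolding fibre_conn_def by (simp add: algebra_simps)
  have sums: "smooth_on S (\<lambda>x. \<Sum>q\<in>UNIV. christoffel g q j k x * ?b $ q)"
    "smooth_on S (\<lambda>x. (fcurv x * proj j k x) * fst e)" "smooth_on S (\<lambda>x. (slope x * pd j f x) * ?b $ k)"
    "smooth_on S (\<lambda>x. (slope x * pd k f x) * ?b $ j)"
    by (intro chart_smooth proj_smooth slope_smooth fcurv_smooth)+
  have c: "pd i (\<lambda>x. F x * H x * r) x = (pd i F x * H x + F x * pd i H x) * r" if "smooth_on S F" "smooth_on S H" for F H r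
    using pd_mult[OF d[OF smooth_on_mult[OF open_S that]], of "\<lambda>_. r" i] pd_mult[OF d[OF that(1)] d[OF that(2)], of i] by simp
  show ?thesis
    unfolding eq
    by (subst pd_diff, intro d sums, intro d smooth_on_add open_S sums, subst pd_add, intro d sums, intro d smooth_on_add open_S sums,
        subst pd_add, intro d sums, intro d sums, subst pd_sum_mult, intro d christoffel_smooth[OF met], simp)
       (simp add: c fcurv_smooth proj_smooth slope_smooth smooth_on_pd fsm)
qed

text \<open>On covectors that annihilate the gradient, the curvature of \<open>g\<close> is given by \<open>riem_up_tangential\<close>.
  It is cancelled by the two correction terms of the connection, because of the derivatives of
  \<open>slope\<close> and \<open>fcurv\<close>.\<close>

lemma fibre_conn_flat:
  assumes x: "x \<in> S" and b: "(\<Sum>j\<in>UNIV. fup j x * snd e $ j) = 0"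
  shows "frechet_derivative (\<lambda>x. fibre_conn j x e) (at x) (axis i 1) + fibre_conn j x (fibre_conn i x e)
    = frechet_derivative (\<lambda>x. fibre_conn i x e) (at x) (axis j 1) + fibre_conn i x (fibre_conn j x e)"
proof -
  note d = smooth_on_differentiable[OF fibre_conn_smooth x]
  let ?G = "\<lambda>a b c. christoffel g a b c x"
  let ?b = "\<lambda>j. snd e $ j"
  have Gs: "?G q a b = ?G q b a" for q a b by (rule christoffel_sym[OF met x])
  define Gb where "Gb i j = (\<Sum>q\<in>UNIV. ?G q i j * ?b q)" for i j
  define Gf where "Gf i j = (\<Sum>q\<in>UNIV. ?G q i j * pd q f x)" for i j
  define GG where "GG i j k = (\<Sum>q\<in>UNIV. ?G q i j * g x $ q $ k)" for i j k
  have syms: "Gb a b = Gb b a" "Gf a b = Gf b a" "GG a b c = GG b a c" for a b c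
    by (simp_all add: Gb_def Gf_def GG_def Gs[of _ a b])
  have GG': "(\<Sum>q\<in>UNIV. ?G q i j * g x $ k $ q) = GG i j k" for i j k
    unfolding GG_def by (simp add: metric_sym[OF met x, of k])
  have gs: "g x $ a $ b = g x $ b $ a" for a b by (rule metric_sym[OF met x])
  have fst0: "fst (frechet_derivative (\<lambda>x. fibre_conn j x e) (at x) (axis i 1)) = 0" for i j
    using pd_pair_components(1)[OF d, of i j e] by (simp add: fibre_conn_def)
  define w where "w = inverse (gradsq x)"
  have wN: "w * gradsq x = 1" using gradsq_nonzero[OF x] by (simp add: w_def)
  define X where "X i j k = (\<Sum>q\<in>UNIV. pd i (christoffel g q j k) x * ?b q) + (\<Sum>l\<in>UNIV. ?G l j k * Gb i l)" for i j k
  have b1: "snd (fibre_conn i x e) $ l = Gb i l - fcurv x * fst e * (g x $ i $ l - pd i f x * pd l f x * w)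
     - slope x * (pd i f x * ?b l + pd l f x * ?b i)" for i l
    by (simp add: fibre_conn_def Gb_def proj_def w_def)
  have comp: "pd i (\<lambda>x. snd (fibre_conn j x e) $ k) x + snd (fibre_conn j x (fibre_conn i x e)) $ k
    = X i j k - fcurv x * fst e * (GG j k i - pd i f x * Gf j k * w) - slope x * (pd i f x * Gb j k + ?b i * Gf j k)
      - (pd i fcurv x * (g x $ j $ k - pd j f x * pd k f x * w) + fcurv x * pd i (proj j k) x) * fst e
      - (pd i slope x * pd j f x + slope x * pd i (pd j f) x) * ?b k
      - (pd i slope x * pd k f x + slope x * pd i (pd k f) x) * ?b j
      - fcurv x * ?b i * (g x $ j $ k - pd j f x * pd k f x * w)
      - slope x * (pd j f x * snd (fibre_conn i x e) $ k + pd k f x * snd (fibre_conn i x e) $ j)" for i j k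
  proof -
    have "(\<Sum>l\<in>UNIV. ?G l j k * snd (fibre_conn i x e) $ l) = (\<Sum>l\<in>UNIV. ?G l j k * Gb i l)
       - fcurv x * fst e * (GG j k i - pd i f x * Gf j k * w) - slope x * (pd i f x * Gb j k + ?b i * Gf j k)"
      unfolding b1 GG'[symmetric] unfolding Gf_def Gb_def[of j k]
      by (simp only: sum_4) (simp add: algebra_simps)
    moreover have "snd (fibre_conn j x (fibre_conn i x e)) $ k = (\<Sum>l\<in>UNIV. ?G l j k * snd (fibre_conn i x e) $ l)
       - fcurv x * ?b i * (g x $ j $ k - pd j f x * pd k f x * w)
       - slope x * (pd j f x * snd (fibre_conn i x e) $ k + pd k f x * snd (fibre_conn i x e) $ j)"
      by (subst fibre_conn_def) (simp add: fibre_conn_def[of i x e] proj_def w_def)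
    ultimately show ?thesis unfolding pd_fibre_conn[OF x] X_def by (simp add: proj_def w_def)
  qed
  have XX: "X i j k - X j i k = (fcurv x - slope x * slope x * gradsq x) * (g x $ j $ k * ?b i - g x $ i $ k * ?b j)
     + ric_y x / 2 * pd k f x * (pd j f x * ?b i - pd i f x * ?b j)" for k
  proof -
    have "X i j k - X j i k = (\<Sum>m\<in>UNIV. riem_up g m k i j x * ?b m)"
      unfolding X_def Gb_def riem_up_def sum_4 by (simp add: algebra_simps)
    then show ?thesis unfolding riem_up_tangential[OF x b] curv_fcurv[OF x] .
  qed
  let ?q' = "w * (slope x * gradsq x * cb x - (fcurv x - slope x * slope x * gradsq x) - ric_y x * gradsq x / 2)
      - 2 * slope x * w * (slope x * gradsq x + cb x * gradsq x)"
  have pdd: "pd i (pd j f) x = slope x * gradsq x * g x $ i $ j + cb x * (pd i f x * pd j f x) + Gf i j" for i j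
    unfolding pd_pd_f[OF x] Gf_def ..
  have pdp: "pd i (proj j k) x = GG i j k + GG i k j
    - (pd i (pd j f) x * pd k f x + pd j f x * pd i (pd k f) x) * w
    + pd j f x * pd k f x * (2 * (slope x * gradsq x + cb x * gradsq x) * pd i f x) * (w * w)" for i j k
    unfolding proj_derivative[OF x] GG' GG_def[symmetric] w_def ..
  have main: "pd i (\<lambda>x. snd (fibre_conn j x e) $ k) x + snd (fibre_conn j x (fibre_conn i x e)) $ k
     = pd j (\<lambda>x. snd (fibre_conn i x e) $ k) x + snd (fibre_conn i x (fibre_conn j x e)) $ k" for k
    unfolding comp b1 pdp pdd slope_derivative[OF x, folded w_def] fcurv_derivative[OF x]
    unfolding syms(1)[of j i] syms(2)[of j i] syms(3)[of j i] gs[of j i]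
    using fibre_flatness_identity[OF wN XX[of k] refl, where B = "fst e" and GGjki = "GG j k i" and GGijk = "GG i j k" and GGikj = "GG i k j"
      and bk = "?b k" and gij = "g x $ i $ j" and Gfij = "Gf i j" and Gfik = "Gf i k" and Gfjk = "Gf j k"
      and Gbij = "Gb i j" and Gbik = "Gb i k" and Gbjk = "Gb j k" and cb = "cb x"]
    by (simp add: mult_ac)
  have snd_eq: "snd (frechet_derivative (\<lambda>x. fibre_conn j x e) (at x) (axis i 1)) $ k + snd (fibre_conn j x (fibre_conn i x e)) $ k
    = snd (frechet_derivative (\<lambda>x. fibre_conn i x e) (at x) (axis j 1)) $ k + snd (fibre_conn i x (fibre_conn j x e)) $ k" for k
    using main[of k] pd_pair_components(2)[OF d, of i j e k] pd_pair_components(2)[OF d, of j i e k] by simp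
  have "fst (fibre_conn j x (fibre_conn i x e)) = fst (fibre_conn i x (fibre_conn j x e))"
    using b1[of i j] b1[of j i] syms(1)[of i j] gs[of i j]
    by (simp add: fibre_conn_def[of j x "fibre_conn i x e"] fibre_conn_def[of i x "fibre_conn j x e"] mult.commute)
  then show ?thesis
    using snd_eq fst0 by (intro prod_eqI) (simp_all add: vec_eq_iff)
qed

end

lemma cometric_derivative:
  fixes S :: "(real^'n::finite) set"
  assumes met: "metric_on S g" and p: "p \<in> S"
    and a: "\<And>i. a i differentiable (at p)" and b: "\<And>i. b i differentiable (at p)"
  shows "pd k (\<lambda>x. \<Sum>i\<in>UNIV. \<Sum>j\<in>UNIV. ginv g i j x * (a i x * b j x)) p
    = (\<Sum>i\<in>UNIV. \<Sum>j\<in>UNIV. ginv g i j p * ((pd k (a i) p - (\<Sum>q\<in>UNIV. christoffel g q k i p * a q p)) * b j p))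
    + (\<Sum>i\<in>UNIV. \<Sum>j\<in>UNIV. ginv g i j p * (a i p * (pd k (b j) p - (\<Sum>q\<in>UNIV. christoffel g q k j p * b q p))))"
proof -
  have gd: "ginv g i j differentiable (at p)" for i j
    by (rule smooth_on_differentiable[OF ginv_smooth[OF met] p])
  let ?G = "\<lambda>q i j. christoffel g q i j p"
  define U where "U = (\<Sum>i\<in>UNIV. \<Sum>j\<in>UNIV. \<Sum>q\<in>UNIV. ?G i k q * (ginv g q j p * (a i p * b j p)))"
  define V where "V = (\<Sum>i\<in>UNIV. \<Sum>j\<in>UNIV. \<Sum>q\<in>UNIV. ?G j k q * (ginv g i q p * (a i p * b j p)))"
  have "pd k (\<lambda>x. \<Sum>i\<in>UNIV. \<Sum>j\<in>UNIV. ginv g i j x * (a i x * b j x)) p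
    = (\<Sum>i\<in>UNIV. \<Sum>j\<in>UNIV. pd k (\<lambda>x. ginv g i j x * (a i x * b j x)) p)"
    by (subst pd_sum, intro differentiable_sum differentiable_mult gd a b ballI finite, intro sum.cong refl pd_sum)
       (intro differentiable_mult gd a b)
  also have "\<dots> = (\<Sum>i\<in>UNIV. \<Sum>j\<in>UNIV. pd k (ginv g i j) p * (a i p * b j p)
      + ginv g i j p * (pd k (a i) p * b j p) + ginv g i j p * (a i p * pd k (b j) p))"
    by (intro sum.cong refl, subst pd_mult, rule gd, intro differentiable_mult a b, subst pd_mult, rule a, rule b)
       (simp add: algebra_simps)
  also have "\<dots> = (\<Sum>i\<in>UNIV. \<Sum>j\<in>UNIV. pd k (ginv g i j) p * (a i p * b j p))
      + (\<Sum>i\<in>UNIV. \<Sum>j\<in>UNIV. ginv g i j p * (pd k (a i) p * b j p)) + (\<Sum>i\<in>UNIV. \<Sum>j\<in>UNIV. ginv g i j p * (a i p * pd k (b j) p))"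
    by (simp add: sum.distrib)
  also have "(\<Sum>i\<in>UNIV. \<Sum>j\<in>UNIV. pd k (ginv g i j) p * (a i p * b j p)) = - U - V"
    unfolding pd_ginv[OF met p] U_def V_def
    by (simp only: left_diff_distrib mult_minus_left sum_subtractf sum_negf sum_distrib_right) (simp add: mult_ac)
  also have "U = (\<Sum>i\<in>UNIV. \<Sum>j\<in>UNIV. ginv g i j p * ((\<Sum>q\<in>UNIV. ?G q k i * a q p) * b j p))"
  proof -
    have "U = (\<Sum>i\<in>UNIV. \<Sum>q\<in>UNIV. \<Sum>j\<in>UNIV. ?G i k q * (ginv g q j p * (a i p * b j p)))"
      unfolding U_def by (intro sum.cong refl sum.swap)
    also have "\<dots> = (\<Sum>q\<in>UNIV. \<Sum>i\<in>UNIV. \<Sum>j\<in>UNIV. ?G i k q * (ginv g q j p * (a i p * b j p)))"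
      by (rule sum.swap)
    also have "\<dots> = (\<Sum>q\<in>UNIV. \<Sum>j\<in>UNIV. \<Sum>i\<in>UNIV. ?G i k q * (ginv g q j p * (a i p * b j p)))"
      by (intro sum.cong refl sum.swap)
    finally show ?thesis by (simp add: sum_distrib_left sum_distrib_right mult_ac)
  qed
  also have "V = (\<Sum>i\<in>UNIV. \<Sum>j\<in>UNIV. ginv g i j p * (a i p * (\<Sum>q\<in>UNIV. ?G q k j * b q p)))"
  proof -
    have "V = (\<Sum>i\<in>UNIV. \<Sum>q\<in>UNIV. \<Sum>j\<in>UNIV. ?G j k q * (ginv g i q p * (a i p * b j p)))"
      unfolding V_def by (intro sum.cong refl sum.swap)
    then show ?thesis by (simp add: sum_distrib_left sum_distrib_right mult_ac)
  qed
  finally show ?thesis by (simp add: right_diff_distrib left_diff_distrib sum_subtractf)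
qed

lemma sum_bilinear3:
  fixes G :: "'i \<Rightarrow> 'j \<Rightarrow> real"
  shows "(\<Sum>i\<in>I. \<Sum>j\<in>J. G i j * ((\<alpha> * u i + \<beta> * v i + \<gamma> * w i) * h j))
    = \<alpha> * (\<Sum>i\<in>I. \<Sum>j\<in>J. G i j * (u i * h j)) + \<beta> * (\<Sum>i\<in>I. \<Sum>j\<in>J. G i j * (v i * h j))
      + \<gamma> * (\<Sum>i\<in>I. \<Sum>j\<in>J. G i j * (w i * h j))"
  by (simp add: distrib_right distrib_left sum.distrib sum_distrib_left mult_ac)

context quasi_einstein_chart
begin

definition cometric :: "(real^4 \<Rightarrow> real) \<Rightarrow> (real^4 \<Rightarrow> real) \<Rightarrow> real^4 \<Rightarrow> real" where
  "cometric F H x = (\<Sum>i\<in>UNIV. \<Sum>j\<in>UNIV. ginv g i j x * (pd i F x * pd j H x))"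

lemma cometric_sym: "x \<in> S \<Longrightarrow> cometric F H x = cometric H F x"
  unfolding cometric_def by (subst sum.swap) (simp add: ginv_sym[OF met] mult_ac)

lemma cometric_f: "x \<in> S \<Longrightarrow> cometric F f x = (\<Sum>i\<in>UNIV. fup i x * pd i F x)"
  unfolding cometric_def fup_def by (simp add: sum_distrib_left sum_distrib_right mult_ac)

lemma cometric_linear_left:
  assumes "\<And>i. pd i F x = c * pd i F1 x + d * pd i F2 x"
  shows "cometric F H x = c * cometric F1 H x + d * cometric F2 H x"
  unfolding cometric_def assms by (simp add: sum_distrib_left distrib_left distrib_right sum.distrib mult_ac)

lemma cometric_linear_right:
  assumes "\<And>i. pd i F x = c * pd i F1 x + d * pd i F2 x"
  shows "cometric H F x = c * cometric H F1 x + d * cometric H F2 x"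
  unfolding cometric_def assms by (simp add: sum_distrib_left distrib_left distrib_right sum.distrib mult_ac)

text \<open>The functions given by the parallel sections of \<open>fibre_conn\<close>.\<close>

definition fibre_function :: "(real^4) set \<Rightarrow> (real^4 \<Rightarrow> real) \<Rightarrow> bool" where
  "fibre_function U B \<longleftrightarrow> smooth_on U B \<and> (\<forall>x\<in>U. (\<Sum>j\<in>UNIV. fup j x * pd j B x) = 0 \<and>
     (\<forall>i j. pd i (pd j B) x = (\<Sum>k\<in>UNIV. christoffel g k i j x * pd k B x) - fcurv x * B x * proj i j x
        - slope x * (pd i f x * pd j B x + pd j f x * pd i B x)))"

lemma fibre_function_subset: "fibre_function U B \<Longrightarrow> V \<subseteq> U \<Longrightarrow> fibre_function V B"
  unfolding fibre_function_def using smooth_on_subset by blast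

lemma fibre_function_exists:
  assumes p: "p \<in> S" and b: "(\<Sum>j\<in>UNIV. fup j p * b $ j) = 0"
  obtains r B where "r > 0" "ball p r \<subseteq> S" "fibre_function (ball p r) B" "B p = B0" "\<And>j. pd j B p = b $ j"
proof -
  obtain r F where F: "r > 0" "ball p r \<subseteq> S" "smooth_on (ball p r) F" "F p = (B0, b)"
    "\<And>x. x \<in> ball p r \<Longrightarrow> (\<Sum>j\<in>UNIV. fup j x * snd (F x) $ j) = 0"
    "\<And>x i. x \<in> ball p r \<Longrightarrow> frechet_derivative F (at x) (axis i 1) = fibre_conn i x (F x)"
  proof (rule parallel_section[of S p fibre_conn "\<lambda>x e. \<Sum>j\<in>UNIV. fup j x * snd e $ j" "\<lambda>i x. (cb x - slope x) * pd i f x" "(B0, b)"])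
    show "linear (\<lambda>e :: real \<times> (real^4). \<Sum>j\<in>UNIV. fup j x * snd e $ j)" for x
      by (rule linearI) (simp_all add: algebra_simps sum.distrib sum_distrib_left)
    show "smooth_on S (\<lambda>x. \<Sum>j\<in>UNIV. fup j x * snd e $ j)" for e :: "real \<times> (real^4)"
      by (intro smooth_on_sum smooth_on_mult smooth_on_const open_S fup_smooth)
    show "smooth_on S (\<lambda>x. (cb x - slope x) * pd i f x)" for i
      by (intro smooth_on_mult smooth_on_diff open_S cb_smooth slope_smooth smooth_on_pd fsm)
  qed (use open_S p b fibre_conn_linear fibre_conn_smooth fibre_conn_constraint fibre_conn_flat in auto)
  define B where "B x = fst (F x)" for x
  have Fd: "F differentiable (at x)" if "x \<in> ball p r" for x by (rule smooth_on_differentiable[OF F(3) that])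
  have d1: "pd j B x = snd (F x) $ j" if "x \<in> ball p r" for j x
    using pd_pair_components(1)[OF Fd[OF that]] F(6)[OF that] by (simp add: B_def[abs_def] fibre_conn_def)
  have d2: "pd i (pd j B) x = snd (fibre_conn i x (F x)) $ j" if x: "x \<in> ball p r" for i j x
  proof -
    have "pd i (pd j B) x = pd i (\<lambda>x. snd (F x) $ j) x"
      by (rule pd_transform[OF open_ball x]) (rule d1)
    then show ?thesis using pd_pair_components(2)[OF Fd[OF x]] F(6)[OF x] by simp
  qed
  have "smooth_on (ball p r) B"
    unfolding B_def[abs_def] by (rule smooth_on_bounded_linear[OF open_ball bounded_linear_fst F(3)])
  then have "fibre_function (ball p r) B"
    unfolding fibre_function_def using F(5) d2 d1
    by (simp add: fibre_conn_def B_def)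
  then show ?thesis
    using that[OF F(1,2)] F(1,4) d1[of p] by (auto simp: B_def)
qed

lemma cometric_fibre_derivative:
  assumes U: "U \<subseteq> S" "open U" and x: "x \<in> U" and B: "fibre_function U B" and B': "fibre_function U B'"
  shows "pd k (cometric B B') x = - 2 * slope x * pd k f x * cometric B B' x - fcurv x * (B x * pd k B' x + B' x * pd k B x)"
proof -
  have xS: "x \<in> S" using U x by blast
  have sB: "smooth_on U B" "smooth_on U B'" using B B' by (auto simp: fibre_function_def)
  have half: "(\<Sum>i\<in>UNIV. \<Sum>j\<in>UNIV. ginv g i j x * ((pd k (pd i C) x - (\<Sum>q\<in>UNIV. christoffel g q k i x * pd q C x)) * pd j H x))
     = - fcurv x * C x * pd k H x - slope x * pd k f x * cometric C H x"
    if C: "fibre_function U C" and H: "fibre_function U H" for C H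
  proof -
    have h0: "(\<Sum>j\<in>UNIV. fup j x * pd j H x) = 0" using H x by (auto simp: fibre_function_def)
    have c: "pd k (pd i C) x - (\<Sum>q\<in>UNIV. christoffel g q k i x * pd q C x)
       = - fcurv x * C x * (g x $ k $ i - pd k f x * inverse (gradsq x) * pd i f x) - slope x * pd k f x * pd i C x - slope x * pd k C x * pd i f x" for i
    proof -
      have "pd k (pd i C) x = (\<Sum>q\<in>UNIV. christoffel g q k i x * pd q C x) - fcurv x * C x * proj k i x
        - slope x * (pd k f x * pd i C x + pd i f x * pd k C x)"
        using C x unfolding fibre_function_def by blast
      then show ?thesis unfolding proj_def by (simp add: algebra_simps)
    qed
    have e1: "(\<Sum>i\<in>UNIV. \<Sum>j\<in>UNIV. ginv g i j x * (g x $ k $ i * pd j H x)) = pd k H x"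
    proof -
      have "(\<Sum>i\<in>UNIV. \<Sum>j\<in>UNIV. ginv g i j x * (g x $ k $ i * pd j H x)) = (\<Sum>i\<in>UNIV. g x $ k $ i * (\<Sum>j\<in>UNIV. ginv g i j x * pd j H x))"
        by (simp add: sum_distrib_left mult_ac)
      then show ?thesis using metric_ginv_contract[OF met xS] by simp
    qed
    have e2: "(\<Sum>i\<in>UNIV. \<Sum>j\<in>UNIV. ginv g i j x * (pd i f x * pd j H x)) = 0"
      using cometric_f[OF xS, of H] cometric_sym[OF xS, of f H] h0 by (simp add: cometric_def)
    have "(\<Sum>i\<in>UNIV. \<Sum>j\<in>UNIV. ginv g i j x * ((pd k (pd i C) x - (\<Sum>q\<in>UNIV. christoffel g q k i x * pd q C x)) * pd j H x))
      = - fcurv x * C x * (\<Sum>i\<in>UNIV. \<Sum>j\<in>UNIV. ginv g i j x * (g x $ k $ i * pd j H x))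
        + (fcurv x * C x * pd k f x * inverse (gradsq x) - slope x * pd k C x) * (\<Sum>i\<in>UNIV. \<Sum>j\<in>UNIV. ginv g i j x * (pd i f x * pd j H x))
        - slope x * pd k f x * cometric C H x"
    proof -
      have c': "pd k (pd i C) x - (\<Sum>q\<in>UNIV. christoffel g q k i x * pd q C x) = (- fcurv x * C x) * g x $ k $ i
        + (fcurv x * C x * pd k f x * inverse (gradsq x) - slope x * pd k C x) * pd i f x + (- slope x * pd k f x) * pd i C x" for i
        unfolding c by (simp add: algebra_simps)
      show ?thesis unfolding c' cometric_def sum_bilinear3 by simp
    qed
    then show ?thesis unfolding e1 e2 by simp
  qed
  have "pd k (cometric B B') x
    = (\<Sum>i\<in>UNIV. \<Sum>j\<in>UNIV. ginv g i j x * ((pd k (pd i B) x - (\<Sum>q\<in>UNIV. christoffel g q k i x * pd q B x)) * pd j B' x))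
    + (\<Sum>i\<in>UNIV. \<Sum>j\<in>UNIV. ginv g i j x * (pd i B x * (pd k (pd j B') x - (\<Sum>q\<in>UNIV. christoffel g q k j x * pd q B' x))))"
    unfolding cometric_def[abs_def]
    by (rule cometric_derivative[OF met xS]) (intro smooth_on_differentiable[OF smooth_on_pd x] sB)+
  also have "(\<Sum>i\<in>UNIV. \<Sum>j\<in>UNIV. ginv g i j x * (pd i B x * (pd k (pd j B') x - (\<Sum>q\<in>UNIV. christoffel g q k j x * pd q B' x))))
    = (\<Sum>i\<in>UNIV. \<Sum>j\<in>UNIV. ginv g i j x * ((pd k (pd i B') x - (\<Sum>q\<in>UNIV. christoffel g q k i x * pd q B' x)) * pd j B x))"
    by (subst sum.swap) (simp add: ginv_sym[OF met xS] mult_ac)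
  finally show ?thesis unfolding half[OF B B'] half[OF B' B] using cometric_sym[OF xS, of B B'] by (simp add: algebra_simps)
qed

lemma slope_form_closed:
  assumes x: "x \<in> S"
  shows "pd i (\<lambda>x. slope x * pd j f x) x = pd j (\<lambda>x. slope x * pd i f x) x"
proof -
  note d = smooth_on_differentiable[OF _ x]
  have "pd i (pd j f) x = pd j (pd i f) x" by (rule pd_commute[OF open_S x fsm])
  then show ?thesis
    by (simp add: pd_mult d slope_smooth smooth_on_pd fsm slope_derivative[OF x] algebra_simps)
qed

end

context quasi_einstein_chart
begin

lemma gradient_multiple_closed:
  assumes U: "open U" "U \<subseteq> S" and x: "x \<in> U" and H: "smooth_on U H" "\<And>i. pd i H x = c * pd i f x"
  shows "pd i (\<lambda>x. pd j f x * H x) x = pd j (\<lambda>x. pd i f x * H x) x"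
proof -
  have xS: "x \<in> S" using U x by blast
  have "pd i (pd j f) x = pd j (pd i f) x" by (rule pd_commute[OF open_S xS fsm])
  then show ?thesis
    using smooth_on_differentiable[OF smooth_on_pd[OF fsm] xS] smooth_on_differentiable[OF H(1) x]
    by (simp add: pd_mult H(2))
qed

lemma pd_inverse_norm:
  assumes x: "x \<in> S" and e: "\<epsilon> * gradsq x > 0"
  obtains c where "\<And>i. pd i (\<lambda>x. inverse (sqrt (\<epsilon> * gradsq x))) x = c * pd i f x"
proof -
  have d: "gradsq differentiable (at x)" by (rule smooth_on_differentiable[OF gradsq_smooth x])
  define h where "h = - (inverse (sqrt (\<epsilon> * gradsq x)) * (\<epsilon> * (inverse (sqrt (\<epsilon> * gradsq x)) / 2)) * inverse (sqrt (\<epsilon> * gradsq x)))"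
  have "((\<lambda>s. inverse (sqrt (\<epsilon> * s))) has_real_derivative h) (at (gradsq x))"
    unfolding h_def using e by (auto intro!: derivative_eq_intros)
  from pd_chain[OF d this]
  have "pd i (\<lambda>x. inverse (sqrt (\<epsilon> * gradsq x))) x = (h * (2 * (ca x + cb x * gradsq x))) * pd i f x" for i
    unfolding gradsq_derivative[OF x] by (simp only: mult.assoc)
  then show ?thesis by (rule that)
qed

text \<open>The gradient is nonnull, so that its annihilator is a nondegenerate hyperplane.\<close>

lemma complementary_covectors:
  assumes p: "p \<in> S"
  obtains b :: "3 \<Rightarrow> real^4" where "\<And>i. (\<Sum>j\<in>UNIV. fup j p * b i $ j) = 0"
    "invertible (\<chi> i j. \<Sum>k\<in>UNIV. \<Sum>m\<in>UNIV. ginv g k m p * (b i $ k * b j $ m) :: real^3^3)"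
proof -
  have "\<exists>m. fup m p \<noteq> 0"
  proof (rule ccontr)
    assume "\<not> (\<exists>m. fup m p \<noteq> 0)"
    then have "gradsq p = 0" using fup_grad[of p] by simp
    then show False using gradsq_nonzero[OF p] by simp
  qed
  then obtain m where m: "fup m p \<noteq> 0" by blast
  \<comment> \<open>\<open>\<pi>\<close> enumerates the coordinates other than \<open>m\<close>, which serve as coordinates on the hyperplane\<close>
  have "card (UNIV - {m}) = card (UNIV :: 3 set)" by (simp add: card_Diff_singleton)
  then obtain \<pi> where \<pi>: "bij_betw \<pi> (UNIV :: 3 set) (UNIV - {m})"
    using finite_same_card_bij[of "UNIV :: 3 set" "UNIV - {m}"] by auto
  have pm: "\<pi> i \<noteq> m" for i using bij_betwE[OF \<pi>] by blast
  have pinj: "\<pi> i = \<pi> j \<longleftrightarrow> i = j" for i j using bij_betw_imp_inj_on[OF \<pi>] by (auto simp: inj_on_def)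
  have psurj: "\<exists>i. k = \<pi> i" if "k \<noteq> m" for k using \<pi> that by (auto simp: bij_betw_def)
  define b :: "3 \<Rightarrow> real^4" where "b i = axis (\<pi> i) 1 - (fup (\<pi> i) p / fup m p) *\<^sub>R axis m 1" for i
  have dot: "(\<Sum>j\<in>UNIV. h j * b i $ j) = h (\<pi> i) - fup (\<pi> i) p / fup m p * h m" for h i
  proof -
    have "(\<Sum>j\<in>UNIV. h j * b i $ j) = (\<Sum>j\<in>UNIV. (if j = \<pi> i then h j else 0) - fup (\<pi> i) p / fup m p * (if j = m then h j else 0))"
      unfolding b_def by (intro sum.cong refl) (simp add: axis_def algebra_simps)
    also have "\<dots> = (\<Sum>j\<in>UNIV. (if j = \<pi> i then h j else 0)) - fup (\<pi> i) p / fup m p * (\<Sum>j\<in>UNIV. (if j = m then h j else 0))"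
      by (simp only: sum_subtractf sum_distrib_left)
    finally show ?thesis by simp
  qed
  have 1: "(\<Sum>j\<in>UNIV. fup j p * b i $ j) = 0" for i unfolding dot using m by simp
  define G where "G = ((\<chi> i j. \<Sum>k\<in>UNIV. \<Sum>m\<in>UNIV. ginv g k m p * (b i $ k * b j $ m)) :: real^3^3)"
  have "c = 0" if c: "G *v c = 0" for c
  proof -
    define \<beta> where "\<beta> k = (\<Sum>j\<in>UNIV. c $ j * b j $ k)" for k
    define \<gamma> where "\<gamma> k = (\<Sum>n\<in>UNIV. ginv g k n p * \<beta> n)" for k
    have g1: "(\<Sum>k\<in>UNIV. \<gamma> k * b i $ k) = 0" for i
    proof -
      have "(G *v c) $ i = (\<Sum>k\<in>UNIV. \<gamma> k * b i $ k)"
        unfolding matrix_vector_mult_def G_def \<gamma>_def \<beta>_def sum_4 sum_3 by (simp add: algebra_simps)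
      then show ?thesis using c by simp
    qed
    have gk: "\<gamma> k = \<gamma> m / fup m p * fup k p" for k
    proof (cases "k = m")
      case True then show ?thesis using m by simp
    next
      case False
      then obtain i where "k = \<pi> i" using psurj by blast
      then show ?thesis using g1[of i] unfolding dot by (simp add: field_simps)
    qed
    have "(\<Sum>k\<in>UNIV. \<gamma> k * pd k f p) = (\<Sum>n\<in>UNIV. fup n p * \<beta> n)"
      unfolding \<gamma>_def fup_def sum_4 
      by (simp add: algebra_simps ginv_sym[OF met p, of 2 1] ginv_sym[OF met p, of 3 1] ginv_sym[OF met p, of 4 1]
        ginv_sym[OF met p, of 3 2] ginv_sym[OF met p, of 4 2] ginv_sym[OF met p, of 4 3])
    also have "\<dots> = (\<Sum>j\<in>UNIV. c $ j * (\<Sum>n\<in>UNIV. fup n p * b j $ n))"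
      unfolding \<beta>_def sum_4 sum_3 by (simp add: algebra_simps)
    finally have "(\<Sum>k\<in>UNIV. \<gamma> k * pd k f p) = 0" unfolding 1 by simp
    moreover have "(\<Sum>k\<in>UNIV. \<gamma> k * pd k f p) = \<gamma> m / fup m p * gradsq p"
      by (subst gk) (simp add: fup_grad[symmetric] sum_distrib_left mult.assoc)
    ultimately have "\<gamma> m = 0" using m gradsq_nonzero[OF p] by simp
    then have "\<gamma> k = 0" for k using gk[of k] by simp
    then have b0: "\<beta> k = 0" for k using metric_ginv_contract[OF met p, of k \<beta>] by (simp add: \<gamma>_def[symmetric])
    have "c $ i = 0" for i
    proof -
      have "\<beta> (\<pi> i) = (\<Sum>j\<in>UNIV. if j = i then c $ j else 0)"
        unfolding \<beta>_def b_def by (intro sum.cong refl) (use pm pinj in \<open>auto simp: axis_def\<close>)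
      then show ?thesis using b0 by simp
    qed
    then show ?thesis by (simp add: vec_eq_iff)
  qed
  then have "invertible G"
    by (simp add: invertible_left_inverse matrix_left_invertible_ker)
  then show ?thesis unfolding G_def by (rule that[OF 1])
qed

end

text \<open>Functions adapted to the structure near \<open>p\<close>: \<open>t\<close> is the arc length of the gradient lines, \<open>\<phi>\<close> is
  the warping function, \<open>B0\<close> and \<open>B\<close> are constant along the gradient, and \<open>A0\<close> and \<open>A1\<close> solve an
  oscillator equation with respect to the parameter with differential \<open>dt / \<phi>\<close>. The values at \<open>p\<close>
  make \<open>A0 + B0\<close> null and orthogonal to \<open>A1\<close> and \<open>B\<close> for the inner product \<open>pairing\<close> below.\<close>

locale adapted_chart = quasi_einstein_chart +
  fixes p :: "real^4" and r \<epsilon> \<kappa> :: real and \<phi> t A0 A0' A1 A1' B0 :: "real^4 \<Rightarrow> real" and B :: "3 \<Rightarrow> real^4 \<Rightarrow> real"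
  assumes r: "r > 0" and sub: "ball p r \<subseteq> S" and eps: "\<epsilon> = 1 \<or> \<epsilon> = -1"
    and eN: "\<And>x. x \<in> ball p r \<Longrightarrow> \<epsilon> * gradsq x > 0"
    and phi: "smooth_on (ball p r) \<phi>" "\<And>x. x \<in> ball p r \<Longrightarrow> \<phi> x > 0"
    and dphi: "\<And>x i. x \<in> ball p r \<Longrightarrow> pd i \<phi> x = slope x * \<phi> x * pd i f x"
    and kappa: "\<And>x. x \<in> ball p r \<Longrightarrow> (\<phi> x)\<^sup>2 * fcurv x = \<kappa>"
    and t: "smooth_on (ball p r) t"
    and dt: "\<And>x i. x \<in> ball p r \<Longrightarrow> pd i t x = pd i f x * inverse (sqrt (\<epsilon> * gradsq x))"
    and A: "smooth_on (ball p r) A0" "smooth_on (ball p r) A0'" "smooth_on (ball p r) A1" "smooth_on (ball p r) A1'"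
    and dA0: "\<And>x i. x \<in> ball p r \<Longrightarrow> pd i A0 x = A0' x * (pd i t x * inverse (\<phi> x))"
      "\<And>x i. x \<in> ball p r \<Longrightarrow> pd i A0' x = \<epsilon> * \<kappa> * A0 x * (pd i t x * inverse (\<phi> x))"
    and dA1: "\<And>x i. x \<in> ball p r \<Longrightarrow> pd i A1 x = A1' x * (pd i t x * inverse (\<phi> x))"
      "\<And>x i. x \<in> ball p r \<Longrightarrow> pd i A1' x = \<epsilon> * \<kappa> * A1 x * (pd i t x * inverse (\<phi> x))"
    and Ap: "A0 p = 1" "A0' p = 0" "A1 p = 0" "A1' p = 1"
    and B0: "fibre_function (ball p r) B0" "B0 p = 1" "\<And>j. pd j B0 p = 0"
    and B: "\<And>i. fibre_function (ball p r) (B i)" "\<And>i. B i p = 0"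
    and gram: "invertible (\<chi> i j. cometric (B i) (B j) p :: real^3^3)"

lemma (in quasi_einstein_chart) adapted_chart_exists:
  assumes p: "p \<in> S"
  shows "\<exists>r \<epsilon> \<kappa> \<phi> t A0 A0' A1 A1' B0 B. adapted_chart S g f l \<mu> \<sigma> p r \<epsilon> \<kappa> \<phi> t A0 A0' A1 A1' B0 B"
proof -
  define \<epsilon> where "\<epsilon> = sgn (gradsq p)"
  have eps: "\<epsilon> = 1 \<or> \<epsilon> = -1" using gradsq_nonzero[OF p] by (auto simp: \<epsilon>_def sgn_if)
  have ep: "\<epsilon> * gradsq p > 0" using gradsq_nonzero[OF p] by (simp add: \<epsilon>_def sgn_mult_self_eq mult_sgn_abs abs_sgn sgn_if)
  define T where "T = {x\<in>S. \<epsilon> * gradsq x > 0}"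
  have oT: "open T"
  proof -
    have "continuous_on S (\<lambda>x. \<epsilon> * gradsq x)"
      by (intro continuous_intros smooth_on_continuous[OF gradsq_smooth])
    from continuous_open_preimage[OF this open_S, of "{0<..}"]
    show ?thesis by (simp add: T_def vimage_def Int_def)
  qed
  have TS: "T \<subseteq> S" and pT: "p \<in> T" using p ep by (auto simp: T_def)
  have TN: "\<epsilon> * gradsq x > 0" if "x \<in> T" for x using that by (simp add: T_def)
  note sT = smooth_on_subset[OF _ TS]
  \<comment> \<open>the logarithm of the warping function: \<open>slope df\<close> is closed since \<open>d slope\<close> is a multiple of \<open>df\<close>\<close>
  obtain r1 \<psi> where 1: "r1 > 0" "ball p r1 \<subseteq> T" "smooth_on (ball p r1) \<psi>" "\<psi> p = 0"
     "\<And>x i. x \<in> ball p r1 \<Longrightarrow> pd i \<psi> x = slope x * pd i f x"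
  proof (rule poincare_lemma[OF oT pT, of "\<lambda>i x. slope x * pd i f x" 0])
    show "smooth_on T (\<lambda>x. slope x * pd i f x)" for i
      by (intro sT smooth_on_mult open_S slope_smooth smooth_on_pd fsm)
  qed (use slope_form_closed TS in auto)
  define \<phi> where "\<phi> x = exp (\<psi> x)" for x
  have phism: "smooth_on (ball p r1) \<phi>" unfolding \<phi>_def[abs_def] by (intro smooth_on_exp open_ball 1(3))
  have phipos: "\<phi> x > 0" for x by (simp add: \<phi>_def)
  have dphi: "pd i \<phi> x = slope x * \<phi> x * pd i f x" if "x \<in> ball p r1" for i x
    unfolding \<phi>_def[abs_def]
    by (subst pd_chain[OF smooth_on_differentiable[OF 1(3) that] DERIV_exp]) (simp add: 1(5)[OF that])
  have b1: "ball p r1 \<subseteq> S" using 1(2) TS by blast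
  \<comment> \<open>the unit conormal is closed because the norm of the gradient also has a differential proportional to \<open>df\<close>\<close>
  have Hsm: "smooth_on T (\<lambda>x. inverse (sqrt (\<epsilon> * gradsq x)))"
    by (intro smooth_on_inverse smooth_on_sqrt smooth_on_mult smooth_on_const oT sT gradsq_smooth) (auto dest: TN)
  have fT: "smooth_on T (pd i f)" for i by (rule sT[OF smooth_on_pd[OF fsm]])
  obtain r2 t where 2: "r2 > 0" "ball p r2 \<subseteq> T" "smooth_on (ball p r2) t" "t p = 0"
     "\<And>x i. x \<in> ball p r2 \<Longrightarrow> pd i t x = pd i f x * inverse (sqrt (\<epsilon> * gradsq x))"
  proof (rule poincare_lemma[OF oT pT, of "\<lambda>i x. pd i f x * inverse (sqrt (\<epsilon> * gradsq x))" 0])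
    show "smooth_on T (\<lambda>x. pd i f x * inverse (sqrt (\<epsilon> * gradsq x)))" for i
      by (intro smooth_on_mult oT fT Hsm)
    fix x i j assume x: "x \<in> T"
    obtain c where "\<And>i. pd i (\<lambda>x. inverse (sqrt (\<epsilon> * gradsq x))) x = c * pd i f x"
      using pd_inverse_norm[of x \<epsilon>] x TS TN by blast
    then show "pd i (\<lambda>x. pd j f x * inverse (sqrt (\<epsilon> * gradsq x))) x = pd j (\<lambda>x. pd i f x * inverse (sqrt (\<epsilon> * gradsq x))) x"
      by (rule gradient_multiple_closed[OF oT TS x Hsm])
  qed blast
  \<comment> \<open>\<open>\<omega>\<close> is \<open>dt / \<phi>\<close>, which is closed for the same reason\<close>
  define r3 where "r3 = min r1 r2"
  have r3: "r3 > 0" "ball p r3 \<subseteq> ball p r1" "ball p r3 \<subseteq> ball p r2" using 1 2 by (auto simp: r3_def)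
  define \<omega> where "\<omega> i x = pd i f x * (inverse (sqrt (\<epsilon> * gradsq x)) * inverse (\<phi> x))" for i x
  have b3: "ball p r3 \<subseteq> T" "ball p r3 \<subseteq> S" using r3 1(2) TS by blast+
  have H3: "smooth_on (ball p r3) (\<lambda>x. inverse (sqrt (\<epsilon> * gradsq x)) * inverse (\<phi> x))"
    using phipos by (intro smooth_on_mult smooth_on_inverse[of _ \<phi>] open_ball smooth_on_subset[OF Hsm b3(1)] smooth_on_subset[OF phism r3(2)])
       (simp add: less_imp_neq[symmetric])
  have osm: "smooth_on (ball p r3) (\<omega> i)" for i
    unfolding \<omega>_def[abs_def] by (rule smooth_on_mult[OF open_ball smooth_on_subset[OF fT b3(1)] H3])
  have ocl: "pd i (\<omega> j) x = pd j (\<omega> i) x" if x: "x \<in> ball p r3" for x i j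
  proof -
    obtain c where c: "\<And>i. pd i (\<lambda>x. inverse (sqrt (\<epsilon> * gradsq x))) x = c * pd i f x"
      using pd_inverse_norm[of x \<epsilon>] x b3 TN by blast
    have d1: "(\<lambda>x. inverse (sqrt (\<epsilon> * gradsq x))) differentiable (at x)" using smooth_on_differentiable[OF Hsm] x b3 by blast
    have d2: "\<phi> differentiable (at x)" using smooth_on_differentiable[OF phism] x r3 by blast
    have "pd i (\<lambda>x. inverse (\<phi> x)) x = - (inverse (\<phi> x) ^ Suc (Suc 0)) * (slope x * \<phi> x * pd i f x)" for i
      using pd_chain[OF d2 DERIV_inverse, of i] phipos[of x] dphi[of x i] x r3 by auto
    then have "pd i (\<lambda>x. inverse (sqrt (\<epsilon> * gradsq x)) * inverse (\<phi> x)) x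
       = (c * inverse (\<phi> x) + inverse (sqrt (\<epsilon> * gradsq x)) * (- (inverse (\<phi> x) ^ Suc (Suc 0)) * (slope x * \<phi> x))) * pd i f x" for i
      using d2 phipos[of x] by (subst pd_mult[OF d1]) (auto simp: c algebra_simps intro!: differentiable_inverse)
    from gradient_multiple_closed[OF open_ball b3(2) x H3 this] show ?thesis unfolding \<omega>_def[abs_def] .
  qed
  define \<kappa> where "\<kappa> = (\<phi> p)\<^sup>2 * fcurv p"
  obtain r4 A0 A0' where 4: "r4 > 0" "ball p r4 \<subseteq> ball p r3" "smooth_on (ball p r4) A0" "smooth_on (ball p r4) A0'"
    "A0 p = 1" "A0' p = 0" "\<And>x i. x \<in> ball p r4 \<Longrightarrow> pd i A0 x = A0' x * \<omega> i x"
    "\<And>x i. x \<in> ball p r4 \<Longrightarrow> pd i A0' x = \<epsilon> * \<kappa> * A0 x * \<omega> i x"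
    using linear_oscillator_exists[OF open_ball _ osm ocl, of p 1 0 "\<epsilon> * \<kappa>"] r3(1) centre_in_ball by metis
  obtain r5 A1 A1' where 5: "r5 > 0" "ball p r5 \<subseteq> ball p r3" "smooth_on (ball p r5) A1" "smooth_on (ball p r5) A1'"
    "A1 p = 0" "A1' p = 1" "\<And>x i. x \<in> ball p r5 \<Longrightarrow> pd i A1 x = A1' x * \<omega> i x"
    "\<And>x i. x \<in> ball p r5 \<Longrightarrow> pd i A1' x = \<epsilon> * \<kappa> * A1 x * \<omega> i x"
    using linear_oscillator_exists[OF open_ball _ osm ocl, of p 0 1 "\<epsilon> * \<kappa>"] r3(1) centre_in_ball by metis
  obtain r6 B0 where 6: "r6 > 0" "ball p r6 \<subseteq> S" "fibre_function (ball p r6) B0" "B0 p = 1" "\<And>j. pd j B0 p = (0::real^4) $ j"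
    using fibre_function_exists[OF p, of 0 1] by auto
  obtain b :: "3 \<Rightarrow> real^4" where b: "\<And>i. (\<Sum>j\<in>UNIV. fup j p * b i $ j) = 0"
    "invertible (\<chi> i j. \<Sum>k\<in>UNIV. \<Sum>m\<in>UNIV. ginv g k m p * (b i $ k * b j $ m) :: real^3^3)"
    using complementary_covectors[OF p] by blast
  have "\<exists>r B. r > 0 \<and> fibre_function (ball p r) B \<and> B p = 0 \<and> (\<forall>j. pd j B p = b i $ j)" for i
    using fibre_function_exists[OF p b(1)[of i], of 0] by metis
  then obtain rr B where 7: "\<And>i. rr i > 0" "\<And>i. fibre_function (ball p (rr i)) (B i)" "\<And>i. B i p = 0" "\<And>i j. pd j (B i) p = b i $ j"
    by metis
  define r where "r = min r3 (min r4 (min r5 (min r6 (Min (range rr)))))"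
  have rr: "r > 0" using r3 4(1) 5(1) 6(1) 7(1) by (auto simp: r_def)
  have le: "r \<le> r1" "r \<le> r2" "r \<le> r3" "r \<le> r4" "r \<le> r5" "r \<le> r6" "r \<le> rr i" for i
  proof -
    have "Min (range rr) \<le> rr i" by (rule Min_le) auto
    then show "r \<le> r1" "r \<le> r2" "r \<le> r3" "r \<le> r4" "r \<le> r5" "r \<le> r6" "r \<le> rr i"
      unfolding r_def r3_def by linarith+
  qed
  have bs: "ball p r \<subseteq> ball p s" if "r \<le> s" for s using that by auto
  have sub: "ball p r \<subseteq> S" using bs[OF le(3)] b3 by blast
  have kc: "(\<phi> x)\<^sup>2 * fcurv x = \<kappa>" if x: "x \<in> ball p r" for x
  proof -
    have sm: "smooth_on (ball p r) (\<lambda>x. \<phi> x * \<phi> x * fcurv x)"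
      by (intro smooth_on_mult open_ball smooth_on_subset[OF phism bs[OF le(1)]] smooth_on_subset[OF fcurv_smooth sub])
    have "pd i (\<lambda>x. \<phi> x * \<phi> x * fcurv x) y = 0" if y: "y \<in> ball p r" for i y
    proof -
      have yS: "y \<in> S" and y1: "y \<in> ball p r1" using y sub bs[OF le(1)] by auto
      have d: "\<phi> differentiable (at y)" "fcurv differentiable (at y)"
        using smooth_on_differentiable[OF phism y1] smooth_on_differentiable[OF fcurv_smooth yS] by auto
      have "pd i (\<lambda>x. \<phi> x * \<phi> x * fcurv x) y = (pd i \<phi> y * \<phi> y + \<phi> y * pd i \<phi> y) * fcurv y + \<phi> y * \<phi> y * pd i fcurv y"
        using d by (subst pd_mult) (auto simp: pd_mult)
      then show ?thesis unfolding dphi[OF y1] fcurv_derivative[OF yS] by (simp add: algebra_simps)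
    qed
    from pd_zero_imp_constant[OF open_ball convex_ball sm this x, of p] rr
    show ?thesis by (simp add: \<kappa>_def power2_eq_square)
  qed
  have om: "\<omega> i x = pd i t x * inverse (\<phi> x)" if "x \<in> ball p r" for i x
    using 2(5)[of x i] bs[OF le(2)] that unfolding \<omega>_def by (auto simp: mult.assoc)
  have "adapted_chart S g f l \<mu> \<sigma> p r \<epsilon> \<kappa> \<phi> t A0 A0' A1 A1' B0 B"
  proof (unfold_locales)
    show "0 < \<epsilon> * gradsq x" if "x \<in> ball p r" for x using that bs[OF le(3)] b3 TN by blast
    show "invertible (\<chi> i j. cometric (B i) (B j) p :: real^3^3)" using b(2) by (simp add: cometric_def 7(4))
    show "smooth_on (ball p r) \<phi>" by (rule smooth_on_subset[OF phism bs[OF le(1)]])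
    show "smooth_on (ball p r) t" by (rule smooth_on_subset[OF 2(3) bs[OF le(2)]])
    show "smooth_on (ball p r) A0" "smooth_on (ball p r) A0'"
      by (rule smooth_on_subset[OF 4(3) bs[OF le(4)]], rule smooth_on_subset[OF 4(4) bs[OF le(4)]])
    show "smooth_on (ball p r) A1" "smooth_on (ball p r) A1'"
      by (rule smooth_on_subset[OF 5(3) bs[OF le(5)]], rule smooth_on_subset[OF 5(4) bs[OF le(5)]])
    show "fibre_function (ball p r) B0" by (rule fibre_function_subset[OF 6(3) bs[OF le(6)]])
    show "fibre_function (ball p r) (B i)" for i by (rule fibre_function_subset[OF 7(2) bs[OF le(7)]])
    fix x i assume x: "x \<in> ball p r"
    show "pd i \<phi> x = slope x * \<phi> x * pd i f x" using dphi x bs[OF le(1)] by blast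
    show "pd i t x = pd i f x * inverse (sqrt (\<epsilon> * gradsq x))" using 2(5) x bs[OF le(2)] by blast
    show "pd i A0 x = A0' x * (pd i t x * inverse (\<phi> x))" "pd i A0' x = \<epsilon> * \<kappa> * A0 x * (pd i t x * inverse (\<phi> x))"
      using 4(7,8)[of x i] x bs[OF le(4)] unfolding om[OF x] by auto
    show "pd i A1 x = A1' x * (pd i t x * inverse (\<phi> x))" "pd i A1' x = \<epsilon> * \<kappa> * A1 x * (pd i t x * inverse (\<phi> x))"
      using 5(7,8)[of x i] x bs[OF le(5)] unfolding om[OF x] by auto
  qed (use rr sub eps phipos kc 4 5 6 7 in auto)
  then show ?thesis by blast
qed

section \<open>Conformal flatness\<close>

lemma matrix_mult_scaleR:
  fixes A B :: "real^'n^'n"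
  shows "(c *\<^sub>R A) ** (d *\<^sub>R B) = (c * d) *\<^sub>R (A ** B)"
  by (simp add: vec_eq_iff matrix_matrix_mult_def sum_distrib_left mult_ac)

text \<open>A metric is determined by the inner products of the differentials of coordinate functions; these
  are the rows of \<open>J\<close>. If these inner products are nondegenerate, the differentials are
  linearly independent.\<close>

lemma metric_from_cometric:
  fixes G J D :: "real^'n^'n"
  assumes G: "invertible G" and D: "invertible D" and eq: "J ** matrix_inv G ** transpose J = D"
  shows "G = transpose J ** matrix_inv D ** J" "invertible J"
proof -
  have "J ** (matrix_inv G ** transpose J ** matrix_inv D) = mat 1"
    using eq matrix_inv_right[OF D] by (simp add: matrix_mul_assoc)
  then show iJ: "invertible J" using invertible_right_inverse by blast
  have "(matrix_inv G ** transpose J ** matrix_inv D) ** J = mat 1"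
    using \<open>J ** (matrix_inv G ** transpose J ** matrix_inv D) = mat 1\<close> by (simp add: matrix_left_right_inverse)
  then have "matrix_inv G ** (transpose J ** matrix_inv D ** J) = mat 1"
    by (simp add: matrix_mul_assoc)
  then have "G ** (matrix_inv G ** (transpose J ** matrix_inv D ** J)) = G" by simp
  then show "G = transpose J ** matrix_inv D ** J"
    using matrix_inv_right[OF G] by (simp add: matrix_mul_assoc)
qed

text \<open>Functions whose differentials have constant inner products and span the cotangent space are
  affine: their second derivatives give the Christoffel symbols. By the Ricci identity the
  curvature annihilates their differentials.\<close>

lemma flat_of_constant_cometric:
  fixes S :: "(real^'n::finite) set" and Z :: "'n \<Rightarrow> real^'n \<Rightarrow> real" and D :: "real^'n^'n"
  assumes met: "metric_on S G" and Z: "\<And>a. smooth_on S (Z a)" and D: "invertible D"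
    and co: "\<And>x a b. x \<in> S \<Longrightarrow> (\<Sum>i\<in>UNIV. \<Sum>j\<in>UNIV. ginv G i j x * (pd i (Z a) x * pd j (Z b) x)) = D $ a $ b"
  shows "flat_on S G"
proof -
  define J where "J x = ((\<chi> a i. pd i (Z a) x) :: real^'n^'n)" for x
  note open_S = metric_open[OF met]
  have JD: "J x ** matrix_inv (G x) ** transpose (J x) = D" if "x \<in> S" for x
  proof -
    have "(J x ** matrix_inv (G x) ** transpose (J x)) $ a $ b = D $ a $ b" for a b
      unfolding co[OF that, symmetric] triple_product_entry ginv_def by (simp add: J_def mult_ac)
    then show ?thesis by (simp add: vec_eq_iff)
  qed
  note GJ = metric_from_cometric[OF metric_invertible[OF met] D JD]
  have Gexp: "G x $ i $ j = (\<Sum>a\<in>UNIV. \<Sum>b\<in>UNIV. matrix_inv D $ a $ b * (pd i (Z a) x * pd j (Z b) x))" if "x \<in> S" for x i j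
  proof -
    have "G x $ i $ j = (transpose (J x) ** matrix_inv D ** J x) $ i $ j" using GJ(1)[OF that that] by simp
    also have "\<dots> = (\<Sum>a\<in>UNIV. \<Sum>b\<in>UNIV. matrix_inv D $ a $ b * (pd i (Z a) x * pd j (Z b) x))"
      using triple_product_entry[of "transpose (J x)" "matrix_inv D" "transpose (J x)" i j]
      by (simp add: transpose_def J_def mult_ac)
    finally show ?thesis .
  qed
  have chr: "(\<Sum>k\<in>UNIV. christoffel G k i j x * pd k (Z a) x) = pd i (pd j (Z a)) x" if x: "x \<in> S" for x i j a
  proof -
    note d = smooth_on_differentiable[OF _ x]
    define Ga where "Ga k i j = (\<Sum>a\<in>UNIV. matrix_inv (J x) $ k $ a * pd i (pd j (Z a)) x)" for k i j
    have iJ: "invertible (J x)" using GJ(2)[OF x x] .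
    have up: "(\<Sum>k\<in>UNIV. Ga k i j * pd k (Z a) x) = pd i (pd j (Z a)) x" for i j a
    proof -
      have "(\<Sum>k\<in>UNIV. Ga k i j * pd k (Z a) x) = (\<Sum>b\<in>UNIV. (J x ** matrix_inv (J x)) $ a $ b * pd i (pd j (Z b)) x)"
        unfolding Ga_def matrix_matrix_mult_def J_def
        by (simp add: sum_distrib_right sum_distrib_left mult_ac) (rule sum.swap)
      also have "\<dots> = (\<Sum>b\<in>UNIV. if b = a then pd i (pd j (Z b)) x else 0)"
        unfolding matrix_inv_right[OF iJ] by (intro sum.cong refl) (simp add: mat_def)
      finally show ?thesis by simp
    qed
    have "christoffel G k i j x = Ga k i j" for k i j
    proof (rule christoffel_unique[OF met x])
      show "Ga k i j = Ga k j i" for k i j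
        unfolding Ga_def using pd_commute[OF open_S x Z, of i j] by simp
      fix k i j
      have "pd k (\<lambda>y. G y $ i $ j) x = pd k (\<lambda>x. \<Sum>a\<in>UNIV. \<Sum>b\<in>UNIV. matrix_inv D $ a $ b * (pd i (Z a) x * pd j (Z b) x)) x"
        by (rule pd_transform[OF open_S x]) (rule Gexp)
      also have "\<dots> = (\<Sum>a\<in>UNIV. \<Sum>b\<in>UNIV. pd k (\<lambda>x. matrix_inv D $ a $ b * (pd i (Z a) x * pd j (Z b) x)) x)"
        by (subst pd_sum, (intro d smooth_intros open_S Z), intro sum.cong refl pd_sum) (intro d smooth_intros open_S Z)
      also have "\<dots> = (\<Sum>a\<in>UNIV. \<Sum>b\<in>UNIV. matrix_inv D $ a $ b * (pd k (pd i (Z a)) x * pd j (Z b) x))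
         + (\<Sum>a\<in>UNIV. \<Sum>b\<in>UNIV. matrix_inv D $ a $ b * (pd i (Z a) x * pd k (pd j (Z b)) x))"
      proof -
        have "pd k (\<lambda>x. matrix_inv D $ a $ b * (pd i (Z a) x * pd j (Z b) x)) x
          = matrix_inv D $ a $ b * (pd k (pd i (Z a)) x * pd j (Z b) x) + matrix_inv D $ a $ b * (pd i (Z a) x * pd k (pd j (Z b)) x)" for a b
          by (subst pd_cmult, intro d smooth_intros open_S Z, subst pd_mult, intro d smooth_intros Z, intro d smooth_intros Z)
             (simp add: distrib_left)
        then show ?thesis by (simp add: sum.distrib)
      qed
      also have "(\<Sum>a\<in>UNIV. \<Sum>b\<in>UNIV. matrix_inv D $ a $ b * (pd k (pd i (Z a)) x * pd j (Z b) x))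
         = (\<Sum>l\<in>UNIV. Ga l k i * G x $ l $ j)"
      proof -
        have "(\<Sum>l\<in>UNIV. Ga l k i * G x $ l $ j)
          = (\<Sum>l\<in>UNIV. \<Sum>a\<in>UNIV. \<Sum>b\<in>UNIV. matrix_inv D $ a $ b * (Ga l k i * pd l (Z a) x * pd j (Z b) x))"
          unfolding Gexp[OF x] by (simp add: sum_distrib_left mult_ac)
        also have "\<dots> = (\<Sum>a\<in>UNIV. \<Sum>l\<in>UNIV. \<Sum>b\<in>UNIV. matrix_inv D $ a $ b * (Ga l k i * pd l (Z a) x * pd j (Z b) x))"
          by (rule sum.swap)
        also have "\<dots> = (\<Sum>a\<in>UNIV. \<Sum>b\<in>UNIV. \<Sum>l\<in>UNIV. matrix_inv D $ a $ b * (Ga l k i * pd l (Z a) x * pd j (Z b) x))"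
          by (intro sum.cong refl sum.swap)
        finally show ?thesis unfolding up[symmetric] by (simp add: sum_distrib_left sum_distrib_right)
      qed
      also have "(\<Sum>a\<in>UNIV. \<Sum>b\<in>UNIV. matrix_inv D $ a $ b * (pd i (Z a) x * pd k (pd j (Z b)) x))
         = (\<Sum>l\<in>UNIV. Ga l k j * G x $ i $ l)"
      proof -
        have "(\<Sum>l\<in>UNIV. Ga l k j * G x $ i $ l)
          = (\<Sum>l\<in>UNIV. \<Sum>a\<in>UNIV. \<Sum>b\<in>UNIV. matrix_inv D $ a $ b * (pd i (Z a) x * (Ga l k j * pd l (Z b) x)))"
          unfolding Gexp[OF x] by (simp add: sum_distrib_left mult_ac)
        also have "\<dots> = (\<Sum>a\<in>UNIV. \<Sum>l\<in>UNIV. \<Sum>b\<in>UNIV. matrix_inv D $ a $ b * (pd i (Z a) x * (Ga l k j * pd l (Z b) x)))"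
          by (rule sum.swap)
        also have "\<dots> = (\<Sum>a\<in>UNIV. \<Sum>b\<in>UNIV. \<Sum>l\<in>UNIV. matrix_inv D $ a $ b * (pd i (Z a) x * (Ga l k j * pd l (Z b) x)))"
          by (intro sum.cong refl sum.swap)
        finally show ?thesis unfolding up[symmetric] by (simp add: sum_distrib_left)
      qed
      finally show "pd k (\<lambda>y. G y $ i $ j) x = (\<Sum>l\<in>UNIV. Ga l k i * G x $ l $ j) + (\<Sum>l\<in>UNIV. Ga l k j * G x $ i $ l)" .
    qed
    then show ?thesis using up by simp
  qed
  have h0: "hess G (Z a) i j x = 0" if "x \<in> S" for a i j x
    unfolding hess_def chr[OF that] by simp
  have "riem_up G l k i j x = 0" if x: "x \<in> S" for l k i j x
  proof -
    have c0: "cov2 G (hess G (Z a)) i j k x = 0" for a i j k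
    proof -
      have "cov2 G (hess G (Z a)) i j k x = cov2 G (\<lambda>i j x. 0) i j k x"
      proof -
        have "pd i (hess G (Z a) j k) x = pd i (\<lambda>x. 0) x"
          by (rule pd_transform[OF open_S x]) (rule h0)
        then show ?thesis unfolding cov2_def by (simp add: h0[OF x])
      qed
      then show ?thesis by (simp add: cov2_def)
    qed
    have "(\<Sum>l\<in>UNIV. pd l (Z a) x * riem_up G l k i j x) = 0" for a
      using ricci_identity[OF met x Z, of a i j k] unfolding c0 by (simp add: mult.commute)
    then have "J x *v (\<chi> l. riem_up G l k i j x) = 0"
      by (simp add: vec_eq_iff matrix_vector_mult_def J_def)
    then have "(matrix_inv (J x) ** J x) *v (\<chi> l. riem_up G l k i j x) = 0"
      by (simp add: matrix_vector_mul_assoc[symmetric])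
    then have "(\<chi> l. riem_up G l k i j x) = 0"
      using matrix_inv_left[OF GJ(2)[OF x x]] by simp
    then show ?thesis by (simp add: vec_eq_iff)
  qed
  then show ?thesis unfolding flat_on_def riem_def by simp
qed

lemma metric_on_scale:
  fixes c :: "real^'n \<Rightarrow> real"
  assumes met: "metric_on S g" and U: "open U" "U \<subseteq> S" and c: "smooth_on U c" "\<And>x. x \<in> U \<Longrightarrow> c x \<noteq> 0"
  shows "metric_on U (\<lambda>x. c x *\<^sub>R g x)"
    and "x \<in> U \<Longrightarrow> ginv (\<lambda>x. c x *\<^sub>R g x) i j x = inverse (c x) * ginv g i j x"
proof -
  have inv: "(c x *\<^sub>R g x) ** (inverse (c x) *\<^sub>R matrix_inv (g x)) = mat 1" if "x \<in> U" for x
    using matrix_inv_right[OF metric_invertible[OF met]] that U(2) c(2)[OF that]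
    by (auto simp: matrix_mult_scaleR)
  have "smooth_on U g" using met U(2) smooth_on_subset unfolding metric_on_def by blast
  then have "smooth_on U (\<lambda>x. c x *\<^sub>R g x)" by (intro smooth_on_scaleR U c)
  moreover have "transpose (c x *\<^sub>R g x) = c x *\<^sub>R g x" if "x \<in> U" for x
    using met that U(2) unfolding metric_on_def transpose_def by (auto simp: vec_eq_iff)
  moreover have "invertible (c x *\<^sub>R g x)" if "x \<in> U" for x
    using inv[OF that] invertible_right_inverse by blast
  ultimately show "metric_on U (\<lambda>x. c x *\<^sub>R g x)"
    using U by (simp add: metric_on_def)
  show "ginv (\<lambda>x. c x *\<^sub>R g x) i j x = inverse (c x) * ginv g i j x" if "x \<in> U"
    unfolding ginv_def matrix_inv_unique_left[OF inv[OF that]] by simp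
qed

context adapted_chart
begin

definition oscillator :: "(real^4 \<Rightarrow> real) \<Rightarrow> (real^4 \<Rightarrow> real) \<Rightarrow> bool" where
  "oscillator D D' \<longleftrightarrow> smooth_on (ball p r) D \<and> smooth_on (ball p r) D' \<and>
    (\<forall>x\<in>ball p r. \<forall>i. pd i D x = D' x * (pd i t x * inverse (\<phi> x)) \<and>
       pd i D' x = \<epsilon> * \<kappa> * D x * (pd i t x * inverse (\<phi> x)))"

lemma oscillators: "oscillator A0 A0'" "oscillator A1 A1'" "oscillator (\<lambda>x. 0) (\<lambda>x. 0)"
  unfolding oscillator_def using A dA0 dA1 by (auto intro: smooth_on_const)

lemma fibre_function_zero: "fibre_function (ball p r) (\<lambda>x. 0)"
proof -
  have z: "pd j (\<lambda>x. 0) = (\<lambda>x. 0)" for j :: 4 by (rule ext) simp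
  show ?thesis unfolding fibre_function_def by (auto simp: z intro: smooth_on_const)
qed

lemma center: "p \<in> ball p r" using r by simp

text \<open>The first integrals of the two linear systems, in polarized form.\<close>

lemma fibre_integral:
  assumes F: "fibre_function (ball p r) F" and H: "fibre_function (ball p r) H" and x: "x \<in> ball p r"
  shows "(\<phi> x)\<^sup>2 * cometric F H x + \<kappa> * F x * H x = (\<phi> p)\<^sup>2 * cometric F H p + \<kappa> * F p * H p"
proof -
  have sm: "smooth_on (ball p r) F" "smooth_on (ball p r) H" using F H by (auto simp: fibre_function_def)
  have csm: "smooth_on (ball p r) (cometric F H)"
    unfolding cometric_def[abs_def]
    by (intro smooth_intros open_ball smooth_on_subset[OF ginv_smooth[OF met] sub] sm)
  let ?K = "\<lambda>x. \<phi> x * \<phi> x * cometric F H x + \<kappa> * (F x * H x)"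
  have Ksm: "smooth_on (ball p r) ?K"
    by (intro smooth_intros open_ball phi csm sm)
  have "pd k ?K y = 0" if y: "y \<in> ball p r" for k y
  proof -
    note d = smooth_on_differentiable[OF _ y]
    have "pd k ?K y = (pd k \<phi> y * \<phi> y + \<phi> y * pd k \<phi> y) * cometric F H y + \<phi> y * \<phi> y * pd k (cometric F H) y
       + \<kappa> * (pd k F y * H y + F y * pd k H y)"
      by (subst pd_add, (intro d smooth_intros open_ball phi csm sm)+, subst pd_mult, (intro d smooth_intros open_ball phi csm)+,
          subst pd_mult, (intro d phi)+, subst pd_cmult, (intro d smooth_intros open_ball sm), subst pd_mult, (intro d sm)+, rule refl)
    also have "\<dots> = 0"
      unfolding dphi[OF y] cometric_fibre_derivative[OF sub open_ball y F H] kappa[OF y, symmetric] power2_eq_square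
      by (simp add: algebra_simps)
    finally show ?thesis .
  qed
  from pd_zero_imp_constant[OF open_ball convex_ball Ksm this x center]
  show ?thesis by (simp add: power2_eq_square mult.assoc)
qed

lemma oscillator_integral:
  assumes D: "oscillator D D'" and E: "oscillator E E'" and x: "x \<in> ball p r"
  shows "\<epsilon> * D' x * E' x - \<kappa> * D x * E x = \<epsilon> * D' p * E' p - \<kappa> * D p * E p"
proof -
  have sm: "smooth_on (ball p r) D" "smooth_on (ball p r) D'" "smooth_on (ball p r) E" "smooth_on (ball p r) E'"
    using D E by (auto simp: oscillator_def)
  let ?K = "\<lambda>x. \<epsilon> * (D' x * E' x) - \<kappa> * (D x * E x)"
  have Ksm: "smooth_on (ball p r) ?K" by (intro smooth_intros open_ball sm)
  have ee: "\<epsilon> * \<epsilon> = 1" using eps by auto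
  have "pd k ?K y = 0" if y: "y \<in> ball p r" for k y
  proof -
    note d = smooth_on_differentiable[OF _ y]
    have dd: "pd k D y = D' y * (pd k t y * inverse (\<phi> y))" "pd k D' y = \<epsilon> * \<kappa> * D y * (pd k t y * inverse (\<phi> y))"
      "pd k E y = E' y * (pd k t y * inverse (\<phi> y))" "pd k E' y = \<epsilon> * \<kappa> * E y * (pd k t y * inverse (\<phi> y))"
      using D E y unfolding oscillator_def by blast+
    have "pd k ?K y = \<epsilon> * (pd k D' y * E' y + D' y * pd k E' y) - \<kappa> * (pd k D y * E y + D y * pd k E y)"
      by (subst pd_diff, (intro d smooth_intros open_ball sm)+, subst pd_cmult, (intro d smooth_intros open_ball sm),
          subst pd_mult, (intro d sm)+, subst pd_cmult, (intro d smooth_intros open_ball sm), subst pd_mult, (intro d sm)+, rule refl)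
    also have "\<dots> = (\<epsilon> * \<epsilon> * \<kappa> - \<kappa>) * ((D y * E' y + D' y * E y) * (pd k t y * inverse (\<phi> y)))"
      unfolding dd by (simp add: algebra_simps)
    finally show ?thesis by (simp add: ee)
  qed
  from pd_zero_imp_constant[OF open_ball convex_ball Ksm this x center]
  show ?thesis by (simp add: mult.assoc)
qed

lemma cometric_t_fibre:
  assumes F: "fibre_function (ball p r) F" and x: "x \<in> ball p r"
  shows "cometric t F x = 0" "cometric F t x = 0"
proof -
  have xS: "x \<in> S" using x sub by blast
  have "cometric t F x = inverse (sqrt (\<epsilon> * gradsq x)) * cometric f F x + 0 * cometric f F x"
    by (rule cometric_linear_left) (simp add: dt[OF x])
  also have "cometric f F x = (\<Sum>i\<in>UNIV. fup i x * pd i F x)"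
    unfolding cometric_sym[OF xS, of f F] by (rule cometric_f[OF xS])
  also have "\<dots> = 0" using F x by (auto simp: fibre_function_def)
  finally show "cometric t F x = 0" by simp
  then show "cometric F t x = 0" using cometric_sym[OF xS] by simp
qed

lemma cometric_t_t:
  assumes x: "x \<in> ball p r" shows "cometric t t x = \<epsilon>"
proof -
  have xS: "x \<in> S" using x sub by blast
  let ?c = "inverse (sqrt (\<epsilon> * gradsq x))"
  have "cometric t t x = ?c * cometric f t x + 0 * cometric f t x"
    by (rule cometric_linear_left) (simp add: dt[OF x])
  also have "cometric f t x = ?c * cometric f f x + 0 * cometric f f x"
    by (rule cometric_linear_right) (simp add: dt[OF x])
  also have "cometric f f x = gradsq x" by (simp add: cometric_def gradsq_def)
  finally have "cometric t t x = ?c * ?c * gradsq x" by simp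
  also have "?c * ?c = inverse (\<epsilon> * gradsq x)" using eN[OF x] by (subst inverse_mult_distrib[symmetric]) simp
  finally have "cometric t t x = inverse (\<epsilon> * gradsq x) * gradsq x" .
  moreover have "gradsq x \<noteq> 0" using eN[OF x] by auto
  ultimately show ?thesis using eps by (elim disjE) simp_all
qed

text \<open>The inner product, given by the first integrals, of two sums of a solution on the base and a
  function on the fibre.\<close>

definition pairing :: "(real^4 \<Rightarrow> real) \<Rightarrow> (real^4 \<Rightarrow> real) \<Rightarrow> (real^4 \<Rightarrow> real) \<Rightarrow>
    (real^4 \<Rightarrow> real) \<Rightarrow> (real^4 \<Rightarrow> real) \<Rightarrow> (real^4 \<Rightarrow> real) \<Rightarrow> real" where
  "pairing D D' F E E' H = \<epsilon> * D' p * E' p - \<kappa> * D p * E p + ((\<phi> p)\<^sup>2 * cometric F H p + \<kappa> * F p * H p)"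

lemma cometric_sum:
  assumes D: "oscillator D D'" and E: "oscillator E E'" and F: "fibre_function (ball p r) F"
    and H: "fibre_function (ball p r) H" and x: "x \<in> ball p r"
  shows "(\<phi> x)\<^sup>2 * cometric (\<lambda>x. D x + F x) (\<lambda>x. E x + H x) x
    = pairing D D' F E E' H + \<kappa> * (D x * E x - F x * H x)"
proof -
  note d = smooth_on_differentiable[OF _ x]
  have sm: "smooth_on (ball p r) D" "smooth_on (ball p r) E" "smooth_on (ball p r) F" "smooth_on (ball p r) H"
    using D E F H by (auto simp: oscillator_def fibre_function_def)
  have p1: "pd i (\<lambda>x. D x + F x) x = (D' x * inverse (\<phi> x)) * pd i t x + 1 * pd i F x" for i
    using D x by (subst pd_add) (auto simp: d sm oscillator_def)
  have p2: "pd i (\<lambda>x. E x + H x) x = (E' x * inverse (\<phi> x)) * pd i t x + 1 * pd i H x" for i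
    using E x by (subst pd_add) (auto simp: d sm oscillator_def)
  have "cometric (\<lambda>x. D x + F x) (\<lambda>x. E x + H x) x
    = D' x * inverse (\<phi> x) * (E' x * inverse (\<phi> x)) * \<epsilon> + cometric F H x"
    unfolding cometric_linear_left[OF p1] cometric_linear_right[OF p2] cometric_t_t[OF x] cometric_t_fibre[OF F x] cometric_t_fibre[OF H x]
    by simp
  then have "(\<phi> x)\<^sup>2 * cometric (\<lambda>x. D x + F x) (\<lambda>x. E x + H x) x
    = (\<epsilon> * D' x * E' x - \<kappa> * D x * E x) + ((\<phi> x)\<^sup>2 * cometric F H x + \<kappa> * F x * H x) + \<kappa> * (D x * E x - F x * H x)"
    using phi(2)[OF x] by (simp add: field_simps power2_eq_square)
  then show ?thesis unfolding oscillator_integral[OF D E x] fibre_integral[OF F H x] pairing_def .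
qed

lemma cometric_quotient:
  assumes "v differentiable (at x)" "w differentiable (at x)" "u differentiable (at x)" "u x \<noteq> 0"
  shows "(u x)\<^sup>2 * cometric (\<lambda>x. v x / u x) (\<lambda>x. w x / u x) x
    = cometric v w x - w x / u x * cometric v u x - v x / u x * cometric u w x + v x * w x / (u x)\<^sup>2 * cometric u u x"
proof -
  have p: "pd i (\<lambda>x. v x / u x) x = inverse (u x) * pd i v x + (- v x / (u x)\<^sup>2) * pd i u x"
    if "v differentiable (at x)" for i v
    using assms(3,4) that by (subst pd_divide) (auto simp: field_simps power2_eq_square)
  show ?thesis
    unfolding cometric_linear_left[OF p[OF assms(1)]] cometric_linear_right[OF p[OF assms(2)]]
    using assms(4) by (simp add: field_simps power2_eq_square)
qed

text \<open>With \<open>u = A0 + B0\<close>, the sums \<open>v = D + F\<close> of functions on base and fibre satisfy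
  \<open>\<phi>\<^sup>2 \<langle>dv, dv'\<rangle> = pairing v v' + \<kappa> (D D' - F F')\<close> by \<open>cometric_sum\<close>. Since \<open>u\<close> is null and orthogonal to
  \<open>A1\<close> and \<open>B\<close>, all terms with \<open>\<kappa>\<close> cancel in the inner products of the quotients \<open>v / u\<close>, and
  \<open>u\<^sup>2 \<phi>\<^sup>2 \<langle>d(v/u), d(v'/u)\<rangle>\<close> is constant.\<close>

theorem conformally_flat_near:
  "\<exists>V. open V \<and> p \<in> V \<and> V \<subseteq> S \<and> conformally_flat_on V g"
proof -
  define u where "u x = A0 x + B0 x" for x
  define V where "V = {x \<in> ball p r. u x > 0}"
  have B0sm: "smooth_on (ball p r) B0" using B0(1) by (simp add: fibre_function_def)
  have usm: "smooth_on (ball p r) u" unfolding u_def[abs_def] by (intro smooth_on_add open_ball A B0sm)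
  have oV: "open V"
    using continuous_open_preimage[OF smooth_on_continuous[OF usm] open_ball, of "{0<..}"]
    by (simp add: V_def vimage_def Int_def)
  have pV: "p \<in> V" using r Ap B0 by (simp add: V_def u_def)
  have Vb: "V \<subseteq> ball p r" by (auto simp: V_def)
  have VS: "V \<subseteq> S" using Vb sub by blast
  have upos: "u x > 0" if "x \<in> V" for x using that by (simp add: V_def)
  \<comment> \<open>the four quotients are those of \<open>B 1\<close>, \<open>B 2\<close>, \<open>B 3\<close> and, as the fourth, \<open>A1\<close>\<close>
  define idx :: "4 \<Rightarrow> 3" where "idx a = (if a = 1 then 1 else if a = 2 then 2 else 3)" for a
  define D where "D a = (if a = 4 then A1 else (\<lambda>x. 0))" for a :: 4
  define D' where "D' a = (if a = 4 then A1' else (\<lambda>x. 0))" for a :: 4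
  define F where "F a = (if a = 4 then (\<lambda>x. 0) else B (idx a))" for a
  have osc: "oscillator (D a) (D' a)" for a unfolding D_def D'_def using oscillators by auto
  have fib: "fibre_function (ball p r) (F a)" for a unfolding F_def using fibre_function_zero B by auto
  define v where "v a x = D a x + F a x" for a x
  define M where "M = ((\<chi> a b. pairing (D a) (D' a) (F a) (D b) (D' b) (F b)) :: real^4^4)"
  have vsm: "smooth_on (ball p r) (v a)" for a
    unfolding v_def[abs_def] using osc fib by (intro smooth_on_add open_ball) (auto simp: oscillator_def fibre_function_def)
  have cz: "cometric (\<lambda>x. 0) H p = 0" "cometric H (\<lambda>x. 0) p = 0" for H unfolding cometric_def by simp_all
  have c0: "cometric H B0 p = 0" "cometric B0 H p = 0" for H unfolding cometric_def B0(3) by simp_all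
  have au: "pairing (D a) (D' a) (F a) A0 A0' B0 = 0" for a
    unfolding pairing_def D_def D'_def F_def by (simp add: Ap B0 B c0)
  have ua: "pairing A0 A0' B0 (D a) (D' a) (F a) = 0" for a
    unfolding pairing_def D_def D'_def F_def by (simp add: Ap B0 B c0)
  have uu: "pairing A0 A0' B0 A0 A0' B0 = 0"
    unfolding pairing_def by (simp add: Ap B0 c0)
  have M4: "M $ a $ b = (if a = 4 \<and> b = 4 then \<epsilon> else if a = 4 \<or> b = 4 then 0
      else (\<phi> p)\<^sup>2 * cometric (B (idx a)) (B (idx b)) p)" for a b
    unfolding M_def pairing_def D_def D'_def F_def by (simp add: Ap B cz)
  have Minv: "invertible M"
  proof -
    have "w = 0" if w: "M *v w = 0" for w
    proof -
      define w' :: "real^3" where "w' = (\<chi> i. if i = 1 then w $ 1 else if i = 2 then w $ 2 else w $ 3)"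
      have 4: "w $ 4 = 0"
        using arg_cong[OF w, of "\<lambda>z. z $ 4"] eps by (auto simp: matrix_vector_mult_def sum_4 M4)
      have e: "(\<Sum>b\<in>UNIV. M $ a $ b * w $ b) = 0" for a
        using arg_cong[OF w, of "\<lambda>z. z $ a"] by (simp add: matrix_vector_mult_def)
      have "(\<phi> p)\<^sup>2 * (\<Sum>j\<in>UNIV. cometric (B i) (B j) p * w' $ j) = 0" for i
      proof -
        have "\<forall>i. (\<phi> p)\<^sup>2 * (\<Sum>j\<in>UNIV. cometric (B i) (B j) p * w' $ j) = 0"
          using e[of 1] e[of 2] e[of 3] 4 unfolding forall_3 sum_4 sum_3 M4
          by (simp add: idx_def w'_def distrib_left mult.assoc)
        then show ?thesis by blast
      qed
      then have "(\<chi> i j. cometric (B i) (B j) p :: real^3^3) *v w' = 0"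
        using phi(2)[OF center] by (simp add: vec_eq_iff matrix_vector_mult_def)
      moreover have "\<exists>N. N ** (\<chi> i j. cometric (B i) (B j) p :: real^3^3) = mat 1"
        using gram invertible_left_inverse by blast
      ultimately have "w' = 0" using matrix_left_invertible_ker by blast
      then have "w $ 1 = 0 \<and> w $ 2 = 0 \<and> w $ 3 = 0" unfolding w'_def vec_eq_iff forall_3 by simp
      then show "w = 0" using 4 by (simp add: vec_eq_iff forall_4)
    qed
    then show ?thesis by (simp add: invertible_left_inverse matrix_left_invertible_ker)
  qed
  define \<tau> where "\<tau> x = - ln (u x * \<phi> x)" for x
  define G where "G x = exp (2 * \<tau> x) *\<^sub>R g x" for x
  have phiV: "\<phi> x > 0" if "x \<in> V" for x using phi(2) that Vb by blast
  have tsm: "smooth_on V \<tau>"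
    unfolding \<tau>_def[abs_def]
    by (intro smooth_on_minus smooth_on_ln smooth_on_mult oV smooth_on_subset[OF usm Vb] smooth_on_subset[OF phi(1) Vb])
       (simp add: upos phiV)
  have csm: "smooth_on V (\<lambda>x. exp (2 * \<tau> x))"
    by (intro smooth_on_exp smooth_on_mult smooth_on_const oV tsm)
  have etau: "inverse (exp (2 * \<tau> x)) = (u x)\<^sup>2 * (\<phi> x)\<^sup>2" if "x \<in> V" for x
  proof -
    have "- (2 * \<tau> x) = ln (u x * \<phi> x) + ln (u x * \<phi> x)" by (simp add: \<tau>_def)
    then have "exp (- (2 * \<tau> x)) = exp (ln (u x * \<phi> x)) * exp (ln (u x * \<phi> x))" by (simp only: exp_add)
    also have "\<dots> = (u x * \<phi> x) * (u x * \<phi> x)" using upos[OF that] phiV[OF that] by simp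
    finally show ?thesis by (simp add: exp_minus power2_eq_square mult_ac)
  qed
  have metG: "metric_on V G"
    unfolding G_def[abs_def] by (rule metric_on_scale(1)[OF met oV VS csm]) simp
  define Z where "Z a x = v a x / u x" for a x
  have Zsm: "smooth_on V (Z a)" for a
    unfolding Z_def[abs_def]
    by (intro smooth_on_divide oV smooth_on_subset[OF usm Vb] smooth_on_subset[OF vsm Vb]) (auto dest: upos)
  have "flat_on V G"
  proof (rule flat_of_constant_cometric[OF metG Zsm Minv])
    fix x a b assume x: "x \<in> V"
    have xb: "x \<in> ball p r" using x Vb by blast
    have u0: "u x \<noteq> 0" using upos[OF x] by simp
    note d = smooth_on_differentiable[OF _ xb]
    have "(\<Sum>i\<in>UNIV. \<Sum>j\<in>UNIV. ginv G i j x * (pd i (Z a) x * pd j (Z b) x)) = (\<phi> x)\<^sup>2 * ((u x)\<^sup>2 * cometric (Z a) (Z b) x)"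
      unfolding G_def[abs_def] metric_on_scale(2)[OF met oV VS csm _ x, simplified] etau[OF x] cometric_def
      by (simp add: sum_distrib_left mult_ac)
    also have "(u x)\<^sup>2 * cometric (Z a) (Z b) x = cometric (v a) (v b) x - v b x / u x * cometric (v a) u x
        - v a x / u x * cometric u (v b) x + v a x * v b x / (u x)\<^sup>2 * cometric u u x"
      unfolding Z_def[abs_def] by (rule cometric_quotient[OF d[OF vsm] d[OF vsm] d[OF usm] u0])
    also have "(\<phi> x)\<^sup>2 * (cometric (v a) (v b) x - v b x / u x * cometric (v a) u x
        - v a x / u x * cometric u (v b) x + v a x * v b x / (u x)\<^sup>2 * cometric u u x)
       = (\<phi> x)\<^sup>2 * cometric (v a) (v b) x - v b x / u x * ((\<phi> x)\<^sup>2 * cometric (v a) u x)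
        - v a x / u x * ((\<phi> x)\<^sup>2 * cometric u (v b) x) + v a x * v b x / (u x)\<^sup>2 * ((\<phi> x)\<^sup>2 * cometric u u x)"
      by (simp add: algebra_simps)
    also have "\<dots> = (M $ a $ b + \<kappa> * (D a x * D b x - F a x * F b x)) - v b x / u x * (\<kappa> * (D a x * A0 x - F a x * B0 x))
        - v a x / u x * (\<kappa> * (A0 x * D b x - B0 x * F b x)) + v a x * v b x / (u x)\<^sup>2 * (\<kappa> * (A0 x * A0 x - B0 x * B0 x))"
      unfolding v_def[abs_def] u_def[abs_def]
      unfolding cometric_sum[OF osc osc fib fib xb] cometric_sum[OF osc oscillators(1) fib B0(1) xb]
        cometric_sum[OF oscillators(1) osc B0(1) fib xb] cometric_sum[OF oscillators(1) oscillators(1) B0(1) B0(1) xb] au ua uu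
      by (simp add: M_def)
    also have "\<dots> = M $ a $ b"
    proof -
      define w where "w = inverse (u x)"
      have w: "w * (A0 x + B0 x) = 1" using u0 by (simp add: w_def u_def)
      have "\<kappa> * (D a x * D b x - F a x * F b x) - (D b x + F b x) * w * (\<kappa> * (D a x * A0 x - F a x * B0 x))
        - (D a x + F a x) * w * (\<kappa> * (A0 x * D b x - B0 x * F b x)) + (D a x + F a x) * (D b x + F b x) * (w * w) * (\<kappa> * (A0 x * A0 x - B0 x * B0 x)) = 0"
        using w by algebra
      then show ?thesis unfolding v_def divide_inverse power2_eq_square inverse_mult_distrib w_def[symmetric] by (simp add: algebra_simps)
    qed
    finally show "(\<Sum>i\<in>UNIV. \<Sum>j\<in>UNIV. ginv G i j x * (pd i (Z a) x * pd j (Z b) x)) = M $ a $ b" .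
  qed
  then have "conformally_flat_on V g"
    unfolding conformally_flat_on_def G_def[abs_def] using tsm by blast
  then show ?thesis using oV pV VS by blast
qed

end

section \<open>The metrics of constant curvature in orthographic coordinates\<close>

lemma inner_matrix_vector:
  fixes A :: "real^'n^'n"
  shows "u \<bullet> (A *v v) = (\<Sum>i\<in>UNIV. \<Sum>j\<in>UNIV. A $ i $ j * (u $ i * v $ j))"
  unfolding inner_vec_def matrix_vector_mult_def
  by (simp add: sum_distrib_left mult_ac)

text \<open>On a quadric of curvature \<open>k\<close>, the restrictions of linear functions have inner products of this
  form. On the unit sphere, with \<open>C\<close> the identity, these are the coordinates of the orthogonal
  projection to a hyperplane.\<close>

definition orthographic_cometric :: "real^'n^'n \<Rightarrow> real \<Rightarrow> real^'n \<Rightarrow> real^'n^'n" where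
  "orthographic_cometric C k y = (\<chi> i j. C $ i $ j - k * (y $ i * y $ j))"

definition orthographic_metric :: "real^'n^'n \<Rightarrow> real \<Rightarrow> real^'n \<Rightarrow> real^'n^'n" where
  "orthographic_metric C k y = matrix_inv (orthographic_cometric C k y)"

locale orthographic_domain =
  fixes N :: "(real^'n::finite) set" and C :: "real^'n^'n" and \<kappa> :: real
  assumes open_N: "open N" and C_sym: "transpose C = C"
    and nondegenerate: "\<And>y. y \<in> N \<Longrightarrow> det (orthographic_cometric C \<kappa> y) \<noteq> 0"
begin

abbreviation "K \<equiv> orthographic_cometric C \<kappa>"
abbreviation "h \<equiv> orthographic_metric C \<kappa>"

lemma K_invertible: "y \<in> N \<Longrightarrow> invertible (K y)"
  using nondegenerate invertible_det_nz by blast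

lemma K_sym: "transpose (K y) = K y"
  using C_sym by (simp add: orthographic_cometric_def transpose_def vec_eq_iff mult.commute)

lemma orthographic_metric_on: "metric_on N h"
  unfolding metric_on_def
proof (intro conjI ballI)
  show "smooth_on N h"
    unfolding orthographic_metric_def[abs_def]
    by (rule smooth_on_vec[OF open_N], rule smooth_on_vec[OF open_N], rule smooth_on_matrix_inv[OF open_N _ K_invertible])
       (simp_all add: orthographic_cometric_def, intro smooth_intros open_N)
  fix y assume y: "y \<in> N"
  show "transpose (h y) = h y"
    using matrix_inv_transpose[OF K_invertible[OF y]] K_sym by (simp add: orthographic_metric_def)
  show "invertible (h y)"
    unfolding orthographic_metric_def using matrix_inv_left[OF K_invertible[OF y]] invertible_right_inverse by blast
qed (rule open_N)

lemma ginv_orthographic: "y \<in> N \<Longrightarrow> ginv h i j y = C $ i $ j - \<kappa> * (y $ i * y $ j)"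
  unfolding ginv_def orthographic_metric_def matrix_inv_unique_left[OF matrix_inv_left[OF K_invertible]]
  by (simp add: orthographic_cometric_def)

abbreviation low :: "'n \<Rightarrow> real^'n \<Rightarrow> real" where
  "low i y \<equiv> (\<Sum>j\<in>UNIV. h y $ i $ j * y $ j)"

text \<open>Differentiate \<open>h K = 1\<close>; the derivative of \<open>K\<close> is explicit.\<close>

lemma pd_orthographic:
  assumes y: "y \<in> N"
  shows "pd k (\<lambda>y. h y $ i $ j) y = \<kappa> * (h y $ i $ k * low j y + low i y * h y $ k $ j)"
proof -
  note met = orthographic_metric_on
  note d = smooth_on_differentiable[OF _ y]
  have sm: "smooth_on N (\<lambda>y. h y $ i $ j)" for i j
    using met by (auto simp: metric_on_def intro!: smooth_intros)
  have dK: "pd k (ginv h l j) y = - (\<kappa> * ((if k = l then 1 else 0) * y $ j + y $ l * (if k = j then 1 else 0)))" for l j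
  proof -
    have "pd k (ginv h l j) y = pd k (\<lambda>y. C $ l $ j - \<kappa> * (y $ l * y $ j)) y"
      by (rule pd_transform[OF open_N y]) (rule ginv_orthographic)
    also have "\<dots> = 0 - \<kappa> * (pd k (\<lambda>y. y $ l) y * y $ j + y $ l * pd k (\<lambda>y. y $ j) y)"
      by (subst pd_diff, (intro d smooth_intros open_N)+, subst pd_cmult, (intro d smooth_intros open_N),
          subst pd_mult, (intro d smooth_intros open_N)+, simp)
    finally show ?thesis by (simp add: pd_coord)
  qed
  have 0: "(\<Sum>l\<in>UNIV. pd k (\<lambda>y. h y $ i $ l) y * ginv h l j y) = \<kappa> * (h y $ i $ k * y $ j + low i y * (if k = j then 1 else 0))" for j
  proof -
    have "pd k (\<lambda>y. \<Sum>l\<in>UNIV. h y $ i $ l * ginv h l j y) y = pd k (\<lambda>y. if i = j then 1 else 0) y"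
      by (rule pd_transform[OF open_N y]) (simp add: metric_ginv[OF met])
    moreover have "pd k (\<lambda>y. \<Sum>l\<in>UNIV. h y $ i $ l * ginv h l j y) y
       = (\<Sum>l\<in>UNIV. pd k (\<lambda>y. h y $ i $ l) y * ginv h l j y + h y $ i $ l * pd k (ginv h l j) y)"
      by (subst pd_sum) (auto intro!: d smooth_intros open_N sum.cong pd_mult sm ginv_smooth[OF met])
    ultimately have "(\<Sum>l\<in>UNIV. pd k (\<lambda>y. h y $ i $ l) y * ginv h l j y) = - (\<Sum>l\<in>UNIV. h y $ i $ l * pd k (ginv h l j) y)"
      by (simp add: sum.distrib)
    also have "\<dots> = (\<Sum>l\<in>UNIV. \<kappa> * y $ j * (if k = l then h y $ i $ l else 0) + \<kappa> * (if k = j then 1 else 0) * (h y $ i $ l * y $ l))"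
      unfolding dK sum_negf[symmetric] by (intro sum.cong refl) (simp add: algebra_simps)
    also have "\<dots> = \<kappa> * y $ j * (\<Sum>l\<in>UNIV. if k = l then h y $ i $ l else 0) + \<kappa> * (if k = j then 1 else 0) * low i y"
      unfolding sum.distrib by (simp only: sum_distrib_left)
    finally show ?thesis by (simp add: algebra_simps)
  qed
  have "pd k (\<lambda>y. h y $ i $ j) y = (\<Sum>l\<in>UNIV. pd k (\<lambda>y. h y $ i $ l) y * (if l = j then 1 else 0))"
    by (simp add: if_distrib cong: if_cong)
  also have "\<dots> = (\<Sum>l\<in>UNIV. \<Sum>m\<in>UNIV. pd k (\<lambda>y. h y $ i $ l) y * ginv h l m y * h y $ m $ j)"
    unfolding ginv_metric[OF met y, symmetric] by (simp add: sum_distrib_left mult.assoc)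
  also have "\<dots> = (\<Sum>m\<in>UNIV. (\<Sum>l\<in>UNIV. pd k (\<lambda>y. h y $ i $ l) y * ginv h l m y) * h y $ m $ j)"
    by (subst sum.swap) (simp add: sum_distrib_right)
  also have "\<dots> = (\<Sum>m\<in>UNIV. \<kappa> * h y $ i $ k * (h y $ j $ m * y $ m) + \<kappa> * low i y * (if k = m then h y $ m $ j else 0))"
    unfolding 0 by (intro sum.cong refl) (simp add: metric_sym[OF met y, of _ j] distrib_left distrib_right mult_ac)
  also have "\<dots> = \<kappa> * h y $ i $ k * low j y + \<kappa> * low i y * (\<Sum>m\<in>UNIV. if k = m then h y $ m $ j else 0)"
    unfolding sum.distrib by (simp only: sum_distrib_left)
  finally show ?thesis by (simp add: algebra_simps)
qed

lemma christoffel_orthographic: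
  assumes y: "y \<in> N"
  shows "christoffel h k i j y = \<kappa> * (y $ k * h y $ i $ j)"
proof (rule christoffel_unique[OF orthographic_metric_on y])
  show "\<kappa> * (y $ k * h y $ i $ j) = \<kappa> * (y $ k * h y $ j $ i)" for k i j
    by (simp add: metric_sym[OF orthographic_metric_on y, of i])
  show "pd k (\<lambda>y. h y $ i $ j) y
      = (\<Sum>l\<in>UNIV. \<kappa> * (y $ l * h y $ k $ i) * h y $ l $ j) + (\<Sum>l\<in>UNIV. \<kappa> * (y $ l * h y $ k $ j) * h y $ i $ l)" for k i j
  proof -
    have "(\<Sum>l\<in>UNIV. \<kappa> * (y $ l * h y $ k $ i) * h y $ l $ j) = \<kappa> * h y $ i $ k * low j y"
      unfolding sum_distrib_left
      by (intro sum.cong refl) (simp add: metric_sym[OF orthographic_metric_on y, of _ j] metric_sym[OF orthographic_metric_on y, of k i] mult_ac)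
    moreover have "(\<Sum>l\<in>UNIV. \<kappa> * (y $ l * h y $ k $ j) * h y $ i $ l) = \<kappa> * h y $ k $ j * low i y"
      unfolding sum_distrib_left by (intro sum.cong refl) (simp add: mult_ac)
    ultimately show ?thesis unfolding pd_orthographic[OF y] by (simp add: algebra_simps)
  qed
qed

lemma riem_orthographic:
  assumes y: "y \<in> N"
  shows "riem h i j k l y = \<kappa> * (h y $ l $ i * h y $ j $ k - h y $ l $ j * h y $ i $ k)"
proof -
  note met = orthographic_metric_on
  note d = smooth_on_differentiable[OF _ y]
  have sm: "smooth_on N (\<lambda>y. h y $ i $ j)" for i j
    using met by (auto simp: metric_on_def intro!: smooth_intros)
  have dG: "pd i (christoffel h l j k) y = \<kappa> * ((if i = l then 1 else 0) * h y $ j $ k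
      + y $ l * (\<kappa> * (h y $ j $ i * low k y + low j y * h y $ i $ k)))" for i j k l
  proof -
    have "pd i (christoffel h l j k) y = pd i (\<lambda>y. \<kappa> * (y $ l * h y $ j $ k)) y"
      by (rule pd_transform[OF open_N y]) (rule christoffel_orthographic)
    also have "\<dots> = \<kappa> * (pd i (\<lambda>y. y $ l) y * h y $ j $ k + y $ l * pd i (\<lambda>y. h y $ j $ k) y)"
      by (subst pd_cmult, (intro d smooth_intros open_N sm), subst pd_mult, (intro d smooth_intros open_N sm)+, simp)
    finally show ?thesis by (simp add: pd_coord pd_orthographic[OF y])
  qed
  have quad: "(\<Sum>m\<in>UNIV. christoffel h l i m y * christoffel h m j k y) = \<kappa> * \<kappa> * y $ l * h y $ j $ k * low i y" for l i j k
    unfolding christoffel_orthographic[OF y] sum_distrib_left by (intro sum.cong refl) (simp add: mult_ac)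
  have up: "riem_up h l k i j y = \<kappa> * ((if i = l then 1 else 0) * h y $ j $ k - (if j = l then 1 else 0) * h y $ i $ k)" for l
    unfolding riem_up_def dG sum_subtractf quad
    using metric_sym[OF met y, of i j] by (simp add: algebra_simps)
  have "riem h i j k l y = (\<Sum>m\<in>UNIV. \<kappa> * h y $ j $ k * (if i = m then h y $ l $ m else 0) - \<kappa> * h y $ i $ k * (if j = m then h y $ l $ m else 0))"
    unfolding riem_def up by (intro sum.cong refl) (simp add: algebra_simps)
  also have "\<dots> = \<kappa> * h y $ j $ k * (\<Sum>m\<in>UNIV. if i = m then h y $ l $ m else 0) - \<kappa> * h y $ i $ k * (\<Sum>m\<in>UNIV. if j = m then h y $ l $ m else 0)"
    unfolding sum_subtractf by (simp only: sum_distrib_left)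
  finally show ?thesis by (simp add: algebra_simps)
qed

theorem orthographic_constant_curvature: "constant_sectional_curvature N h"
  unfolding constant_sectional_curvature_def
proof (intro exI[of _ \<kappa>] ballI allI impI)
  fix y u v assume y: "y \<in> N" and nz: "gram h y u v \<noteq> 0"
  have prod: "(\<Sum>i\<in>UNIV. \<Sum>j\<in>UNIV. \<Sum>k\<in>UNIV. \<Sum>l\<in>UNIV. (F l i * u $ l * u $ i) * (F' j k * v $ j * v $ k))
     = (\<Sum>l\<in>UNIV. \<Sum>i\<in>UNIV. F l i * u $ l * u $ i) * (\<Sum>j\<in>UNIV. \<Sum>k\<in>UNIV. F' j k * v $ j * v $ k)" for F F' :: "'n \<Rightarrow> 'n \<Rightarrow> real"
  proof -
    let ?A = "\<lambda>l i. F l i * u $ l * u $ i" and ?B = "\<lambda>j k. F' j k * v $ j * v $ k"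
    have "(\<Sum>i\<in>UNIV. \<Sum>j\<in>UNIV. \<Sum>k\<in>UNIV. \<Sum>l\<in>UNIV. ?A l i * ?B j k) = (\<Sum>i\<in>UNIV. (\<Sum>l\<in>UNIV. ?A l i) * (\<Sum>j\<in>UNIV. \<Sum>k\<in>UNIV. ?B j k))"
      by (simp only: sum_distrib_left[symmetric] sum_distrib_right[symmetric])
    also have "\<dots> = (\<Sum>i\<in>UNIV. \<Sum>l\<in>UNIV. ?A l i) * (\<Sum>j\<in>UNIV. \<Sum>k\<in>UNIV. ?B j k)"
      by (simp only: sum_distrib_right)
    finally show ?thesis by (subst (2) sum.swap)
  qed
  have prod2: "(\<Sum>i\<in>UNIV. \<Sum>j\<in>UNIV. \<Sum>k\<in>UNIV. \<Sum>l\<in>UNIV. (F l j * u $ l * v $ j) * (F i k * u $ i * v $ k))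
     = (\<Sum>l\<in>UNIV. \<Sum>j\<in>UNIV. F l j * u $ l * v $ j) * (\<Sum>i\<in>UNIV. \<Sum>k\<in>UNIV. F i k * u $ i * v $ k)" for F :: "'n \<Rightarrow> 'n \<Rightarrow> real"
  proof -
    let ?A = "\<lambda>l j. F l j * u $ l * v $ j"
    have "(\<Sum>i\<in>UNIV. \<Sum>j\<in>UNIV. \<Sum>k\<in>UNIV. \<Sum>l\<in>UNIV. ?A l j * ?A i k) = (\<Sum>i\<in>UNIV. (\<Sum>j\<in>UNIV. \<Sum>l\<in>UNIV. ?A l j) * (\<Sum>k\<in>UNIV. ?A i k))"
      by (simp only: sum_distrib_left[symmetric] sum_distrib_right[symmetric])
    also have "\<dots> = (\<Sum>j\<in>UNIV. \<Sum>l\<in>UNIV. ?A l j) * (\<Sum>i\<in>UNIV. \<Sum>k\<in>UNIV. ?A i k)"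
      by (simp only: sum_distrib_left)
    finally show ?thesis by (subst (2) sum.swap)
  qed
  have "riem_vec h y u v v u = (\<Sum>i\<in>UNIV. \<Sum>j\<in>UNIV. \<Sum>k\<in>UNIV. \<Sum>l\<in>UNIV.
      \<kappa> * ((h y $ l $ i * u $ l * u $ i) * (h y $ j $ k * v $ j * v $ k)) - \<kappa> * ((h y $ l $ j * u $ l * v $ j) * (h y $ i $ k * u $ i * v $ k)))"
    unfolding riem_vec_def riem_orthographic[OF y] by (intro sum.cong refl) (simp add: algebra_simps)
  also have "\<dots> = \<kappa> * (ip h y u u * ip h y v v) - \<kappa> * (ip h y u v * ip h y u v)"
    unfolding sum_subtractf sum_distrib_left[symmetric] prod prod2 ip_def inner_matrix_vector by (simp only: mult.assoc)
  finally have "riem_vec h y u v v u = \<kappa> * gram h y u v" by (simp add: gram_def power2_eq_square algebra_simps)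
  then show "sectional_curvature h y u v = \<kappa>" using nz by (simp add: sectional_curvature_def)
qed

end

section \<open>The smooth inverse function theorem\<close>

text \<open>The derivative of the inverse is the inverse of the Jacobian matrix, taken at the inverse. So
  each order of differentiability of the inverse implies the next one.\<close>

lemma smooth_inverse_function_theorem:
  fixes F :: "real^'n \<Rightarrow> real^'n"
  assumes U: "open U" "x0 \<in> U" and sm: "\<And>a. smooth_on U (\<lambda>x. F x $ a)"
    and inv: "\<And>x. x \<in> U \<Longrightarrow> invertible (\<chi> a i. pd i (\<lambda>x. F x $ a) x :: real^'n^'n)"
  obtains U' V G where "open U'" "U' \<subseteq> U" "x0 \<in> U'" "open V" "F x0 \<in> V" "homeomorphism U' V F G" "smooth_on V G"
proof -
  define J where "J x = ((\<chi> a i. pd i (\<lambda>x. F x $ a) x) :: real^'n^'n)" for x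
  have dF: "(F has_derivative (\<lambda>v. J x *v v)) (at x)" if x: "x \<in> U" for x
  proof (subst has_derivative_componentwise_within, intro ballI)
    fix b :: "real^'n" assume "b \<in> Basis"
    then obtain a where b: "b = axis a 1" by (auto simp: Basis_vec_def)
    have "((\<lambda>x. F x $ a) has_derivative frechet_derivative (\<lambda>x. F x $ a) (at x)) (at x)"
      by (rule smooth_on_has_derivative[OF sm x])
    moreover have "frechet_derivative (\<lambda>x. F x $ a) (at x) = (\<lambda>v. (J x *v v) $ a)"
      using frechet_eq_sum_pd[OF smooth_on_differentiable[OF sm x], of a]
      by (auto simp: J_def matrix_vector_mult_def mult.commute)
    ultimately show "((\<lambda>x. F x \<bullet> b) has_derivative (\<lambda>v. (J x *v v) \<bullet> b)) (at x)"
      by (simp add: b inner_axis)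
  qed
  define f' where "f' x = Blinfun (\<lambda>v. J x *v v)" for x
  have f': "blinfun_apply (f' x) = (\<lambda>v. J x *v v)" for x
    unfolding f'_def by (rule bounded_linear_Blinfun_apply[OF matrix_vector_mul_bounded_linear])
  have Jsm: "smooth_on U (\<lambda>x. J x $ a $ i)" for a i
    unfolding J_def by (simp add: smooth_on_pd[OF sm])
  have Jv: "smooth_on U (\<lambda>x. J x *v v)" for v
    by (rule smooth_on_vec[OF U(1)]) (simp add: matrix_vector_mult_def, intro smooth_intros U(1) Jsm)
  have cf: "continuous_on U f'"
    by (rule continuous_on_blinfun_componentwise) (simp add: f' smooth_on_continuous[OF Jv])
  have inv': "invertible (J x)" if "x \<in> U" for x using inv[OF that] by (simp add: J_def)
  define iv where "iv = Blinfun (\<lambda>v. matrix_inv (J x0) *v v)"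
  have iv: "blinfun_apply iv = (\<lambda>v. matrix_inv (J x0) *v v)"
    unfolding iv_def by (rule bounded_linear_Blinfun_apply[OF matrix_vector_mul_bounded_linear])
  have id: "iv o\<^sub>L f' x0 = id_blinfun"
    by (rule blinfun_eqI) (simp add: iv f' matrix_vector_mul_assoc matrix_inv_left[OF inv'[OF U(2)]])
  have dF': "(F has_derivative blinfun_apply (f' x)) (at x)" if "x \<in> U" for x
    unfolding f' by (rule dF[OF that])
  obtain U' V G G' where IFT: "open U'" "U' \<subseteq> U" "x0 \<in> U'" "open V" "F x0 \<in> V" "homeomorphism U' V F G"
    "\<And>y. y \<in> V \<Longrightarrow> (G has_derivative (G' y)) (at y)"
    "\<And>y. y \<in> V \<Longrightarrow> G' y = Hilbert_Choice.inv (blinfun_apply (f'(G y)))"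
    using inverse_function_theorem[OF U(1) dF' cf U(2) id] by metis
  have GU: "G y \<in> U" if "y \<in> V" for y using IFT(2,6) that unfolding homeomorphism_def by blast
  have dG: "(G has_derivative (\<lambda>v. matrix_inv (J (G y)) *v v)) (at y)" if y: "y \<in> V" for y
  proof -
    have "Hilbert_Choice.inv (\<lambda>v. J (G y) *v v) = (\<lambda>v. matrix_inv (J (G y)) *v v)"
      by (rule inv_unique_comp)
         (simp_all add: fun_eq_iff matrix_vector_mul_assoc matrix_inv_left[OF inv'[OF GU[OF y]]] matrix_inv_right[OF inv'[OF GU[OF y]]])
    then show ?thesis using IFT(7)[OF y] unfolding IFT(8)[OF y] f' by simp
  qed
  have Msm: "smooth_on U (\<lambda>x. matrix_inv (J x) *v v)" for v
    by (rule smooth_on_vec[OF U(1)])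
       (simp add: matrix_vector_mult_def, intro smooth_intros U(1) smooth_on_matrix_inv[OF U(1) Jsm inv'])
  have "C_k_on k V G" for k
  proof (induction k)
    case 0
    then show ?case using IFT(6) by (simp add: homeomorphism_def)
  next
    case (Suc k)
    show ?case
    proof (rule C_k_on_SucI[OF IFT(4) dG])
      fix v
      show "C_k_on k V (\<lambda>y. matrix_inv (J (G y)) *v v)"
        by (rule C_k_on_compose[OF IFT(4) U(1) Suc]) (use Msm GU in \<open>auto simp: smooth_on_def\<close>)
    qed
  qed
  then have "smooth_on V G" by (simp add: smooth_on_def)
  then show ?thesis by (rule that[OF IFT(1-6)])
qed

section \<open>The warped product structure\<close>

text \<open>The fourth coordinate belongs to the base and the other three to the fibre.\<close>

definition split4 :: "real^4 \<Rightarrow> real \<times> (real^3)" where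
  "split4 w = (w $ 4, \<chi> i. if i = 1 then w $ 1 else if i = 2 then w $ 2 else w $ 3)"

definition join4 :: "real \<times> (real^3) \<Rightarrow> real^4" where
  "join4 z = (\<chi> a. if a = 4 then fst z else snd z $ (if a = 1 then 1 else if a = 2 then 2 else 3))"

lemma join4_split4 [simp]: "join4 (split4 w) = w"
  by (simp add: vec_eq_iff forall_4 join4_def split4_def)

lemma split4_join4 [simp]: "split4 (join4 z) = z"
  by (simp add: prod_eq_iff vec_eq_iff forall_3 join4_def split4_def)

lemma bounded_linear_split4: "bounded_linear split4"
  unfolding linear_conv_bounded_linear[symmetric]
  by (rule linearI) (simp_all add: split4_def vec_eq_iff)

lemma bounded_linear_join4: "bounded_linear join4"
  unfolding linear_conv_bounded_linear[symmetric]
  by (rule linearI) (simp_all add: join4_def vec_eq_iff)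

context adapted_chart
begin

definition fibre_gram :: "real^3^3" where
  "fibre_gram = (\<chi> i j. (\<phi> p)\<^sup>2 * cometric (B i) (B j) p)"

definition fibre_map :: "real^4 \<Rightarrow> real^3" where "fibre_map x = (\<chi> i. B i x)"

definition fibre_index :: "4 \<Rightarrow> 3" where "fibre_index a = (if a = 1 then 1 else if a = 2 then 2 else 3)"

definition coords :: "real^4 \<Rightarrow> real^4" where "coords x = join4 (t x, fibre_map x)"

lemma coords_nth: "coords x $ a = (if a = 4 then t x else B (fibre_index a) x)"
  by (simp add: coords_def join4_def fibre_map_def fibre_index_def)

definition coord_jacobian :: "real^4 \<Rightarrow> real^4^4" where
  "coord_jacobian x = (\<chi> a i. pd i (\<lambda>x. coords x $ a) x)"

text \<open>Here \<open>t\<close> and the functions \<open>B\<close> are local coordinates.\<close>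

definition regular_domain :: "(real^4) set" where
  "regular_domain = {x \<in> ball p r. det (orthographic_cometric fibre_gram \<kappa> (fibre_map x)) \<noteq> 0}"

lemma B_smooth: "smooth_on (ball p r) (B i)" using B(1) by (simp add: fibre_function_def)

lemma coords_smooth: "smooth_on (ball p r) (\<lambda>x. coords x $ a)"
  unfolding coords_nth using t B_smooth by (cases "a = 4") simp_all

lemma regular_domain: "open regular_domain" "p \<in> regular_domain" "regular_domain \<subseteq> ball p r"
proof -
  have "smooth_on (ball p r) (\<lambda>x. det (orthographic_cometric fibre_gram \<kappa> (fibre_map x)))"
    by (intro smooth_on_det open_ball) (simp add: orthographic_cometric_def fibre_map_def, intro smooth_intros open_ball B_smooth)
  from continuous_open_preimage[OF smooth_on_continuous[OF this] open_ball open_Compl[OF closed_singleton], of 0]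
  show "open regular_domain" by (simp add: regular_domain_def vimage_def Int_def)
  have "orthographic_cometric fibre_gram \<kappa> (fibre_map p) = (\<phi> p)\<^sup>2 *\<^sub>R (\<chi> i j. cometric (B i) (B j) p)"
    by (simp add: orthographic_cometric_def fibre_gram_def fibre_map_def B vec_eq_iff)
  moreover have "(((\<phi> p)\<^sup>2 *\<^sub>R (\<chi> i j. cometric (B i) (B j) p)) ** (inverse ((\<phi> p)\<^sup>2) *\<^sub>R matrix_inv (\<chi> i j. cometric (B i) (B j) p)) :: real^3^3) = mat 1"
    unfolding matrix_mult_scaleR matrix_inv_right[OF gram] using phi(2)[OF center] by simp
  ultimately have "invertible (orthographic_cometric fibre_gram \<kappa> (fibre_map p))"
    using invertible_right_inverse by metis
  then show "p \<in> regular_domain" using r by (simp add: regular_domain_def invertible_det_nz)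
  show "regular_domain \<subseteq> ball p r" by (auto simp: regular_domain_def)
qed

text \<open>The metric in the coordinates \<open>t, B 1, B 2, B 3\<close>. Its inverse is the matrix of inner products of their
  differentials, which is block diagonal because \<open>dt\<close> is a multiple of \<open>df\<close>; the block of the fibre
  is known by \<open>fibre_integral\<close>.\<close>

definition model_metric :: "real^4 \<Rightarrow> real^4^4" where
  "model_metric x = (\<chi> a b. if a = 4 then (if b = 4 then \<epsilon> else 0) else if b = 4 then 0
      else (\<phi> x)\<^sup>2 * orthographic_metric fibre_gram \<kappa> (fibre_map x) $ fibre_index a $ fibre_index b)"

lemma coord_pullback:
  assumes x: "x \<in> regular_domain"
  shows "g x = transpose (coord_jacobian x) ** model_metric x ** coord_jacobian x"
    and "invertible (coord_jacobian x)"
proof -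
  have xb: "x \<in> ball p r" using x regular_domain(3) by blast
  have xS: "x \<in> S" using xb sub by blast
  define K where "K = orthographic_cometric fibre_gram \<kappa> (fibre_map x)"
  define D where "D = ((\<chi> a b. if a = 4 then (if b = 4 then \<epsilon> else 0) else if b = 4 then 0
      else inverse ((\<phi> x)\<^sup>2) * K $ fibre_index a $ fibre_index b) :: real^4^4)"
  have pos: "(\<phi> x)\<^sup>2 \<noteq> 0" using phi(2)[OF xb] by simp
  have "det K \<noteq> 0" using x by (simp add: regular_domain_def K_def)
  then have iK: "invertible K" by (simp add: invertible_det_nz)
  have KI: "K ** orthographic_metric fibre_gram \<kappa> (fibre_map x) = mat 1"
    unfolding orthographic_metric_def K_def[symmetric] by (rule matrix_inv_right[OF iK])
  have KI': "(\<Sum>k\<in>UNIV. K $ i $ k * orthographic_metric fibre_gram \<kappa> (fibre_map x) $ k $ j) = (if i = j then 1 else 0)" for i j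
    using KI by (simp add: vec_eq_iff matrix_matrix_mult_def mat_def)
  have e2: "\<epsilon> * \<epsilon> = 1" using eps by auto
  have DE: "D ** model_metric x = mat 1"
  proof -
    have "(D ** model_metric x) $ a $ b = mat 1 $ a $ b" for a b
    proof (cases "a = 4 \<or> b = 4")
      case True
      then show ?thesis
        by (auto simp: D_def model_metric_def matrix_matrix_mult_def mat_def sum_4 e2)
    next
      case False
      have "(D ** model_metric x) $ a $ b = (\<Sum>k\<in>UNIV. K $ fibre_index a $ k * orthographic_metric fibre_gram \<kappa> (fibre_map x) $ k $ fibre_index b)"
        using False pos by (simp add: D_def model_metric_def matrix_matrix_mult_def sum_4 sum_3 fibre_index_def field_simps)
      also have "\<dots> = mat 1 $ a $ b"
        unfolding KI' using False exhaust_4[of a] exhaust_4[of b] by (auto simp: mat_def fibre_index_def)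
      finally show ?thesis .
    qed
    then show ?thesis by (simp add: vec_eq_iff)
  qed
  have iD: "invertible D" using DE invertible_right_inverse by blast
  have "(coord_jacobian x ** matrix_inv (g x) ** transpose (coord_jacobian x)) $ a $ b = D $ a $ b" for a b
  proof -
    have "(coord_jacobian x ** matrix_inv (g x) ** transpose (coord_jacobian x)) $ a $ b
      = cometric (\<lambda>x. coords x $ a) (\<lambda>x. coords x $ b) x"
      unfolding triple_product_entry cometric_def ginv_def coord_jacobian_def by (simp add: mult_ac)
    also have "\<dots> = D $ a $ b"
    proof -
      have BB: "cometric (B i) (B j) x = inverse ((\<phi> x)\<^sup>2) * K $ i $ j" for i j
        using fibre_integral[OF B(1) B(1) xb, of i j] pos
        by (simp add: K_def orthographic_cometric_def fibre_gram_def fibre_map_def B field_simps)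
      show ?thesis unfolding coords_nth D_def
        by (simp add: cometric_t_t[OF xb] cometric_t_fibre[OF B(1) xb] BB)
    qed
    finally show ?thesis .
  qed
  then have eq: "coord_jacobian x ** matrix_inv (g x) ** transpose (coord_jacobian x) = D" by (simp add: vec_eq_iff)
  show "g x = transpose (coord_jacobian x) ** model_metric x ** coord_jacobian x"
    using metric_from_cometric(1)[OF metric_invertible[OF met xS] iD eq] matrix_inv_unique_left[OF DE] by simp
  show "invertible (coord_jacobian x)"
    by (rule metric_from_cometric(2)[OF metric_invertible[OF met xS] iD eq])
qed

lemma ip_split:
  assumes x: "x \<in> regular_domain"
  defines "w \<equiv> \<lambda>u. split4 (coord_jacobian x *v u)"
  shows "ip g x u v = \<epsilon> * fst (w u) * fst (w v) + (\<phi> x)\<^sup>2 * ip (orthographic_metric fibre_gram \<kappa>) (fibre_map x) (snd (w u)) (snd (w v))"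
proof -
  let ?J = "coord_jacobian x"
  have "ip g x u v = u \<bullet> (transpose ?J *v (model_metric x *v (?J *v v)))"
    unfolding ip_def by (subst coord_pullback(1)[OF x]) (simp add: matrix_vector_mul_assoc matrix_mul_assoc)
  also have "\<dots> = (?J *v u) \<bullet> (model_metric x *v (?J *v v))"
    by (metis dot_lmul_matrix inner_commute transpose_matrix_vector)
  also have "\<dots> = \<epsilon> * fst (w u) * fst (w v) + (\<phi> x)\<^sup>2 * ip (orthographic_metric fibre_gram \<kappa>) (fibre_map x) (snd (w u)) (snd (w v))"
    unfolding w_def
    unfolding ip_def inner_matrix_vector
    by (simp add: sum_4 sum_3 split4_def model_metric_def fibre_index_def algebra_simps)
  finally show ?thesis .
qed

lemma coords_has_derivative:
  assumes x: "x \<in> ball p r"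
  shows "((\<lambda>x. split4 (coords x)) has_derivative (\<lambda>u. split4 (coord_jacobian x *v u))) (at x)"
proof (rule bounded_linear.has_derivative[OF bounded_linear_split4], subst has_derivative_componentwise_within, intro ballI)
  fix b :: "real^4" assume "b \<in> Basis"
  then obtain a where b: "b = axis a 1" by (auto simp: Basis_vec_def)
  have "((\<lambda>x. coords x $ a) has_derivative frechet_derivative (\<lambda>x. coords x $ a) (at x)) (at x)"
    by (rule smooth_on_has_derivative[OF coords_smooth x])
  moreover have "frechet_derivative (\<lambda>x. coords x $ a) (at x) = (\<lambda>v. (coord_jacobian x *v v) $ a)"
    using frechet_eq_sum_pd[OF smooth_on_differentiable[OF coords_smooth x], of a]
    by (auto simp: coord_jacobian_def matrix_vector_mult_def mult.commute)
  ultimately show "((\<lambda>x. coords x \<bullet> b) has_derivative (\<lambda>v. (coord_jacobian x *v v) \<bullet> b)) (at x)"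
    by (simp add: b inner_axis)
qed

text \<open>The differentials of \<open>\<phi>\<close> and \<open>t\<close> are both multiples of \<open>df\<close>.\<close>

lemma warping_constant_on_fibre:
  fixes Y :: "real^3 \<Rightarrow> real^4"
  assumes N: "open N" "convex N" and Y: "smooth_on N Y" "Y ` N \<subseteq> ball p r" "\<And>y. y \<in> N \<Longrightarrow> t (Y y) = s"
    and y: "y \<in> N" "z \<in> N"
  shows "\<phi> (Y y) = \<phi> (Y z)"
proof (rule pd_zero_imp_constant[OF N _ _ y, of "\<lambda>y. \<phi> (Y y)"])
  show "smooth_on N (\<lambda>y. \<phi> (Y y))" by (rule smooth_on_compose[OF N(1) open_ball Y(1) phi(1) Y(2)])
  fix i y assume y: "y \<in> N"
  have Yb: "Y y \<in> ball p r" using Y(2) y by blast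
  let ?Y' = "frechet_derivative Y (at y)" and ?x = "Y y"
  note dY = smooth_on_has_derivative[OF Y(1) y]
  have ch: "pd i (\<lambda>y. F (Y y)) y = (\<Sum>k\<in>UNIV. ?Y' (axis i 1) $ k * pd k F ?x)" if F: "smooth_on (ball p r) F" for F
  proof -
    have "((\<lambda>y. F (Y y)) has_derivative (\<lambda>v. frechet_derivative F (at ?x) (?Y' v))) (at y)"
      by (rule has_derivative_compose[OF dY smooth_on_has_derivative[OF F Yb]])
    from has_derivative_imp_pd[OF this] show ?thesis
      using frechet_eq_sum_pd[OF smooth_on_differentiable[OF F Yb]] by simp
  qed
  have "pd i (\<lambda>y. t (Y y)) y = pd i (\<lambda>y. s) y" by (rule pd_transform[OF N(1) y]) (rule Y(3))
  then have t0: "(\<Sum>k\<in>UNIV. ?Y' (axis i 1) $ k * pd k t ?x) = 0" unfolding ch[OF t] by simp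
  have pos: "sqrt (\<epsilon> * gradsq ?x) \<noteq> 0" using eN[OF Yb] by auto
  have "pd i (\<lambda>y. \<phi> (Y y)) y = (\<Sum>k\<in>UNIV. slope ?x * \<phi> ?x * sqrt (\<epsilon> * gradsq ?x) * (?Y' (axis i 1) $ k * pd k t ?x))"
    unfolding ch[OF phi(1)] dphi[OF Yb] dt[OF Yb] using pos by (intro sum.cong refl) simp
  also have "\<dots> = 0" unfolding sum_distrib_left[symmetric] t0 by simp
  finally show "pd i (\<lambda>y. \<phi> (Y y)) y = 0" .
qed

theorem warped_product_near:
  "\<exists>V. open V \<and> p \<in> V \<and> V \<subseteq> S \<and> warped_product_constant_curvature_fibre V g"
proof -
  note U = regular_domain
  obtain U' V G where IFT: "open U'" "U' \<subseteq> regular_domain" "p \<in> U'" "open V" "coords p \<in> V"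
    "homeomorphism U' V coords G" "smooth_on V G"
    using smooth_inverse_function_theorem[OF U(1,2) smooth_on_subset[OF coords_smooth U(3)]] coord_pullback(2)
    unfolding coord_jacobian_def by metis
  have GF: "G (coords x) = x" if "x \<in> U'" for x using IFT(6) that by (simp add: homeomorphism_def)
  have FG: "coords (G v) = v" "G v \<in> U'" if "v \<in> V" for v using IFT(6) that by (auto simp: homeomorphism_def)
  have oW: "open (join4 -` V)"
    by (rule continuous_open_vimage[OF IFT(4)]) (use bounded_linear_join4 linear_continuous_at in blast)
  have "(t p, 0) \<in> join4 -` V"
  proof -
    have "fibre_map p = 0" by (simp add: fibre_map_def B vec_eq_iff)
    then show ?thesis using IFT(5) by (simp add: coords_def)
  qed
  \<comment> \<open>the image of the coordinates contains a product of an interval and a ball, and its preimage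
    \<open>S'\<close> is the warped product\<close>
  then obtain X Y where XY: "open X" "open Y" "(t p, 0) \<in> X \<times> Y" "X \<times> Y \<subseteq> join4 -` V"
    by (rule open_prod_elim[OF oW])
  obtain d e where de: "d > 0" "ball (t p) d \<subseteq> X" "e > 0" "ball 0 e \<subseteq> Y"
    using XY(1,2,3) by (meson mem_Sigma_iff openE)
  define I where "I = ball (t p) d"
  define N where "N = ball (0 :: real^3) e"
  have IN: "open I" "open N" "is_interval I" "convex N" "t p \<in> I" "0 \<in> N"
    using de by (auto simp: I_def N_def is_interval_ball_real)
  have IV: "join4 z \<in> V" if "z \<in> I \<times> N" for z using that XY(4) de by (auto simp: I_def N_def)
  define \<Psi> where "\<Psi> x = split4 (coords x)" for x
  define \<Phi> where "\<Phi> z = G (join4 z)" for z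
  have \<Psi>: "\<Psi> x = (t x, fibre_map x)" for x by (simp add: \<Psi>_def coords_def)
  have \<Phi>U: "\<Phi> z \<in> U'" "\<Psi> (\<Phi> z) = z" if "z \<in> I \<times> N" for z
    using FG[OF IV[OF that]] by (simp_all add: \<Phi>_def \<Psi>_def)
  have \<Phi>\<Psi>: "\<Phi> (\<Psi> x) = x" if "x \<in> U'" for x using GF[OF that] by (simp add: \<Phi>_def \<Psi>_def)
  define S' where "S' = {x \<in> U'. \<Psi> x \<in> I \<times> N}"
  have U'b: "U' \<subseteq> ball p r" using IFT(2) U(3) by blast
  have \<Psi>sm: "smooth_on U' \<Psi>"
    unfolding \<Psi>[abs_def] fibre_map_def
    by (intro smooth_on_Pair IFT(1) smooth_on_subset[OF t U'b] smooth_on_vec) (simp add: smooth_on_subset[OF B_smooth U'b])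
  have oS': "open S'"
    using continuous_open_preimage[OF smooth_on_continuous[OF \<Psi>sm] IFT(1) open_Times[OF IN(1,2)]]
    by (simp add: S'_def vimage_def Int_def)
  have S'U: "S' \<subseteq> U'" by (auto simp: S'_def)
  have \<Phi>sm: "smooth_on (I \<times> N) \<Phi>"
    unfolding \<Phi>_def[abs_def]
    by (rule smooth_on_compose[OF open_Times[OF IN(1,2)] IFT(4) smooth_on_linear_map[OF open_Times[OF IN(1,2)] bounded_linear_join4] IFT(7)])
       (use IV in blast)
  have bij: "bij_betw \<Psi> S' (I \<times> N)"
    by (rule bij_betw_byWitness[where f' = \<Phi>]) (use \<Phi>\<Psi> \<Phi>U S'U in \<open>auto simp: S'_def\<close>)
  have inv: "inv_into S' \<Psi> z = \<Phi> z" if z: "z \<in> I \<times> N" for z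
    by (rule inv_into_f_eq[OF bij_betw_imp_inj_on[OF bij]]) (use \<Phi>U[OF z] z in \<open>auto simp: S'_def\<close>)
  have diffeo: "diffeo_on S' (I \<times> N) \<Psi>"
    unfolding diffeo_on_def
  proof (intro conjI)
    show "smooth_on (I \<times> N) (inv_into S' \<Psi>)"
      using \<Phi>sm smooth_on_cong[OF open_Times[OF IN(1,2)] inv] by simp
  qed (use oS' open_Times[OF IN(1,2)] bij smooth_on_subset[OF \<Psi>sm S'U] in auto)
  define w where "w s = \<phi> (\<Phi> (s, 0))" for s
  have \<Phi>b: "\<Phi> z \<in> ball p r" if "z \<in> I \<times> N" for z using \<Phi>U(1)[OF that] U'b by blast
  have wsm: "smooth_on I w"
    unfolding w_def[abs_def]
  proof (rule smooth_on_compose[OF IN(1) open_ball _ phi(1)])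
    show "smooth_on I (\<lambda>s. \<Phi> (s, 0))"
      by (rule smooth_on_compose[OF IN(1) open_Times[OF IN(1,2)] _ \<Phi>sm])
         (auto intro: smooth_on_Pair[OF IN(1) smooth_on_linear_map[OF IN(1) bounded_linear_ident] smooth_on_const[OF IN(1)]] IN(6))
    show "(\<lambda>s. \<Phi> (s, 0)) ` I \<subseteq> ball p r" using \<Phi>b IN(6) by blast
  qed
  have wpos: "w s > 0" if "s \<in> I" for s
    unfolding w_def by (rule phi(2)) (use \<Phi>b that IN(6) in blast)
  have w: "w (t x) = \<phi> x" if x: "x \<in> S'" for x
  proof -
    have z: "t x \<in> I" "fibre_map x \<in> N" using x by (auto simp: S'_def \<Psi>)
    have "\<phi> (\<Phi> (t x, 0)) = \<phi> (\<Phi> (t x, fibre_map x))"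
    proof (rule warping_constant_on_fibre[OF IN(2,4), of "\<lambda>y. \<Phi> (t x, y)" "t x"])
      show "smooth_on N (\<lambda>y. \<Phi> (t x, y))"
        by (rule smooth_on_compose[OF IN(2) open_Times[OF IN(1,2)] _ \<Phi>sm])
           (auto intro: smooth_on_Pair[OF IN(2) smooth_on_const[OF IN(2)] smooth_on_linear_map[OF IN(2) bounded_linear_ident]] z(1))
      show "(\<lambda>y. \<Phi> (t x, y)) ` N \<subseteq> ball p r" using \<Phi>b z(1) by blast
      show "t (\<Phi> (t x, y)) = t x" if "y \<in> N" for y
        using \<Phi>U(2)[of "(t x, y)"] that z(1) by (simp add: \<Psi>)
    qed (use IN z in auto)
    also have "\<Phi> (t x, fibre_map x) = x" using \<Phi>\<Psi>[of x] x S'U by (auto simp: \<Psi>)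
    finally show ?thesis by (simp add: w_def)
  qed
  have Csym: "transpose fibre_gram = fibre_gram"
    using cometric_sym[of p] center sub by (simp add: fibre_gram_def transpose_def vec_eq_iff subset_iff)
  interpret fib: orthographic_domain N fibre_gram \<kappa>
  proof
    fix y assume "y \<in> N"
    then have "(t p, y) \<in> I \<times> N" using IN by blast
    from \<Phi>U[OF this] IFT(2) show "det (orthographic_cometric fibre_gram \<kappa> y) \<noteq> 0"
      by (auto simp: \<Psi> regular_domain_def)
  qed (use IN Csym in auto)
  have isom: "isometric_to_warped_product S' g I \<epsilon> w N (orthographic_metric fibre_gram \<kappa>)"
    unfolding isometric_to_warped_product_def
  proof (intro exI[of _ \<Psi>] conjI ballI allI diffeo)
    fix x u v assume x: "x \<in> S'"
    have xr: "x \<in> regular_domain" using x S'U IFT(2) by blast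
    have "frechet_derivative \<Psi> (at x) = (\<lambda>u. split4 (coord_jacobian x *v u))"
      unfolding \<Psi>_def[abs_def] by (rule frechet_eq_of_has_derivative[OF coords_has_derivative]) (use xr U(3) in blast)
    then show "ip g x u v = warped_form \<epsilon> w (orthographic_metric fibre_gram \<kappa>) (\<Psi> x)
        (frechet_derivative \<Psi> (at x) u) (frechet_derivative \<Psi> (at x) v)"
      by (simp add: warped_form_def \<Psi> w[OF x] ip_split[OF xr])
  qed
  have "warped_product_constant_curvature_fibre S' g"
    unfolding warped_product_constant_curvature_fibre_def
    using IN(1,3) eps wsm wpos fib.orthographic_metric_on fib.orthographic_constant_curvature isom by blast
  moreover have "p \<in> S'" using IFT(3) IN(5,6) by (simp add: S'_def \<Psi> fibre_map_def B vec_eq_iff zero_vec_def)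
  moreover have "S' \<subseteq> S" using S'U U'b sub by blast
  ultimately show ?thesis using oS' by blast
qed

end

section \<open>From the manifold to a chart\<close>

text \<open>The columns of the diagonalizing matrix, reordered by \<open>\<pi>\<close> so that the negative ones come first.\<close>

lemma neutral_frame:
  fixes A :: "real^4^4"
  assumes "has_signature A 2 2"
  shows "\<exists>Q. \<forall>a b. con2 Q (\<lambda>i j. A $ i $ j) a b = eta a b"
proof -
  obtain P :: "real^4^4" and e :: "4 \<Rightarrow> real" where e: "\<And>i. e i = 1 \<or> e i = -1"
    "card {i. e i = -1} = 2" "card {i. e i = 1} = 2"
    and PA: "transpose P ** A ** P = (\<chi> i j. if i = j then e i else 0)"
    using assms unfolding has_signature_def by blast
  obtain m1 m2 where m: "{i. e i = -1} = {m1, m2}" "m1 \<noteq> m2" using e(2) by (auto simp: card_2_iff)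
  obtain n1 n2 where n: "{i. e i = 1} = {n1, n2}" "n1 \<noteq> n2" using e(3) by (auto simp: card_2_iff)
  define \<pi> :: "4 \<Rightarrow> 4" where "\<pi> a = (if a = 1 then m1 else if a = 2 then m2 else if a = 3 then n1 else n2)" for a
  have ev: "e m1 = -1" "e m2 = -1" "e n1 = 1" "e n2 = 1" using m n by auto
  then have ne: "m1 \<noteq> n1" "m1 \<noteq> n2" "m2 \<noteq> n1" "m2 \<noteq> n2" by auto
  define Q where "Q a = (\<chi> i. P $ i $ \<pi> a)" for a
  have "con2 Q (\<lambda>i j. A $ i $ j) a b = eta a b" for a b
  proof -
    have "con2 Q (\<lambda>i j. A $ i $ j) a b = (transpose P ** A ** P) $ \<pi> a $ \<pi> b"
      using triple_product_entry[of "transpose P" A "transpose P" "\<pi> a" "\<pi> b"]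
      by (simp add: con2_def con_def Q_def transpose_def sum_distrib_left mult_ac)
    also have "\<dots> = (if \<pi> a = \<pi> b then e (\<pi> a) else 0)" unfolding PA by simp
    also have "\<dots> = eta a b"
      using exhaust_4[of a] exhaust_4[of b] ev ne m(2) n(2) by (auto simp: \<pi>_def eta_def)
    finally show ?thesis .
  qed
  then show ?thesis by blast
qed

lemma neutral_frame_det:
  fixes A :: "real^4^4"
  assumes Q: "\<And>a b. con2 Q (\<lambda>i j. A $ i $ j) a b = eta a b"
  shows "det A > 0"
proof -
  define M where "M = ((\<chi> a i. Q a $ i) :: real^4^4)"
  have "(M ** A ** transpose M) $ a $ b = eta a b" for a b
    unfolding Q[symmetric] triple_product_entry by (simp add: con2_def con_def M_def sum_distrib_left mult_ac)
  then have "M ** A ** transpose M = (\<chi> a b. eta a b)" by (simp add: vec_eq_iff)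
  moreover have "det (\<chi> a b. eta a b :: real^4^4) = 1"
    by (simp add: det_4 eta_def)
  ultimately have "det M * det A * det M = 1" by (metis det_mul det_transpose)
  then have "(det M)\<^sup>2 * det A = 1" by (simp add: power2_eq_square mult_ac)
  then show ?thesis by (metis not_less zero_less_one zero_le_power2 mult_nonneg_nonpos)
qed

lemma linear_weyl_op: "linear (weyl_op g x)"
  by (rule linearI)
     (simp_all add: vec_eq_iff weyl_op_def raise2_def triple_product_entry sum_distrib_left sum.distrib algebra_simps)

lemma half_conformally_flat_weyl_op:
  assumes "self_dual_on S g \<or> anti_self_dual_on S g"
  shows "\<exists>\<sigma>::real. (\<sigma> = 1 \<or> \<sigma> = -1) \<and>
    (\<forall>x\<in>S. \<forall>w. is_2form w \<longrightarrow> weyl_op g x w = \<sigma> *\<^sub>R weyl_op g x (hodge g x w))"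
  using assms
proof
  assume sd: "self_dual_on S g"
  show ?thesis
  proof (intro exI[of _ 1] conjI ballI allI impI)
    fix x w assume "x \<in> S" "is_2form w"
    then have "weyl_op g x ((1/2) *\<^sub>R (w - hodge g x w)) = 0"
      using sd by (simp add: self_dual_on_def weyl_minus_def)
    then show "weyl_op g x w = 1 *\<^sub>R weyl_op g x (hodge g x w)"
      by (simp add: linear_scale[OF linear_weyl_op] linear_diff[OF linear_weyl_op])
  qed simp
next
  assume sd: "anti_self_dual_on S g"
  show ?thesis
  proof (intro exI[of _ "-1"] conjI ballI allI impI)
    fix x w assume "x \<in> S" "is_2form w"
    then have "weyl_op g x ((1/2) *\<^sub>R (w + hodge g x w)) = 0"
      using sd by (simp add: anti_self_dual_on_def weyl_plus_def)
    then show "weyl_op g x w = (-1) *\<^sub>R weyl_op g x (hodge g x w)"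
      by (simp add: linear_scale[OF linear_weyl_op] linear_add[OF linear_weyl_op] add_eq_0_iff2)
  qed simp
qed

lemma ip_grad:
  assumes met: "metric_on S g" and x: "x \<in> S"
  shows "ip g x (grad g F x) (grad g F x) = (\<Sum>i\<in>UNIV. \<Sum>j\<in>UNIV. ginv g i j x * (pd i F x * pd j F x))"
proof -
  have "ip g x (grad g F x) (grad g F x) = grad g F x \<bullet> (\<chi> i. pd i F x)"
    unfolding ip_def grad_def using matrix_inv_right[OF metric_invertible[OF met x]]
    by (simp add: matrix_vector_mul_assoc)
  also have "\<dots> = (\<Sum>i\<in>UNIV. \<Sum>j\<in>UNIV. ginv g i j x * (pd i F x * pd j F x))"
    unfolding grad_def by (subst inner_commute) (simp add: inner_matrix_vector ginv_def)
  finally show ?thesis .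
qed

theorem theorem8:
  fixes M :: "'a topology"
    and \<A> :: "('a, 4) chart set"
    and g :: "('a, 4) chart \<Rightarrow> 4 metric"
    and f :: "'a \<Rightarrow> real"
    and \<mu> :: real
  assumes "generalized_quasi_einstein M \<A> g f \<mu>"
    and "manifold_signature \<A> g 2 2"
    and "half_conformally_flat M \<A> g"
    and "\<mu> \<noteq> - 1 / 2"
    and "nonnull_gradient \<A> g f"
  shows "locally_conformally_flat M \<A> g \<and>
    locally_warped_product_constant_curvature_fibre M \<A> g"
proof -
  obtain l where l: "smooth_function \<A> l" and qe: "\<And>c x i j. c \<in> \<A> \<Longrightarrow> x \<in> chart_image c \<Longrightarrow>
      hess (g c) (f \<circ> chart_inv c) i j x + ricci (g c) i j x
        - \<mu> * (pd i (f \<circ> chart_inv c) x * pd j (f \<circ> chart_inv c) x) = l (chart_inv c x) * g c x $ i $ j"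
    using assms(1) unfolding generalized_quasi_einstein_def by blast
  have met: "metric_on (chart_image c) (g c)" and fsm: "smooth_on (chart_image c) (f \<circ> chart_inv c)"
    and lsm: "smooth_on (chart_image c) (l \<circ> chart_inv c)" if "c \<in> \<A>" for c
    using assms(1) l that
    by (auto simp: generalized_quasi_einstein_def pseudo_riemannian_manifold_def smooth_function_def)
  have near: "\<exists>c\<in>\<A>. p \<in> fst c \<and>
      (\<exists>V. open V \<and> snd c p \<in> V \<and> V \<subseteq> chart_image c \<and> conformally_flat_on V (g c)) \<and>
      (\<exists>V. open V \<and> snd c p \<in> V \<and> V \<subseteq> chart_image c \<and> warped_product_constant_curvature_fibre V (g c))"
    if p: "p \<in> topspace M" for p
  proof -
    obtain c S where c: "c \<in> \<A>" "p \<in> fst c" and S: "open S" "snd c p \<in> S" "S \<subseteq> chart_image c"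
      and hcf: "self_dual_on S (g c) \<or> anti_self_dual_on S (g c)"
      using assms(3) p unfolding half_conformally_flat_def near_every_point_def by blast
    obtain \<sigma> :: real where \<sigma>: "\<sigma> = 1 \<or> \<sigma> = -1"
      "\<And>x w. x \<in> S \<Longrightarrow> is_2form w \<Longrightarrow> weyl_op (g c) x w = \<sigma> *\<^sub>R weyl_op (g c) x (hodge (g c) x w)"
      using half_conformally_flat_weyl_op[OF hcf] by blast
    have frame: "\<exists>Q. \<forall>a b. con2 Q (\<lambda>i j. g c x $ i $ j) a b = eta a b" if "x \<in> S" for x
      using assms(2) c(1) S(3) that by (intro neutral_frame) (auto simp: manifold_signature_def)
    have metS: "metric_on S (g c)"
      using met[OF c(1)] S smooth_on_subset by (auto simp: metric_on_def)
    interpret quasi_einstein_chart S "g c" "f \<circ> chart_inv c" "l \<circ> chart_inv c" \<mu> \<sigma>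
    proof (unfold_locales)
      fix x assume x: "x \<in> S"
      then have xc: "x \<in> chart_image c" using S(3) by blast
      show "(\<Sum>i\<in>UNIV. \<Sum>j\<in>UNIV. ginv (g c) i j x * (pd i (f \<circ> chart_inv c) x * pd j (f \<circ> chart_inv c) x)) \<noteq> 0"
        using assms(5) c(1) xc unfolding nonnull_gradient_def ip_grad[OF metS x, symmetric] by blast
      show "det (g c x) > 0" using frame[OF x] neutral_frame_det by metis
      show "hess (g c) (f \<circ> chart_inv c) i j x + ricci (g c) i j x
        - \<mu> * (pd i (f \<circ> chart_inv c) x * pd j (f \<circ> chart_inv c) x) = (l \<circ> chart_inv c) x * g c x $ i $ j" for i j
        using qe[OF c(1) xc] by simp
    qed (use metS smooth_on_subset[OF fsm[OF c(1)] S(3)] smooth_on_subset[OF lsm[OF c(1)] S(3)] frame \<sigma> assms(4) in auto)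
    obtain r \<epsilon> \<kappa> \<phi> t A0 A0' A1 A1' B0 B where
      "adapted_chart S (g c) (f \<circ> chart_inv c) (l \<circ> chart_inv c) \<mu> \<sigma> (snd c p) r \<epsilon> \<kappa> \<phi> t A0 A0' A1 A1' B0 B"
      using adapted_chart_exists[OF S(2)] by blast
    then interpret adapted_chart S "g c" "f \<circ> chart_inv c" "l \<circ> chart_inv c" \<mu> \<sigma> "snd c p" r \<epsilon> \<kappa> \<phi> t A0 A0' A1 A1' B0 B .
    obtain V where V: "open V" "snd c p \<in> V" "V \<subseteq> S" "conformally_flat_on V (g c)"
      using conformally_flat_near by blast
    obtain V' where V': "open V'" "snd c p \<in> V'" "V' \<subseteq> S" "warped_product_constant_curvature_fibre V' (g c)"
      using warped_product_near by blast
    have "V \<subseteq> chart_image c" "V' \<subseteq> chart_image c" using V(3) V'(3) S(3) by blast+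
    then show ?thesis using c V(1,2,4) V'(1,2,4) by blast
  qed
  show ?thesis
    unfolding locally_conformally_flat_def locally_warped_product_constant_curvature_fibre_def near_every_point_def
  proof (intro conjI ballI)
    fix p assume "p \<in> topspace M"
    from near[OF this]
    show "\<exists>c\<in>\<A>. p \<in> fst c \<and> (\<exists>V. open V \<and> snd c p \<in> V \<and> V \<subseteq> chart_image c \<and> conformally_flat_on V (g c))"
      by (elim bexE conjE) (intro bexI conjI; assumption)
  next
    fix p assume "p \<in> topspace M"
    from near[OF this]
    show "\<exists>c\<in>\<A>. p \<in> fst c \<and>
        (\<exists>V. open V \<and> snd c p \<in> V \<and> V \<subseteq> chart_image c \<and> warped_product_constant_curvature_fibre V (g c))"
      by (elim bexE conjE) (intro bexI conjI; assumption)
  qed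
qed

end
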